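(* Let $i\ne j$ in $I$, $a=a_{ij}=-\langle h_i,\alpha_j\rangle$, let $c\le a$ (with $c\in\mathbb N$) and $\nu=ci+j$. For each $n$ with $0\le n\le c$ there exists, up to isomorphism (and grading shift), a unique irreducible $R(\nu)$-module, denoted $\mathcal L(i^{c-n}ji^n)$, with $$\varepsilon_i\big(\mathcal L(i^{c-n}ji^n)\big)=n.$$ Furthermore $\varepsilon_i^\vee\big(\mathcal L(i^{c-n}ji^n)\big)=c-n$ and (for a suitable choice of grading shift) $$\mathrm{ch}\big(\mathcal L(i^{c-n}ji^n)\big)=[c-n]_i!\,[n]_i!\; i^{c-n}ji^n .$$ In particular, in the Grothendieck group, $e_i^{(c-s)}e_je_i^{(s)}[\mathcal L(i^{c-n}ji^n)]=0$ unless $s=n$.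
   Context: Cartan data: a free $\mathbb{Z}$-module $P$, an index set $I$, simple roots $\alpha_i\in P$ and simple coroots $h_i\in P^\vee=\mathrm{Hom}_{\mathbb{Z}}(P,\mathbb{Z})$ ($i\in I$), and a symmetric bilinear form $(\,,\,):P\times P\to\mathbb{Z}$; $\langle\,,\,\rangle$ is the canonical pairing. These satisfy $(\alpha_i,\alpha_i)\in 2\mathbb{Z}_{>0}$, $\langle h_i,\lambda\rangle=2(\alpha_i,\lambda)/(\alpha_i,\alpha_i)$ for $\lambda\in P$, and $(\alpha_i,\alpha_j)\le 0$ for $i\ne j$. Put $a_{ij}=-\langle h_i,\alpha_j\rangle$. For $\nu=\sum\nu_i\, i\in\mathbb{N}[I]$, $|\nu|=\sum\nu_i$. $q_i=q^{(\alpha_i,\alpha_i)/2}$, $[a]_i=q_i^{a-1}+q_i^{a-3}+\dots+q_i^{1-a}$, $[a]_i!=[a]_i\cdots[1]_i$. Algebra $R(\nu)$: let $\Bbbk$ be an algebraically closed field, $m=|\nu|$, and $\mathrm{Seq}(\nu)$ the set of sequences $\mathbf{i}=i_1\dots i_m$ in which each $i\in I$ appears $\nu_i$ times; $s_r$ swaps the $r$-th and $(r+1)$-st entries. $R(\nu)$ is the graded associative $\Bbbk$-algebra with generators $1_{\mathbf i}$ ($\mathbf i\in\mathrm{Seq}(\nu)$), $x_r$ ($1\le r\le m$), $\psi_r$ ($1\le r\le m-1$), unit $\sum_{\mathbf i}1_{\mathbf i}$, and relations: $1_{\mathbf i}1_{\mathbf j}=\delta_{\mathbf i,\mathbf j}1_{\mathbf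 i}$; $x_r1_{\mathbf i}=1_{\mathbf i}x_r$; $\psi_r1_{\mathbf i}=1_{s_r(\mathbf i)}\psi_r$; $x_rx_t=x_tx_r$; $\psi_r\psi_t=\psi_t\psi_r$ if $|r-t|>1$; $\psi_r^2 1_{\mathbf i}$ equals $0$ if $i_r=i_{r+1}$, equals $1_{\mathbf i}$ if $(\alpha_{i_r},\alpha_{i_{r+1}})=0$, and equals $(x_r^{a_{i_ri_{r+1}}}+x_{r+1}^{a_{i_{r+1}i_r}})1_{\mathbf i}$ if $i_r\neq i_{r+1}$ and $(\alpha_{i_r},\alpha_{i_{r+1}})\ne0$; $(\psi_r\psi_{r+1}\psi_r-\psi_{r+1}\psi_r\psi_{r+1})1_{\mathbf i}=\sum_{t=0}^{a_{i_ri_{r+1}}-1}x_r^tx_{r+2}^{a_{i_ri_{r+1}}-1-t}1_{\mathbf i}$ if $i_r=i_{r+2}$ and $(\alpha_{i_r},\alpha_{i_{r+1}})\neq0$ (empty sum if $i_r=i_{r+1}$), and $=0$ otherwise; $(\psi_rx_t-x_{s_r(t)}\psi_r)1_{\mathbf i}$ equals $1_{\mathbf i}$ if $t=r,\ i_r=i_{r+1}$, equals $-1_{\mathbf i}$ if $t=r+1,\ i_r=i_{r+1}$, and $0$ otherwise. Degrees: $\deg(x_r1_{\mathbf i})=(\alpha_{i_r},\alpha_{i_r})$, $\deg(\psi_r1_{\mathbf i})=-(\alpha_{i_r},\alpha_{i_{r+1}})$. Modules are finite-dimensional graded left modules; isomorphisms are up to grading shift. The character is $\mathrm{ch}(M)=\sum_{\mathbf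 i\in\mathrm{Seq}(\nu)}\mathrm{gdim}(1_{\mathbf i}M)\cdot\mathbf i$ in the free $\mathbb Z[q,q^{-1}]$-module on $\mathrm{Seq}(\nu)$. For an $R(\nu)$-module $M$, $e_iM$ is $\sum_{\mathbf j}1_{\mathbf ji}M$ (sum over $\mathbf j\in\mathrm{Seq}(\nu-i)$) regarded as an $R(\nu-i)$-module via the first $|\nu|-1$ strands (zero if $\nu_i=0$), and $e_i^\vee M=\sum_{\mathbf j}1_{i\mathbf j}M$ regarded as an $R(\nu-i)$-module via the last $|\nu|-1$ strands. For simple $M$, $\tilde e_iM=\mathrm{soc}\,e_iM$ and $\tilde e_i^\vee M=\mathrm{soc}\,e_i^\vee M$ are simple or zero; $\varepsilon_i(M)=\max\{n\ge0\mid\tilde e_i^nM\ne0\}$, $\varepsilon_i^\vee(M)=\max\{n\ge0\mid(\tilde e_i^\vee)^nM\neq0\}$. In the Grothendieck group of finite-dimensional graded modules, $q[M]=[M\{1\}]$ (upward grading shift) and $e_i^{(r)}[M]=\frac1{[r]_i!}[e_i^rM]$. *)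

theory Defs
  imports
    "HOL-Algebra.QuotRing"
    "HOL-Algebra.Free_Abelian_Groups"
    "HOL-Computational_Algebra.Polynomial"
    "HOL-Combinatorics.Multiset_Permutations"
begin

section \<open>Cartan data\<close>

text \<open>
  The index set \<open>I\<close> is the type \<open>'i\<close> and \<open>P\<close> is the additive group of the type \<open>'p\<close>.
\<close>

record ('i, 'p) cartan_data =
  cd_form :: "'p \<Rightarrow> 'p \<Rightarrow> int"
  cd_root :: "'i \<Rightarrow> 'p"
  cd_coroot :: "'i \<Rightarrow> 'p \<Rightarrow> int"

locale cartan_datum =
  fixes C :: "('i, 'p::ab_group_add) cartan_data"
  assumes free:
      "\<exists>S :: 'p set.
         \<lparr>carrier = UNIV :: 'p set, monoid.mult = (+), one = 0\<rparr> \<cong> free_Abelian_group S"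
    and form_add: "cd_form C (x + y) z = cd_form C x z + cd_form C y z"
    and form_sym: "cd_form C x y = cd_form C y x"
    and coroot_add: "cd_coroot C i (x + y) = cd_coroot C i x + cd_coroot C i y"
    and root_pos: "cd_form C (cd_root C i) (cd_root C i) > 0"
    and root_even: "even (cd_form C (cd_root C i) (cd_root C i))"
    and coroot_eq:
      "cd_form C (cd_root C i) (cd_root C i) * cd_coroot C i x = 2 * cd_form C (cd_root C i) x"
    and root_nonpos: "i \<noteq> j \<Longrightarrow> cd_form C (cd_root C i) (cd_root C j) \<le> 0"

abbreviation rform :: "('i, 'p) cartan_data \<Rightarrow> 'i \<Rightarrow> 'i \<Rightarrow> int" where
  "rform C i j \<equiv> cd_form C (cd_root C i) (cd_root C j)"

definition cartan_a :: "('i, 'p) cartan_data \<Rightarrow> 'i \<Rightarrow> 'i \<Rightarrow> int" where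
  "cartan_a C i j = - cd_coroot C i (cd_root C j)"

text \<open>\<open>\<int>[q, q\<^sup>-\<^sup>1]\<close> is the group ring of \<open>\<int>\<close>; \<open>single d 1\<close> is the \<open>d\<close>-th power of \<open>q\<close>.\<close>

type_synonym laurent = "int \<Rightarrow>\<^sub>0 int"

definition qint :: "('i, 'p) cartan_data \<Rightarrow> 'i \<Rightarrow> nat \<Rightarrow> laurent" where
  "qint C i a =
     (\<Sum>t<a. Poly_Mapping.single (rform C i i div 2 * (int a - 1 - 2 * int t)) 1)"

definition qfact :: "('i, 'p) cartan_data \<Rightarrow> 'i \<Rightarrow> nat \<Rightarrow> laurent" where
  "qfact C i a = (\<Prod>t=1..a. qint C i t)"


section \<open>Free associative algebras\<close>

text \<open>
  Free monoids, written additively, so that \<open>'g fmon \<Rightarrow>\<^sub>0 'k\<close> with its convolution product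
  is the free associative \<open>'k\<close>-algebra on \<open>'g\<close>.
\<close>

datatype 'g fmon = FMon (letters: "'g list")

instantiation fmon :: (type) monoid_add
begin

definition zero_fmon :: "'a fmon" where
  "zero_fmon = FMon []"

definition plus_fmon :: "'a fmon \<Rightarrow> 'a fmon \<Rightarrow> 'a fmon" where
  "plus_fmon u v = FMon (letters u @ letters v)"

instance
  by standard (simp_all add: zero_fmon_def plus_fmon_def)

end

definition free_alg :: "'g set \<Rightarrow> ('g fmon \<Rightarrow>\<^sub>0 'k::field) ring" where
  "free_alg S =
     \<lparr>carrier = {p. \<forall>w\<in>Poly_Mapping.keys p. set (letters w) \<subseteq> S}, monoid.mult = (*), one = 1,
      ring.zero = 0, add = (+)\<rparr>"


section \<open>The algebra \<open>R(\<nu>)\<close>\<close>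

text \<open>
  Elements of \<open>\<nat>[I]\<close> are multisets, \<open>Seq(\<nu>)\<close> is \<open>permutations_of_multiset \<nu>\<close>.
  Strands are numbered from 0: \<open>Dot r\<close> (\<open>r < size \<nu>\<close>) and \<open>Cross r\<close>
  (\<open>Suc r < size \<nu>\<close>) stand for \<open>x\<close> and \<open>\<psi>\<close> with index \<open>r + 1\<close>.
\<close>

datatype 'i klr_gen = Idemp "'i list" | Dot nat | Cross nat

type_synonym ('i, 'k) klr_free = "'i klr_gen fmon \<Rightarrow>\<^sub>0 'k"

definition klr_gens :: "'i multiset \<Rightarrow> 'i klr_gen set" where
  "klr_gens \<nu> =
     Idemp ` permutations_of_multiset \<nu> \<union> Dot ` {r. r < size \<nu>} \<union> Cross ` {r. Suc r < size \<nu>}"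

definition idemp :: "'i list \<Rightarrow> ('i, 'k::field) klr_free" where
  "idemp u = Poly_Mapping.single (FMon [Idemp u]) 1"

definition dot :: "nat \<Rightarrow> ('i, 'k::field) klr_free" where
  "dot r = Poly_Mapping.single (FMon [Dot r]) 1"

definition crs :: "nat \<Rightarrow> ('i, 'k::field) klr_free" where
  "crs r = Poly_Mapping.single (FMon [Cross r]) 1"

definition swap_seq :: "nat \<Rightarrow> 'i list \<Rightarrow> 'i list" where
  "swap_seq r u = u[r := u ! Suc r, Suc r := u ! r]"

text \<open>A relator \<open>p\<close> stands for the relation \<open>p = 0\<close>.\<close>

inductive_set klr_relators ::
    "('i, 'p) cartan_data \<Rightarrow> 'i multiset \<Rightarrow> ('i, 'k::field) klr_free set"
  for C :: "('i, 'p) cartan_data" and \<nu> :: "'i multiset" where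
  unit: "(\<Sum>u\<in>permutations_of_multiset \<nu>. idemp u) - 1 \<in> klr_relators C \<nu>"
| idem_idem:
    "u \<in> permutations_of_multiset \<nu> \<Longrightarrow> v \<in> permutations_of_multiset \<nu> \<Longrightarrow>
     idemp u * idemp v - (if u = v then idemp u else 0) \<in> klr_relators C \<nu>"
| dot_idem:
    "u \<in> permutations_of_multiset \<nu> \<Longrightarrow> r < size \<nu> \<Longrightarrow>
     dot r * idemp u - idemp u * dot r \<in> klr_relators C \<nu>"
| crs_idem:
    "u \<in> permutations_of_multiset \<nu> \<Longrightarrow> Suc r < size \<nu> \<Longrightarrow>
     crs r * idemp u - idemp (swap_seq r u) * crs r \<in> klr_relators C \<nu>"
| dot_dot:
    "r < size \<nu> \<Longrightarrow> t < size \<nu> \<Longrightarrow> dot r * dot t - dot t * dot r \<in> klr_relators C \<nu>"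
| crs_crs:
    "Suc r < size \<nu> \<Longrightarrow> Suc t < size \<nu> \<Longrightarrow> \<bar>int r - int t\<bar> > 1 \<Longrightarrow>
     crs r * crs t - crs t * crs r \<in> klr_relators C \<nu>"
| crs_sq:
    "u \<in> permutations_of_multiset \<nu> \<Longrightarrow> Suc r < size \<nu> \<Longrightarrow> i = u ! r \<Longrightarrow> j = u ! Suc r \<Longrightarrow>
     crs r * crs r * idemp u -
       (if i = j then 0
        else if rform C i j = 0 then idemp u
        else (dot r ^ nat (cartan_a C i j) + dot (Suc r) ^ nat (cartan_a C j i)) * idemp u)
     \<in> klr_relators C \<nu>"
| braid: \<comment> \<open>for \<open>i = j\<close> the sum is empty, since then \<open>cartan_a C i j = -2\<close>\<close>
    "u \<in> permutations_of_multiset \<nu> \<Longrightarrow> Suc (Suc r) < size \<nu> \<Longrightarrow>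
     i = u ! r \<Longrightarrow> j = u ! Suc r \<Longrightarrow> l = u ! Suc (Suc r) \<Longrightarrow> a = nat (cartan_a C i j) \<Longrightarrow>
     (crs r * crs (Suc r) * crs r - crs (Suc r) * crs r * crs (Suc r)) * idemp u -
       (if i = l \<and> rform C i j \<noteq> 0
        then (\<Sum>t<a. dot r ^ t * dot (Suc (Suc r)) ^ (a - 1 - t)) * idemp u
        else 0)
     \<in> klr_relators C \<nu>"
| crs_dot:
    "u \<in> permutations_of_multiset \<nu> \<Longrightarrow> Suc r < size \<nu> \<Longrightarrow> t < size \<nu> \<Longrightarrow>
     (crs r * dot t - dot (transpose r (Suc r) t) * crs r) * idemp u -
       (if t = r \<and> u ! r = u ! Suc r then idemp u
        else if t = Suc r \<and> u ! r = u ! Suc r then - idemp u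
        else 0)
     \<in> klr_relators C \<nu>"

type_synonym ('i, 'k) klr_elem = "('i, 'k) klr_free set"

definition klr_ideal ::
    "('i, 'p) cartan_data \<Rightarrow> 'i multiset \<Rightarrow> ('i, 'k::field) klr_free set" where
  "klr_ideal C \<nu> = Idl\<^bsub>free_alg (klr_gens \<nu>)\<^esub> (klr_relators C \<nu>)"

definition klr ::
    "('i, 'p) cartan_data \<Rightarrow> 'i multiset \<Rightarrow> ('i, 'k::field) klr_elem ring" where
  "klr C \<nu> = free_alg (klr_gens \<nu>) Quot klr_ideal C \<nu>"

definition klr_cls ::
    "('i, 'p) cartan_data \<Rightarrow> 'i multiset \<Rightarrow> ('i, 'k::field) klr_free \<Rightarrow> ('i, 'k) klr_elem" where
  "klr_cls C \<nu> p = klr_ideal C \<nu> +>\<^bsub>free_alg (klr_gens \<nu>)\<^esub> p"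

text \<open>The structure map of the \<open>'k\<close>-algebra \<open>R(\<nu>)\<close>.\<close>

definition klr_const ::
    "('i, 'p) cartan_data \<Rightarrow> 'i multiset \<Rightarrow> 'k::field \<Rightarrow> ('i, 'k) klr_elem" where
  "klr_const C \<nu> c = klr_cls C \<nu> (Poly_Mapping.single 0 c)"

text \<open>\<open>klr_homog C \<nu> d\<close> is the homogeneous part of degree \<open>d\<close> of \<open>R(\<nu>)\<close>.\<close>

inductive klr_homog ::
    "('i, 'p) cartan_data \<Rightarrow> 'i multiset \<Rightarrow> int \<Rightarrow> ('i, 'k::field) klr_elem \<Rightarrow> bool"
  for C :: "('i, 'p) cartan_data" and \<nu> :: "'i multiset" where
  idem: "u \<in> permutations_of_multiset \<nu> \<Longrightarrow> klr_homog C \<nu> 0 (klr_cls C \<nu> (idemp u))"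
| dot: "u \<in> permutations_of_multiset \<nu> \<Longrightarrow> r < size \<nu> \<Longrightarrow>
     klr_homog C \<nu> (rform C (u ! r) (u ! r)) (klr_cls C \<nu> (dot r * idemp u))"
| crs: "u \<in> permutations_of_multiset \<nu> \<Longrightarrow> Suc r < size \<nu> \<Longrightarrow>
     klr_homog C \<nu> (- rform C (u ! r) (u ! Suc r)) (klr_cls C \<nu> (crs r * idemp u))"
| zero: "klr_homog C \<nu> d \<zero>\<^bsub>klr C \<nu>\<^esub>"
| add: "klr_homog C \<nu> d x \<Longrightarrow> klr_homog C \<nu> d y \<Longrightarrow> klr_homog C \<nu> d (x \<oplus>\<^bsub>klr C \<nu>\<^esub> y)"
| scale: "klr_homog C \<nu> d x \<Longrightarrow> klr_homog C \<nu> d (klr_const C \<nu> c \<otimes>\<^bsub>klr C \<nu>\<^esub> x)"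
| mult: "klr_homog C \<nu> d x \<Longrightarrow> klr_homog C \<nu> e y \<Longrightarrow>
     klr_homog C \<nu> (d + e) (x \<otimes>\<^bsub>klr C \<nu>\<^esub> y)"


section \<open>Finite-dimensional graded modules\<close>

text \<open>
  The underlying space of a module is a subspace of a vector space \<open>'v\<close>, and everything
  outside that subspace is irrelevant.
\<close>

record ('r, 'k, 'v) gmodule =
  gm_space :: "'v set"
  gm_scale :: "'k \<Rightarrow> 'v \<Rightarrow> 'v"
  gm_act :: "'r \<Rightarrow> 'v \<Rightarrow> 'v"
  gm_part :: "int \<Rightarrow> 'v set"

abbreviation gm_span :: "('r, 'k::field, 'v::ab_group_add) gmodule \<Rightarrow> 'v set \<Rightarrow> 'v set" where
  "gm_span M \<equiv> module.span (gm_scale M)"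

abbreviation gm_subspace :: "('r, 'k::field, 'v::ab_group_add) gmodule \<Rightarrow> 'v set \<Rightarrow> bool" where
  "gm_subspace M \<equiv> module.subspace (gm_scale M)"

locale klr_module =
  fixes C :: "('i, 'p) cartan_data" and \<nu> :: "'i multiset"
    and M :: "(('i, 'k::field) klr_elem, 'k, 'v::ab_group_add) gmodule"
  assumes vector_space: "vector_space (gm_scale M)"
    and subspace: "gm_subspace M (gm_space M)"
    and finite_dim: "\<exists>B. finite B \<and> gm_space M = gm_span M B"
    and act_closed:
      "r \<in> carrier (klr C \<nu>) \<Longrightarrow> v \<in> gm_space M \<Longrightarrow> gm_act M r v \<in> gm_space M"
    and act_add_right:
      "r \<in> carrier (klr C \<nu>) \<Longrightarrow> v \<in> gm_space M \<Longrightarrow> w \<in> gm_space M \<Longrightarrow>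
       gm_act M r (v + w) = gm_act M r v + gm_act M r w"
    and act_add_left:
      "r \<in> carrier (klr C \<nu>) \<Longrightarrow> s \<in> carrier (klr C \<nu>) \<Longrightarrow> v \<in> gm_space M \<Longrightarrow>
       gm_act M (r \<oplus>\<^bsub>klr C \<nu>\<^esub> s) v = gm_act M r v + gm_act M s v"
    and act_mult:
      "r \<in> carrier (klr C \<nu>) \<Longrightarrow> s \<in> carrier (klr C \<nu>) \<Longrightarrow> v \<in> gm_space M \<Longrightarrow>
       gm_act M (r \<otimes>\<^bsub>klr C \<nu>\<^esub> s) v = gm_act M r (gm_act M s v)"
    and act_one: "v \<in> gm_space M \<Longrightarrow> gm_act M \<one>\<^bsub>klr C \<nu>\<^esub> v = v"
    and act_const: "v \<in> gm_space M \<Longrightarrow> gm_act M (klr_const C \<nu> c) v = gm_scale M c v"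
    and part_subspace: "gm_subspace M (gm_part M d)"
    and part_subset: "gm_part M d \<subseteq> gm_space M"
    and part_decomp:
      "v \<in> gm_space M \<Longrightarrow>
       \<exists>!f. (\<forall>d. f d \<in> gm_part M d) \<and> finite {d. f d \<noteq> 0} \<and> v = (\<Sum>d | f d \<noteq> 0. f d)"
    and act_part:
      "klr_homog C \<nu> d r \<Longrightarrow> v \<in> gm_part M e \<Longrightarrow> gm_act M r v \<in> gm_part M (d + e)"

definition gm_hom ::
    "('i, 'p) cartan_data \<Rightarrow> 'i multiset
     \<Rightarrow> (('i, 'k::field) klr_elem, 'k, 'v::ab_group_add) gmodule
     \<Rightarrow> (('i, 'k) klr_elem, 'k, 'w::ab_group_add) gmodule \<Rightarrow> ('v \<Rightarrow> 'w) \<Rightarrow> bool" where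
  "gm_hom C \<nu> M N f \<longleftrightarrow>
     (\<forall>v\<in>gm_space M. f v \<in> gm_space N) \<and>
     (\<forall>v\<in>gm_space M. \<forall>w\<in>gm_space M. f (v + w) = f v + f w) \<and>
     (\<forall>r\<in>carrier (klr C \<nu>). \<forall>v\<in>gm_space M. f (gm_act M r v) = gm_act N r (f v)) \<and>
     (\<forall>d. \<forall>v\<in>gm_part M d. f v \<in> gm_part N d)"

definition gm_iso ::
    "('i, 'p) cartan_data \<Rightarrow> 'i multiset
     \<Rightarrow> (('i, 'k::field) klr_elem, 'k, 'v::ab_group_add) gmodule
     \<Rightarrow> (('i, 'k) klr_elem, 'k, 'w::ab_group_add) gmodule \<Rightarrow> bool" where
  "gm_iso C \<nu> M N \<longleftrightarrow> (\<exists>f. gm_hom C \<nu> M N f \<and> bij_betw f (gm_space M) (gm_space N))"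

text \<open>\<open>gm_shift k M\<close> is \<open>M{k}\<close>, so that \<open>gdim M{1}\<close> is \<open>q\<close> times \<open>gdim M\<close>.\<close>

definition gm_shift :: "int \<Rightarrow> ('r, 'k, 'v) gmodule \<Rightarrow> ('r, 'k, 'v) gmodule" where
  "gm_shift k M = M\<lparr>gm_part := \<lambda>d. gm_part M (d - k)\<rparr>"

definition gm_submodule ::
    "('i, 'p) cartan_data \<Rightarrow> 'i multiset
     \<Rightarrow> (('i, 'k::field) klr_elem, 'k, 'v::ab_group_add) gmodule \<Rightarrow> 'v set \<Rightarrow> bool" where
  "gm_submodule C \<nu> M N \<longleftrightarrow>
     gm_subspace M N \<and> N \<subseteq> gm_space M \<and>
     (\<forall>r\<in>carrier (klr C \<nu>). \<forall>v\<in>N. gm_act M r v \<in> N) \<and>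
     N = gm_span M (\<Union>d. N \<inter> gm_part M d)"

definition gm_restrict :: "('r, 'k, 'v) gmodule \<Rightarrow> 'v set \<Rightarrow> ('r, 'k, 'v) gmodule" where
  "gm_restrict M N = M\<lparr>gm_space := N, gm_part := \<lambda>d. gm_part M d \<inter> N\<rparr>"

definition gm_irreducible ::
    "('i, 'p) cartan_data \<Rightarrow> 'i multiset
     \<Rightarrow> (('i, 'k::field) klr_elem, 'k, 'v::ab_group_add) gmodule \<Rightarrow> bool" where
  "gm_irreducible C \<nu> M \<longleftrightarrow>
     klr_module C \<nu> M \<and> gm_space M \<noteq> {0} \<and>
     (\<forall>N. gm_submodule C \<nu> M N \<longrightarrow> N = {0} \<or> N = gm_space M)"

definition gm_soc ::
    "('i, 'p) cartan_data \<Rightarrow> 'i multiset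
     \<Rightarrow> (('i, 'k::field) klr_elem, 'k, 'v::ab_group_add) gmodule
     \<Rightarrow> (('i, 'k) klr_elem, 'k, 'v) gmodule" where
  "gm_soc C \<nu> M =
     gm_restrict M (gm_span M (\<Union>{N. gm_submodule C \<nu> M N \<and> gm_irreducible C \<nu> (gm_restrict M N)}))"

definition idem_space ::
    "('i, 'p) cartan_data \<Rightarrow> 'i multiset
     \<Rightarrow> (('i, 'k::field) klr_elem, 'k, 'v::ab_group_add) gmodule \<Rightarrow> 'i list \<Rightarrow> 'v set" where
  "idem_space C \<nu> M u = gm_act M (klr_cls C \<nu> (idemp u)) ` gm_space M"

definition gm_gdim ::
    "('r, 'k::field, 'v::ab_group_add) gmodule \<Rightarrow> 'v set \<Rightarrow> laurent" where
  "gm_gdim M U =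
     (\<Sum>d | gm_part M d \<inter> U \<noteq> {0}.
        Poly_Mapping.single d (int (vector_space.dim (gm_scale M) (gm_part M d \<inter> U))))"

text \<open>Characters are elements of the free \<open>\<int>[q, q\<^sup>-\<^sup>1]\<close>-module on sequences.\<close>

definition gm_ch ::
    "('i, 'p) cartan_data \<Rightarrow> 'i multiset
     \<Rightarrow> (('i, 'k::field) klr_elem, 'k, 'v::ab_group_add) gmodule \<Rightarrow> 'i list \<Rightarrow>\<^sub>0 laurent" where
  "gm_ch C \<nu> M =
     (\<Sum>u\<in>permutations_of_multiset \<nu>. Poly_Mapping.single u (gm_gdim M (idem_space C \<nu> M u)))"


section \<open>Restriction functors and crystal operators\<close>

text \<open>
  \<open>strand_map C \<nu> i g w\<close> is the (non-unital) algebra map from \<open>R(\<nu> - i)\<close> to \<open>R(\<nu>)\<close> which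
  renames generators by \<open>g\<close> and then multiplies with the image of the unit, i.e. with the
  sum of the idempotents of \<open>w u\<close> for \<open>u\<close> in \<open>Seq(\<nu> - i)\<close>. Without this factor the result
  would depend on the representative \<open>p\<close>.
\<close>

definition push_gens :: "('g \<Rightarrow> 'h) \<Rightarrow> ('g fmon \<Rightarrow>\<^sub>0 'k::field) \<Rightarrow> ('h fmon \<Rightarrow>\<^sub>0 'k)" where
  "push_gens g p =
     (\<Sum>w\<in>Poly_Mapping.keys p. Poly_Mapping.single (FMon (map g (letters w))) (Poly_Mapping.lookup p w))"

definition strand_map ::
    "('i, 'p) cartan_data \<Rightarrow> 'i multiset \<Rightarrow> 'i \<Rightarrow> ('i klr_gen \<Rightarrow> 'i klr_gen)
     \<Rightarrow> ('i list \<Rightarrow> 'i list) \<Rightarrow> ('i, 'k::field) klr_elem \<Rightarrow> ('i, 'k) klr_elem" where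
  "strand_map C \<nu> i g w r =
     the_elem ((\<lambda>p. klr_cls C \<nu>
        (push_gens g p * (\<Sum>u\<in>permutations_of_multiset (\<nu> - {#i#}). idemp (w u)))) ` r)"

fun gen_first :: "'i \<Rightarrow> 'i klr_gen \<Rightarrow> 'i klr_gen" where
  "gen_first i (Idemp u) = Idemp (u @ [i])"
| "gen_first i (Dot r) = Dot r"
| "gen_first i (Cross r) = Cross r"

fun gen_last :: "'i \<Rightarrow> 'i klr_gen \<Rightarrow> 'i klr_gen" where
  "gen_last i (Idemp u) = Idemp (i # u)"
| "gen_last i (Dot r) = Dot (Suc r)"
| "gen_last i (Cross r) = Cross (Suc r)"

definition gm_zero ::
    "('r, 'k::field, 'v::ab_group_add) gmodule \<Rightarrow> ('r, 'k, 'v) gmodule" where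
  "gm_zero M = M\<lparr>gm_space := {0}, gm_act := \<lambda>_ _. 0, gm_part := \<lambda>_. {0}\<rparr>"

definition gm_res ::
    "('i, 'p) cartan_data \<Rightarrow> 'i multiset \<Rightarrow> 'i \<Rightarrow> ('i klr_gen \<Rightarrow> 'i klr_gen)
     \<Rightarrow> ('i list \<Rightarrow> 'i list)
     \<Rightarrow> (('i, 'k::field) klr_elem, 'k, 'v::ab_group_add) gmodule
     \<Rightarrow> (('i, 'k) klr_elem, 'k, 'v) gmodule" where
  "gm_res C \<nu> i g w M =
     (if i \<in># \<nu> then
        gm_restrict (M\<lparr>gm_act := \<lambda>r. gm_act M (strand_map C \<nu> i g w r)\<rparr>)
          (gm_span M (\<Union>u\<in>permutations_of_multiset (\<nu> - {#i#}). idem_space C \<nu> M (w u)))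
      else gm_zero M)"

definition e_fun ::
    "('i, 'p) cartan_data \<Rightarrow> 'i multiset \<Rightarrow> 'i
     \<Rightarrow> (('i, 'k::field) klr_elem, 'k, 'v::ab_group_add) gmodule
     \<Rightarrow> (('i, 'k) klr_elem, 'k, 'v) gmodule" where
  "e_fun C \<nu> i = gm_res C \<nu> i (gen_first i) (\<lambda>u. u @ [i])"

definition e_check ::
    "('i, 'p) cartan_data \<Rightarrow> 'i multiset \<Rightarrow> 'i
     \<Rightarrow> (('i, 'k::field) klr_elem, 'k, 'v::ab_group_add) gmodule
     \<Rightarrow> (('i, 'k) klr_elem, 'k, 'v) gmodule" where
  "e_check C \<nu> i = gm_res C \<nu> i (gen_last i) (\<lambda>u. i # u)"

definition e_tilde ::
    "('i, 'p) cartan_data \<Rightarrow> 'i multiset \<Rightarrow> 'i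
     \<Rightarrow> (('i, 'k::field) klr_elem, 'k, 'v::ab_group_add) gmodule
     \<Rightarrow> (('i, 'k) klr_elem, 'k, 'v) gmodule" where
  "e_tilde C \<nu> i M = gm_soc C (\<nu> - {#i#}) (e_fun C \<nu> i M)"

definition e_tilde_check ::
    "('i, 'p) cartan_data \<Rightarrow> 'i multiset \<Rightarrow> 'i
     \<Rightarrow> (('i, 'k::field) klr_elem, 'k, 'v::ab_group_add) gmodule
     \<Rightarrow> (('i, 'k) klr_elem, 'k, 'v) gmodule" where
  "e_tilde_check C \<nu> i M = gm_soc C (\<nu> - {#i#}) (e_check C \<nu> i M)"

text \<open>
  Iteration of a family \<open>F\<close> of operations, where \<open>F \<mu>\<close> goes from weight \<open>\<mu>\<close> to \<open>\<mu> - i\<close>,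
  starting at weight \<open>\<nu>\<close>.
\<close>

primrec weight_pow :: "'i \<Rightarrow> ('i multiset \<Rightarrow> 'm \<Rightarrow> 'm) \<Rightarrow> nat \<Rightarrow> 'i multiset \<Rightarrow> 'm \<Rightarrow> 'm" where
  "weight_pow i F 0 \<nu> x = x"
| "weight_pow i F (Suc n) \<nu> x = weight_pow i F n (\<nu> - {#i#}) (F \<nu> x)"

definition eps ::
    "('i, 'p) cartan_data \<Rightarrow> 'i multiset \<Rightarrow> 'i
     \<Rightarrow> (('i, 'k::field) klr_elem, 'k, 'v::ab_group_add) gmodule \<Rightarrow> nat" where
  "eps C \<nu> i M =
     Max {n. gm_space (weight_pow i (\<lambda>\<mu>. e_tilde C \<mu> i) n \<nu> M) \<noteq> {0}}"

definition eps_check ::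
    "('i, 'p) cartan_data \<Rightarrow> 'i multiset \<Rightarrow> 'i
     \<Rightarrow> (('i, 'k::field) klr_elem, 'k, 'v::ab_group_add) gmodule \<Rightarrow> nat" where
  "eps_check C \<nu> i M =
     Max {n. gm_space (weight_pow i (\<lambda>\<mu>. e_tilde_check C \<mu> i) n \<nu> M) \<noteq> {0}}"


section \<open>Grothendieck groups\<close>

text \<open>
  Every finite-dimensional module is isomorphic to one whose underlying space is a subspace of
  \<open>nat \<Rightarrow>\<^sub>0 'k\<close>, so the Grothendieck group is built from modules of that type only.
\<close>

type_synonym ('i, 'k) klr_mod = "(('i, 'k) klr_elem, 'k, nat \<Rightarrow>\<^sub>0 'k) gmodule"

type_synonym ('i, 'k) klr_frag = "('i, 'k) klr_mod \<Rightarrow>\<^sub>0 int"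

definition gm_exact ::
    "('i, 'p) cartan_data \<Rightarrow> 'i multiset
     \<Rightarrow> (('i, 'k::field) klr_elem, 'k, 'v::ab_group_add) gmodule
     \<Rightarrow> (('i, 'k) klr_elem, 'k, 'v) gmodule \<Rightarrow> (('i, 'k) klr_elem, 'k, 'v) gmodule \<Rightarrow> bool" where
  "gm_exact C \<nu> L M N \<longleftrightarrow>
     (\<exists>f g. gm_hom C \<nu> L M f \<and> gm_hom C \<nu> M N g \<and> inj_on f (gm_space L) \<and>
        g ` gm_space M = gm_space N \<and> f ` gm_space L = {v \<in> gm_space M. g v = 0})"

definition K0_free ::
    "('i, 'p) cartan_data \<Rightarrow> 'i multiset \<Rightarrow> ('i, 'k::field) klr_frag monoid" where
  "K0_free C \<nu> = free_Abelian_group {M. klr_module C \<nu> M}"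

definition K0_rel ::
    "('i, 'p) cartan_data \<Rightarrow> 'i multiset \<Rightarrow> ('i, 'k::field) klr_frag set" where
  "K0_rel C \<nu> = generate (K0_free C \<nu>)
     {frag_of M - frag_of L - frag_of N | L M N.
        klr_module C \<nu> L \<and> klr_module C \<nu> M \<and> klr_module C \<nu> N \<and> gm_exact C \<nu> L M N}"

definition K0 ::
    "('i, 'p) cartan_data \<Rightarrow> 'i multiset \<Rightarrow> ('i, 'k::field) klr_frag set monoid" where
  "K0 C \<nu> = K0_free C \<nu> Mod K0_rel C \<nu>"

definition K0_cls ::
    "('i, 'p) cartan_data \<Rightarrow> 'i multiset
     \<Rightarrow> ('i, 'k::field) klr_frag \<Rightarrow> ('i, 'k) klr_frag set" where
  "K0_cls C \<nu> x = K0_rel C \<nu> #>\<^bsub>K0_free C \<nu>\<^esub> x"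

definition K0_of ::
    "('i, 'p) cartan_data \<Rightarrow> 'i multiset
     \<Rightarrow> ('i, 'k::field) klr_mod \<Rightarrow> ('i, 'k) klr_frag set" where
  "K0_of C \<nu> M = K0_cls C \<nu> (frag_of M)"

text \<open>The homomorphism into \<open>K0 C \<mu>\<close> with \<open>[M] \<mapsto> [F M]\<close>.\<close>

definition K0_map ::
    "('i, 'p) cartan_data \<Rightarrow> 'i multiset
     \<Rightarrow> (('i, 'k::field) klr_mod \<Rightarrow> ('i, 'k) klr_frag)
     \<Rightarrow> ('i, 'k) klr_frag set \<Rightarrow> ('i, 'k) klr_frag set" where
  "K0_map C \<mu> F X = the_elem ((\<lambda>x. K0_cls C \<mu> (frag_extend F x)) ` X)"

definition K0_scale ::
    "('i, 'p) cartan_data \<Rightarrow> 'i multiset \<Rightarrow> laurent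
     \<Rightarrow> ('i, 'k::field) klr_frag set \<Rightarrow> ('i, 'k) klr_frag set" where
  "K0_scale C \<nu> p =
     K0_map C \<nu> (\<lambda>M. \<Sum>d\<in>Poly_Mapping.keys p. frag_cmul (Poly_Mapping.lookup p d) (frag_of (gm_shift d M)))"

definition K0_e ::
    "('i, 'p) cartan_data \<Rightarrow> 'i multiset \<Rightarrow> 'i
     \<Rightarrow> ('i, 'k::field) klr_frag set \<Rightarrow> ('i, 'k) klr_frag set" where
  "K0_e C \<nu> i = K0_map C (\<nu> - {#i#}) (\<lambda>M. frag_of (e_fun C \<nu> i M))"

text \<open>
  Division by \<open>[r]\<^sub>i!\<close> is the (unique) solution of an equation in the Grothendieck group,
  which is a free \<open>\<int>[q, q\<^sup>-\<^sup>1]\<close>-module.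
\<close>

definition K0_e_div ::
    "('i, 'p) cartan_data \<Rightarrow> 'i multiset \<Rightarrow> 'i \<Rightarrow> nat
     \<Rightarrow> ('i, 'k::field) klr_frag set \<Rightarrow> ('i, 'k) klr_frag set" where
  "K0_e_div C \<nu> i r X =
     (THE Y. Y \<in> carrier (K0 C (\<nu> - replicate_mset r i)) \<and>
        K0_scale C (\<nu> - replicate_mset r i) (qfact C i r) Y
          = weight_pow i (\<lambda>\<mu>. K0_e C \<mu> i) r \<nu> X)"

end

theory Submission imports Defs "HOL-Library.Function_Algebras" begin

text \<open>
  The words of weight \<open>ci + j\<close> are \<open>i\<^sup>pji\<^sup>c\<^sup>-\<^sup>p\<close>. The hypothesis \<open>c \<le> a\<close> makes the strand of colour \<open>j\<close> rigid,
  for a reason of degree. On an irreducible module a central element of positive degree is zero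
  (\<open>central_positive_degree_zero\<close>). The dot on the strand of colour \<open>j\<close> is such an element, and so are
  the complete symmetric polynomials \<open>h\<^sub>k\<close> in the \<open>c\<close> dots on the strands of colour \<open>i\<close>. Hence
  \<open>h\<^sub>k\<close> of a single dot vanishes for \<open>k \<ge> c\<close> and \<open>h\<^sub>k\<close> of two dots for \<open>k \<ge> c - 1\<close>, and these are the
  correction terms in the quadratic and in the braid relation for crossings with \<open>j\<close>. So such a
  crossing squares to zero and the braid relation holds exactly. This is what it takes to show that
  the vectors on which \<open>j\<close> cannot be moved to the left, not even after an action of the other
  strands, form a submodule (\<open>sigma_Kp\<close>). The leftmost word that occurs contributes to it, so it
  is everything, and then the part of the rightmost word is a submodule as well: an irreducible
  module lives on one word (\<open>irreducible_concentrated\<close>), and there \<open>\<epsilon>\<^sub>i\<close> and its dual are read off.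

  On such a module the crossings with \<open>j\<close> and the dot on \<open>j\<close> vanish, and the rest is an action of the
  nilHecke algebras of the two blocks of strands of colour \<open>i\<close>, with all \<open>h\<^sub>k\<close>, \<open>k > 0\<close>, of a block equal to
  zero. A vector of lowest degree is killed by the crossings. Its multiples by staircase monomials in
  the dots span, because \<open>h\<^sub>k = 0\<close> allows to lower exponents, and are independent, because crossings
  act as divided differences and recover the vector. This gives the character (\<open>gdim_irr\<close>). Two such
  modules are isomorphic: the pairs generated from a pair of lowest vectors form the graph of
  an isomorphism (\<open>cij_irr_unique\<close>).

  For existence, the nilHecke algebra acts on linear functionals on polynomial functions, by
  multiplication and divided differences on the functions. Evaluation of constants at a point
  generates a finite-dimensional module. The functionals killed by the \<open>h\<^sub>k\<close> of both blocks become
  an \<open>R(ci + j)\<close>-module on the word \<open>i\<^sup>pji\<^sup>c\<^sup>-\<^sup>p\<close> when everything that involves \<open>j\<close> acts by zero; the relations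
  hold because the correction terms vanish as before. An irreducible submodule is what is wanted
  (\<open>exists_irreducible\<close>).

  In the Grothendieck group, irreducible modules that are determined up to shift by the word they
  live on are separated by characters (\<open>word_reps\<close>), so that divided powers of restriction can be
  computed on characters. Let \<open>L\<close> live on \<open>i\<^sup>c\<^sup>-\<^sup>nji\<^sup>n\<close>. If \<open>s > n\<close>, its character has no word that ends in
  \<open>i\<^sup>s\<close>. If \<open>s < n\<close>, the class \<open>e\<^sub>i\<^sup>(\<^sup>s\<^sup>)[L]\<close> is, up to a shift, a Gaussian binomial coefficient times the class of the
  irreducible module on \<open>i\<^sup>c\<^sup>-\<^sup>nji\<^sup>n\<^sup>-\<^sup>s\<close>, which \<open>e\<^sub>j\<close> annihilates because that word ends in \<open>i\<close>.
\<close>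

abbreviation "single \<equiv> Poly_Mapping.single"
abbreviation "lookup \<equiv> Poly_Mapping.lookup"
abbreviation "keys \<equiv> Poly_Mapping.keys"

section \<open>Subspaces of finite-dimensional spaces\<close>

context vector_space begin

lemma finite_basis_of_subspace:
  assumes "subspace T" "T \<subseteq> span F" "finite F"
  obtains A where "A \<subseteq> T" "independent A" "finite A" "span A = T"
proof -
  obtain A where A: "A \<subseteq> T" "independent A" "T \<subseteq> span A"
    using maximal_independent_subset[of T] by blast
  have "finite A"
    using independent_span_bound[OF assms(3) A(2)] A(1) assms(2) by blast
  moreover have "span A = T"
    using A assms(1) span_subspace by blast
  ultimately show thesis
    using that A by blast
qed

lemma finite_basis_extending:
  assumes "subspace T" "T \<subseteq> span F" "finite F" "A \<subseteq> T" "independent A"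
  obtains B where "A \<subseteq> B" "B \<subseteq> T" "independent B" "finite B" "span B = T"
proof -
  obtain B where B: "A \<subseteq> B" "B \<subseteq> T" "independent B" "T \<subseteq> span B"
    using maximal_independent_subset_extend[OF assms(4,5)] by blast
  have "finite B"
    using independent_span_bound[OF assms(3) B(3)] B(2) assms(2) by blast
  moreover have "span B = T"
    using B assms(1) span_subspace by blast
  ultimately show thesis
    using that B by blast
qed

lemma dim_less_of_psubset:
  assumes "subspace S" "subspace T" "S \<subset> T" "T \<subseteq> span F" "finite F"
  shows "dim S < dim T"
proof -
  obtain A where A: "A \<subseteq> S" "independent A" "finite A" "span A = S"
    using finite_basis_of_subspace[OF assms(1) _ assms(5)] assms(3,4) by blast
  obtain B where B: "A \<subseteq> B" "B \<subseteq> T" "independent B" "finite B" "span B = T"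
    using finite_basis_extending[OF assms(2,4,5) _ A(2)] A(1) assms(3) by blast
  have "A \<noteq> B" using A B assms(3) by auto
  hence "card A < card B" using B by (metis psubsetI psubset_card_mono)
  thus ?thesis
    using A B by (metis dim_eq_card_independent dim_span)
qed

text \<open>Membership in a span is inherited by every subspace, phrased for proofs about closed sets.\<close>

lemma span_inductS:
  assumes "v \<in> span S" "P 0" "\<And>x y. P x ==> P y ==> P (x + y)" "\<And>c x. P x ==> P (scale c x)"
    "\<And>x. x \<in> S ==> P x"
  shows "P v"
proof -
  have "subspace {v. P v}" using assms by (auto intro!: subspaceI)
  thus ?thesis using span_induct[OF assms(1), of P] assms(5) by (simp add: Collect_mem_eq)
qed

end

text \<open>
  Linearity of \<open>g\<close> is asked for on \<open>S\<close>: a module's operations are controlled on its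
  underlying space and nowhere else.
\<close>

lemma rank_nullity:
  fixes s1 :: "'k::field \<Rightarrow> 'v::ab_group_add \<Rightarrow> 'v" and s2 :: "'k \<Rightarrow> 'w::ab_group_add \<Rightarrow> 'w"
  assumes vs: "vector_space s1" "vector_space s2"
    and S: "module.subspace s1 S" "S \<subseteq> module.span s1 F" "finite F"
    and add: "\<And>v w. v \<in> S ==> w \<in> S ==> g (v + w) = g v + g w"
    and scale: "\<And>c v. v \<in> S ==> g (s1 c v) = s2 c (g v)"
  shows "vector_space.dim s1 S
    = vector_space.dim s1 {v \<in> S. g v = 0} + vector_space.dim s2 (g ` S)"
proof -
  interpret V: vector_space s1 by fact
  interpret W: vector_space s2 by fact
  interpret VW: vector_space_pair s1 s2 by unfold_locales
  have g0: "g 0 = 0" using scale[of 0 0] S(1) V.subspace_0 by (metis V.scale_zero_left W.scale_zero_left)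
  let ?K = "{v \<in> S. g v = 0}"
  have K: "V.subspace ?K"
    using S(1) add scale g0 by (auto intro!: V.subspaceI simp: V.subspace_def)
  obtain A where A: "A \<subseteq> ?K" "V.independent A" "finite A" "V.span A = ?K"
    using V.finite_basis_of_subspace[OF K _ S(3)] S(2) by blast
  obtain B where B: "A \<subseteq> B" "B \<subseteq> S" "V.independent B" "finite B" "V.span B = S"
    using V.finite_basis_extending[OF S _ A(2)] A(1) by blast
  have gsum: "g (\<Sum>b\<in>X. s1 (f b) b) = (\<Sum>b\<in>X. s2 (f b) (g b))" if "X \<subseteq> S" "finite X" for X f
    using that(2,1)
  proof (induction X)
    case empty then show ?case by (simp add: g0)
  next
    case (insert x X)
    have "(\<Sum>b\<in>X. s1 (f b) b) \<in> S"
      using insert S(1) by (auto intro!: V.subspace_sum V.subspace_scale)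
    thus ?case using insert S(1) by (simp add: add scale V.subspace_scale)
  qed
  have indep: "f b = 0" if f: "(\<Sum>b\<in>B - A. s2 (f b) (g b)) = 0" and b: "b \<in> B - A" for f b
  proof -
    let ?v = "\<Sum>b\<in>B - A. s1 (f b) b"
    have vS: "?v \<in> S" using B S(1) by (auto intro!: V.subspace_sum V.subspace_scale)
    have "g ?v = 0" using f B by (subst gsum) auto
    hence "?v \<in> V.span A" using A(4) vS by simp
    then obtain u where u: "?v = (\<Sum>a\<in>A. s1 (u a) a)"
      using V.span_finite[OF A(3)] by auto
    let ?h = "\<lambda>x. if x \<in> A then - u x else f x"
    have "(\<Sum>x\<in>B. s1 (?h x) x) = (\<Sum>x\<in>B - A. s1 (?h x) x) + (\<Sum>x\<in>A. s1 (?h x) x)"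
      using B by (simp add: sum.subset_diff)
    also have "\<dots> = ?v + (\<Sum>x\<in>A. - s1 (u x) x)"
      by (intro arg_cong2[of _ _ _ _ "(+)"] sum.cong) auto
    also have "\<dots> = 0" by (simp add: u sum_negf)
    finally have "?h b = 0"
      using V.independentD[OF B(3) B(4) order_refl, where u="?h"] b by blast
    thus ?thesis using b by simp
  qed
  have inj: "inj_on g (B - A)"
  proof (rule inj_onI)
    fix a b assume ab: "a \<in> B - A" "b \<in> B - A" "g a = g b"
    show "a = b"
    proof (rule ccontr)
      assume ne: "a \<noteq> b"
      let ?f = "\<lambda>x. if x = a then 1 else if x = b then -1 else 0 :: 'k"
      have "(\<Sum>x\<in>B - A. s2 (?f x) (g x)) = (\<Sum>x\<in>{a, b}. s2 (?f x) (g x))"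
        using ab B by (intro sum.mono_neutral_right) auto
      also have "\<dots> = 0" using ne ab by simp
      finally have "?f a = 0" using indep[of ?f a] ab(1) by blast
      thus False by simp
    qed
  qed
  have ind: "W.independent (g ` (B - A))"
  proof (rule W.independent_if_scalars_zero)
    show "finite (g ` (B - A))" using B by auto
    fix f x assume f: "(\<Sum>x\<in>g ` (B - A). s2 (f x) x) = 0" and x: "x \<in> g ` (B - A)"
    have "(\<Sum>b\<in>B - A. s2 (f (g b)) (g b)) = 0"
      using f sum.reindex[OF inj, of "\<lambda>x. s2 (f x) x"] by (simp only: o_def)
    thus "f x = 0" using indep[of "f \<circ> g"] x by auto
  qed
  have sp: "g ` S \<subseteq> W.span (g ` (B - A))"
  proof
    fix y assume "y \<in> g ` S"
    then obtain v where v: "v \<in> S" "y = g v" by auto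
    then obtain u where u: "v = (\<Sum>b\<in>B. s1 (u b) b)"
      using B(5) V.span_finite[OF B(4)] by auto
    have "g v = (\<Sum>b\<in>B. s2 (u b) (g b))" using u B gsum by simp
    also have "\<dots> \<in> W.span (g ` (B - A))"
    proof (intro W.span_sum W.span_scale)
      fix b assume b: "b \<in> B"
      show "g b \<in> W.span (g ` (B - A))"
      proof (cases "b \<in> A")
        case True
        hence "g b = 0" using A by auto
        thus ?thesis by (simp add: W.span_zero)
      qed (use b in \<open>auto intro: W.span_base\<close>)
    qed
    finally show "y \<in> W.span (g ` (B - A))" using v by simp
  qed
  have "W.dim (g ` S) = card (B - A)"
    using W.dim_unique[OF _ sp ind] B card_image[OF inj] by (metis Diff_subset image_mono subset_trans)
  moreover have "V.dim S = card B" using B by (metis V.dim_eq_card_independent V.dim_span)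
  moreover have "V.dim ?K = card A" using A by (metis V.dim_eq_card_independent V.dim_span)
  moreover have "card (B - A) = card B - card A" "card A \<le> card B"
    using A B by (auto simp: card_Diff_subset card_mono)
  ultimately show ?thesis by simp
qed

section \<open>Elements of the free algebra and of \<open>R(\<nu>)\<close>\<close>

definition gen :: "'g \<Rightarrow> ('g fmon \<Rightarrow>\<^sub>0 'k::field)" where
  "gen g = single (FMon [g]) 1"

abbreviation const :: "'k::field \<Rightarrow> ('g fmon \<Rightarrow>\<^sub>0 'k)" where
  "const a \<equiv> single 0 a"

lemma idemp_gen: "idemp u = gen (Idemp u)" and dot_gen: "dot r = gen (Dot r)"
  and crs_gen: "crs r = gen (Cross r)"
  by (simp_all add: idemp_def dot_def crs_def gen_def)

lemma single_Cons: "single (FMon (g # w)) c = gen g * single (FMon w) c"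
  by (simp add: gen_def mult_single plus_fmon_def)

lemma single_Nil: "single (FMon []) c = const c"
  by (simp add: zero_fmon_def)

lemma carrier_free_alg_iff: "p \<in> carrier (free_alg S) \<longleftrightarrow> (\<forall>w\<in>keys p. set (letters w) \<subseteq> S)"
  by (simp add: free_alg_def)

lemma free_alg_ops [simp]:
  "(\<otimes>\<^bsub>free_alg S\<^esub>) = (*)" "(\<oplus>\<^bsub>free_alg S\<^esub>) = (+)" "\<one>\<^bsub>free_alg S\<^esub> = 1" "\<zero>\<^bsub>free_alg S\<^esub> = 0"
  by (simp_all add: free_alg_def)

lemma free_alg_add: "p \<in> carrier (free_alg S) ==> q \<in> carrier (free_alg S) ==> p + q \<in> carrier (free_alg S)"
  unfolding carrier_free_alg_iff using keys_add[of p q] by blast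

lemma free_alg_uminus: "p \<in> carrier (free_alg S) ==> - p \<in> carrier (free_alg S)"
  unfolding carrier_free_alg_iff by simp

lemma free_alg_diff: "p \<in> carrier (free_alg S) ==> q \<in> carrier (free_alg S) ==> p - q \<in> carrier (free_alg S)"
  using free_alg_add[of p S "- q"] free_alg_uminus[of q S] by simp

lemma free_alg_mult: "p \<in> carrier (free_alg S) ==> q \<in> carrier (free_alg S) ==> p * q \<in> carrier (free_alg S)"
  unfolding carrier_free_alg_iff using keys_mult[of p q] by (force simp: plus_fmon_def)

lemma free_alg_const: "const a \<in> carrier (free_alg S)"
  unfolding carrier_free_alg_iff by (simp add: zero_fmon_def)

lemma free_alg_zero: "0 \<in> carrier (free_alg S)"
  unfolding carrier_free_alg_iff by simp

lemma free_alg_one: "1 \<in> carrier (free_alg S)"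
  using free_alg_const[of 1 S] by simp

lemma free_alg_gen: "g \<in> S ==> gen g \<in> carrier (free_alg S)"
  unfolding carrier_free_alg_iff gen_def by simp

lemma free_alg_power: "p \<in> carrier (free_alg S) ==> p ^ n \<in> carrier (free_alg S)"
  by (induction n) (auto intro: free_alg_one free_alg_mult)

lemma free_alg_sum: "(\<And>x. x \<in> A ==> f x \<in> carrier (free_alg S)) ==> sum f A \<in> carrier (free_alg S)"
  by (induction A rule: infinite_finite_induct) (auto intro: free_alg_zero free_alg_add)

lemmas free_alg_closed = free_alg_add free_alg_uminus free_alg_diff free_alg_mult free_alg_const
  free_alg_zero free_alg_one free_alg_gen free_alg_power free_alg_sum

lemma poly_mapping_sum_singles: "p = (\<Sum>w\<in>keys p. single w (lookup p w))"
  by (rule poly_mapping_eqI) (auto simp: lookup_sum lookup_single when_def in_keys_iff)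

lemma free_alg_induct [consumes 1, case_names const add gen]:
  assumes p: "p \<in> carrier (free_alg S)"
    and c: "\<And>a. P (const a)"
    and a: "\<And>p q. p \<in> carrier (free_alg S) ==> q \<in> carrier (free_alg S) ==> P p ==> P q ==> P (p + q)"
    and g: "\<And>g p. g \<in> S ==> p \<in> carrier (free_alg S) ==> P p ==> P (gen g * p)"
  shows "P p"
proof -
  have P0: "P 0" using c[of 0] by simp
  have sing: "P (single (FMon w) b) \<and> single (FMon w) b \<in> carrier (free_alg S)"
    if "set w \<subseteq> S" for w b
    using that
  proof (induction w)
    case Nil show ?case using c by (simp only: single_Nil) (auto simp: free_alg_const)
  next
    case (Cons x w) thus ?case unfolding single_Cons by (auto intro!: g free_alg_mult free_alg_gen)
  qed
  have "P (\<Sum>w\<in>A. single w (lookup p w)) \<and>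
        (\<Sum>w\<in>A. single w (lookup p w)) \<in> carrier (free_alg S)"
    if "A \<subseteq> keys p" for A
    using finite_subset[OF that finite_keys] that
  proof (induction A)
    case empty show ?case using P0 by (simp add: free_alg_zero)
  next
    case (insert x A)
    have "set (letters x) \<subseteq> S" using insert p by (auto simp: carrier_free_alg_iff)
    hence "P (single x (lookup p x)) \<and>
       single x (lookup p x) \<in> carrier (free_alg S)"
      using sing[of "letters x"] by simp
    thus ?case using insert by (auto intro!: a free_alg_add)
  qed
  from this[of "keys p"] show ?thesis
    using poly_mapping_sum_singles[of p] by simp
qed

lemma const_mult_commute: "const a * p = p * (const a :: ('g fmon \<Rightarrow>\<^sub>0 'k::field))"
proof -
  have "p \<in> carrier (free_alg UNIV)" by (simp add: carrier_free_alg_iff)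
  thus ?thesis
  proof (induction p rule: free_alg_induct)
    case (gen g p)
    have *: "const a * gen g = gen g * (const a :: ('g fmon \<Rightarrow>\<^sub>0 'k))"
      by (simp add: gen_def mult_single)
    have "const a * (gen g * p) = const a * gen g * p" by (simp only: mult.assoc)
    also have "\<dots> = gen g * (const a * p)" by (simp only: * mult.assoc)
    also have "\<dots> = gen g * p * const a" by (simp only: gen(3) mult.assoc)
    finally show ?case .
  qed (auto simp: mult_single mult.commute distrib_left distrib_right)
qed

lemma free_alg_ring: "ring (free_alg S :: ('g fmon \<Rightarrow>\<^sub>0 'k::field) ring)"
proof (rule ringI)
  show "abelian_group (free_alg S :: ('g fmon \<Rightarrow>\<^sub>0 'k) ring)"
  proof (rule abelian_groupI)
    fix x :: "'g fmon \<Rightarrow>\<^sub>0 'k" assume "x \<in> carrier (free_alg S)"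
    thus "\<exists>y\<in>carrier (free_alg S). y \<oplus>\<^bsub>free_alg S\<^esub> x = \<zero>\<^bsub>free_alg S\<^esub>"
      by (intro bexI[of _ "- x"]) (auto intro: free_alg_uminus)
  qed (auto intro: free_alg_closed simp: add.assoc add.commute)
  show "Group.monoid (free_alg S :: ('g fmon \<Rightarrow>\<^sub>0 'k) ring)"
    by (rule monoidI) (auto intro: free_alg_closed simp: mult.assoc)
qed (auto intro: free_alg_closed simp: distrib_left distrib_right)

lemma free_alg_a_inv: "p \<in> carrier (free_alg S) ==> a_inv (free_alg S) p = - p"
  by (rule abelian_group.minus_equality[OF ring.is_abelian_group[OF free_alg_ring]])
    (auto intro: free_alg_uminus)

abbreviation seqs :: "'i multiset \<Rightarrow> 'i list set" where
  "seqs \<nu> \<equiv> permutations_of_multiset \<nu>"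

abbreviation klr_fcar :: "'i multiset \<Rightarrow> ('i, 'k::field) klr_free set" where
  "klr_fcar \<nu> \<equiv> carrier (free_alg (klr_gens \<nu>))"

lemma idemp_in: "u \<in> seqs \<nu> ==> idemp u \<in> klr_fcar \<nu>"
  and dot_in: "r < size \<nu> ==> dot r \<in> klr_fcar \<nu>"
  and crs_in: "Suc r < size \<nu> ==> crs r \<in> klr_fcar \<nu>"
  by (auto simp: idemp_gen dot_gen crs_gen klr_gens_def intro!: free_alg_gen)

lemma finite_seqs [simp]: "finite (seqs \<nu>)" by simp

lemma seqs_length: "u \<in> seqs \<nu> ==> length u = size \<nu>"
  by (auto simp: permutations_of_multiset_def)

lemma length_swap_seq [simp]: "length (swap_seq r u) = length u"
  by (simp add: swap_seq_def)

lemma swap_seq_in: "u \<in> seqs \<nu> ==> Suc r < size \<nu> ==> swap_seq r u \<in> seqs \<nu>"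
  by (auto simp: permutations_of_multiset_def swap_seq_def mset_swap)

lemma swap_seq_swap_seq: "Suc r < length u ==> swap_seq r (swap_seq r u) = u"
  by (auto simp: swap_seq_def list_eq_iff_nth_eq nth_list_update)

lemma bij_swap_seq: "Suc r < size \<nu> ==> bij_betw (swap_seq r) (seqs \<nu>) (seqs \<nu>)"
  by (rule bij_betw_byWitness[of _ "swap_seq r"])
    (auto simp: swap_seq_swap_seq seqs_length swap_seq_in)

lemmas klr_closed = free_alg_closed idemp_in dot_in crs_in

lemma klr_relators_in: "p \<in> klr_relators C \<nu> ==> p \<in> klr_fcar \<nu>"
proof (induction p rule: klr_relators.induct)
  case (crs_dot u r t)
  have "transpose r (Suc r) t < size \<nu>" using crs_dot by (auto simp: transpose_def)
  thus ?case using crs_dot by (auto intro!: klr_closed)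
qed (auto intro!: klr_closed simp: swap_seq_in)

lemma klr_ideal: "ideal (klr_ideal C \<nu> :: ('i,'k::field) klr_free set) (free_alg (klr_gens \<nu>))"
  unfolding klr_ideal_def by (rule ring.genideal_ideal[OF free_alg_ring]) (auto intro: klr_relators_in)

lemma klr_relators_ideal: "p \<in> klr_relators C \<nu> ==> p \<in> klr_ideal C \<nu>"
  unfolding klr_ideal_def using ring.genideal_self[OF free_alg_ring] klr_relators_in by blast

text \<open>Universal property of \<open>R(\<nu>)\<close>, in the form in which it is used: the kernel of any map
  that respects sums and left and right multiplication contains the ideal as soon as it
  contains the relators.\<close>

lemma klr_ideal_induct [consumes 1, case_names rel zero add uminus left right]:
  assumes "p \<in> klr_ideal C \<nu>"
    and "\<And>p. p \<in> klr_relators C \<nu> ==> Q p"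
    and "Q 0"
    and "\<And>p q. p \<in> klr_fcar \<nu> ==> q \<in> klr_fcar \<nu> ==> Q p ==> Q q ==> Q (p + q)"
    and "\<And>p. p \<in> klr_fcar \<nu> ==> Q p ==> Q (- p)"
    and "\<And>p q. p \<in> klr_fcar \<nu> ==> q \<in> klr_fcar \<nu> ==> Q p ==> Q (q * p)"
    and "\<And>p q. p \<in> klr_fcar \<nu> ==> q \<in> klr_fcar \<nu> ==> Q p ==> Q (p * q)"
  shows "Q (p :: ('i,'k::field) klr_free)"
proof -
  let ?R = "free_alg (klr_gens \<nu>) :: ('i klr_gen fmon \<Rightarrow>\<^sub>0 'k) ring"
  let ?J = "{p \<in> klr_fcar \<nu>. Q p}"
  have "ideal ?J ?R"
  proof (rule idealI)
    show "ring ?R" by (rule free_alg_ring)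
    have ag: "abelian_group ?R" by (rule ring.is_abelian_group[OF free_alg_ring])
    show "subgroup ?J (add_monoid ?R)"
    proof (rule group.subgroupI[OF abelian_group.a_group[OF ag]])
      fix a assume "a \<in> ?J"
      moreover from this have "inv\<^bsub>add_monoid ?R\<^esub> a = - a"
        using free_alg_a_inv[of a "klr_gens \<nu>"] by (simp add: a_inv_def)
      ultimately show "inv\<^bsub>add_monoid ?R\<^esub> a \<in> ?J" using assms by (auto intro: klr_closed)
    qed (use assms in \<open>auto intro: klr_closed\<close>)
  qed (use assms in \<open>auto intro: klr_closed\<close>)
  hence "klr_ideal C \<nu> \<subseteq> ?J"
    unfolding klr_ideal_def using assms(2) klr_relators_in
    by (intro ring.genideal_minimal[OF free_alg_ring]) auto
  thus ?thesis using assms(1) by auto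
qed

lemma klr_ring: "ring (klr C \<nu>)"
  unfolding klr_def by (rule ideal.quotient_is_ring[OF klr_ideal])

lemma klr_cls_hom: "klr_cls C \<nu> \<in> ring_hom (free_alg (klr_gens \<nu>)) (klr C \<nu>)"
proof -
  have "klr_cls C \<nu> = (+>\<^bsub>free_alg (klr_gens \<nu>)\<^esub>) (klr_ideal C \<nu>)"
    by (rule ext) (simp add: klr_cls_def)
  thus ?thesis unfolding klr_def using ideal.rcos_ring_hom[OF klr_ideal] by metis
qed

lemma klr_cls_in [simp]: "p \<in> klr_fcar \<nu> ==> klr_cls C \<nu> p \<in> carrier (klr C \<nu>)"
  using ring_hom_closed[OF klr_cls_hom] .

lemma klr_carrierE:
  assumes "r \<in> carrier (klr C \<nu>)" obtains p where "p \<in> klr_fcar \<nu>" "r = klr_cls C \<nu> p"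
  using assms unfolding klr_def FactRing_def A_RCOSETS_def' klr_cls_def by auto

lemma klr_cls_add: "p \<in> klr_fcar \<nu> ==> q \<in> klr_fcar \<nu> ==>
    klr_cls C \<nu> (p + q) = klr_cls C \<nu> p \<oplus>\<^bsub>klr C \<nu>\<^esub> klr_cls C \<nu> q"
  using ring_hom_add[OF klr_cls_hom] by simp

lemma klr_cls_mult: "p \<in> klr_fcar \<nu> ==> q \<in> klr_fcar \<nu> ==>
    klr_cls C \<nu> (p * q) = klr_cls C \<nu> p \<otimes>\<^bsub>klr C \<nu>\<^esub> klr_cls C \<nu> q"
  using ring_hom_mult[OF klr_cls_hom] by simp

lemma klr_cls_one: "klr_cls C \<nu> 1 = \<one>\<^bsub>klr C \<nu>\<^esub>"
  using ring_hom_one[OF klr_cls_hom] by simp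

lemma klr_cls_zero: "klr_cls C \<nu> 0 = \<zero>\<^bsub>klr C \<nu>\<^esub>"
  using ring_hom_zero[OF klr_cls_hom free_alg_ring klr_ring] by simp

lemma klr_cls_eq_iff: "p \<in> klr_fcar \<nu> ==> q \<in> klr_fcar \<nu> ==>
    klr_cls C \<nu> p = klr_cls C \<nu> q \<longleftrightarrow> p - q \<in> klr_ideal C \<nu>"
  unfolding klr_cls_def
  using ring.quotient_eq_iff_same_a_r_cos[OF free_alg_ring klr_ideal, of p \<nu> q C] free_alg_a_inv[of q]
  by (auto simp: a_minus_def)

lemma klr_cls_rel: "p \<in> klr_relators C \<nu> ==> klr_cls C \<nu> p = klr_cls C \<nu> 0"
  using klr_cls_eq_iff[OF klr_relators_in free_alg_zero, of p C \<nu> C] klr_relators_ideal[of p C \<nu>] by simp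

lemma klr_cls_mem: "q \<in> klr_cls C \<nu> p \<longleftrightarrow> q \<in> klr_fcar \<nu> \<and> klr_cls C \<nu> q = klr_cls C \<nu> p"
  if "p \<in> klr_fcar \<nu>"
proof -
  have I: "klr_ideal C \<nu> \<subseteq> klr_fcar \<nu>"
    using additive_subgroup.a_subset[OF ideal.axioms(1)[OF klr_ideal]] .
  have "q \<in> klr_cls C \<nu> p \<longleftrightarrow> q - p \<in> klr_ideal C \<nu>"
    unfolding klr_cls_def a_r_coset_def' by (force intro: bexI[of _ "q - p"])
  moreover have "q \<in> klr_fcar \<nu>" if "q - p \<in> klr_ideal C \<nu>"
    using free_alg_add[of "q - p" "klr_gens \<nu>" p] that I \<open>p \<in> klr_fcar \<nu>\<close> by auto
  ultimately show ?thesis using klr_cls_eq_iff[of q \<nu> p C] that by blast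
qed

section \<open>Operators on a module\<close>

text \<open>
  Elements of \<open>R(\<nu>)\<close> act through representatives in the free algebra, where computations with
  generators take place.
\<close>

definition gact :: "('i, 'p) cartan_data \<Rightarrow> 'i multiset
     \<Rightarrow> (('i, 'k::field) klr_elem, 'k, 'v::ab_group_add) gmodule \<Rightarrow> ('i, 'k) klr_free \<Rightarrow> 'v \<Rightarrow> 'v" where
  "gact C \<nu> M p v = gm_act M (klr_cls C \<nu> p) v"

definition hc :: "('r, 'k::field, 'v::ab_group_add) gmodule \<Rightarrow> 'v \<Rightarrow> int \<Rightarrow> 'v" where
  "hc M v = (THE f. (\<forall>d. f d \<in> gm_part M d) \<and> finite {d. f d \<noteq> 0} \<and> v = (\<Sum>d | f d \<noteq> 0. f d))"

lemma klr_const_cls: "klr_const C \<nu> a = klr_cls C \<nu> (const a)"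
  by (simp add: klr_const_def)

lemma klr_homog_in: "klr_homog C \<nu> d r ==> r \<in> carrier (klr C \<nu>)"
proof (induction rule: klr_homog.induct)
  case (scale d x c)
  show ?case unfolding klr_const_cls
    by (rule monoid.m_closed[OF ring.is_monoid[OF klr_ring] klr_cls_in scale.IH]) (rule free_alg_const)
qed (auto intro!: klr_cls_in klr_closed ring.ring_simprules[OF klr_ring])

context klr_module
begin

sublocale vs: vector_space "gm_scale M" by (rule vector_space)

abbreviation "S \<equiv> gm_space M"
abbreviation "act \<equiv> gact C \<nu> M"
abbreviation "E u \<equiv> gact C \<nu> M (idemp u)"
abbreviation "X r \<equiv> gact C \<nu> M (dot r)"
abbreviation "P r \<equiv> gact C \<nu> M (crs r)"

lemma zero_in [simp]: "0 \<in> S" using vs.subspace_0[OF subspace] .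
lemma add_in: "v \<in> S ==> w \<in> S ==> v + w \<in> S" using vs.subspace_add[OF subspace] .
lemma diff_in: "v \<in> S ==> w \<in> S ==> v - w \<in> S" using vs.subspace_diff[OF subspace] .
lemma neg_in: "v \<in> S ==> - v \<in> S" using vs.subspace_neg[OF subspace] .
lemma scale_in: "v \<in> S ==> gm_scale M c v \<in> S" using vs.subspace_scale[OF subspace] .
lemma sum_in: "(\<And>x. x \<in> B ==> f x \<in> S) ==> sum f B \<in> S" using vs.subspace_sum[OF subspace] .

lemma act_in: "p \<in> klr_fcar \<nu> ==> v \<in> S ==> act p v \<in> S"
  by (simp add: gact_def act_closed)

lemma act_addr: "p \<in> klr_fcar \<nu> ==> v \<in> S ==> w \<in> S ==> act p (v + w) = act p v + act p w"
  by (simp add: gact_def act_add_right)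

lemma act_addl: "p \<in> klr_fcar \<nu> ==> q \<in> klr_fcar \<nu> ==> v \<in> S ==> act (p + q) v = act p v + act q v"
  by (simp add: gact_def klr_cls_add act_add_left)

lemma act_times: "p \<in> klr_fcar \<nu> ==> q \<in> klr_fcar \<nu> ==> v \<in> S ==> act (p * q) v = act p (act q v)"
  by (simp add: gact_def klr_cls_mult act_mult)

lemma act_1: "v \<in> S ==> act 1 v = v"
  by (simp add: gact_def klr_cls_one act_one)

lemma act_const': "v \<in> S ==> act (const a) v = gm_scale M a v"
  by (simp add: gact_def act_const flip: klr_const_cls)

lemma act_0: "v \<in> S ==> act 0 v = 0"
  using act_addl[of 0 0 v] by (simp add: free_alg_zero)

lemma act_zero [simp]: "p \<in> klr_fcar \<nu> ==> act p 0 = 0"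
  using act_addr[of p 0 0] by simp

lemma act_uminus: "p \<in> klr_fcar \<nu> ==> v \<in> S ==> act (- p) v = - act p v"
  using act_addl[of p "- p" v] act_0[of v] by (simp add: free_alg_uminus eq_neg_iff_add_eq_0 add.commute)

lemma act_diff: "p \<in> klr_fcar \<nu> ==> q \<in> klr_fcar \<nu> ==> v \<in> S ==> act (p - q) v = act p v - act q v"
  using act_addl[of p "- q" v] by (simp add: free_alg_uminus act_uminus)

lemma act_suml: "(\<And>x. x \<in> B ==> f x \<in> klr_fcar \<nu>) ==> v \<in> S ==> act (\<Sum>x\<in>B. f x) v = (\<Sum>x\<in>B. act (f x) v)"
  by (induction B rule: infinite_finite_induct) (auto simp: act_0 act_addl free_alg_sum)

lemma act_negr: "p \<in> klr_fcar \<nu> ==> v \<in> S ==> act p (- v) = - act p v"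
  using act_addr[of p v "- v"] by (simp add: neg_in eq_neg_iff_add_eq_0 add.commute)

lemma act_diffr: "p \<in> klr_fcar \<nu> ==> v \<in> S ==> w \<in> S ==> act p (v - w) = act p v - act p w"
  using act_addr[of p v "- w"] by (simp add: neg_in act_negr)

lemma act_sumr: "p \<in> klr_fcar \<nu> ==> (\<And>x. x \<in> B ==> f x \<in> S) ==> act p (\<Sum>x\<in>B. f x) = (\<Sum>x\<in>B. act p (f x))"
  by (induction B rule: infinite_finite_induct) (auto simp: act_addr sum_in)

lemma act_scale: "p \<in> klr_fcar \<nu> ==> v \<in> S ==> act p (gm_scale M a v) = gm_scale M a (act p v)"
  using act_times[of p "const a" v] act_times[of "const a" p v] const_mult_commute[of a p]
  by (simp add: act_const' act_in free_alg_const)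

lemma act_power: "p \<in> klr_fcar \<nu> ==> v \<in> S ==> act (p ^ n) v = (act p ^^ n) v"
  by (induction n) (auto simp: act_1 act_times free_alg_power)

lemma act_power_in: "p \<in> klr_fcar \<nu> ==> v \<in> S ==> (act p ^^ n) v \<in> S"
  by (induction n) (auto simp: act_in)

lemma act_rel: "p \<in> klr_relators C \<nu> ==> v \<in> S ==> act p v = 0"
  using klr_cls_rel[of p C \<nu>] act_0[of v] by (simp add: gact_def)

lemmas act_simps = act_addl act_diff act_uminus act_times act_1 act_0 act_suml act_power act_in

lemma E_in: "u \<in> seqs \<nu> ==> v \<in> S ==> E u v \<in> S"
  and X_in: "r < size \<nu> ==> v \<in> S ==> X r v \<in> S"
  and P_in: "Suc r < size \<nu> ==> v \<in> S ==> P r v \<in> S"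
  by (simp_all add: act_in klr_closed)

lemma E_E:
  assumes "u \<in> seqs \<nu>" "w \<in> seqs \<nu>" "v \<in> S"
  shows "E u (E w v) = (if u = w then E u v else 0)"
  using act_rel[OF klr_relators.idem_idem[OF assms(1,2)] assms(3)] assms
  by (auto simp: act_simps klr_closed split: if_splits)

lemma E_sum: "v \<in> S ==> (\<Sum>u\<in>seqs \<nu>. E u v) = v"
  using act_rel[OF klr_relators.unit, of v] by (simp add: act_simps klr_closed)

lemma X_E: "u \<in> seqs \<nu> ==> r < size \<nu> ==> v \<in> S ==> X r (E u v) = E u (X r v)"
  using act_rel[OF klr_relators.dot_idem[of u \<nu> r], of v] by (simp add: act_simps klr_closed)

lemma P_E: "u \<in> seqs \<nu> ==> Suc r < size \<nu> ==> v \<in> S ==> P r (E u v) = E (swap_seq r u) (P r v)"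
  using act_rel[OF klr_relators.crs_idem[of u \<nu> r], of v] by (simp add: act_simps klr_closed swap_seq_in)

lemma X_X: "r < size \<nu> ==> t < size \<nu> ==> v \<in> S ==> X r (X t v) = X t (X r v)"
  using act_rel[OF klr_relators.dot_dot[of r \<nu> t], of v] by (simp add: act_simps klr_closed)

lemma P_P: "Suc r < size \<nu> ==> Suc t < size \<nu> ==> \<bar>int r - int t\<bar> > 1 ==> v \<in> S ==>
    P r (P t v) = P t (P r v)"
  using act_rel[OF klr_relators.crs_crs[of r \<nu> t], of v] by (simp add: act_simps klr_closed)

lemma P_sq:
  assumes "u \<in> seqs \<nu>" "Suc r < size \<nu>" "v \<in> S" "E u v = v"
  shows "P r (P r v) = (if u ! r = u ! Suc r then 0 else if rform C (u ! r) (u ! Suc r) = 0 then v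
     else (X r ^^ nat (cartan_a C (u ! r) (u ! Suc r))) v + (X (Suc r) ^^ nat (cartan_a C (u ! Suc r) (u ! r))) v)"
  using act_rel[OF klr_relators.crs_sq[OF assms(1,2) refl refl] assms(3)] assms
  by (auto simp: act_simps klr_closed split: if_splits)

lemma P_braid:
  assumes "u \<in> seqs \<nu>" "Suc (Suc r) < size \<nu>" "v \<in> S" "E u v = v"
    and a: "a = nat (cartan_a C (u ! r) (u ! Suc r))"
  shows "P r (P (Suc r) (P r v)) - P (Suc r) (P r (P (Suc r) v)) =
    (if u ! r = u ! Suc (Suc r) \<and> rform C (u ! r) (u ! Suc r) \<noteq> 0
     then \<Sum>t<a. (X r ^^ t) ((X (Suc (Suc r)) ^^ (a - 1 - t)) v) else 0)"
proof -
  have s: "Suc r < size \<nu>" "r < size \<nu>" using assms by auto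
  note 1 = act_rel[OF klr_relators.braid[OF assms(1,2) refl refl refl a] assms(3)]
  show ?thesis
  proof (cases "u ! r = u ! Suc (Suc r) \<and> rform C (u ! r) (u ! Suc r) \<noteq> 0")
    case True
    show ?thesis using 1 assms(1-4) s unfolding if_P[OF True]
      by (simp add: act_simps klr_closed act_power_in)
  next
    case False
    show ?thesis using 1 assms(1-4) s unfolding if_not_P[OF False]
      by (simp add: act_simps klr_closed act_power_in)
  qed
qed

lemma P_X:
  assumes "u \<in> seqs \<nu>" "Suc r < size \<nu>" "t < size \<nu>" "v \<in> S" "E u v = v"
  shows "P r (X t v) = X (transpose r (Suc r) t) (P r v) +
    (if t = r \<and> u ! r = u ! Suc r then v else if t = Suc r \<and> u ! r = u ! Suc r then - v else 0)"
proof -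
  have s: "transpose r (Suc r) t < size \<nu>" using assms by (auto simp: transpose_def)
  show ?thesis
    using act_rel[OF klr_relators.crs_dot[OF assms(1-3)] assms(4)] assms s
    by (auto simp: act_simps klr_closed algebra_simps split: if_splits)
qed

text \<open>Subsets and maps need only be tested against generators.\<close>

lemma closed_of_gens:
  assumes N: "gm_subspace M N" "N \<subseteq> S" and g: "\<And>g v. g \<in> klr_gens \<nu> ==> v \<in> N ==> act (gen g) v \<in> N"
    and r: "r \<in> carrier (klr C \<nu>)" and v: "v \<in> N"
  shows "gm_act M r v \<in> N"
proof -
  obtain p where p: "p \<in> klr_fcar \<nu>" "r = klr_cls C \<nu> p" using r by (rule klr_carrierE)
  have "act p v \<in> N" using p(1)
  proof (induction p rule: free_alg_induct)
    case (const a) thus ?case using N v by (auto simp: act_const' vs.subspace_scale)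
  next
    case (add p q) thus ?case using N v by (auto simp: act_addl vs.subspace_add)
  next
    case (gen x p) thus ?case using N v g by (auto simp: act_times free_alg_gen)
  qed
  thus ?thesis by (simp add: p gact_def)
qed

lemma part_add: "v \<in> gm_part M d ==> w \<in> gm_part M d ==> v + w \<in> gm_part M d"
  using vs.subspace_add[OF part_subspace] .
lemma part_scale: "v \<in> gm_part M d ==> gm_scale M c v \<in> gm_part M d"
  using vs.subspace_scale[OF part_subspace] .
lemma part_zero [simp]: "0 \<in> gm_part M d"
  using vs.subspace_0[OF part_subspace] .
lemma part_in: "v \<in> gm_part M d ==> v \<in> S"
  using part_subset by blast

lemma
  assumes "v \<in> S"
  shows hc_part: "hc M v d \<in> gm_part M d" and hc_finite: "finite {d. hc M v d \<noteq> 0}"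
    and hc_sum: "v = (\<Sum>d | hc M v d \<noteq> 0. hc M v d)"
proof -
  from theI'[OF part_decomp[OF assms]]
  have "(\<forall>d. hc M v d \<in> gm_part M d) \<and> finite {d. hc M v d \<noteq> 0} \<and> v = (\<Sum>d | hc M v d \<noteq> 0. hc M v d)"
    unfolding hc_def .
  thus "hc M v d \<in> gm_part M d" "finite {d. hc M v d \<noteq> 0}" "v = (\<Sum>d | hc M v d \<noteq> 0. hc M v d)"
    by auto
qed

lemma hc_unique:
  assumes "\<And>d. f d \<in> gm_part M d" "finite A" "\<And>d. d \<notin> A ==> f d = 0" "v = (\<Sum>d\<in>A. f d)"
  shows "hc M v = f"
proof -
  have v: "v \<in> S" unfolding assms(4) by (rule sum_in) (use assms(1) part_in in auto)
  have sub: "{d. f d \<noteq> 0} \<subseteq> A" using assms(3) by blast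
  have "finite {d. f d \<noteq> 0}" using finite_subset[OF sub assms(2)] .
  moreover have "v = (\<Sum>d | f d \<noteq> 0. f d)"
    unfolding assms(4) by (rule sum.mono_neutral_right[OF assms(2) sub]) auto
  ultimately show ?thesis
    using part_decomp[OF v] hc_part[OF v] hc_finite[OF v] hc_sum[OF v] assms(1) by blast
qed

lemma hc_of_part: "v \<in> gm_part M d ==> hc M v = (\<lambda>e. if e = d then v else 0)"
  by (rule hc_unique[of _ "{d}"]) auto

lemma hc_in: "v \<in> S ==> hc M v d \<in> S" using hc_part part_in by blast

lemma hc_map:
  assumes T: "\<And>v w. v \<in> S ==> w \<in> S ==> T (v + w) = T v + T w"
    and part: "\<And>d v. v \<in> gm_part M d ==> T v \<in> gm_part M (d + \<delta>)" and v: "v \<in> S"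
  shows "hc M (T v) (d + \<delta>) = T (hc M v d)"
proof -
  have T0: "T 0 = 0" using T[of 0 0] by simp
  have Tsum: "T (\<Sum>x\<in>B. f x) = (\<Sum>x\<in>B. T (f x))" if "\<And>x. x \<in> B ==> f x \<in> S" for f and B :: "int set"
    using that by (induction B rule: infinite_finite_induct) (auto simp: T0 T sum_in)
  let ?D = "{d. hc M v d \<noteq> 0}"
  have "hc M (T v) = (\<lambda>e. T (hc M v (e - \<delta>)))"
  proof (rule hc_unique)
    show "finite ((\<lambda>d. d + \<delta>) ` ?D)" using hc_finite[OF v] by simp
    show "T (hc M v (e - \<delta>)) \<in> gm_part M e" for e using part[OF hc_part[OF v], of "e - \<delta>"] by simp
    show "T (hc M v (e - \<delta>)) = 0" if "e \<notin> (\<lambda>d. d + \<delta>) ` ?D" for e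
    proof -
      have "e - \<delta> \<notin> ?D" using that by (auto simp: image_iff)
      thus ?thesis by (simp add: T0)
    qed
    have "T v = (\<Sum>d\<in>?D. T (hc M v d))" by (subst hc_sum[OF v], subst Tsum) (auto simp: hc_in v)
    also have "\<dots> = (\<Sum>d\<in>(\<lambda>d. d + \<delta>) ` ?D. T (hc M v (d - \<delta>)))"
      by (subst sum.reindex) (auto simp: inj_on_def)
    finally show "T v = (\<Sum>d\<in>(\<lambda>d. d + \<delta>) ` ?D. T (hc M v (d - \<delta>)))" .
  qed
  thus ?thesis by simp
qed

lemma hc_add: "v \<in> S ==> w \<in> S ==> hc M (v + w) d = hc M v d + hc M w d"
proof -
  assume v: "v \<in> S" and w: "w \<in> S"
  let ?A = "{d. hc M v d \<noteq> 0} \<union> {d. hc M w d \<noteq> 0}"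
  have f: "finite ?A" using hc_finite v w by auto
  have e: "x = (\<Sum>d\<in>?A. hc M x d)" if "x = v \<or> x = w" for x
  proof -
    have "(\<Sum>d\<in>?A. hc M x d) = (\<Sum>d | hc M x d \<noteq> 0. hc M x d)"
      by (rule sum.mono_neutral_right[OF f]) (use that in auto)
    thus ?thesis using hc_sum[of x] that v w by auto
  qed
  have "hc M (v + w) = (\<lambda>d. hc M v d + hc M w d)"
  proof (rule hc_unique[OF _ f])
    have "v + w = (\<Sum>d\<in>?A. hc M v d) + (\<Sum>d\<in>?A. hc M w d)" using e[of v] e[of w] by simp
    thus "v + w = (\<Sum>d\<in>?A. hc M v d + hc M w d)" by (simp only: sum.distrib)
  qed (auto intro: part_add hc_part v w)
  thus ?thesis by simp
qed

lemma hc_scale: "v \<in> S ==> hc M (gm_scale M c v) d = gm_scale M c (hc M v d)"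
  using hc_map[of "gm_scale M c" 0 v d] by (simp add: vs.scale_right_distrib part_scale)

lemma hc_zero [simp]: "hc M 0 d = 0"
  using hc_of_part[of 0 0] by simp

lemma hc_eq_0: "v \<in> S ==> (\<And>d. hc M v d = 0) ==> v = 0"
  using hc_sum[of v] by simp

text \<open>
  Closure under homogeneous components takes the place of the spanning condition in \<open>gm_submodule_def\<close>.
\<close>

lemma submoduleI:
  assumes N: "gm_subspace M N" "N \<subseteq> S"
    and r: "\<And>r v. r \<in> carrier (klr C \<nu>) ==> v \<in> N ==> gm_act M r v \<in> N"
    and h: "\<And>v d. v \<in> N ==> hc M v d \<in> N"
  shows "gm_submodule C \<nu> M N"
proof -
  have "v \<in> gm_span M (\<Union>d. N \<inter> gm_part M d)" if "v \<in> N" for v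
  proof -
    have "v = (\<Sum>d | hc M v d \<noteq> 0. hc M v d)" using hc_sum that N by auto
    also have "\<dots> \<in> gm_span M (\<Union>d. N \<inter> gm_part M d)"
    proof (intro vs.span_sum vs.span_base)
      fix d show "hc M v d \<in> (\<Union>d. N \<inter> gm_part M d)"
        using h[OF that, of d] hc_part[of v d] that N by auto
    qed
    finally show ?thesis .
  qed
  moreover have "gm_span M (\<Union>d. N \<inter> gm_part M d) \<subseteq> N"
    by (rule vs.span_minimal[OF _ N(1)]) auto
  ultimately show ?thesis using N r unfolding gm_submodule_def by blast
qed

lemma
  assumes "gm_submodule C \<nu> M N"
  shows sub_subspace: "gm_subspace M N" and sub_le: "N \<subseteq> S"
    and sub_act: "\<And>r v. r \<in> carrier (klr C \<nu>) ==> v \<in> N ==> gm_act M r v \<in> N"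
    and sub_hc: "\<And>v d. v \<in> N ==> hc M v d \<in> N"
proof -
  note * = assms[unfolded gm_submodule_def]
  show N: "gm_subspace M N" "N \<subseteq> S" "\<And>r v. r \<in> carrier (klr C \<nu>) ==> v \<in> N ==> gm_act M r v \<in> N"
    using * by blast+
  fix v d assume v: "v \<in> N"
  have "v \<in> gm_span M (\<Union>d. N \<inter> gm_part M d)" using v * by blast
  hence "v \<in> S \<and> (\<forall>d. hc M v d \<in> N)"
  proof (rule vs.span_inductS)
    fix x assume "x \<in> (\<Union>d. N \<inter> gm_part M d)"
    then obtain e where "x \<in> N" "x \<in> gm_part M e" by auto
    thus "x \<in> S \<and> (\<forall>d. hc M x d \<in> N)" using N vs.subspace_0[OF N(1)] by (auto simp: hc_of_part part_in)
  qed (use N vs.subspace_0[OF N(1)] in \<open>auto simp: hc_add hc_scale vs.subspace_add vs.subspace_scale add_in scale_in\<close>)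
  thus "hc M v d \<in> N" by blast
qed

lemma zero_submodule: "gm_submodule C \<nu> M {0}"
proof (rule submoduleI)
  show "gm_act M r v \<in> {0}" if "r \<in> carrier (klr C \<nu>)" "v \<in> {0}" for r v
    using act_add_right[OF that(1), of 0 0] that by simp
qed auto

lemma whole_submodule: "gm_submodule C \<nu> M S"
  by (rule submoduleI) (auto simp: subspace act_closed hc_in)

lemma finite_parts: "finite {d. gm_part M d \<noteq> {0}}"
proof -
  obtain B where B: "finite B" "S = gm_span M B" using finite_dim by auto
  let ?D = "\<Union>b\<in>B. {d. hc M b d \<noteq> 0}"
  have BS: "B \<subseteq> S" using B vs.span_superset by auto
  have "finite ?D" using B BS hc_finite by (intro finite_UN_I) auto
  moreover have "{d. gm_part M d \<noteq> {0}} \<subseteq> ?D"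
  proof
    fix d assume "d \<in> {d. gm_part M d \<noteq> {0}}"
    hence "gm_part M d \<noteq> {0}" by simp
    then obtain v where v: "v \<in> gm_part M d" "v \<noteq> 0" using part_zero[of d] by blast
    show "d \<in> ?D"
    proof (rule ccontr)
      assume d: "d \<notin> ?D"
      have "v \<in> gm_span M B" using v part_in B by auto
      hence "v \<in> S \<and> hc M v d = 0"
        by (rule vs.span_inductS) (use d BS in \<open>auto simp: hc_add hc_scale add_in scale_in\<close>)
      thus False using hc_of_part[OF v(1)] v(2) by simp
    qed
  qed
  ultimately show ?thesis by (rule finite_subset[rotated])
qed

lemma dim_sub:
  assumes "gm_subspace M N" "gm_subspace M N'" "N \<subset> N'" "N' \<subseteq> S"
  shows "vs.dim N < vs.dim N'"
proof -
  obtain B where "finite B" "S = gm_span M B" using finite_dim by auto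
  thus ?thesis using vs.dim_less_of_psubset[OF assms(1-3)] assms(4) by metis
qed

lemma homogE:
  assumes "v \<in> S" "v \<noteq> 0" obtains d where "hc M v d \<noteq> 0" "hc M v d \<in> gm_part M d"
  using hc_eq_0[OF assms(1)] hc_part[OF assms(1)] assms(2) by blast

lemma restrict_module:
  assumes N: "gm_submodule C \<nu> M N"
  shows "klr_module C \<nu> (gm_restrict M N)"
proof -
  note Ns = sub_subspace[OF N] sub_le[OF N] sub_act[OF N] sub_hc[OF N]
  have NS: "v \<in> N ==> v \<in> S" for v using Ns by auto
  obtain B where B: "finite B" "S = gm_span M B" using finite_dim by auto
  obtain B' where B': "finite B'" "gm_span M B' = N"
  proof (rule vs.finite_basis_of_subspace[OF sub_subspace[OF N] _ B(1)])
    show "N \<subseteq> gm_span M B" using sub_le[OF N] B(2) by simp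
  qed (rule that)
  have sel: "gm_space (gm_restrict M N) = N" "gm_scale (gm_restrict M N) = gm_scale M"
    "gm_act (gm_restrict M N) = gm_act M" "gm_part (gm_restrict M N) d = gm_part M d \<inter> N" for d
    by (simp_all add: gm_restrict_def)
  show ?thesis
  proof (rule klr_module.intro, unfold sel, goal_cases)
    case 1 show ?case by (rule vector_space)
  next
    case 2 show ?case by (rule Ns)
  next
    case 3 show ?case using B' by auto
  next
    case 4 thus ?case using Ns(3) by blast
  next
    case 5 thus ?case using act_add_right NS by blast
  next
    case 6 thus ?case using act_add_left NS by blast
  next
    case 7 thus ?case using act_mult NS by blast
  next
    case 8 thus ?case using act_one NS by blast
  next
    case 9 thus ?case using act_const NS by blast
  next
    case (10 d) show ?case by (rule vs.subspace_inter[OF part_subspace Ns(1)])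
  next
    case 11 show ?case by (rule Int_lower2)
  next
    case (12 v)
    hence v: "v \<in> N" "v \<in> S" using Ns by auto
    show ?case
    proof (rule ex1I[of _ "hc M v"])
      show "(\<forall>d. hc M v d \<in> gm_part M d \<inter> N) \<and> finite {d. hc M v d \<noteq> 0} \<and> v = (\<Sum>d | hc M v d \<noteq> 0. hc M v d)"
        using v hc_part hc_finite hc_sum Ns(4) by auto
      fix f assume f: "(\<forall>d. f d \<in> gm_part M d \<inter> N) \<and> finite {d. f d \<noteq> 0} \<and> v = (\<Sum>d | f d \<noteq> 0. f d)"
      show "f = hc M v"
        by (rule hc_unique[symmetric, of _ "{d. f d \<noteq> 0}"]) (use f in auto)
    qed
  next
    case 13 thus ?case using act_part sub_act[OF N] klr_homog_in by blast
  qed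
qed

end

section \<open>Shifts, submodules and quotients\<close>

text \<open>
  It is enough to show that a sum of homogeneous vectors vanishes only if every summand does.
\<close>

lemma ex1_decomposition:
  assumes vs: "vector_space sc" and part: "\<And>d. module.subspace sc (part d)"
    and ex: "\<And>d. f d \<in> part d" "finite A" "\<And>d. d \<notin> A ==> f d = 0" "v = (\<Sum>d\<in>A. f d)"
    and ind: "\<And>g A d. (\<And>d. g d \<in> part d) ==> finite A ==> (\<And>d. d \<notin> A ==> g d = 0) ==>
      (\<Sum>d\<in>A. g d) = 0 ==> g d = 0"
  shows "\<exists>!f :: int \<Rightarrow> 'v::ab_group_add. (\<forall>d. f d \<in> part d) \<and> finite {d. f d \<noteq> 0} \<and> v = (\<Sum>d | f d \<noteq> 0. f d)"
proof (rule ex1I[of _ f])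
  interpret vector_space sc by fact
  have sub: "{d. f d \<noteq> 0} \<subseteq> A" using ex(3) by blast
  have "v = (\<Sum>d | f d \<noteq> 0. f d)"
    unfolding ex(4) by (rule sum.mono_neutral_right[OF ex(2) sub]) auto
  thus "(\<forall>d. f d \<in> part d) \<and> finite {d. f d \<noteq> 0} \<and> v = (\<Sum>d | f d \<noteq> 0. f d)"
    using ex(1) finite_subset[OF sub ex(2)] by blast
  fix g assume g: "(\<forall>d. g d \<in> part d) \<and> finite {d. g d \<noteq> 0} \<and> v = (\<Sum>d | g d \<noteq> 0. g d)"
  let ?B = "A \<union> {d. g d \<noteq> 0}"
  have fB: "finite ?B" using g ex(2) by simp
  have "(\<Sum>d\<in>?B. g d) = (\<Sum>d | g d \<noteq> 0. g d)" by (rule sum.mono_neutral_right[OF fB]) auto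
  moreover have "(\<Sum>d\<in>?B. f d) = (\<Sum>d\<in>A. f d)" by (rule sum.mono_neutral_right[OF fB]) (use ex(3) in auto)
  ultimately have "(\<Sum>d\<in>?B. g d) = (\<Sum>d\<in>?B. f d)" using g ex(4) by simp
  hence "(\<Sum>d\<in>?B. g d - f d) = 0" by (simp add: sum_subtractf)
  moreover have "g d - f d \<in> part d" for d using subspace_diff[OF part] g ex(1) by blast
  moreover have "d \<notin> ?B ==> g d - f d = 0" for d using ex(3) by auto
  ultimately have "g d - f d = 0" for d using ind[of "\<lambda>d. g d - f d" ?B d] fB by blast
  thus "g = f" by (auto simp: fun_eq_iff)
qed

lemma gm_shift_sel [simp]: "gm_space (gm_shift k M) = gm_space M" "gm_scale (gm_shift k M) = gm_scale M"
    "gm_act (gm_shift k M) = gm_act M" "gm_part (gm_shift k M) d = gm_part M (d - k)"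
  by (simp_all add: gm_shift_def)

lemma gm_restrict_sel [simp]: "gm_space (gm_restrict M N) = N" "gm_scale (gm_restrict M N) = gm_scale M"
    "gm_act (gm_restrict M N) = gm_act M" "gm_part (gm_restrict M N) d = gm_part M d \<inter> N"
  by (simp_all add: gm_restrict_def)

lemma gact_shift [simp]: "gact C \<nu> (gm_shift k M) = gact C \<nu> M"
  by (auto simp: gact_def fun_eq_iff)

lemma gact_restrict [simp]: "gact C \<nu> (gm_restrict M N) = gact C \<nu> M"
  by (auto simp: gact_def fun_eq_iff)

context klr_module
begin

lemma hc_indep:
  assumes "\<And>d. g d \<in> gm_part M d" "finite A" "\<And>d. d \<notin> A ==> g d = 0" "(\<Sum>d\<in>A. g d) = 0"
  shows "g d = 0"
  using hc_unique[OF assms(1-3), of 0] assms(4) by (metis hc_zero)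

lemma shift_module: "klr_module C \<nu> (gm_shift k M)"
proof (rule klr_module.intro, unfold gm_shift_sel, goal_cases)
  case (12 v)
  show ?case
  proof (rule ex1_decomposition[OF vector_space, where f = "\<lambda>d. hc M v (d - k)" and A = "(\<lambda>d. d + k) ` {d. hc M v d \<noteq> 0}"])
    show "v = (\<Sum>d\<in>(\<lambda>d. d + k) ` {d. hc M v d \<noteq> 0}. hc M v (d - k))"
      using hc_sum[OF 12] by (subst sum.reindex) (auto simp: inj_on_def)
    show "hc M v (d - k) = 0" if "d \<notin> (\<lambda>d. d + k) ` {d. hc M v d \<noteq> 0}" for d
      using that by (force simp: image_iff)
    fix g :: "int \<Rightarrow> 'v" and A :: "int set" and d
    assume g: "\<And>d. g d \<in> gm_part M (d - k)" "finite A" "\<And>d. d \<notin> A ==> g d = 0" "(\<Sum>d\<in>A. g d) = 0"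
    have "(\<lambda>d. g (d + k)) (d - k) = 0"
    proof (rule hc_indep[where g = "\<lambda>d. g (d + k)" and d = "d - k"])
      show "finite ((\<lambda>d. d - k) ` A)" using g by simp
      show "g (e + k) \<in> gm_part M e" for e using g(1)[of "e + k"] by simp
      show "g (e + k) = 0" if "e \<notin> (\<lambda>d. d - k) ` A" for e
        using that g(3)[of "e + k"] by (force simp: image_iff)
      show "(\<Sum>d\<in>(\<lambda>d. d - k) ` A. g (d + k)) = 0"
        using g(4) by (subst sum.reindex) (auto simp: inj_on_def)
    qed
    thus "g d = 0" by simp
  qed (auto simp: hc_part 12 hc_finite part_subspace)
next
  case (13 d r v e)
  thus ?case using act_part[of d r v "e - k"] by (simp add: algebra_simps)
qed (use vector_space subspace finite_dim act_closed act_add_right act_add_left act_mult act_one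
     act_const part_subspace part_subset in \<open>simp_all\<close>)

lemma submodule_restrict_iff:
  assumes N: "gm_submodule C \<nu> M N"
  shows "gm_submodule C \<nu> (gm_restrict M N) N' \<longleftrightarrow> gm_submodule C \<nu> M N' \<and> N' \<subseteq> N"
proof -
  have "(\<Union>d. N' \<inter> (gm_part M d \<inter> N)) = (\<Union>d. N' \<inter> gm_part M d)" if "N' \<subseteq> N" using that by auto
  thus ?thesis using sub_le[OF N] unfolding gm_submodule_def gm_restrict_sel by auto
qed

text \<open>A nonzero submodule of smallest dimension is irreducible.\<close>

lemma irreducible_submodule:
  assumes "S \<noteq> {0}"
  obtains N where "gm_submodule C \<nu> M N" "gm_irreducible C \<nu> (gm_restrict M N)" "N \<noteq> {0}"
proof -
  let ?Q = "\<lambda>N. gm_submodule C \<nu> M N \<and> N \<noteq> {0}"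
  have "?Q S" using whole_submodule assms by blast
  then obtain N where N: "?Q N" and min: "\<And>N'. ?Q N' ==> vs.dim N \<le> vs.dim N'"
    using ex_has_least_nat[of ?Q S vs.dim] by blast
  have "gm_irreducible C \<nu> (gm_restrict M N)"
    unfolding gm_irreducible_def gm_restrict_sel
  proof (intro conjI allI impI)
    fix N' assume "gm_submodule C \<nu> (gm_restrict M N) N'"
    hence N': "gm_submodule C \<nu> M N'" "N' \<subseteq> N" using submodule_restrict_iff N by auto
    show "N' = {0} \<or> N' = N"
    proof (rule ccontr)
      assume "\<not> (N' = {0} \<or> N' = N)"
      hence "N' \<subset> N" "N' \<noteq> {0}" using N' by auto
      thus False using dim_sub[of N' N] min[of N'] N N' sub_subspace sub_le by (metis leD)
    qed
  qed (use N restrict_module in auto)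
  thus thesis using that N by blast
qed

lemma hc_E: "u \<in> seqs \<nu> ==> v \<in> S ==> hc M (E u v) d = E u (hc M v d)"
proof -
  assume u: "u \<in> seqs \<nu>" and v: "v \<in> S"
  have "hc M (E u v) (d + 0) = E u (hc M v d)"
  proof (rule hc_map)
    show "E u v \<in> gm_part M (d + 0)" if "v \<in> gm_part M d" for d v
      using act_part[OF klr_homog.idem[OF u] that] by (simp add: gact_def)
  qed (use u v in \<open>auto simp: act_addr idemp_in\<close>)
  thus ?thesis by simp
qed

lemma lookup_gdim:
  assumes "0 \<in> U"
  shows "lookup (gm_gdim M U) d = int (vs.dim (gm_part M d \<inter> U))"
proof -
  have fin: "finite {d. gm_part M d \<inter> U \<noteq> {0}}"
    by (rule finite_subset[OF _ finite_parts]) (use assms part_zero in blast)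
  have "lookup (gm_gdim M U) d
      = (\<Sum>e | gm_part M e \<inter> U \<noteq> {0}. if e = d then int (vs.dim (gm_part M e \<inter> U)) else 0)"
    unfolding gm_gdim_def lookup_sum by (intro sum.cong) (auto simp: lookup_single when_def)
  also have "\<dots> = int (vs.dim (gm_part M d \<inter> U))"
  proof (cases "gm_part M d \<inter> U = {0}")
    case True
    have "vs.dim {0} = 0" using vs.dim_unique[of "{}" "{0}" 0, OF _ _ vs.independent_empty] by simp
    thus ?thesis using fin True by simp
  qed (use fin in simp)
  finally show ?thesis .
qed

definition soc_space where
  "soc_space = gm_span M (\<Union>{N. gm_submodule C \<nu> M N \<and> gm_irreducible C \<nu> (gm_restrict M N)})"

lemma gm_soc_eq: "gm_soc C \<nu> M = gm_restrict M soc_space"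
  by (simp add: gm_soc_def soc_space_def)

lemma soc_submodule: "gm_submodule C \<nu> M soc_space"
proof (rule submoduleI)
  let ?U = "\<Union>{N. gm_submodule C \<nu> M N \<and> gm_irreducible C \<nu> (gm_restrict M N)}"
  have US: "?U \<subseteq> S" using sub_le by blast
  show sub: "gm_subspace M soc_space" unfolding soc_space_def by simp
  show le: "soc_space \<subseteq> S" unfolding soc_space_def by (rule vs.span_minimal[OF US subspace])
  have *: "v \<in> soc_space" if "v \<in> ?U" for v unfolding soc_space_def using that by (rule vs.span_base)
  fix v assume v: "v \<in> soc_space"
  hence v': "v \<in> gm_span M ?U" by (simp add: soc_space_def)
  have a: "v \<in> S \<and> (\<forall>r\<in>carrier (klr C \<nu>). gm_act M r v \<in> soc_space) \<and> (\<forall>d. hc M v d \<in> soc_space)"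
    using v'
  proof (rule vs.span_inductS)
    show "0 \<in> S \<and> (\<forall>r\<in>carrier (klr C \<nu>). gm_act M r 0 \<in> soc_space) \<and> (\<forall>d. hc M 0 d \<in> soc_space)"
      using sub_act[OF zero_submodule] vs.subspace_0[OF sub] by auto
  next
    fix x y
    assume "x \<in> S \<and> (\<forall>r\<in>carrier (klr C \<nu>). gm_act M r x \<in> soc_space) \<and> (\<forall>d. hc M x d \<in> soc_space)"
      "y \<in> S \<and> (\<forall>r\<in>carrier (klr C \<nu>). gm_act M r y \<in> soc_space) \<and> (\<forall>d. hc M y d \<in> soc_space)"
    thus "x + y \<in> S \<and> (\<forall>r\<in>carrier (klr C \<nu>). gm_act M r (x + y) \<in> soc_space) \<and> (\<forall>d. hc M (x + y) d \<in> soc_space)"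
      by (auto simp: add_in act_add_right hc_add intro!: vs.subspace_add[OF sub])
  next
    fix c x
    assume x: "x \<in> S \<and> (\<forall>r\<in>carrier (klr C \<nu>). gm_act M r x \<in> soc_space) \<and> (\<forall>d. hc M x d \<in> soc_space)"
    have "gm_act M r (gm_scale M c x) = gm_scale M c (gm_act M r x)" if "r \<in> carrier (klr C \<nu>)" for r
      using that x act_scale[of _ x c] by (auto elim!: klr_carrierE simp: gact_def)
    thus "gm_scale M c x \<in> S \<and> (\<forall>r\<in>carrier (klr C \<nu>). gm_act M r (gm_scale M c x) \<in> soc_space) \<and> (\<forall>d. hc M (gm_scale M c x) d \<in> soc_space)"
      using x by (auto simp: scale_in hc_scale intro!: vs.subspace_scale[OF sub])
  next
    fix x assume "x \<in> ?U"
    then obtain N where N: "gm_submodule C \<nu> M N" "gm_irreducible C \<nu> (gm_restrict M N)" "x \<in> N" by blast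
    have "N \<subseteq> ?U" using N by blast
    hence "N \<subseteq> soc_space" using * by blast
    thus "x \<in> S \<and> (\<forall>r\<in>carrier (klr C \<nu>). gm_act M r x \<in> soc_space) \<and> (\<forall>d. hc M x d \<in> soc_space)"
      using N sub_act[OF N(1)] sub_hc[OF N(1)] sub_le[OF N(1)] by blast
  qed
  show "gm_act M r v \<in> soc_space" if "r \<in> carrier (klr C \<nu>)" for r using a that by blast
  show "hc M v d \<in> soc_space" for d using a by blast
qed

lemma soc_module: "klr_module C \<nu> (gm_soc C \<nu> M)"
  unfolding gm_soc_eq by (rule restrict_module[OF soc_submodule])

lemma soc_nonzero: "S \<noteq> {0} ==> gm_space (gm_soc C \<nu> M) \<noteq> {0}"
proof -
  assume "S \<noteq> {0}"
  then obtain N where N: "gm_submodule C \<nu> M N" "gm_irreducible C \<nu> (gm_restrict M N)" "N \<noteq> {0}"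
    by (rule irreducible_submodule)
  hence "N \<subseteq> soc_space" unfolding soc_space_def by (intro subsetI vs.span_base) blast
  thus ?thesis using N(3) vs.subspace_0[OF sub_subspace[OF N(1)]] unfolding gm_soc_eq gm_restrict_sel by blast
qed

lemma soc_le: "gm_space (gm_soc C \<nu> M) \<subseteq> S"
  using sub_le[OF soc_submodule] by (simp add: gm_soc_eq)

text \<open>
  Degree reasons kill every central element of positive degree on an irreducible module:
  its kernel is a submodule, and contains the homogeneous vectors of highest degree.
\<close>

lemma central_positive_degree_zero:
  assumes irr: "gm_irreducible C \<nu> M"
    and T: "\<And>v. v \<in> S ==> T v \<in> S" "\<And>v w. v \<in> S ==> w \<in> S ==> T (v + w) = T v + T w"
      "\<And>c v. v \<in> S ==> T (gm_scale M c v) = gm_scale M c (T v)"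
    and com: "\<And>g v. g \<in> klr_gens \<nu> ==> v \<in> S ==> T (act (gen g) v) = act (gen g) (T v)"
    and deg: "\<And>d v. v \<in> gm_part M d ==> T v \<in> gm_part M (d + \<delta>)" "\<delta> > 0"
    and v: "v \<in> S"
  shows "T v = 0"
proof -
  let ?N = "{v \<in> S. T v = 0}"
  have T0: "T 0 = 0" using T(2)[of 0 0] by simp
  have "gm_submodule C \<nu> M ?N"
  proof (rule submoduleI)
    show sub: "gm_subspace M ?N"
      by (rule vs.subspaceI) (auto simp: T0 T add_in scale_in)
    show le: "?N \<subseteq> S" by auto
    show "gm_act M r v \<in> ?N" if "r \<in> carrier (klr C \<nu>)" "v \<in> ?N" for r v
      by (rule closed_of_gens[OF sub le _ that]) (auto simp: com act_in free_alg_gen)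
    fix v d assume v: "v \<in> ?N"
    have "T (hc M v d) = hc M (T v) (d + \<delta>)" by (rule hc_map[symmetric]) (use T deg v in auto)
    thus "hc M v d \<in> ?N" using v by (simp add: hc_in)
  qed
  hence "?N = {0} \<or> ?N = S" using irr by (auto simp: gm_irreducible_def)
  moreover have "?N \<noteq> {0}"
  proof
    assume N0: "?N = {0}"
    obtain w where w: "w \<in> S" "w \<noteq> 0" using irr by (auto simp: gm_irreducible_def)
    let ?D = "{d. gm_part M d \<noteq> {0}}"
    obtain d where "hc M w d \<noteq> 0" "hc M w d \<in> gm_part M d" using homogE[OF w] .
    hence ne: "?D \<noteq> {}" by blast
    let ?m = "Max ?D"
    have "?m \<in> ?D" using Max_in[OF finite_parts ne] .
    then obtain x where x: "x \<in> gm_part M ?m" "x \<noteq> 0" using part_zero by blast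
    have "?m + \<delta> \<notin> ?D" using Max_ge[OF finite_parts, of "?m + \<delta>"] deg(2) by auto
    hence "T x = 0" using deg(1)[OF x(1)] by blast
    thus False using N0 x part_in by blast
  qed
  ultimately show ?thesis using v by auto
qed

end

lemma irreducible_module: "gm_irreducible C \<nu> M ==> klr_module C \<nu> M"
  by (simp add: gm_irreducible_def)

text \<open>
  Transport of structure along a linear map \<open>\<pi>\<close> out of \<open>M\<close>. An injective \<open>\<pi>\<close> moves a module to
  another ambient space, a general one yields the quotient by its kernel.
\<close>

definition gm_push :: "('k \<Rightarrow> 'w \<Rightarrow> 'w) \<Rightarrow> ('v \<Rightarrow> 'w) \<Rightarrow> ('r, 'k, 'v) gmodule \<Rightarrow> ('r, 'k, 'w) gmodule" where
  "gm_push sc \<pi> M = \<lparr>gm_space = \<pi> ` gm_space M, gm_scale = sc,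
     gm_act = \<lambda>r w. \<pi> (gm_act M r (SOME v. v \<in> gm_space M \<and> \<pi> v = w)),
     gm_part = \<lambda>d. \<pi> ` gm_part M d\<rparr>"

text \<open>
  The preimages chosen in \<open>gm_push\<close> are unique up to the kernel of \<open>\<pi>\<close>. The kernel is stable under the
  action and under taking homogeneous components, so action and grading descend to the image.
\<close>

lemma (in klr_module) push_module:
  fixes \<pi> :: "'v \<Rightarrow> 'w::ab_group_add"
  assumes sc: "vector_space sc"
    and add: "\<And>v w. v \<in> S ==> w \<in> S ==> \<pi> (v + w) = \<pi> v + \<pi> w"
    and scale: "\<And>c v. v \<in> S ==> \<pi> (gm_scale M c v) = sc c (\<pi> v)"
    and N: "gm_submodule C \<nu> M {v \<in> S. \<pi> v = 0}"
  shows "klr_module C \<nu> (gm_push sc \<pi> M)" and "gm_hom C \<nu> M (gm_push sc \<pi> M) \<pi>"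
proof -
  interpret W: vector_space sc by fact
  let ?Q = "gm_push sc \<pi> M"
  have sel: "gm_space ?Q = \<pi> ` S" "gm_scale ?Q = sc" "gm_part ?Q d = \<pi> ` gm_part M d" for d
    by (simp_all add: gm_push_def)
  have pi0: "\<pi> 0 = 0" using add[of 0 0] by simp
  have pisum: "\<pi> (\<Sum>x\<in>B. f x) = (\<Sum>x\<in>B. \<pi> (f x))" if "\<And>x. x \<in> B ==> f x \<in> S" for f and B :: "'z set"
    using that by (induction B rule: infinite_finite_induct) (auto simp: pi0 add sum_in)
  have pidiff: "\<pi> (v - w) = \<pi> v - \<pi> w" if "v \<in> S" "w \<in> S" for v w
    using add[of "v - w" w] that by (simp add: diff_in)
  have Qact: "gm_act ?Q r (\<pi> v) = \<pi> (gm_act M r v)" if r: "r \<in> carrier (klr C \<nu>)" and v: "v \<in> S" for r v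
  proof -
    let ?w = "SOME w. w \<in> S \<and> \<pi> w = \<pi> v"
    have w: "?w \<in> S \<and> \<pi> ?w = \<pi> v" by (rule someI[of _ v]) (simp add: v)
    obtain p where p: "p \<in> klr_fcar \<nu>" "r = klr_cls C \<nu> p" using r by (rule klr_carrierE)
    have "?w - v \<in> {v \<in> S. \<pi> v = 0}" using w v by (simp add: diff_in pidiff)
    hence "gm_act M r (?w - v) \<in> {v \<in> S. \<pi> v = 0}" using sub_act[OF N r] by blast
    hence "\<pi> (gm_act M r ?w - gm_act M r v) = 0" using act_diffr[OF p(1), of ?w v] w v p by (simp add: gact_def)
    hence "\<pi> (gm_act M r ?w) = \<pi> (gm_act M r v)" using w v r by (simp add: pidiff act_closed)
    thus ?thesis by (simp add: gm_push_def)
  qed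
  have sub: "module.subspace sc (\<pi> ` T)" if "gm_subspace M T" "T \<subseteq> S" for T
  proof (rule W.subspaceI)
    show "0 \<in> \<pi> ` T" using vs.subspace_0[OF that(1)] pi0 by force
    fix x y assume "x \<in> \<pi> ` T" "y \<in> \<pi> ` T"
    then obtain a b where "a \<in> T" "b \<in> T" "x = \<pi> a" "y = \<pi> b" by auto
    thus "x + y \<in> \<pi> ` T" using vs.subspace_add[OF that(1)] that(2) by (auto simp: subsetD add[symmetric])
  next
    fix c x assume "x \<in> \<pi> ` T"
    then obtain a where a: "a \<in> T" "x = \<pi> a" by auto
    hence "sc c x = \<pi> (gm_scale M c a)" using scale that(2) by auto
    thus "sc c x \<in> \<pi> ` T" using vs.subspace_scale[OF that(1) a(1)] by auto
  qed
  show "klr_module C \<nu> ?Q"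
  proof (rule klr_module.intro, goal_cases)
    case 1 show ?case unfolding sel by (rule sc)
  next
    case 2 show ?case unfolding sel by (rule sub[OF subspace order_refl])
  next
    case 3
    obtain B where B: "finite B" "S = gm_span M B" using finite_dim by auto
    have BS: "B \<subseteq> S" using B vs.span_superset by auto
    have "\<pi> ` S = W.span (\<pi> ` B)"
    proof
      show "\<pi> ` S \<subseteq> W.span (\<pi> ` B)"
      proof
        fix y assume "y \<in> \<pi> ` S"
        then obtain v where v: "v \<in> S" "y = \<pi> v" by auto
        obtain u where u: "v = (\<Sum>b\<in>B. gm_scale M (u b) b)" using v B vs.span_finite[OF B(1)] by auto
        have "y = (\<Sum>b\<in>B. sc (u b) (\<pi> b))" unfolding v u using BS
          by (subst pisum) (auto simp: scale_in scale subsetD)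
        thus "y \<in> W.span (\<pi> ` B)" by (simp only:) (intro W.span_sum W.span_scale W.span_base imageI)
      qed
      show "W.span (\<pi> ` B) \<subseteq> \<pi> ` S"
        by (rule W.span_minimal[OF image_mono[OF BS] sub[OF subspace order_refl]])
    qed
    thus ?case unfolding sel using B(1) by blast
  next
    case 4 thus ?case unfolding sel by (auto simp: Qact act_closed)
  next
    case (5 r v w) thus ?case unfolding sel by (auto simp: Qact act_closed add_in act_add_right simp flip: add)
  next
    case (6 r s v)
    hence "r \<oplus>\<^bsub>klr C \<nu>\<^esub> s \<in> carrier (klr C \<nu>)" using ring.ring_simprules(1)[OF klr_ring] by blast
    thus ?case using 6 unfolding sel by (auto simp: Qact act_closed act_add_left add)
  next
    case (7 r s v)
    hence "r \<otimes>\<^bsub>klr C \<nu>\<^esub> s \<in> carrier (klr C \<nu>)" using ring.ring_simprules(5)[OF klr_ring] by blast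
    thus ?case using 7 unfolding sel by (auto simp: Qact act_closed act_mult)
  next
    case (8 v)
    thus ?case unfolding sel by (auto simp: Qact[OF ring.ring_simprules(6)[OF klr_ring]] act_one)
  next
    case (9 v c)
    have "klr_const C \<nu> c \<in> carrier (klr C \<nu>)" unfolding klr_const_cls by (rule klr_cls_in[OF free_alg_const])
    thus ?case using 9 unfolding sel by (auto simp: Qact act_const scale)
  next
    case (10 d) show ?case unfolding sel by (rule sub[OF part_subspace part_subset])
  next
    case (11 d) show ?case unfolding sel by (rule image_mono[OF part_subset])
  next
    case (12 w)
    then obtain v where v: "v \<in> S" "w = \<pi> v" unfolding sel by auto
    show ?case unfolding sel
    proof (rule ex1_decomposition[OF sc, where f = "\<lambda>d. \<pi> (hc M v d)" and A = "{d. hc M v d \<noteq> 0}"])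
      show "w = (\<Sum>d | hc M v d \<noteq> 0. \<pi> (hc M v d))" unfolding v(2)
        by (subst hc_sum[OF v(1)], rule pisum) (auto simp: hc_in v)
      show "module.subspace sc (\<pi> ` gm_part M d)" for d by (rule sub[OF part_subspace part_subset])
      fix g A d
      assume g: "\<And>d. g d \<in> \<pi> ` gm_part M d" "finite A" "\<And>d. d \<notin> A ==> g d = 0" "(\<Sum>d\<in>A. g d) = 0"
      have "\<exists>h. h \<in> gm_part M d \<and> g d = \<pi> h \<and> (d \<notin> A \<longrightarrow> h = 0)" for d
        using g(1)[of d] g(3)[of d] pi0 part_zero by (cases "d \<in> A") (blast, metis)
      then obtain h where h: "\<And>d. h d \<in> gm_part M d" "\<And>d. g d = \<pi> (h d)" "\<And>d. d \<notin> A ==> h d = 0" by metis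
      let ?s = "\<Sum>d\<in>A. h d"
      have hs: "hc M ?s = h" by (rule hc_unique[OF h(1) g(2) h(3) refl])
      have hS: "h d \<in> S" for d using part_in[OF h(1)] .
      have "?s \<in> S" using hS by (intro sum_in)
      moreover have "\<pi> ?s = 0" using g(4) h(2) by (subst pisum) (simp_all add: hS)
      ultimately have "hc M ?s d \<in> {v \<in> S. \<pi> v = 0}" using sub_hc[OF N] by blast
      thus "g d = 0" using hs h(2) by simp
    qed (auto simp: hc_part v hc_finite pi0)
  next
    case (13 d r v e)
    then obtain x where x: "x \<in> gm_part M e" "v = \<pi> x" unfolding sel by auto
    show ?case unfolding sel x(2) Qact[OF klr_homog_in[OF 13(1)] part_in[OF x(1)]]
      using act_part[OF 13(1) x(1)] by (rule imageI)
  qed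
  show "gm_hom C \<nu> M ?Q \<pi>"
    unfolding gm_hom_def sel by (auto simp: add Qact)
qed

section \<open>Isomorphisms of irreducible modules\<close>

text \<open>
  A submodule of a direct sum of two irreducible modules is the graph of an isomorphism once
  it meets one bidegree in a line spanned by a vector with two nonzero components.
\<close>

lemma iso_from_graph:
  fixes M :: "(('i, 'k::field) klr_elem, 'k, 'v::ab_group_add) gmodule"
    and L :: "(('i, 'k) klr_elem, 'k, 'w::ab_group_add) gmodule"
  assumes M: "gm_irreducible C \<nu> M" and L: "gm_irreducible C \<nu> L"
    and le: "\<And>a b. G a b ==> a \<in> gm_space M \<and> b \<in> gm_space L"
    and zero: "G 0 0" and add: "\<And>a b a' b'. G a b ==> G a' b' ==> G (a + a') (b + b')"
    and scale: "\<And>c a b. G a b ==> G (gm_scale M c a) (gm_scale L c b)"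
    and gens: "\<And>g a b. g \<in> klr_gens \<nu> ==> G a b ==> G (gact C \<nu> M (gen g) a) (gact C \<nu> L (gen g) b)"
    and graded: "\<And>a b d. G a b ==> G (hc M a d) (hc L b (d - k))"
    and v: "G v w" "v \<noteq> 0" "w \<noteq> 0" "v \<in> gm_part M d0" "w \<in> gm_part L (d0 - k)"
    and line: "\<And>a b. G a b ==> a \<in> gm_part M d0 ==> b \<in> gm_part L (d0 - k) ==>
      \<exists>c. a = gm_scale M c v \<and> b = gm_scale L c w"
  shows "gm_iso C \<nu> M (gm_shift k L)"
proof -
  interpret M: klr_module C \<nu> M using M by (rule irreducible_module)
  interpret L: klr_module C \<nu> L using L by (rule irreducible_module)
  have G: "G (gm_act M r a) (gm_act L r b)" if r: "r \<in> carrier (klr C \<nu>)" and ab: "G a b" for r a b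
  proof -
    obtain p where p: "p \<in> klr_fcar \<nu>" "r = klr_cls C \<nu> p" using r by (rule klr_carrierE)
    have "G (gact C \<nu> M p a) (gact C \<nu> L p b)" using p(1)
    proof (induction p rule: free_alg_induct)
      case (const c) thus ?case using scale[OF ab] le[OF ab] by (simp add: M.act_const' L.act_const')
    next
      case (add p q) thus ?case using assms(5) le[OF ab] by (simp add: M.act_addl L.act_addl)
    next
      case (gen x p) thus ?case using gens[of x] le[OF ab] by (simp add: M.act_times L.act_times free_alg_gen)
    qed
    thus ?thesis by (simp add: p gact_def)
  qed
  have M0: "gm_act M r 0 = 0" and L0: "gm_act L r 0 = 0" if "r \<in> carrier (klr C \<nu>)" for r
    using M.act_add_right[OF that, of 0 0] L.act_add_right[OF that, of 0 0] by auto
  have s1: "gm_submodule C \<nu> L {b. G 0 b}"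
  proof (rule L.submoduleI)
    show "gm_subspace L {b. G 0 b}"
      using zero add[of 0 _ 0] scale[of 0] by (auto intro!: L.vs.subspaceI)
    show "gm_act L r b \<in> {b. G 0 b}" if "r \<in> carrier (klr C \<nu>)" "b \<in> {b. G 0 b}" for r b
      using G[OF that(1), of 0 b] that M0 by auto
    show "hc L b d \<in> {b. G 0 b}" if "b \<in> {b. G 0 b}" for b d
      using graded[of 0 b "d + k"] that by simp
  qed (use le in auto)
  have s2: "gm_submodule C \<nu> M {a. G a 0}"
  proof (rule M.submoduleI)
    show "gm_subspace M {a. G a 0}"
      using zero add[of _ 0 _ 0] scale[of _ 0] by (auto intro!: M.vs.subspaceI)
    show "gm_act M r a \<in> {a. G a 0}" if "r \<in> carrier (klr C \<nu>)" "a \<in> {a. G a 0}" for r a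
      using G[OF that(1), of a 0] that L0 by auto
    show "hc M a d \<in> {a. G a 0}" if "a \<in> {a. G a 0}" for a d
      using graded[of a 0 d] that by simp
  qed (use le in auto)
  have s3: "gm_submodule C \<nu> M {a. \<exists>b. G a b}"
  proof (rule M.submoduleI)
    show "gm_subspace M {a. \<exists>b. G a b}"
      using zero add scale by (intro M.vs.subspaceI) (simp_all, blast+)
    show "gm_act M r a \<in> {a. \<exists>b. G a b}" if "r \<in> carrier (klr C \<nu>)" "a \<in> {a. \<exists>b. G a b}" for r a
      using G[OF that(1)] that by blast
    show "hc M a d \<in> {a. \<exists>b. G a b}" if "a \<in> {a. \<exists>b. G a b}" for a d
      using graded that by blast
  qed (use le in auto)
  have s4: "gm_submodule C \<nu> L {b. \<exists>a. G a b}"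
  proof (rule L.submoduleI)
    show "gm_subspace L {b. \<exists>a. G a b}"
      using zero add scale by (intro L.vs.subspaceI) (simp_all, blast+)
    show "gm_act L r b \<in> {b. \<exists>a. G a b}" if "r \<in> carrier (klr C \<nu>)" "b \<in> {b. \<exists>a. G a b}" for r b
      using G[OF that(1)] that by blast
    show "hc L b d \<in> {b. \<exists>a. G a b}" if b: "b \<in> {b. \<exists>a. G a b}" for b d
    proof -
      obtain a where "G a b" using b by blast
      thus ?thesis using graded[of a b "d + k"] by auto
    qed
  qed (use le in auto)
  note irrM = M[unfolded gm_irreducible_def] and irrL = L[unfolded gm_irreducible_def]
  have n1: "{b. G 0 b} = {0}"
  proof (rule ccontr)
    assume "{b. G 0 b} \<noteq> {0}"
    hence "{b. G 0 b} = gm_space L" using s1 irrL by blast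
    hence "G 0 w" using le[OF v(1)] by blast
    then obtain c where "0 = gm_scale M c v" "w = gm_scale L c w" using line[of 0 w] v(5) by auto
    thus False using v by auto
  qed
  have n2: "{a. G a 0} = {0}"
  proof (rule ccontr)
    assume "{a. G a 0} \<noteq> {0}"
    hence "{a. G a 0} = gm_space M" using s2 irrM by blast
    hence "G v 0" using le[OF v(1)] by blast
    then obtain c where "v = gm_scale M c v" "0 = gm_scale L c w" using line[of v 0] v(4) by auto
    thus False using v by auto
  qed
  have "v \<in> {a. \<exists>b. G a b}" "w \<in> {b. \<exists>a. G a b}" using v(1) by auto
  hence n3: "{a. \<exists>b. G a b} = gm_space M" and n4: "{b. \<exists>a. G a b} = gm_space L"
    using s3 s4 irrM irrL v(2,3) by (metis singletonD)+
  have neg: "G (- a) (- b)" if "G a b" for a b using scale[OF that, of "- 1"] by simp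
  have u1: "b = b'" if "G a b" "G a b'" for a b b'
  proof -
    have "b - b' \<in> {b. G 0 b}" using add[OF that(1) neg[OF that(2)]] by simp
    thus ?thesis unfolding n1 by simp
  qed
  have u2: "a = a'" if "G a b" "G a' b" for a a' b
  proof -
    have "a - a' \<in> {a. G a 0}" using add[OF that(1) neg[OF that(2)]] by simp
    thus ?thesis unfolding n2 by simp
  qed
  define f where "f a = (THE b. G a b)" for a
  have f: "G a (f a)" if "a \<in> gm_space M" for a
  proof -
    from that have "a \<in> {a. \<exists>b. G a b}" unfolding n3 .
    then obtain b where b: "G a b" by auto
    have "f a = b" unfolding f_def
    proof (rule the_equality)
      show "G a b" by (rule b)
      show "b' = b" if "G a b'" for b' by (rule u1[OF that b])
    qed
    thus ?thesis using b by simp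
  qed
  have feq: "f a = b" if "G a b" for a b
    using u1[OF f that] le[OF that] by simp
  have "gm_hom C \<nu> M (gm_shift k L) f"
    unfolding gm_hom_def gm_shift_sel
  proof (intro conjI ballI allI)
    fix a assume "a \<in> gm_space M" thus "f a \<in> gm_space L" using f le by blast
  next
    fix a b assume "a \<in> gm_space M" "b \<in> gm_space M"
    thus "f (a + b) = f a + f b" using add[OF f f] feq by blast
  next
    fix r :: "('i, 'k) klr_elem" and a assume "r \<in> carrier (klr C \<nu>)" "a \<in> gm_space M"
    thus "f (gm_act M r a) = gm_act L r (f a)" using G[OF _ f] feq by blast
  next
    fix d a assume a: "a \<in> gm_part M d"
    have "G a (hc L (f a) (d - k))" using graded[OF f, of a d] M.part_in[OF a] M.hc_of_part[OF a] by simp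
    hence "f a = hc L (f a) (d - k)" using feq by blast
    thus "f a \<in> gm_part L (d - k)" using L.hc_part[of "f a" "d - k"] f le M.part_in[OF a] by metis
  qed
  moreover have "bij_betw f (gm_space M) (gm_space (gm_shift k L))"
    unfolding bij_betw_def gm_shift_sel
  proof
    show "inj_on f (gm_space M)" by (rule inj_onI) (metis f u2)
    show "f ` gm_space M = gm_space L"
    proof
      show "f ` gm_space M \<subseteq> gm_space L" using f le by blast
      show "gm_space L \<subseteq> f ` gm_space M"
      proof
        fix b assume "b \<in> gm_space L"
        hence "b \<in> {b. \<exists>a. G a b}" unfolding n4 .
        then obtain a where a: "G a b" by auto
        show "b \<in> f ` gm_space M" using feq[OF a] le[OF a] by auto
      qed
    qed
  qed
  ultimately show ?thesis unfolding gm_iso_def by blast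
qed

section \<open>Modules from operators\<close>

text \<open>
  The action of a noncommutative polynomial by operators attached to the letters.
\<close>

definition word_ext :: "('k::field \<Rightarrow> 'v::ab_group_add \<Rightarrow> 'v) \<Rightarrow> ('g \<Rightarrow> 'v \<Rightarrow> 'v) \<Rightarrow> ('g fmon \<Rightarrow>\<^sub>0 'k) \<Rightarrow> 'v \<Rightarrow> 'v" where
  "word_ext sc f p v = (\<Sum>w\<in>keys p. sc (lookup p w) (foldr f (letters w) v))"

lemma pm_induct [case_names single add]:
  assumes s: "\<And>w c. P (single w c)" and a: "\<And>p q. P p ==> P q ==> P (p + q)"
  shows "P (p :: 'a \<Rightarrow>\<^sub>0 'b::comm_monoid_add)"
proof -
  have "P (\<Sum>w\<in>A. single w (lookup p w))" if "finite A" for A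
    using that
  proof (induction A)
    case empty show ?case using s[of undefined 0] by simp
  qed (use s a in auto)
  from this[of "keys p"] show ?thesis using poly_mapping_sum_singles[of p] by simp
qed

locale word_ops = vector_space sc for sc :: "'k::field \<Rightarrow> 'v::ab_group_add \<Rightarrow> 'v" +
  fixes A :: "'g set" and S :: "'v set" and f :: "'g \<Rightarrow> 'v \<Rightarrow> 'v"
  assumes sub: "subspace S"
    and f_in: "g \<in> A ==> v \<in> S ==> f g v \<in> S"
    and f_add: "g \<in> A ==> v \<in> S ==> w \<in> S ==> f g (v + w) = f g v + f g w"
    and f_scale: "g \<in> A ==> v \<in> S ==> f g (sc c v) = sc c (f g v)"
begin

abbreviation "ext \<equiv> word_ext sc f"

lemma ext_superset:
  assumes "finite K" "keys p \<subseteq> K"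
  shows "ext p v = (\<Sum>w\<in>K. sc (lookup p w) (foldr f (letters w) v))"
  unfolding word_ext_def by (rule sum.mono_neutral_left[OF assms]) (auto simp: in_keys_iff)

lemma ext_add: "ext (p + q) v = ext p v + ext q v"
proof -
  let ?K = "keys p \<union> keys q"
  have "ext (p + q) v = (\<Sum>w\<in>?K. sc (lookup (p + q) w) (foldr f (letters w) v))"
    by (rule ext_superset) (use keys_add[of p q] in auto)
  also have "\<dots> = ext p v + ext q v"
    by (subst (1 2) ext_superset[of ?K]) (auto simp: lookup_add scale_left_distrib sum.distrib)
  finally show ?thesis .
qed

lemma ext_single: "ext (single w c) v = sc c (foldr f (letters w) v)"
  by (subst ext_superset[of "{w}"]) auto

lemma ext_0 [simp]: "ext 0 v = 0" by (simp add: word_ext_def)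

lemma ext_uminus: "ext (- p) v = - ext p v"
  using ext_add[of p "- p" v] by (simp add: eq_neg_iff_add_eq_0 add.commute)

lemma ext_diff: "ext (p - q) v = ext p v - ext q v"
  using ext_add[of p "- q" v] by (simp add: ext_uminus)

lemma ext_sum: "ext (\<Sum>x\<in>B. h x) v = (\<Sum>x\<in>B. ext (h x) v)"
  by (induction B rule: infinite_finite_induct) (auto simp: ext_add)

lemma ext_const: "ext (const a) v = sc a v"
  by (simp add: ext_single zero_fmon_def)

lemma ext_1 [simp]: "ext 1 v = v"
  using ext_const[of 1] by simp

lemma ext_const_mult: "ext (const a * q) v = sc a (ext q v)"
  by (induction q rule: pm_induct)
    (simp_all add: mult_single ext_single distrib_left ext_add scale_right_distrib)

lemma foldr_in: "set w \<subseteq> A ==> v \<in> S ==> foldr f w v \<in> S"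
  by (induction w) (auto intro: f_in)

lemma foldr_lin: "set w \<subseteq> A ==> v \<in> S ==> u \<in> S ==> foldr f w (v + u) = foldr f w v + foldr f w u"
    "set w \<subseteq> A ==> v \<in> S ==> foldr f w (sc c v) = sc c (foldr f w v)"
  by (induction w) (auto simp: f_add f_scale foldr_in)

lemma ext_in: "p \<in> carrier (free_alg A) ==> v \<in> S ==> ext p v \<in> S"
  unfolding word_ext_def carrier_free_alg_iff by (auto intro!: subspace_sum subspace_scale sub foldr_in)

lemma ext_addr: "p \<in> carrier (free_alg A) ==> v \<in> S ==> u \<in> S ==> ext p (v + u) = ext p v + ext p u"
  unfolding word_ext_def carrier_free_alg_iff
  by (simp add: foldr_lin scale_right_distrib sum.distrib)

lemma f_0: "g \<in> A ==> f g 0 = 0"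
  using f_scale[of g 0 0] subspace_0[OF sub] by simp

lemma f_sum: "g \<in> A ==> (\<And>x. x \<in> B ==> h x \<in> S) ==> f g (\<Sum>x\<in>B. h x) = (\<Sum>x\<in>B. f g (h x))"
  by (induction B rule: infinite_finite_induct) (auto simp: f_0 f_add subspace_sum[OF sub])

lemma ext_gen_mult:
  assumes "g \<in> A" "q \<in> carrier (free_alg A)" "v \<in> S"
  shows "ext (gen g * q) v = f g (ext q v)"
proof -
  have "gen g * q = (\<Sum>w\<in>keys q. single (FMon (g # letters w)) (lookup q w))"
    by (subst (1) poly_mapping_sum_singles[of q], subst sum_distrib_left)
      (simp add: gen_def mult_single plus_fmon_def)
  hence "ext (gen g * q) v = (\<Sum>w\<in>keys q. sc (lookup q w) (f g (foldr f (letters w) v)))"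
    by (simp add: ext_sum ext_single)
  also have "\<dots> = f g (ext q v)"
    unfolding word_ext_def using assms
    by (subst f_sum) (auto simp: carrier_free_alg_iff f_scale foldr_in subspace_scale[OF sub])
  finally show ?thesis .
qed

lemma ext_gen: "g \<in> A ==> v \<in> S ==> ext (gen g) v = f g v"
  using ext_gen_mult[of g 1 v] by (simp add: free_alg_one)

lemma ext_mult:
  assumes p: "p \<in> carrier (free_alg A)" and q: "q \<in> carrier (free_alg A)" and v: "v \<in> S"
  shows "ext (p * q) v = ext p (ext q v)"
  using p
proof (induction p rule: free_alg_induct)
  case (gen x p)
  thus ?case using q v by (simp add: mult.assoc ext_gen_mult free_alg_mult ext_in)
qed (simp_all add: ext_const_mult ext_const ext_add distrib_right)

lemma ext_power: "p \<in> carrier (free_alg A) ==> v \<in> S ==> ext (p ^ n) v = (ext p ^^ n) v"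
  by (induction n) (auto simp: ext_mult free_alg_power)

end

text \<open>
  Operators attached to the generators and satisfying the relations make up a module: the
  ideal of relations then acts by zero, so the action does not depend on representatives.
\<close>

locale klr_ops = word_ops sc "klr_gens \<nu>" S f
  for C :: "('i, 'p) cartan_data" and \<nu> :: "'i multiset" and sc :: "'k::field \<Rightarrow> 'v::ab_group_add \<Rightarrow> 'v"
    and S :: "'v set" and f :: "'i klr_gen \<Rightarrow> 'v \<Rightarrow> 'v" +
  fixes part :: "int \<Rightarrow> 'v set"
  assumes fd: "\<exists>B. finite B \<and> S = span B"
    and rels: "p \<in> klr_relators C \<nu> ==> v \<in> S ==> ext p v = 0"
    and part_sub: "subspace (part d)" and part_le: "part d \<subseteq> S"
    and part_dec: "v \<in> S ==>
       \<exists>!f. (\<forall>d. f d \<in> part d) \<and> finite {d. f d \<noteq> 0} \<and> v = (\<Sum>d | f d \<noteq> 0. f d)"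
    and deg_idemp: "u \<in> seqs \<nu> ==> v \<in> part e ==> f (Idemp u) v \<in> part e"
    and deg_dot: "u \<in> seqs \<nu> ==> r < size \<nu> ==> v \<in> part e ==>
       f (Dot r) (f (Idemp u) v) \<in> part (rform C (u ! r) (u ! r) + e)"
    and deg_crs: "u \<in> seqs \<nu> ==> Suc r < size \<nu> ==> v \<in> part e ==>
       f (Cross r) (f (Idemp u) v) \<in> part (- rform C (u ! r) (u ! Suc r) + e)"
begin

lemma ext_ideal: "p \<in> klr_ideal C \<nu> ==> v \<in> S ==> ext p v = 0"
proof -
  assume "p \<in> klr_ideal C \<nu>"
  hence "\<forall>v\<in>S. ext p v = 0"
  proof (induction p rule: klr_ideal_induct)
    case (left p q) thus ?case using ext_mult subspace_0[OF sub] ext_addr[of q 0 0] by simp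
  next
    case (right p q) thus ?case by (simp add: ext_mult ext_in)
  qed (auto simp: rels ext_add ext_uminus)
  thus "v \<in> S ==> ext p v = 0" by blast
qed

definition op_act where
  "op_act r v = ext (SOME p. p \<in> klr_fcar \<nu> \<and> klr_cls C \<nu> p = r) v"

lemma op_act_cls:
  assumes "p \<in> klr_fcar \<nu>" "v \<in> S" shows "op_act (klr_cls C \<nu> p) v = ext p v"
proof -
  let ?q = "SOME q. q \<in> klr_fcar \<nu> \<and> klr_cls C \<nu> q = klr_cls C \<nu> p"
  have q: "?q \<in> klr_fcar \<nu> \<and> klr_cls C \<nu> ?q = klr_cls C \<nu> p" by (rule someI[of _ p]) (simp add: assms)
  hence "ext (?q - p) v = 0" using klr_cls_eq_iff[of ?q \<nu> p C] assms by (intro ext_ideal) auto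
  thus ?thesis by (simp add: op_act_def ext_diff)
qed

definition op_module :: "(('i, 'k) klr_elem, 'k, 'v) gmodule" where
  "op_module = \<lparr>gm_space = S, gm_scale = sc, gm_act = op_act, gm_part = part\<rparr>"

lemma op_module_sel [simp]: "gm_space op_module = S" "gm_scale op_module = sc"
    "gm_part op_module = part" "gm_act op_module = op_act"
  by (simp_all add: op_module_def)

lemma gact_op_module: "p \<in> klr_fcar \<nu> ==> v \<in> S ==> gact C \<nu> op_module p v = ext p v"
  by (simp add: gact_def op_act_cls)

lemma op_act_homog:
  assumes "klr_homog C \<nu> d r" "v \<in> part e" shows "op_act r v \<in> part (d + e)"
  using assms
proof (induction arbitrary: v e rule: klr_homog.induct)
  case (idem u)
  hence "v \<in> S" using part_le by auto
  thus ?case using op_act_cls[OF idemp_in[OF idem(1)], of v] ext_gen[of "Idemp u" v] idem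
    by (simp add: idemp_gen klr_gens_def deg_idemp)
next
  case (dot u r)
  have v: "v \<in> S" using dot part_le by auto
  have g: "Idemp u \<in> klr_gens \<nu>" "Dot r \<in> klr_gens \<nu>" using dot by (auto simp: klr_gens_def)
  show ?case using deg_dot[OF dot] dot v g
    by (simp add: op_act_cls klr_closed ext_mult) (simp add: idemp_gen dot_gen ext_gen f_in)
next
  case (crs u r)
  have v: "v \<in> S" using crs part_le by auto
  have g: "Idemp u \<in> klr_gens \<nu>" "Cross r \<in> klr_gens \<nu>" using crs by (auto simp: klr_gens_def)
  show ?case using deg_crs[OF crs] crs v g
    by (simp add: op_act_cls klr_closed ext_mult) (simp add: idemp_gen crs_gen ext_gen f_in)
next
  case (zero d)
  hence "v \<in> S" using part_le by auto
  thus ?case using op_act_cls[OF free_alg_zero, of v] subspace_0[OF part_sub]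
    by (simp flip: klr_cls_zero)
next
  case (add d x y)
  have v: "v \<in> S" using subsetD[OF part_le add(5)] .
  obtain p where p: "p \<in> klr_fcar \<nu>" "x = klr_cls C \<nu> p" using klr_homog_in[OF add(1)] by (rule klr_carrierE)
  obtain q where q: "q \<in> klr_fcar \<nu>" "y = klr_cls C \<nu> q" using klr_homog_in[OF add(2)] by (rule klr_carrierE)
  have "op_act (x \<oplus>\<^bsub>klr C \<nu>\<^esub> y) v = op_act x v + op_act y v"
    using p q v by (simp add: op_act_cls ext_add free_alg_add flip: klr_cls_add)
  thus ?case using add by (auto intro: subspace_add[OF part_sub])
next
  case (scale d x c)
  have v: "v \<in> S" using subsetD[OF part_le scale(3)] .
  obtain p where p: "p \<in> klr_fcar \<nu>" "x = klr_cls C \<nu> p" using klr_homog_in[OF scale(1)] by (rule klr_carrierE)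
  have "op_act (klr_const C \<nu> c \<otimes>\<^bsub>klr C \<nu>\<^esub> x) v = sc c (op_act x v)"
    using p v by (simp add: op_act_cls klr_const_cls free_alg_const free_alg_mult ext_const_mult flip: klr_cls_mult)
  thus ?case using scale by (auto intro: subspace_scale[OF part_sub])
next
  case (mult d x e' y)
  have v: "v \<in> S" using subsetD[OF part_le mult(5)] .
  obtain p where p: "p \<in> klr_fcar \<nu>" "x = klr_cls C \<nu> p" using klr_homog_in[OF mult(1)] by (rule klr_carrierE)
  obtain q where q: "q \<in> klr_fcar \<nu>" "y = klr_cls C \<nu> q" using klr_homog_in[OF mult(2)] by (rule klr_carrierE)
  have "op_act (x \<otimes>\<^bsub>klr C \<nu>\<^esub> y) v = op_act x (op_act y v)"
    using p q v by (simp add: op_act_cls ext_mult ext_in free_alg_mult flip: klr_cls_mult)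
  thus ?case using mult(3)[OF mult(4)[OF mult(5)]] by (simp add: add.assoc)
qed

lemma klr_module_op_module: "klr_module C \<nu> op_module"
proof (rule klr_module.intro, unfold op_module_sel, goal_cases)
  case 1 show ?case by (rule vector_space_axioms)
next
  case 2 show ?case by (rule sub)
next
  case 3 show ?case by (rule fd)
next
  case 4 thus ?case by (auto elim!: klr_carrierE simp: op_act_cls ext_in)
next
  case 5 thus ?case by (auto elim!: klr_carrierE simp: op_act_cls ext_addr subspace_add[OF sub])
next
  case 6 thus ?case by (auto elim!: klr_carrierE simp: op_act_cls ext_add free_alg_add simp flip: klr_cls_add)
next
  case 7 thus ?case by (auto elim!: klr_carrierE simp: op_act_cls ext_mult ext_in free_alg_mult simp flip: klr_cls_mult)
next
  case 8 thus ?case by (simp add: op_act_cls free_alg_one flip: klr_cls_one)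
next
  case 9 thus ?case by (simp add: op_act_cls free_alg_const ext_const klr_const_cls)
next
  case 10 show ?case by (rule part_sub)
next
  case 11 show ?case by (rule part_le)
next
  case 12 thus ?case by (rule part_dec)
next
  case 13 thus ?case by (rule op_act_homog)
qed

end

section \<open>Adding a strand\<close>

lemma push_gens_superset:
  assumes "finite K" "keys p \<subseteq> K"
  shows "push_gens g p = (\<Sum>w\<in>K. single (FMon (map g (letters w))) (lookup p w))"
  unfolding push_gens_def by (rule sum.mono_neutral_left[OF assms]) (auto simp: in_keys_iff)

lemma push_gens_add: "push_gens g (p + q) = push_gens g p + push_gens g q"
proof -
  let ?K = "keys p \<union> keys q"
  have "push_gens g (p + q) = (\<Sum>w\<in>?K. single (FMon (map g (letters w))) (lookup (p + q) w))"
    by (rule push_gens_superset) (use keys_add[of p q] in auto)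
  also have "\<dots> = push_gens g p + push_gens g q"
    by (subst (1 2) push_gens_superset[of ?K]) (auto simp: lookup_add single_add sum.distrib)
  finally show ?thesis .
qed

lemma push_gens_single: "push_gens g (single w c) = single (FMon (map g (letters w))) c"
  by (subst push_gens_superset[of "{w}"]) auto

lemma push_gens_0 [simp]: "push_gens g 0 = 0" by (simp add: push_gens_def)

lemma push_gens_uminus: "push_gens g (- p) = - push_gens g p"
  using push_gens_add[of g p "- p"] by (simp add: eq_neg_iff_add_eq_0 add.commute)

lemma push_gens_diff: "push_gens g (p - q) = push_gens g p - push_gens g q"
  using push_gens_add[of g p "- q"] by (simp add: push_gens_uminus)

lemma push_gens_sum: "push_gens g (\<Sum>x\<in>B. h x) = (\<Sum>x\<in>B. push_gens g (h x))"
  by (induction B rule: infinite_finite_induct) (auto simp: push_gens_add)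

lemma push_gens_mult: "push_gens g (p * q) = push_gens g p * push_gens g q"
proof (induction p rule: pm_induct)
  case (single w c)
  show ?case
    by (induction q rule: pm_induct)
      (simp_all add: mult_single push_gens_single plus_fmon_def distrib_left push_gens_add)
qed (simp add: distrib_right push_gens_add)

lemma push_gens_const: "push_gens g (const a) = const a"
  by (simp add: push_gens_single zero_fmon_def)

lemma push_gens_1 [simp]: "push_gens g 1 = 1"
  using push_gens_const[of g 1] by simp

lemma push_gens_gen: "push_gens g (gen x) = gen (g x)"
  by (simp add: push_gens_single gen_def)

lemma push_gens_power: "push_gens g (p ^ n) = push_gens g p ^ n"
  by (induction n) (simp_all add: push_gens_mult)

text \<open>
  Strands are added on both sides at once: \<open>gen_first\<close> and \<open>gen_last\<close> are the cases in which
  one of \<open>pre\<close> and \<open>post\<close> is empty.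
\<close>

fun gen_between :: "'i list \<Rightarrow> 'i list \<Rightarrow> 'i klr_gen \<Rightarrow> 'i klr_gen" where
  "gen_between pre post (Idemp u) = Idemp (pre @ u @ post)"
| "gen_between pre post (Dot r) = Dot (length pre + r)"
| "gen_between pre post (Cross r) = Cross (length pre + r)"

lemma gen_first_between: "gen_first i = gen_between [] [i]"
proof
  fix x show "gen_first i x = gen_between [] [i] x" by (cases x) auto
qed

lemma gen_last_between: "gen_last i = gen_between [i] []"
proof
  fix x show "gen_last i x = gen_between [i] [] x" by (cases x) auto
qed

locale strand =
  fixes C :: "('i, 'p) cartan_data" and \<nu> :: "'i multiset" and i :: 'i and pre post :: "'i list"
  assumes i_in: "i \<in># \<nu>" and side: "mset pre + mset post = {#i#}"
begin

abbreviation "\<mu> \<equiv> \<nu> - {#i#}"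
abbreviation "wd u \<equiv> pre @ u @ post"
abbreviation push :: "('i, 'k::field) klr_free \<Rightarrow> ('i, 'k) klr_free" where
  "push \<equiv> push_gens (gen_between pre post)"
definition Esum :: "('i, 'k::field) klr_free" where
  "Esum = (\<Sum>u\<in>seqs \<mu>. idemp (wd u))"

lemma size_eq: "size \<nu> = Suc (size \<mu>)" "length pre + length post = 1"
proof -
  show "size \<nu> = Suc (size \<mu>)" using i_in by (metis size_Suc_Diff1)
  show "length pre + length post = 1" using arg_cong[OF side, of size] by simp
qed

lemma wd_in: "u \<in> seqs \<mu> ==> wd u \<in> seqs \<nu>"
proof -
  assume u: "u \<in> seqs \<mu>"
  have "mset (wd u) = mset u + (mset pre + mset post)" by simp
  also have "\<dots> = \<nu>" unfolding side using u i_in by (simp add: permutations_of_multiset_def)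
  finally show ?thesis by (simp add: permutations_of_multiset_def)
qed

lemma wd_nth: "u \<in> seqs \<mu> ==> r < size \<mu> ==> wd u ! (length pre + r) = u ! r"
  using seqs_length[of u \<mu>] by (simp add: nth_append)

lemma wd_swap: "u \<in> seqs \<mu> ==> Suc r < size \<mu> ==> swap_seq (length pre + r) (wd u) = wd (swap_seq r u)"
  using wd_nth[of u r] wd_nth[of u "Suc r"] seqs_length[of u \<mu>]
  by (simp add: swap_seq_def list_update_append)

lemma bound: "r < size \<mu> ==> length pre + r < size \<nu>"
  using size_eq by simp

lemma push_idemp: "push (idemp u) = idemp (wd u)"
  and push_dot: "push (dot r) = dot (length pre + r)"
  and push_crs: "push (crs r) = crs (length pre + r)"
  by (simp_all add: idemp_gen dot_gen crs_gen push_gens_gen)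

lemmas push_simps = push_gens_add push_gens_diff push_gens_uminus push_gens_mult push_gens_power
  push_gens_sum push_idemp push_dot push_crs push_gens_const

lemma push_gen_in: "x \<in> klr_gens \<mu> ==> gen_between pre post x \<in> klr_gens \<nu>"
  using size_eq by (auto simp: klr_gens_def wd_in)

lemma push_in: "p \<in> klr_fcar \<mu> ==> push p \<in> klr_fcar \<nu>"
proof (induction p rule: free_alg_induct)
  case (gen x p) thus ?case by (auto simp: push_gens_mult push_gens_gen intro!: klr_closed push_gen_in)
qed (auto simp: push_gens_const push_gens_add intro: klr_closed)

lemma Esum_in: "Esum \<in> klr_fcar \<nu>"
  unfolding Esum_def by (auto intro!: klr_closed wd_in)

text \<open>
  The relations are local, so a shift of the strand numbers maps relators to relators. The one
  exception is the relator for the unit, since the words \<open>wd u\<close> are not all words of \<open>\<nu>\<close>.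
\<close>

lemma push_relator: "p \<in> klr_relators C \<mu> ==> push p \<in> klr_relators C \<nu> \<or> push p = Esum - (1 :: ('i,'k::field) klr_free)"
proof (induction p rule: klr_relators.induct)
  case unit thus ?case by (simp add: push_simps Esum_def)
next
  case (idem_idem u v)
  thus ?case using klr_relators.idem_idem[OF wd_in[OF idem_idem(1)] wd_in[OF idem_idem(2)]]
    by (auto simp: push_simps)
next
  case (dot_idem u r)
  thus ?case using klr_relators.dot_idem[OF wd_in[OF dot_idem(1)] bound[OF dot_idem(2)]]
    by (auto simp: push_simps)
next
  case (crs_idem u r)
  thus ?case using klr_relators.crs_idem[OF wd_in[OF crs_idem(1)], of "length pre + r"] bound[of "Suc r"]
    by (auto simp: push_simps wd_swap)
next
  case (dot_dot r t)
  thus ?case using klr_relators.dot_dot[OF bound bound] by (auto simp: push_simps)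
next
  case (crs_crs r t)
  thus ?case using klr_relators.crs_crs[of "length pre + r" \<nu> "length pre + t"] bound[of "Suc r"] bound[of "Suc t"]
    by (auto simp: push_simps)
next
  case (crs_sq u r x y)
  have "push (if x = y then 0 else if rform C x y = 0 then idemp u :: ('i,'k) klr_free
     else (dot r ^ nat (cartan_a C x y) + dot (Suc r) ^ nat (cartan_a C y x)) * idemp u) =
    (if x = y then 0 else if rform C x y = 0 then idemp (wd u)
     else (dot (length pre + r) ^ nat (cartan_a C x y) + dot (Suc (length pre + r)) ^ nat (cartan_a C y x)) * idemp (wd u))"
    by (simp add: push_simps)
  moreover have "crs (length pre + r) * crs (length pre + r) * idemp (wd u) - \<dots> \<in> klr_relators C \<nu>"
    using wd_nth[of u r] wd_nth[of u "Suc r"] crs_sq bound[of "Suc r"]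
    by (intro klr_relators.crs_sq wd_in) auto
  ultimately show ?case by (simp only: push_gens_diff push_gens_mult push_crs push_idemp simp_thms)
next
  case (braid u r x y z a)
  let ?l = "length pre + r"
  have "push (if x = z \<and> rform C x y \<noteq> 0 then (\<Sum>t<a. dot r ^ t * dot (Suc (Suc r)) ^ (a - 1 - t)) * idemp u else (0 :: ('i,'k) klr_free)) =
    (if x = z \<and> rform C x y \<noteq> 0 then (\<Sum>t<a. dot ?l ^ t * dot (Suc (Suc ?l)) ^ (a - 1 - t)) * idemp (wd u) else 0)"
    by (simp only: if_distrib[of push] push_simps push_gens_0 add_Suc_right cong: if_cong)
  moreover have "(crs ?l * crs (Suc ?l) * crs ?l - crs (Suc ?l) * crs ?l * crs (Suc ?l)) * idemp (wd u) - \<dots> \<in> klr_relators C \<nu>"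
    using wd_nth[of u r] wd_nth[of u "Suc r"] wd_nth[of u "Suc (Suc r)"] braid bound[of "Suc (Suc r)"]
    by (intro klr_relators.braid wd_in) auto
  ultimately show ?case by (simp only: push_gens_diff push_gens_mult push_crs push_idemp add_Suc_right simp_thms)
next
  case (crs_dot u r t)
  have tr: "transpose (length pre + r) (Suc (length pre + r)) (length pre + t) = length pre + transpose r (Suc r) t"
    by (auto simp: transpose_def)
  have nth: "wd u ! (length pre + r) = u ! r" "wd u ! (Suc (length pre + r)) = u ! Suc r"
    using wd_nth[of u r] wd_nth[of u "Suc r"] crs_dot by auto
  have "push (if t = r \<and> u ! r = u ! Suc r then idemp u else if t = Suc r \<and> u ! r = u ! Suc r then - idemp u else 0) =
    (if length pre + t = length pre + r \<and> u ! r = u ! Suc r then idemp (wd u)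
     else if length pre + t = Suc (length pre + r) \<and> u ! r = u ! Suc r then - idemp (wd u) else (0 :: ('i,'k) klr_free))"
    by (simp add: push_simps)
  thus ?case
    using klr_relators.crs_dot[OF wd_in[OF crs_dot(1)], of "length pre + r" "length pre + t" C,
        where ?'k = 'k, unfolded nth tr] crs_dot bound[of "Suc r"] bound[of t]
    by (simp only: push_gens_diff push_gens_mult push_crs push_idemp push_dot) simp
qed

abbreviation klr_eq :: "('i, 'k::field) klr_free \<Rightarrow> ('i, 'k) klr_free \<Rightarrow> bool" (infix "\<approx>" 50) where
  "p \<approx> q \<equiv> klr_cls C \<nu> p = klr_cls C \<nu> q"

lemma eq_mult: "p \<approx> p' ==> q \<approx> q' ==> p \<in> klr_fcar \<nu> ==> p' \<in> klr_fcar \<nu> ==> q \<in> klr_fcar \<nu> ==>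
    q' \<in> klr_fcar \<nu> ==> p * q \<approx> p' * q'"
  by (simp add: klr_cls_mult)

lemma eq_add: "p \<approx> p' ==> q \<approx> q' ==> p \<in> klr_fcar \<nu> ==> p' \<in> klr_fcar \<nu> ==> q \<in> klr_fcar \<nu> ==>
    q' \<in> klr_fcar \<nu> ==> p + q \<approx> p' + q'"
  by (simp add: klr_cls_add)

lemma eq_sum: "(\<And>x. x \<in> B ==> f x \<approx> g x \<and> f x \<in> klr_fcar \<nu> \<and> g x \<in> klr_fcar \<nu>) ==> (\<Sum>x\<in>B. f x) \<approx> (\<Sum>x\<in>B. g x)"
proof (induction B rule: infinite_finite_induct)
  case (insert x F)
  have "f x + sum f F \<approx> g x + sum g F"
  proof (rule eq_add)
    show "sum f F \<approx> sum g F" using insert by simp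
  qed (use insert.prems in \<open>simp_all add: free_alg_sum\<close>)
  thus ?case using insert by simp
qed simp_all

lemma rel_eq: "p - q \<in> klr_relators C \<nu> ==> p \<in> klr_fcar \<nu> ==> q \<in> klr_fcar \<nu> ==> p \<approx> q"
  using klr_cls_eq_iff[of p \<nu> q C] klr_relators_ideal[of "p - q" C \<nu>] by simp

lemma idemp_idemp:
  assumes "u \<in> seqs \<nu>" "v \<in> seqs \<nu>"
  shows "(idemp u * idemp v :: ('i,'k::field) klr_free) \<approx> (if u = v then idemp u else 0)"
  by (rule rel_eq[OF klr_relators.idem_idem[OF assms]]) (use assms in \<open>auto intro: klr_closed\<close>)

lemma idemp_wd:
  assumes "u \<in> seqs \<mu>" "v \<in> seqs \<mu>"
  shows "(idemp (wd u) * idemp (wd v) :: ('i,'k::field) klr_free) \<approx> (if u = v then idemp (wd u) else 0) \<and>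
    idemp (wd u) * idemp (wd v) \<in> (klr_fcar \<nu> :: ('i,'k) klr_free set) \<and>
    (if u = v then idemp (wd u) else (0 :: ('i,'k) klr_free)) \<in> klr_fcar \<nu>"
proof -
  have e: "(wd u = wd v) = (u = v)" by auto
  have a: "(idemp (wd u) * idemp (wd v) :: ('i,'k) klr_free) \<approx> (if u = v then idemp (wd u) else 0)"
    using idemp_idemp[OF wd_in wd_in, OF assms, where ?'k = 'k] unfolding e by (cases "u = v") simp_all
  have b: "idemp (wd u) * idemp (wd v) \<in> (klr_fcar \<nu> :: ('i,'k) klr_free set)"
    by (intro free_alg_mult idemp_in wd_in assms)
  have c: "(if u = v then idemp (wd u) else 0) \<in> (klr_fcar \<nu> :: ('i,'k) klr_free set)"
    using idemp_in[OF wd_in[OF assms(1)]] free_alg_zero by (cases "u = v") (simp_all only: if_True if_False refl)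
  show ?thesis by (rule conjI[OF a conjI[OF b c]])
qed

lemma idemp_Esum: "u \<in> seqs \<mu> ==> (idemp (wd u) * Esum :: ('i,'k::field) klr_free) \<approx> idemp (wd u)"
proof -
  assume u: "u \<in> seqs \<mu>"
  have "(idemp (wd u) * Esum :: ('i,'k) klr_free) \<approx> (\<Sum>v\<in>seqs \<mu>. if u = v then idemp (wd u) else 0)"
    unfolding Esum_def sum_distrib_left by (rule eq_sum[OF idemp_wd[OF u]])
  thus ?thesis using u by simp
qed

lemma Esum_idemp: "u \<in> seqs \<mu> ==> (Esum * idemp (wd u) :: ('i,'k::field) klr_free) \<approx> idemp (wd u)"
proof -
  assume u: "u \<in> seqs \<mu>"
  have "(Esum * idemp (wd u) :: ('i,'k) klr_free) \<approx> (\<Sum>v\<in>seqs \<mu>. if v = u then idemp (wd v) else 0)"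
    unfolding Esum_def sum_distrib_right by (rule eq_sum[OF idemp_wd[OF _ u]])
  thus ?thesis using u by simp
qed

lemma Esum_Esum: "(Esum * Esum :: ('i,'k::field) klr_free) \<approx> Esum"
proof -
  have "((\<Sum>u\<in>seqs \<mu>. idemp (wd u) * Esum) :: ('i,'k) klr_free) \<approx> (\<Sum>u\<in>seqs \<mu>. idemp (wd u))"
    by (rule eq_sum) (use idemp_Esum in \<open>auto intro!: klr_closed wd_in Esum_in\<close>)
  thus ?thesis by (simp add: Esum_def sum_distrib_right)
qed

text \<open>
  A crossing permutes the words \<open>wd u\<close>, as it does not involve the added letters.
\<close>

lemma gen_Esum:
  assumes "x \<in> klr_gens \<mu>"
  shows "(gen (gen_between pre post x) * Esum :: ('i,'k::field) klr_free) \<approx> Esum * gen (gen_between pre post x)"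
proof -
  consider u where "x = Idemp u" "u \<in> seqs \<mu>" | r where "x = Dot r" "r < size \<mu>" | r where "x = Cross r" "Suc r < size \<mu>"
    using assms by (auto simp: klr_gens_def)
  thus ?thesis
  proof cases
    case 1 thus ?thesis by (simp add: idemp_Esum Esum_idemp flip: idemp_gen)
  next
    case 2
    have "((\<Sum>u\<in>seqs \<mu>. dot (length pre + r) * idemp (wd u)) :: ('i,'k) klr_free) \<approx>
        (\<Sum>u\<in>seqs \<mu>. idemp (wd u) * dot (length pre + r))"
    proof (rule eq_sum)
      fix u assume u: "u \<in> seqs \<mu>"
      have m: "dot (length pre + r) * idemp (wd u) \<in> (klr_fcar \<nu> :: ('i,'k) klr_free set)"
        "idemp (wd u) * dot (length pre + r) \<in> (klr_fcar \<nu> :: ('i,'k) klr_free set)"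
        using u bound[OF 2(2)] by (auto intro!: klr_closed wd_in)
      thus "(dot (length pre + r) * idemp (wd u) :: ('i,'k) klr_free) \<approx> idemp (wd u) * dot (length pre + r) \<and>
          dot (length pre + r) * idemp (wd u) \<in> (klr_fcar \<nu> :: ('i,'k) klr_free set) \<and>
          idemp (wd u) * dot (length pre + r) \<in> (klr_fcar \<nu> :: ('i,'k) klr_free set)"
        using rel_eq[OF klr_relators.dot_idem[OF wd_in[OF u] bound[OF 2(2)]] m] by blast
    qed
    thus ?thesis unfolding 2 gen_between.simps dot_gen[symmetric] Esum_def sum_distrib_left sum_distrib_right .
  next
    case 3
    let ?r = "length pre + r"
    have b: "Suc ?r < size \<nu>" using bound[OF 3(2)] by simp
    have "((\<Sum>u\<in>seqs \<mu>. crs ?r * idemp (wd u)) :: ('i,'k) klr_free) \<approx>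
        (\<Sum>u\<in>seqs \<mu>. idemp (wd (swap_seq r u)) * crs ?r)"
    proof (rule eq_sum)
      fix u assume u: "u \<in> seqs \<mu>"
      have m: "crs ?r * idemp (wd u) \<in> (klr_fcar \<nu> :: ('i,'k) klr_free set)"
        "idemp (swap_seq ?r (wd u)) * crs ?r \<in> (klr_fcar \<nu> :: ('i,'k) klr_free set)"
        using u b by (auto intro!: klr_closed wd_in swap_seq_in)
      thus "(crs ?r * idemp (wd u) :: ('i,'k) klr_free) \<approx> idemp (wd (swap_seq r u)) * crs ?r \<and>
          crs ?r * idemp (wd u) \<in> (klr_fcar \<nu> :: ('i,'k) klr_free set) \<and>
          idemp (wd (swap_seq r u)) * crs ?r \<in> (klr_fcar \<nu> :: ('i,'k) klr_free set)"
        using rel_eq[OF klr_relators.crs_idem[OF wd_in[OF u] b] m] wd_swap[OF u 3(2)] by simp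
    qed
    also have "(\<Sum>u\<in>seqs \<mu>. idemp (wd (swap_seq r u)) * crs ?r) = (\<Sum>u\<in>seqs \<mu>. idemp (wd u) * (crs ?r :: ('i,'k) klr_free))"
      by (rule sum.reindex_bij_betw[OF bij_swap_seq[OF 3(2)]])
    finally show ?thesis unfolding 3 gen_between.simps crs_gen[symmetric] Esum_def sum_distrib_left sum_distrib_right .
  qed
qed

lemma push_Esum: "p \<in> klr_fcar \<mu> ==> (push p * Esum :: ('i,'k::field) klr_free) \<approx> Esum * push p"
proof (induction p rule: free_alg_induct)
  case (const a) thus ?case by (simp add: push_gens_const const_mult_commute)
next
  case (add p q) show ?case unfolding push_gens_add distrib_left distrib_right
    by (rule eq_add[OF add(3,4)]) (intro free_alg_mult push_in Esum_in add(1,2))+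
next
  case (gen x p)
  let ?g = "gen (gen_between pre post x) :: ('i,'k) klr_free"
  have g: "?g \<in> klr_fcar \<nu>" using gen by (intro klr_closed push_gen_in)
  note cl = klr_closed push_in[OF gen(2)] Esum_in g
  have "?g * push p * Esum = ?g * (push p * Esum)" by (simp add: mult.assoc)
  also have "\<dots> \<approx> ?g * (Esum * push p)" by (intro eq_mult gen refl cl)
  also have "?g * (Esum * push p) = (?g * Esum) * push p" by (simp add: mult.assoc)
  also have "\<dots> \<approx> (Esum * ?g) * push p" by (intro eq_mult gen_Esum gen refl cl)
  finally show ?case by (simp add: push_gens_mult push_gens_gen mult.assoc)
qed

definition \<theta> :: "('i, 'k::field) klr_free \<Rightarrow> ('i, 'k) klr_elem" where
  "\<theta> p = klr_cls C \<nu> (push p * Esum)"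

lemma theta_mult:
  assumes p: "p \<in> klr_fcar \<mu>" and q: "q \<in> klr_fcar \<mu>"
  shows "\<theta> (p * q) = \<theta> p \<otimes>\<^bsub>klr C \<nu>\<^esub> (\<theta> q :: ('i,'k::field) klr_elem)"
proof -
  note cl = klr_closed push_in[OF p] push_in[OF q] Esum_in
  have "push p * push q * Esum = push p * (push q * Esum)" by (simp add: mult.assoc)
  also have "\<dots> \<approx> push p * (push q * (Esum * Esum))" by (intro eq_mult refl Esum_Esum[symmetric] cl)
  also have "push p * (push q * (Esum * Esum)) = push p * ((push q * Esum) * Esum)" by (simp add: mult.assoc)
  also have "\<dots> \<approx> push p * ((Esum * push q) * Esum)" by (intro eq_mult refl push_Esum q cl)
  finally show ?thesis
    unfolding \<theta>_def push_gens_mult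
    by (subst klr_cls_mult[symmetric]) (auto intro!: cl simp: mult.assoc)
qed

lemma theta_add: "p \<in> klr_fcar \<mu> ==> q \<in> klr_fcar \<mu> ==> \<theta> (p + q) = \<theta> p \<oplus>\<^bsub>klr C \<nu>\<^esub> \<theta> q"
  by (simp add: \<theta>_def push_gens_add distrib_right klr_cls_add push_in Esum_in free_alg_mult)

text \<open>
  Multiplication by the idempotent \<open>Esum\<close> repairs the relator for the unit.
\<close>

lemma theta_ideal: "p \<in> klr_ideal C \<mu> ==> push p * Esum \<in> (klr_ideal C \<nu> :: ('i,'k::field) klr_free set)"
proof -
  interpret I: ideal "klr_ideal C \<nu>" "free_alg (klr_gens \<nu>) :: ('i klr_gen fmon \<Rightarrow>\<^sub>0 'k) ring" by (rule klr_ideal)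
  have ideal_iff: "x \<in> klr_ideal C \<nu> \<longleftrightarrow> x \<approx> 0" if "x \<in> klr_fcar \<nu>" for x :: "('i,'k) klr_free"
    using klr_cls_eq_iff[OF that free_alg_zero, of C] by simp
  assume "p \<in> klr_ideal C \<mu>"
  thus ?thesis
  proof (induction p rule: klr_ideal_induct)
    case (rel p)
    have p: "p \<in> klr_fcar \<mu>" using klr_relators_in rel by blast
    from push_relator[OF rel] show ?case
    proof
      assume "push p \<in> klr_relators C \<nu>"
      from I.I_r_closed[OF klr_relators_ideal[OF this] Esum_in] show ?thesis by simp
    next
      assume "push p = Esum - 1"
      hence "push p * Esum = Esum * Esum - Esum" by (simp add: left_diff_distrib)
      moreover have "Esum * Esum - Esum \<in> (klr_ideal C \<nu> :: ('i,'k) klr_free set)"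
        by (subst klr_cls_eq_iff[symmetric]) (intro free_alg_mult Esum_in Esum_Esum)+
      ultimately show ?thesis by simp
    qed
  next
    case zero thus ?case using additive_subgroup.zero_closed[OF I.additive_subgroup_axioms] by simp
  next
    case (add p q) thus ?case using additive_subgroup.a_closed[OF I.additive_subgroup_axioms]
      by (simp add: push_gens_add distrib_right)
  next
    case (uminus p)
    thus ?case using additive_subgroup.a_inv_closed[OF I.additive_subgroup_axioms, of "push p * Esum"]
        free_alg_a_inv[of "push p * Esum"]
      by (simp add: push_gens_uminus push_in Esum_in free_alg_mult)
  next
    case (left p q)
    thus ?case using I.I_l_closed[of "push p * Esum" "push q"] by (simp add: push_gens_mult mult.assoc push_in)
  next
    case (right p q)
    note cl = klr_closed push_in[OF right(1)] push_in[OF right(2)] Esum_in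
    have "push p * push q * Esum = push p * (push q * Esum)" by (simp add: mult.assoc)
    also have "\<dots> \<approx> push p * (Esum * push q)" by (intro eq_mult refl push_Esum right cl)
    finally have "push p * push q * Esum - push p * (Esum * push q) \<in> klr_ideal C \<nu>"
      by (subst klr_cls_eq_iff[symmetric]) (auto intro!: cl)
    moreover have "push p * (Esum * push q) \<in> klr_ideal C \<nu>"
      using I.I_r_closed[OF right(3), of "push q"] push_in[OF right(2)] by (simp add: mult.assoc)
    ultimately show ?case using additive_subgroup.a_closed[OF I.additive_subgroup_axioms]
      by (fastforce simp: push_gens_mult)
  qed
qed

lemma theta_cong:
  assumes "p \<in> klr_fcar \<mu>" "q \<in> klr_fcar \<mu>" "klr_cls C \<mu> p = klr_cls C \<mu> q"
  shows "\<theta> p = (\<theta> q :: ('i,'k::field) klr_elem)"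
proof -
  have "push (p - q) * Esum \<in> klr_ideal C \<nu>" using assms klr_cls_eq_iff[of p \<mu> q C] by (intro theta_ideal) simp
  thus ?thesis unfolding \<theta>_def
    using klr_cls_eq_iff[of "push p * Esum" \<nu> "push q * Esum" C] assms
    by (simp add: push_gens_diff left_diff_distrib push_in Esum_in free_alg_mult)
qed

lemma strand_map_cls:
  assumes "p \<in> klr_fcar \<mu>"
  shows "strand_map C \<nu> i (gen_between pre post) wd (klr_cls C \<mu> p) = (\<theta> p :: ('i,'k::field) klr_elem)"
proof -
  have f: "(\<lambda>p. klr_cls C \<nu> (push p * (\<Sum>u\<in>seqs \<mu>. idemp (wd u)))) = (\<theta> :: ('i,'k) klr_free \<Rightarrow> _)"
    by (rule ext) (simp add: \<theta>_def Esum_def)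
  have "\<theta> ` klr_cls C \<mu> p = {\<theta> p :: ('i,'k) klr_elem}"
  proof
    show "\<theta> ` klr_cls C \<mu> p \<subseteq> {\<theta> p :: ('i,'k) klr_elem}"
    proof
      fix y assume "y \<in> \<theta> ` klr_cls C \<mu> p"
      then obtain q where q: "q \<in> klr_cls C \<mu> p" "y = \<theta> q" by blast
      hence "q \<in> klr_fcar \<mu>" "klr_cls C \<mu> q = klr_cls C \<mu> p" using klr_cls_mem[OF assms] by blast+
      thus "y \<in> {\<theta> p}" using theta_cong[OF _ assms] q(2) by simp
    qed
    have "p \<in> klr_cls C \<mu> p" using klr_cls_mem[OF assms] assms by blast
    thus "{\<theta> p} \<subseteq> \<theta> ` klr_cls C \<mu> p" by blast
  qed
  thus ?thesis unfolding strand_map_def f by simp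
qed

lemma theta_idemp: "u \<in> seqs \<mu> ==> \<theta> (idemp u) = klr_cls C \<nu> (idemp (wd u))"
  by (simp add: \<theta>_def push_idemp idemp_Esum)

lemma strand_map_homog:
  "klr_homog C \<mu> d r ==> klr_homog C \<nu> d (strand_map C \<nu> i (gen_between pre post) wd r :: ('i,'k::field) klr_elem)"
proof (induction rule: klr_homog.induct)
  case (idem u) thus ?case by (simp add: strand_map_cls idemp_in theta_idemp wd_in klr_homog.idem)
next
  case (dot u r)
  have "\<theta> (dot r * idemp u) = klr_cls C \<nu> (dot (length pre + r) * idemp (wd u) :: ('i,'k) klr_free)"
    unfolding \<theta>_def push_gens_mult push_dot push_idemp mult.assoc
    using dot bound by (intro eq_mult refl idemp_Esum) (auto intro!: klr_closed wd_in Esum_in)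
  thus ?case using klr_homog.dot[OF wd_in[OF dot(1)] bound[OF dot(2)], of C, unfolded wd_nth[OF dot]] dot
    by (simp add: strand_map_cls klr_closed)
next
  case (crs u r)
  have "\<theta> (crs r * idemp u) = klr_cls C \<nu> (crs (length pre + r) * idemp (wd u) :: ('i,'k) klr_free)"
    unfolding \<theta>_def push_gens_mult push_crs push_idemp mult.assoc
    using crs bound[of "Suc r"] by (intro eq_mult refl idemp_Esum) (auto intro!: klr_closed wd_in Esum_in)
  moreover have "wd u ! (length pre + r) = u ! r" "wd u ! Suc (length pre + r) = u ! Suc r"
    using wd_nth[of u r] wd_nth[of u "Suc r"] crs by auto
  ultimately show ?case
    using klr_homog.crs[OF wd_in[OF crs(1)], of "length pre + r" C] bound[of "Suc r"] crs
    by (simp only: strand_map_cls klr_closed add_Suc_right True_implies_equals)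
next
  case (zero d)
  have "strand_map C \<nu> i (gen_between pre post) wd (\<zero>\<^bsub>klr C \<mu>\<^esub> :: ('i,'k) klr_elem) = \<theta> 0"
    using strand_map_cls[OF free_alg_zero] by (simp flip: klr_cls_zero)
  also have "\<dots> = \<zero>\<^bsub>klr C \<nu>\<^esub>" by (simp add: \<theta>_def klr_cls_zero)
  finally show ?case by (simp add: klr_homog.zero)
next
  case (add d x y)
  obtain p where p: "p \<in> klr_fcar \<mu>" "x = klr_cls C \<mu> p" using klr_homog_in[OF add(1)] by (rule klr_carrierE)
  obtain q where q: "q \<in> klr_fcar \<mu>" "y = klr_cls C \<mu> q" using klr_homog_in[OF add(2)] by (rule klr_carrierE)
  show ?case using klr_homog.add[OF add(3,4)] p q
    by (simp add: strand_map_cls theta_add free_alg_add flip: klr_cls_add)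
next
  case (scale d x c)
  obtain p where p: "p \<in> klr_fcar \<mu>" "x = klr_cls C \<mu> p" using klr_homog_in[OF scale(1)] by (rule klr_carrierE)
  have "\<theta> (const c * p) = klr_const C \<nu> c \<otimes>\<^bsub>klr C \<nu>\<^esub> (\<theta> p :: ('i,'k) klr_elem)"
    unfolding \<theta>_def push_gens_mult push_gens_const klr_const_cls mult.assoc
    by (rule klr_cls_mult) (auto intro!: klr_closed push_in Esum_in p)
  thus ?case using klr_homog.scale[OF scale(2), of c] p
    by (simp add: strand_map_cls free_alg_mult free_alg_const klr_const_cls flip: klr_cls_mult)
next
  case (mult d x e y)
  obtain p where p: "p \<in> klr_fcar \<mu>" "x = klr_cls C \<mu> p" using klr_homog_in[OF mult(1)] by (rule klr_carrierE)
  obtain q where q: "q \<in> klr_fcar \<mu>" "y = klr_cls C \<mu> q" using klr_homog_in[OF mult(2)] by (rule klr_carrierE)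
  show ?case using klr_homog.mult[OF mult(3,4)] p q
    by (simp add: strand_map_cls theta_mult free_alg_mult flip: klr_cls_mult)
qed

end

section \<open>Restriction functors\<close>

text \<open>
  All other idempotents act by zero on such a module, as \<open>concentrated_E\<close> shows.
\<close>

definition concentrated ::
    "('i, 'p) cartan_data \<Rightarrow> 'i multiset
     \<Rightarrow> (('i, 'k::field) klr_elem, 'k, 'v::ab_group_add) gmodule \<Rightarrow> 'i list \<Rightarrow> bool" where
  "concentrated C \<nu> M u \<longleftrightarrow> u \<in> seqs \<nu> \<and> (\<forall>v\<in>gm_space M. gact C \<nu> M (idemp u) v = v)"

lemma (in klr_module) concentrated_E:
  "concentrated C \<nu> M u ==> w \<in> seqs \<nu> ==> v \<in> S ==> E w v = (if w = u then v else 0)"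
  using E_E[of w u v] unfolding concentrated_def by (metis (full_types))

lemma (in klr_module) idem_space_eq: "idem_space C \<nu> M u = E u ` S"
  by (simp add: idem_space_def gact_def)

lemma (in klr_module) soc_concentrated:
  "concentrated C \<nu> M u ==> concentrated C \<nu> (gm_soc C \<nu> M) u"
  using soc_le unfolding concentrated_def gm_soc_eq by auto

context strand
begin

abbreviation "Res \<equiv> gm_res C \<nu> i (gen_between pre post) wd"

lemma gact_eq: "p \<approx> q ==> gact C \<nu> M p = gact C \<nu> M q"
  by (simp add: gact_def fun_eq_iff)

context
  fixes M :: "(('i, 'k::field) klr_elem, 'k, 'v::ab_group_add) gmodule"
  assumes M: "klr_module C \<nu> M"
begin

interpretation M: klr_module C \<nu> M by (rule M)

lemma Esum_act_idem: "v \<in> M.S ==> M.act Esum (M.act Esum v) = M.act Esum v"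
  using gact_eq[OF Esum_Esum, of M] by (simp add: Esum_in flip: M.act_times)

lemma E_wd_Esum: "u \<in> seqs \<mu> ==> v \<in> M.S ==> M.act Esum (M.E (wd u) v) = M.E (wd u) v"
  using gact_eq[OF Esum_idemp, of u M] by (simp add: Esum_in idemp_in wd_in flip: M.act_times)

lemma E_wd_Esum': "u \<in> seqs \<mu> ==> v \<in> M.S ==> M.E (wd u) (M.act Esum v) = M.E (wd u) v"
  using gact_eq[OF idemp_Esum, of u M] by (simp add: Esum_in idemp_in wd_in flip: M.act_times)

lemma Esum_eq: "v \<in> M.S ==> M.act Esum v = (\<Sum>u\<in>seqs \<mu>. M.E (wd u) v)"
  unfolding Esum_def by (rule M.act_suml) (auto intro!: idemp_in wd_in)

lemma Res_space: "gm_space (Res M) = {v \<in> M.S. M.act Esum v = v}"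
proof -
  let ?T = "{v \<in> M.S. M.act Esum v = v}"
  have sub: "gm_subspace M ?T"
    by (rule M.vs.subspaceI) (auto simp: M.add_in M.scale_in M.act_addr M.act_scale Esum_in)
  have "gm_span M (\<Union>u\<in>seqs \<mu>. idem_space C \<nu> M (wd u)) = ?T"
  proof
    show "gm_span M (\<Union>u\<in>seqs \<mu>. idem_space C \<nu> M (wd u)) \<subseteq> ?T"
      by (rule M.vs.span_minimal[OF _ sub]) (auto simp: M.idem_space_eq E_wd_Esum M.E_in wd_in)
    show "?T \<subseteq> gm_span M (\<Union>u\<in>seqs \<mu>. idem_space C \<nu> M (wd u))"
    proof
      fix v assume v: "v \<in> ?T"
      hence "v = (\<Sum>u\<in>seqs \<mu>. M.E (wd u) v)" using Esum_eq[of v] by simp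
      also have "\<dots> \<in> gm_span M (\<Union>u\<in>seqs \<mu>. idem_space C \<nu> M (wd u))"
        using v by (intro M.vs.span_sum M.vs.span_base) (auto simp: M.idem_space_eq)
      finally show "v \<in> gm_span M (\<Union>u\<in>seqs \<mu>. idem_space C \<nu> M (wd u))" .
    qed
  qed
  thus ?thesis using i_in by (simp add: gm_res_def)
qed

lemma Res_sel: "gm_scale (Res M) = gm_scale M" "gm_part (Res M) d = gm_part M d \<inter> gm_space (Res M)"
    "gm_act (Res M) r v = gm_act M (strand_map C \<nu> i (gen_between pre post) wd r) v"
  using i_in by (simp_all add: gm_res_def gm_restrict_def)

lemma Res_act:
  assumes p: "p \<in> klr_fcar \<mu>" and v: "v \<in> gm_space (Res M)"
  shows "gact C \<mu> (Res M) p v = M.act (push p) v"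
proof -
  have v': "v \<in> M.S" "M.act Esum v = v" using v by (auto simp: Res_space)
  have "gact C \<mu> (Res M) p v = M.act (push p * Esum) v"
    using p by (simp add: gact_def Res_sel strand_map_cls \<theta>_def)
  also have "\<dots> = M.act (push p) v" using v' p by (simp add: M.act_times push_in Esum_in)
  finally show ?thesis .
qed

lemma Res_act_in:
  assumes p: "p \<in> klr_fcar \<mu>" and v: "v \<in> gm_space (Res M)"
  shows "M.act (push p) v \<in> gm_space (Res M)"
proof -
  have v': "v \<in> M.S" "M.act Esum v = v" using v by (auto simp: Res_space)
  have "M.act Esum (M.act (push p) v) = M.act (Esum * push p) v"
    using v' p by (simp add: M.act_times push_in Esum_in)
  also have "\<dots> = M.act (push p * Esum) v" using gact_eq[OF push_Esum[OF p], of M] by simp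
  also have "\<dots> = M.act (push p) v" using v' p by (simp add: M.act_times push_in Esum_in)
  finally show ?thesis using v' p by (simp add: Res_space M.act_in push_in)
qed

lemma Esum_part: "v \<in> gm_part M d ==> M.act Esum v \<in> gm_part M d"
proof -
  assume v: "v \<in> gm_part M d"
  have "M.E (wd u) v \<in> gm_part M d" if "u \<in> seqs \<mu>" for u
    using M.act_part[OF klr_homog.idem[OF wd_in[OF that]] v] by (simp add: gact_def)
  thus ?thesis using Esum_eq[OF M.part_in[OF v]] by (simp add: M.vs.subspace_sum[OF M.part_subspace])
qed

lemma hc_Res: "v \<in> gm_space (Res M) ==> hc M v d \<in> gm_space (Res M)"
proof -
  assume "v \<in> gm_space (Res M)"
  hence v: "v \<in> M.S" "M.act Esum v = v" by (auto simp: Res_space)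
  have "hc M (M.act Esum v) (d + 0) = M.act Esum (hc M v d)"
    by (rule M.hc_map) (use v Esum_part in \<open>auto simp: M.act_addr Esum_in\<close>)
  thus ?thesis using v by (simp add: Res_space M.hc_in)
qed

lemma Res_subspace: "gm_subspace M (gm_space (Res M))"
  unfolding Res_space
  by (rule M.vs.subspaceI) (auto simp: M.add_in M.scale_in M.act_addr M.act_scale Esum_in)

lemma Res_module: "klr_module C \<mu> (Res M)"
proof -
  let ?T = "gm_space (Res M)"
  have TS: "v \<in> ?T ==> v \<in> M.S" for v by (simp add: Res_space)
  have act: "gm_act (Res M) (klr_cls C \<mu> p) v = M.act (push p) v" if "p \<in> klr_fcar \<mu>" "v \<in> ?T" for p v
    using Res_act[OF that] by (simp add: gact_def)
  show ?thesis
  proof (rule klr_module.intro, unfold Res_sel(1,2), goal_cases)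
    case 1 show ?case by (rule M.vector_space)
  next
    case 2 show ?case by (rule Res_subspace)
  next
    case 3
    obtain B where B: "finite B" "M.S = gm_span M B" using M.finite_dim by auto
    obtain B' where B': "finite B'" "gm_span M B' = ?T"
    proof (rule M.vs.finite_basis_of_subspace[OF Res_subspace _ B(1)])
      show "?T \<subseteq> gm_span M B" using TS B(2) by auto
    qed (rule that)
    thus ?case by auto
  next
    case 4 thus ?case by (auto elim!: klr_carrierE simp: act Res_act_in)
  next
    case 5 thus ?case
      by (auto elim!: klr_carrierE simp: act M.vs.subspace_add[OF Res_subspace] M.act_addr push_in TS)
  next
    case 6 thus ?case
      by (auto elim!: klr_carrierE simp: act M.act_addl push_in push_gens_add TS free_alg_add simp flip: klr_cls_add)
  next
    case 7 thus ?case
      by (auto elim!: klr_carrierE simp: act M.act_times push_in push_gens_mult TS free_alg_mult Res_act_in simp flip: klr_cls_mult)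
  next
    case 8 thus ?case by (simp add: act free_alg_one M.act_1 TS flip: klr_cls_one)
  next
    case 9 thus ?case by (simp add: act klr_const_cls free_alg_const push_gens_const M.act_const' TS)
  next
    case 10 show ?case by (rule M.vs.subspace_inter[OF M.part_subspace Res_subspace])
  next
    case 11 show ?case by (rule Int_lower2)
  next
    case (12 v)
    hence v: "v \<in> M.S" using TS by blast
    show ?case
    proof (rule ex1_decomposition[OF M.vector_space, where f = "hc M v" and A = "{d. hc M v d \<noteq> 0}"])
      show "gm_subspace M (gm_part M d \<inter> ?T)" for d by (rule M.vs.subspace_inter[OF M.part_subspace Res_subspace])
      show "hc M v d \<in> gm_part M d \<inter> ?T" for d using M.hc_part[OF v] hc_Res[OF 12] by blast
      fix g A d assume g: "\<And>d. g d \<in> gm_part M d \<inter> ?T" "finite A" "\<And>d. d \<notin> A ==> g d = 0" "(\<Sum>d\<in>A. g d) = 0"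
      show "g d = 0" by (rule M.hc_indep[of g A]) (use g in auto)
    qed (use v M.hc_finite M.hc_sum in auto)
  next
    case (13 d r v e)
    obtain p where p: "p \<in> klr_fcar \<mu>" "r = klr_cls C \<mu> p" using klr_homog_in[OF 13(1)] by (rule klr_carrierE)
    have "gm_act (Res M) r v \<in> ?T" using 13 p by (auto simp: act Res_act_in)
    moreover have "gm_act (Res M) r v \<in> gm_part M (d + e)"
      unfolding Res_sel using M.act_part[OF strand_map_homog[OF 13(1)]] 13 by blast
    ultimately show ?case by blast
  qed
qed

lemma Res_le: "gm_space (Res M) \<subseteq> M.S"
  by (auto simp: Res_space)

lemma idem_space_Res:
  assumes u: "u \<in> seqs \<mu>"
  shows "idem_space C \<mu> (Res M) u = idem_space C \<nu> M (wd u)"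
proof -
  have E: "gact C \<mu> (Res M) (idemp u) v = M.E (wd u) v" if "v \<in> gm_space (Res M)" for v
    using Res_act[OF idemp_in[OF u] that] by (simp add: push_idemp)
  have "M.E (wd u) v \<in> gact C \<mu> (Res M) (idemp u) ` gm_space (Res M)" if v: "v \<in> M.S" for v
  proof -
    have e: "M.act Esum v \<in> gm_space (Res M)" using v by (simp add: Res_space M.act_in Esum_in Esum_act_idem)
    show ?thesis by (rule image_eqI[OF _ e]) (simp add: E[OF e] E_wd_Esum'[OF u v])
  qed
  moreover have "gact C \<mu> (Res M) (idemp u) v \<in> M.E (wd u) ` M.S" if "v \<in> gm_space (Res M)" for v
    using E[OF that] that Res_le by auto
  ultimately show ?thesis
    unfolding M.idem_space_eq klr_module.idem_space_eq[OF Res_module] by blast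
qed

lemma gdim_Res:
  assumes u: "u \<in> seqs \<mu>"
  shows "gm_gdim (Res M) (idem_space C \<mu> (Res M) u) = gm_gdim M (idem_space C \<nu> M (wd u))"
proof -
  have "idem_space C \<nu> M (wd u) \<subseteq> gm_space (Res M)"
    by (auto simp: M.idem_space_eq Res_space E_wd_Esum u M.E_in wd_in)
  hence "gm_part (Res M) d \<inter> idem_space C \<nu> M (wd u) = gm_part M d \<inter> idem_space C \<nu> M (wd u)" for d
    unfolding Res_sel by blast
  thus ?thesis unfolding gm_gdim_def idem_space_Res[OF u] Res_sel(1) by simp
qed

text \<open>
  On a module with one word, restriction removes the outer letter and keeps the vector space, or
  yields zero if the word has another letter there.
\<close>

lemma Res_concentrated:
  assumes "concentrated C \<nu> M (wd u)"
  shows "gm_space (Res M) = M.S" "concentrated C \<mu> (Res M) u"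
proof -
  have "mset u + {#i#} = \<nu>" using assms side by (auto simp: concentrated_def permutations_of_multiset_def)
  hence u: "u \<in> seqs \<mu>" by (auto simp: permutations_of_multiset_def)
  have "v \<in> gm_space (Res M)" if v: "v \<in> M.S" for v
  proof -
    have "M.E (wd u) v = v" using assms v by (simp add: concentrated_def)
    thus ?thesis using E_wd_Esum[OF u v] v by (simp add: Res_space)
  qed
  thus *: "gm_space (Res M) = M.S" using Res_le by blast
  show "concentrated C \<mu> (Res M) u"
    using assms u Res_act[OF idemp_in[OF u]] * by (simp add: concentrated_def push_idemp)
qed

lemma Res_concentrated_zero:
  assumes c: "concentrated C \<nu> M w" and w: "w \<notin> range wd"
  shows "gm_space (Res M) = {0}"
proof -
  have "M.act Esum v = 0" if "v \<in> M.S" for v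
    unfolding Esum_eq[OF that] using M.concentrated_E[OF c wd_in that] w by (intro sum.neutral) auto
  thus ?thesis by (auto simp: Res_space Esum_in)
qed

end

text \<open>Restriction is exact, because it is multiplication by an idempotent.\<close>

lemma Res_hom:
  fixes L :: "(('i, 'k::field) klr_elem, 'k, 'v::ab_group_add) gmodule"
    and M :: "(('i, 'k) klr_elem, 'k, 'w::ab_group_add) gmodule"
  assumes L: "klr_module C \<nu> L" and M: "klr_module C \<nu> M" and f: "gm_hom C \<nu> L M f"
  shows "gm_hom C \<mu> (Res L) (Res M) f"
proof -
  interpret L: klr_module C \<nu> L by fact
  interpret M: klr_module C \<nu> M by fact
  have fact: "f (gact C \<nu> L p v) = gact C \<nu> M p (f v)" if "p \<in> klr_fcar \<nu>" "v \<in> L.S" for p v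
    using f that by (simp add: gm_hom_def gact_def)
  have sp: "f v \<in> gm_space (Res M)" if "v \<in> gm_space (Res L)" for v
    using that f fact[OF Esum_in, of v] by (simp add: Res_space[OF L] Res_space[OF M] gm_hom_def)
  show ?thesis unfolding gm_hom_def
  proof (intro conjI ballI allI)
    fix v assume "v \<in> gm_space (Res L)" thus "f v \<in> gm_space (Res M)" by (rule sp)
  next
    fix v w assume "v \<in> gm_space (Res L)" "w \<in> gm_space (Res L)"
    hence "v \<in> L.S" "w \<in> L.S" using Res_le[OF L] by auto
    thus "f (v + w) = f v + f w" using f by (simp add: gm_hom_def)
  next
    fix r :: "('i, 'k) klr_elem" and v assume r: "r \<in> carrier (klr C \<mu>)" and v: "v \<in> gm_space (Res L)"
    then obtain p where p: "p \<in> klr_fcar \<mu>" "r = klr_cls C \<mu> p" using r by (auto elim: klr_carrierE)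
    have "f (gact C \<mu> (Res L) p v) = gact C \<mu> (Res M) p (f v)"
      using Res_act[OF L p(1) v] Res_act[OF M p(1) sp[OF v]] fact[OF push_in[OF p(1)]] v Res_le[OF L] by auto
    thus "f (gm_act (Res L) r v) = gm_act (Res M) r (f v)" by (simp add: p gact_def)
  next
    fix d v assume "v \<in> gm_part (Res L) d"
    hence v: "v \<in> gm_part L d" "v \<in> gm_space (Res L)" unfolding Res_sel[OF L] by auto
    have "f v \<in> gm_part M d" using f v(1) by (simp add: gm_hom_def)
    thus "f v \<in> gm_part (Res M) d" unfolding Res_sel[OF M] using sp[OF v(2)] by blast
  qed
qed

lemma Res_exact:
  assumes L: "klr_module C \<nu> L" and M: "klr_module C \<nu> M" and N: "klr_module C \<nu> N"
    and ex: "gm_exact C \<nu> L M N"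
  shows "gm_exact C \<mu> (Res L) (Res M) (Res N)"
proof -
  interpret L: klr_module C \<nu> L by fact
  interpret M: klr_module C \<nu> M by fact
  interpret N: klr_module C \<nu> N by fact
  obtain f g where fg: "gm_hom C \<nu> L M f" "gm_hom C \<nu> M N g" "inj_on f L.S" "g ` M.S = N.S"
    "f ` L.S = {v \<in> M.S. g v = 0}" using ex by (auto simp: gm_exact_def)
  have facts: "f (L.act Esum v) = M.act Esum (f v)" if "v \<in> L.S" for v
    using fg(1) that by (simp add: gm_hom_def gact_def Esum_in)
  have gacts: "g (M.act Esum v) = N.act Esum (g v)" if "v \<in> M.S" for v
    using fg(2) that by (simp add: gm_hom_def gact_def Esum_in)
  note h = Res_hom[OF L M fg(1)] Res_hom[OF M N fg(2)]
  have "inj_on f (gm_space (Res L))" using fg(3) Res_le[OF L] inj_on_subset by blast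
  moreover have "g ` gm_space (Res M) = gm_space (Res N)"
  proof
    show "g ` gm_space (Res M) \<subseteq> gm_space (Res N)" using h(2) by (auto simp: gm_hom_def)
    show "gm_space (Res N) \<subseteq> g ` gm_space (Res M)"
    proof
      fix n assume "n \<in> gm_space (Res N)"
      hence n: "n \<in> N.S" "N.act Esum n = n" by (auto simp: Res_space[OF N])
      then obtain m where m: "m \<in> M.S" "n = g m" using fg(4) by blast
      have "M.act Esum m \<in> gm_space (Res M)" using m
        by (simp add: Res_space[OF M] M.act_in Esum_in Esum_act_idem[OF M])
      moreover have "g (M.act Esum m) = n" using gacts[OF m(1)] m n by simp
      ultimately show "n \<in> g ` gm_space (Res M)" by (intro image_eqI) auto
    qed
  qed
  moreover have "f ` gm_space (Res L) = {v \<in> gm_space (Res M). g v = 0}"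
  proof
    show "f ` gm_space (Res L) \<subseteq> {v \<in> gm_space (Res M). g v = 0}"
      using h(1) fg(5) Res_le[OF L] by (auto simp: gm_hom_def)
    show "{v \<in> gm_space (Res M). g v = 0} \<subseteq> f ` gm_space (Res L)"
    proof
      fix m assume "m \<in> {v \<in> gm_space (Res M). g v = 0}"
      hence m: "m \<in> M.S" "M.act Esum m = m" "g m = 0" by (auto simp: Res_space[OF M])
      hence "m \<in> f ` L.S" using fg(5) by blast
      then obtain l where l: "l \<in> L.S" "m = f l" by blast
      have "L.act Esum l \<in> gm_space (Res L)" using l
        by (simp add: Res_space[OF L] L.act_in Esum_in Esum_act_idem[OF L])
      moreover have "f (L.act Esum l) = m" using facts[OF l(1)] l m by simp
      ultimately show "m \<in> f ` gm_space (Res L)" by (intro image_eqI) auto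
    qed
  qed
  ultimately show ?thesis using h unfolding gm_exact_def by blast
qed

end

lemma zero_space_module:
  assumes "vector_space (gm_scale M)" shows "klr_module C \<nu> (gm_zero M)"
proof -
  interpret vector_space "gm_scale M" by fact
  have sel: "gm_space (gm_zero M) = {0}" "gm_scale (gm_zero M) = gm_scale M" "gm_act (gm_zero M) r v = 0"
    "gm_part (gm_zero M) d = {0}" for r v d by (simp_all add: gm_zero_def)
  show ?thesis
  proof (rule klr_module.intro, unfold sel, goal_cases)
    case 3 show ?case by (rule exI[of _ "{}"]) simp
  next
    case (12 v)
    thus ?case by (intro ex1I[of _ "\<lambda>_. 0"]) (auto simp: fun_eq_iff)
  qed (use vector_space_axioms in auto)
qed

section \<open>The functions \<open>\<epsilon>\<close> and their duals on modules with one word\<close>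

definition e_tilde_between where
  "e_tilde_between C i pre post \<nu> M =
     gm_soc C (\<nu> - {#i#}) (gm_res C \<nu> i (gen_between pre post) (\<lambda>u. pre @ u @ post) M)"

lemma e_tilde_first: "e_tilde C \<nu> i M = e_tilde_between C i [] [i] \<nu> M"
  and e_tilde_last: "e_tilde_check C \<nu> i M = e_tilde_between C i [i] [] \<nu> M"
  by (simp_all add: e_tilde_def e_tilde_check_def e_fun_def e_check_def e_tilde_between_def
      gen_first_between gen_last_between)

context
  fixes C :: "('i, 'p) cartan_data" and i :: 'i and pre post :: "'i list"
  assumes side: "mset pre + mset post = {#i#}"
begin

lemma e_tilde_between_module:
  assumes M: "klr_module C \<nu> M"
  shows "klr_module C (\<nu> - {#i#}) (e_tilde_between C i pre post \<nu> M)"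
    "gm_space (e_tilde_between C i pre post \<nu> M) \<subseteq> gm_space M"
proof -
  interpret klr_module C \<nu> M by fact
  let ?R = "gm_res C \<nu> i (gen_between pre post) (\<lambda>u. pre @ u @ post) M"
  have R: "klr_module C (\<nu> - {#i#}) ?R \<and> gm_space ?R \<subseteq> gm_space M"
  proof (cases "i \<in># \<nu>")
    case True
    interpret strand C \<nu> i pre post by unfold_locales (use True side in auto)
    show ?thesis using Res_module[OF M] Res_le[OF M] by blast
  next
    case False
    hence "?R = gm_zero M" by (simp add: gm_res_def)
    thus ?thesis using zero_space_module[OF vector_space] by (auto simp: gm_zero_def)
  qed
  then interpret R: klr_module C "\<nu> - {#i#}" ?R by blast
  show "klr_module C (\<nu> - {#i#}) (e_tilde_between C i pre post \<nu> M)"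
    unfolding e_tilde_between_def by (rule R.soc_module)
  show "gm_space (e_tilde_between C i pre post \<nu> M) \<subseteq> gm_space M"
    unfolding e_tilde_between_def using R.soc_le R by blast
qed

lemma e_tilde_pow_zero:
  assumes "klr_module C \<nu> M" "gm_space M = {0}"
  shows "gm_space (weight_pow i (e_tilde_between C i pre post) k \<nu> M) = {0}"
  using assms
proof (induction k arbitrary: \<nu> M)
  case (Suc k)
  note m = e_tilde_between_module[OF Suc(2)]
  interpret F: klr_module C "\<nu> - {#i#}" "e_tilde_between C i pre post \<nu> M" by (rule m(1))
  have "gm_space (e_tilde_between C i pre post \<nu> M) = {0}" using m(2) Suc(3) F.zero_in by blast
  thus ?case using Suc.IH[OF m(1)] by simp
qed simp

text \<open>
  The socle of a module with one word has the same word, so each step strips one outer letter.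
\<close>

lemma e_tilde_pow_nonzero_iff:
  assumes "klr_module C \<nu> M" "gm_space M \<noteq> {0}" "concentrated C \<nu> M (((\<lambda>u. pre @ u @ post) ^^ n) w)"
    "w \<notin> range (\<lambda>u. pre @ u @ post)"
  shows "gm_space (weight_pow i (e_tilde_between C i pre post) k \<nu> M) \<noteq> {0} \<longleftrightarrow> k \<le> n"
  using assms(1-3)
proof (induction k arbitrary: \<nu> M n)
  case (Suc k)
  note M = Suc.prems(1)
  interpret M: klr_module C \<nu> M by (rule M)
  let ?F = "e_tilde_between C i pre post \<nu> M"
  note m = e_tilde_between_module[OF M]
  interpret F: klr_module C "\<nu> - {#i#}" ?F by (rule m(1))
  show ?case
  proof (cases n)
    case 0
    have "gm_space ?F = {0}"
    proof (cases "i \<in># \<nu>")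
      case True
      interpret strand C \<nu> i pre post by unfold_locales (use True side in auto)
      interpret R: klr_module C "\<nu> - {#i#}" "Res M" by (rule Res_module[OF M])
      have "gm_space (Res M) = {0}" using Res_concentrated_zero[OF M] Suc.prems(3) assms(4) 0 by simp
      thus ?thesis using R.soc_le F.zero_in unfolding e_tilde_between_def by blast
    next
      case False
      hence e: "gm_res C \<nu> i (gen_between pre post) (\<lambda>u. pre @ u @ post) M = gm_zero M" by (simp add: gm_res_def)
      interpret R: klr_module C "\<nu> - {#i#}" "gm_zero M" by (rule zero_space_module[OF M.vector_space])
      have "gm_space ?F \<subseteq> gm_space (gm_zero M)" unfolding e_tilde_between_def e by (rule R.soc_le)
      thus ?thesis using F.zero_in by (auto simp: gm_zero_def)
    qed
    thus ?thesis using e_tilde_pow_zero[OF m(1)] 0 by simp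
  next
    case (Suc n')
    let ?u = "((\<lambda>u. pre @ u @ post) ^^ n') w"
    have c: "concentrated C \<nu> M (pre @ ?u @ post)" using Suc.prems(3) Suc by simp
    hence "mset (pre @ ?u @ post) = \<nu>" by (simp add: concentrated_def permutations_of_multiset_def)
    hence "\<nu> = mset ?u + {#i#}" unfolding side[symmetric] by (simp add: ac_simps)
    hence "i \<in># \<nu>" by simp
    then interpret strand C \<nu> i pre post by unfold_locales (use side in auto)
    interpret R: klr_module C "\<nu> - {#i#}" "Res M" by (rule Res_module[OF M])
    note rc = Res_concentrated[OF M c]
    have "gm_space ?F \<noteq> {0}" unfolding e_tilde_between_def
      by (rule R.soc_nonzero) (use rc(1) Suc.prems(2) in simp)
    moreover have "concentrated C (\<nu> - {#i#}) ?F ?u"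
      unfolding e_tilde_between_def by (rule R.soc_concentrated[OF rc(2)])
    ultimately show ?thesis using Suc.IH[OF m(1)] Suc by simp
  qed
qed simp

end

lemma
  assumes "klr_module C \<nu> M" "gm_space M \<noteq> {0}" "i \<noteq> j"
    and "concentrated C \<nu> M (replicate p i @ [j] @ replicate n i)"
  shows eps_concentrated: "eps C \<nu> i M = n" and eps_check_concentrated: "eps_check C \<nu> i M = p"
proof -
  have 1: "((\<lambda>u. [] @ u @ [i]) ^^ n) w = w @ replicate n i" for w
    by (induction n) (auto simp: replicate_append_same)
  have 2: "((\<lambda>u. [i] @ u @ []) ^^ p) w = replicate p i @ w" for w
    by (induction p) auto
  have "gm_space (weight_pow i (e_tilde_between C i [] [i]) k \<nu> M) \<noteq> {0} \<longleftrightarrow> k \<le> n" for k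
  proof (rule e_tilde_pow_nonzero_iff)
    show "concentrated C \<nu> M (((\<lambda>u. [] @ u @ [i]) ^^ n) (replicate p i @ [j]))"
      unfolding 1 using assms(4) by simp
  qed (use assms in auto)
  hence "{k. gm_space (weight_pow i (\<lambda>\<mu>. e_tilde C \<mu> i) k \<nu> M) \<noteq> {0}} = {..n}"
    unfolding e_tilde_first by auto
  thus "eps C \<nu> i M = n" unfolding eps_def by (auto intro!: Max_eqI)
  have "gm_space (weight_pow i (e_tilde_between C i [i] []) k \<nu> M) \<noteq> {0} \<longleftrightarrow> k \<le> p" for k
  proof (rule e_tilde_pow_nonzero_iff)
    show "concentrated C \<nu> M (((\<lambda>u. [i] @ u @ []) ^^ p) ([j] @ replicate n i))"
      unfolding 2 using assms(4) by simp
  qed (use assms in auto)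
  hence "{k. gm_space (weight_pow i (\<lambda>\<mu>. e_tilde_check C \<mu> i) k \<nu> M) \<noteq> {0}} = {..p}"
    unfolding e_tilde_last by auto
  thus "eps_check C \<nu> i M = p" unfolding eps_check_def by (auto intro!: Max_eqI)
qed

section \<open>Complete symmetric polynomials in commuting operators\<close>

fun hsym :: "(nat \<Rightarrow> 'v \<Rightarrow> 'v) \<Rightarrow> nat \<Rightarrow> nat list \<Rightarrow> 'v \<Rightarrow> 'v::ab_group_add" where
  "hsym x 0 ls v = v"
| "hsym x (Suc k) [] v = 0"
| "hsym x (Suc k) (l # ls) v = hsym x (Suc k) ls v + x l (hsym x k (l # ls) v)"

lemma hsym_induct:
  assumes "\<And>ls. P 0 ls" "\<And>k. P (Suc k) []"
    "\<And>k l ls. P (Suc k) ls ==> P k (l # ls) ==> P (Suc k) (l # ls)"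
  shows "P k ls"
proof (induction ls arbitrary: k)
  case Nil thus ?case using assms(1,2) by (cases k) auto
next
  case (Cons l ls)
  show ?case by (induction k) (use assms(1,3) Cons in auto)
qed

locale dot_ops = vector_space sc for sc :: "'k::field \<Rightarrow> 'v::ab_group_add \<Rightarrow> 'v" +
  fixes S :: "'v set" and x :: "nat \<Rightarrow> 'v \<Rightarrow> 'v" and I :: "nat set"
  assumes S: "subspace S"
    and x_in: "l \<in> I ==> v \<in> S ==> x l v \<in> S"
    and x_add: "l \<in> I ==> v \<in> S ==> w \<in> S ==> x l (v + w) = x l v + x l w"
    and x_scale: "l \<in> I ==> v \<in> S ==> x l (sc c v) = sc c (x l v)"
    and x_x: "l \<in> I ==> m \<in> I ==> v \<in> S ==> x l (x m v) = x m (x l v)"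
begin

lemma S_add: "v \<in> S ==> w \<in> S ==> v + w \<in> S" using subspace_add[OF S] .
lemma S_0 [simp]: "0 \<in> S" using subspace_0[OF S] .
lemma x_0 [simp]: "l \<in> I ==> x l 0 = 0" using x_add[of l 0 0] by simp

lemma x_diff: "l \<in> I ==> v \<in> S ==> w \<in> S ==> x l (v - w) = x l v - x l w"
  using x_add[of l "v - w" w] subspace_diff[OF S, of v w] by simp

lemma h_in: "set ls \<subseteq> I ==> v \<in> S ==> hsym x k ls v \<in> S"
  by (induction k ls rule: hsym_induct) (auto intro: S_add x_in)

lemma h_add: "set ls \<subseteq> I ==> v \<in> S ==> w \<in> S ==> hsym x k ls (v + w) = hsym x k ls v + hsym x k ls w"
  by (induction k ls rule: hsym_induct) (auto simp: x_add h_in)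

lemma h_scale: "set ls \<subseteq> I ==> v \<in> S ==> hsym x k ls (sc c v) = sc c (hsym x k ls v)"
  by (induction k ls rule: hsym_induct) (auto simp: x_scale h_in scale_right_distrib)

lemma h_0 [simp]: "set ls \<subseteq> I ==> hsym x k ls 0 = (if k = 0 then 0 else 0)"
  using h_scale[of ls 0 k 0] by simp

lemma h_x: "set ls \<subseteq> I ==> l \<in> I ==> v \<in> S ==> hsym x k ls (x l v) = x l (hsym x k ls v)"
proof (induction k ls rule: hsym_induct)
  case (3 k a ls)
  thus ?case by (simp add: x_add h_in x_in x_x[of l a])
qed (auto)

text \<open>Expanding both sides in each of the two variables leaves the same terms.\<close>

lemma h_swap:
  assumes ab: "a \<in> I" "b \<in> I" "set ls \<subseteq> I" and v: "v \<in> S"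
  shows "hsym x k (a # b # ls) v = hsym x k (b # a # ls) v"
proof (induction k rule: less_induct)
  case (less k)
  show ?case
  proof (cases k)
    case (Suc k1)
    let ?T = "hsym x k1 (a # b # ls) v"
    have T: "hsym x k1 (b # a # ls) v = ?T" using less.IH[of k1] Suc by simp
    show ?thesis
    proof (cases k1)
      case 0 thus ?thesis using Suc by (simp add: ac_simps)
    next
      case (Suc k2)
      let ?T' = "hsym x k2 (a # b # ls) v"
      have T': "hsym x k2 (b # a # ls) v = ?T'" using less.IH[of k2] \<open>k = Suc k1\<close> Suc by simp
      have in': "?T \<in> S" "?T' \<in> S" using ab v by (auto intro!: h_in)
      have B: "hsym x k1 (b # ls) v = ?T - x a ?T'" using Suc by simp
      have A: "hsym x k1 (a # ls) v = ?T - x b ?T'" using T T' Suc by (simp add: algebra_simps)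
      have "hsym x k (a # b # ls) v = hsym x k ls v + x b (?T - x a ?T') + x a ?T"
        unfolding B[symmetric] \<open>k = Suc k1\<close> by simp
      also have "\<dots> = hsym x k ls v + x a (?T - x b ?T') + x b ?T"
        using ab in' by (simp add: x_diff x_in x_x[of a b])
      also have "\<dots> = hsym x k (b # a # ls) v"
        unfolding A[symmetric] \<open>k = Suc k1\<close> by (simp only: hsym.simps T)
      finally show ?thesis .
    qed
  qed simp
qed

lemma h_cong_Cons:
  assumes "\<And>k. hsym x k ls v = hsym x k ls' v"
  shows "hsym x k (a # ls) v = hsym x k (a # ls') v"
  by (induction k) (use assms in simp_all)

lemma h_front:
  assumes "b \<in> I" "set as \<subseteq> I" "set bs \<subseteq> I" "v \<in> S"
  shows "hsym x k (as @ b # bs) v = hsym x k (b # as @ bs) v"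
  using assms
proof (induction as arbitrary: k)
  case (Cons a as)
  have "hsym x k ((a # as) @ b # bs) v = hsym x k (a # b # as @ bs) v"
    using h_cong_Cons[of "as @ b # bs" v "b # as @ bs" k a] Cons by simp
  also have "\<dots> = hsym x k (b # (a # as) @ bs) v" using Cons h_swap[of a b "as @ bs"] by simp
  finally show ?case .
qed simp

lemma h_mset:
  assumes "mset ls = mset ls'" "set ls \<subseteq> I" "v \<in> S"
  shows "hsym x k ls v = hsym x k ls' v"
  using assms
proof (induction ls arbitrary: ls' k)
  case (Cons a ls)
  have "a \<in> set ls'" using Cons.prems(1) by (metis list.set_intros(1) set_mset_mset)
  then obtain as bs where ls': "ls' = as @ a # bs" by (meson split_list)
  have m: "mset ls = mset (as @ bs)" using Cons.prems(1) ls' by simp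
  have s: "set as \<union> set bs \<subseteq> I" using mset_eq_setD[OF m] Cons.prems(2) by auto
  have "hsym x k (a # ls) v = hsym x k (a # as @ bs) v"
    by (rule h_cong_Cons) (use Cons.IH[OF m] Cons.prems in auto)
  also have "\<dots> = hsym x k ls' v" unfolding ls' using h_front[of a as bs v k] s Cons.prems by simp
  finally show ?case .
qed simp

text \<open>Fewer variables than the vanishing complete symmetric polynomials involve cost degree:
  this is \<open>h\<^sub>k(Z) = h\<^sub>k(Z, y) - y h\<^sub>k\<^sub>-\<^sub>1(Z, y)\<close>.\<close>

lemma h_tail_zero:
  assumes "\<And>k v. k > K ==> v \<in> S ==> hsym x k (ws @ zs) v = 0" "set ws \<subseteq> I" "v \<in> S" "k > K + length ws"
  shows "hsym x k zs v = 0"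
  using assms
proof (induction ws arbitrary: K k v)
  case Nil thus ?case by simp
next
  case (Cons w ws)
  show ?case
  proof (rule Cons.IH[of "Suc K"])
    fix k v assume k: "Suc K < k" and v: "v \<in> S"
    obtain k' where k': "k = Suc k'" "k' > K" using k by (cases k) auto
    have "hsym x k (w # ws @ zs) v = 0" "hsym x k' (w # ws @ zs) v = 0"
      using Cons.prems(1)[of k v] Cons.prems(1)[of k' v] k k' v by auto
    thus "hsym x k (ws @ zs) v = 0" using k' Cons.prems(2) by simp
  qed (use Cons.prems in auto)
qed

lemma h_expand: "hsym x k (a # R) v = (\<Sum>t\<le>k. (x a ^^ t) (hsym x (k - t) R v))"
  if "a \<in> I" "set R \<subseteq> I" "v \<in> S"
proof (induction k)
  case (Suc k)
  have xs: "x a (\<Sum>t\<in>A. f t) = (\<Sum>t\<in>A. x a (f t))" if "\<And>t. t \<in> A ==> f t \<in> S" for f and A :: "nat set"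
    using that by (induction A rule: infinite_finite_induct) (auto simp: \<open>a \<in> I\<close> x_add subspace_sum[OF S])
  have pow: "(x a ^^ t) w \<in> S" if "w \<in> S" for t w
    using that \<open>a \<in> I\<close> by (induction t) (auto intro: x_in)
  have "hsym x (Suc k) (a # R) v = hsym x (Suc k) R v + (\<Sum>t\<le>k. x a ((x a ^^ t) (hsym x (k - t) R v)))"
    using that by (simp add: Suc xs pow h_in)
  also have "\<dots> = (\<Sum>t\<le>Suc k. (x a ^^ t) (hsym x (Suc k - t) R v))"
    by (subst sum.atMost_Suc_shift) simp
  finally show ?case .
qed simp

lemma h_single: "hsym x k [a] v = (x a ^^ k) v"
  by (induction k) auto

lemma h_pair: "hsym x k [a, b] v = (\<Sum>t\<le>k. (x a ^^ t) ((x b ^^ (k - t)) v))"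
  if "a \<in> I" "b \<in> I" "v \<in> S"
  using h_expand[of a "[b]" v k] that by (simp add: h_single)

text \<open>
  Crossings act on symmetric polynomials as divided differences: \<open>\<phi>\<close> is a crossing of the
  strands \<open>r\<close> and \<open>s\<close>, defined on a subspace \<open>T\<close> of vectors with equal colours there.
\<close>

context
  fixes T :: "'v set" and \<phi> :: "'v \<Rightarrow> 'v" and r s :: nat
  assumes T: "subspace T" "T \<subseteq> S" "\<And>l v. l \<in> I ==> v \<in> T ==> x l v \<in> T"
    and \<phi>_in: "\<And>v. v \<in> T ==> \<phi> v \<in> S"
    and \<phi>_add: "\<And>v w. v \<in> T ==> w \<in> T ==> \<phi> (v + w) = \<phi> v + \<phi> w"
    and rs: "r \<in> I" "s \<in> I" "r \<noteq> s"
    and \<phi>_r: "\<And>v. v \<in> T ==> \<phi> (x r v) = x s (\<phi> v) + v"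
    and \<phi>_s: "\<And>v. v \<in> T ==> \<phi> (x s v) = x r (\<phi> v) - v"
    and \<phi>_l: "\<And>l v. l \<in> I ==> l \<noteq> r ==> l \<noteq> s ==> v \<in> T ==> \<phi> (x l v) = x l (\<phi> v)"
begin

lemma T_h: "set ls \<subseteq> I ==> v \<in> T ==> hsym x k ls v \<in> T"
  by (induction k ls rule: hsym_induct) (auto intro: subspace_add[OF T(1)] subspace_0[OF T(1)] T(3))

lemma \<phi>_0: "\<phi> 0 = 0" using \<phi>_add[of 0 0] subspace_0[OF T(1)] by simp

lemma \<phi>_h: "set R \<subseteq> I - {r, s} ==> v \<in> T ==> \<phi> (hsym x k R v) = hsym x k R (\<phi> v)"
proof (induction k R rule: hsym_induct)
  case (3 k l ls)
  have "set (l # ls) \<subseteq> I" "set ls \<subseteq> I" using 3(3) by auto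
  thus ?case using 3 by (simp add: \<phi>_add T_h T(3) \<phi>_l)
qed (auto simp: \<phi>_0)

lemma \<phi>_h_r:
  assumes R: "set R \<subseteq> I - {r, s}" and v: "v \<in> T"
  shows "\<phi> (hsym x (Suc k) (r # R) v) = hsym x (Suc k) (s # R) (\<phi> v) + hsym x k (r # s # R) v"
proof (induction k)
  case 0
  have "set R \<subseteq> I" using R by auto
  thus ?case using R v rs by (simp add: \<phi>_add T_h T(3) \<phi>_r \<phi>_h)
next
  case (Suc k)
  have RI: "set R \<subseteq> I" "set (r # R) \<subseteq> I" "set (s # R) \<subseteq> I" "set (r # s # R) \<subseteq> I" using R rs by auto
  let ?u = "hsym x (Suc k) (r # R) v"
  have u: "?u \<in> T" using T_h[OF RI(2) v] .
  have vS: "v \<in> S" "\<phi> v \<in> S" using T(2) v \<phi>_in by auto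
  have "\<phi> (hsym x (Suc (Suc k)) (r # R) v) = \<phi> (hsym x (Suc (Suc k)) R v + x r ?u)" by simp
  also have "\<dots> = hsym x (Suc (Suc k)) R (\<phi> v) + (x s (\<phi> ?u) + ?u)"
    using u v rs RI by (subst \<phi>_add) (auto simp: T_h T(3) \<phi>_h[OF R] \<phi>_r simp del: hsym.simps)
  also have "x s (\<phi> ?u) = x s (hsym x (Suc k) (s # R) (\<phi> v)) + x s (hsym x k (s # r # R) v)"
    unfolding Suc using RI vS rs h_swap[of r s R v k] by (simp add: x_add h_in del: hsym.simps)
  also have "hsym x (Suc (Suc k)) R (\<phi> v) + (x s (hsym x (Suc k) (s # R) (\<phi> v)) + x s (hsym x k (s # r # R) v) + ?u) =
      hsym x (Suc (Suc k)) (s # R) (\<phi> v) + hsym x (Suc k) (s # r # R) v"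
    by (simp add: algebra_simps)
  finally show ?case using h_swap[of r s R v "Suc k"] rs RI vS by simp
qed

lemma \<phi>_h_s:
  assumes R: "set R \<subseteq> I - {r, s}" and v: "v \<in> T"
  shows "\<phi> (hsym x (Suc k) (s # R) v) = hsym x (Suc k) (r # R) (\<phi> v) - hsym x k (r # s # R) v"
proof (induction k)
  case 0
  have "set R \<subseteq> I" using R by auto
  thus ?case using R v rs by (simp add: \<phi>_add T_h T(3) \<phi>_s \<phi>_h)
next
  case (Suc k)
  have RI: "set R \<subseteq> I" "set (r # R) \<subseteq> I" "set (s # R) \<subseteq> I" "set (r # s # R) \<subseteq> I" using R rs by auto
  let ?u = "hsym x (Suc k) (s # R) v"
  have u: "?u \<in> T" using T_h[OF RI(3) v] .
  have vS: "v \<in> S" "\<phi> v \<in> S" using T(2) v \<phi>_in by auto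
  have "\<phi> (hsym x (Suc (Suc k)) (s # R) v) = \<phi> (hsym x (Suc (Suc k)) R v + x s ?u)" by simp
  also have "\<dots> = hsym x (Suc (Suc k)) R (\<phi> v) + (x r (\<phi> ?u) - ?u)"
    using u v rs RI by (subst \<phi>_add) (auto simp: T_h T(3) \<phi>_h[OF R] \<phi>_s simp del: hsym.simps)
  also have "x r (\<phi> ?u) = x r (hsym x (Suc k) (r # R) (\<phi> v)) - x r (hsym x k (r # s # R) v)"
    unfolding Suc using RI vS rs by (simp add: x_diff h_in del: hsym.simps)
  finally show ?case by (simp add: algebra_simps)
qed

lemma \<phi>_h_rs:
  assumes R: "set R \<subseteq> I - {r, s}" and v: "v \<in> T"
  shows "\<phi> (hsym x k (r # s # R) v) = hsym x k (r # s # R) (\<phi> v)"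
proof (induction k)
  case (Suc k)
  have RI: "set R \<subseteq> I" "set (s # R) \<subseteq> I" "set (r # s # R) \<subseteq> I" using R rs by auto
  let ?u = "hsym x k (r # s # R) v"
  have u: "?u \<in> T" using T_h[OF RI(3) v] .
  have vS: "\<phi> v \<in> S" using v \<phi>_in by auto
  have "\<phi> (hsym x (Suc k) (r # s # R) v) = \<phi> (hsym x (Suc k) (s # R) v + x r ?u)" by simp
  also have "\<dots> = hsym x (Suc k) (r # R) (\<phi> v) - ?u + (x s (\<phi> ?u) + ?u)"
    using u v rs RI by (subst \<phi>_add) (auto simp: T_h T(3) \<phi>_h_s[OF R] \<phi>_r simp del: hsym.simps)
  also have "\<dots> = hsym x (Suc k) (s # r # R) (\<phi> v)"
    unfolding Suc using h_swap[of r s R "\<phi> v" k] rs RI vS by simp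
  also have "\<dots> = hsym x (Suc k) (r # s # R) (\<phi> v)" using h_swap[of r s R "\<phi> v" "Suc k"] rs RI vS by simp
  finally show ?case .
qed simp

text \<open>By symmetry \<open>r\<close> and \<open>s\<close> can be moved to the front, where the two correction terms cancel.\<close>

lemma \<phi>_h_sym:
  assumes "set ls \<subseteq> I" "distinct ls" "r \<in> set ls" "s \<in> set ls" "v \<in> T"
  shows "\<phi> (hsym x k ls v) = hsym x k ls (\<phi> v)"
proof -
  let ?R = "filter (\<lambda>l. l \<noteq> r \<and> l \<noteq> s) ls"
  have "mset ls = mset (r # s # ?R)"
    by (rule multiset_eqI) (use assms rs in \<open>auto simp: distinct_count_atmost_1 count_mset_0_iff count_mset\<close>)
  hence m: "hsym x k ls w = hsym x k (r # s # ?R) w" if "w \<in> S" for w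
    using h_mset that assms(1) by blast
  have R: "set ?R \<subseteq> I - {r, s}" using assms by auto
  have "v \<in> S" "\<phi> v \<in> S" using assms(5) T(2) \<phi>_in by auto
  thus ?thesis using m[of v] m[of "\<phi> v"] \<phi>_h_rs[OF R assms(5), of k] by simp
qed

end

end

section \<open>The nilHecke algebra\<close>

locale nil_hecke = dot_ops sc S x "{..p}" for sc :: "'k::field \<Rightarrow> 'v::ab_group_add \<Rightarrow> 'v" and S x p +
  fixes \<phi> :: "nat \<Rightarrow> 'v \<Rightarrow> 'v"
  assumes phi_in: "t < p ==> v \<in> S ==> \<phi> t v \<in> S"
    and phi_add: "t < p ==> v \<in> S ==> w \<in> S ==> \<phi> t (v + w) = \<phi> t v + \<phi> t w"
    and phi_scale: "t < p ==> v \<in> S ==> \<phi> t (sc c v) = sc c (\<phi> t v)"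
    and phi_sq: "t < p ==> v \<in> S ==> \<phi> t (\<phi> t v) = 0"
    and phi_far: "t < p ==> u < p ==> Suc t < u ==> v \<in> S ==> \<phi> t (\<phi> u v) = \<phi> u (\<phi> t v)"
    and phi_braid: "Suc t < p ==> v \<in> S ==> \<phi> t (\<phi> (Suc t) (\<phi> t v)) = \<phi> (Suc t) (\<phi> t (\<phi> (Suc t) v))"
    and phi_x: "t < p ==> u \<le> p ==> v \<in> S ==>
      \<phi> t (x u v) = x (transpose t (Suc t) u) (\<phi> t v) + (if u = t then v else if u = Suc t then - v else 0)"

primrec desc :: "(nat \<Rightarrow> 'v \<Rightarrow> 'v) \<Rightarrow> nat \<Rightarrow> nat \<Rightarrow> 'v \<Rightarrow> 'v" where
  "desc \<phi> k 0 u = u"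
| "desc \<phi> k (Suc m) u = \<phi> k (desc \<phi> (Suc k) m u)"

context nil_hecke
begin

lemma phi_0: "t < p ==> \<phi> t 0 = 0" using phi_add[of t 0 0] by simp

lemma desc_in: "k + m \<le> p ==> v \<in> S ==> desc \<phi> k m v \<in> S"
  by (induction m arbitrary: k) (auto intro: phi_in)

lemma desc_far: "Suc t < k ==> k + m \<le> p ==> v \<in> S ==> \<phi> t (desc \<phi> k m v) = desc \<phi> k m (\<phi> t v)"
proof (induction m arbitrary: k)
  case (Suc m)
  have "\<phi> t (\<phi> k (desc \<phi> (Suc k) m v)) = \<phi> k (\<phi> t (desc \<phi> (Suc k) m v))"
    using Suc by (intro phi_far desc_in) auto
  thus ?case using Suc by simp
qed simp

lemma desc_shift: "k < t ==> t < k + m ==> k + m \<le> p ==> v \<in> S ==>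
    \<phi> t (desc \<phi> k m v) = desc \<phi> k m (\<phi> (t - 1) v)"
proof (induction m arbitrary: k)
  case (Suc m)
  show ?case
  proof (cases "t = Suc k")
    case True
    then obtain m' where m': "m = Suc m'" using Suc by (cases m) auto
    have "\<phi> t (desc \<phi> k (Suc m) v) = \<phi> (Suc k) (\<phi> k (\<phi> (Suc k) (desc \<phi> (Suc (Suc k)) m' v)))"
      using True m' by simp
    also have "\<dots> = \<phi> k (\<phi> (Suc k) (\<phi> k (desc \<phi> (Suc (Suc k)) m' v)))"
      using Suc m' by (intro phi_braid[symmetric] desc_in) auto
    also have "\<dots> = \<phi> k (\<phi> (Suc k) (desc \<phi> (Suc (Suc k)) m' (\<phi> k v)))"
      using Suc m' by (subst desc_far) auto
    finally show ?thesis using True m' by simp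
  next
    case False
    have "\<phi> k (\<phi> t (desc \<phi> (Suc k) m v)) = \<phi> t (\<phi> k (desc \<phi> (Suc k) m v))"
      using Suc False by (intro phi_far desc_in) auto
    thus ?thesis using Suc False by simp
  qed
qed simp

text \<open>
  A basis of a nilHecke algebra over the one on one strand less: the coset representatives
  \<open>\<phi>\<^sub>k \<dots> \<phi>\<^sub>p\<^sub>-\<^sub>1\<close> with the last strand moved to position \<open>k\<close>.
\<close>

definition coset_span :: "'v set \<Rightarrow> 'v set" where
  "coset_span U = span {desc \<phi> k (p - k) u | k u. k \<le> p \<and> u \<in> U}"

context
  fixes U :: "'v set"
  assumes U: "U \<subseteq> S" "\<And>t u. t \<le> p ==> u \<in> U ==> x t u \<in> span U"
    "\<And>t u. Suc t < p ==> u \<in> U ==> \<phi> t u \<in> span U"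
begin

lemma desc_lin: "k + m \<le> p ==> v \<in> S ==> w \<in> S ==> desc \<phi> k m (v + w) = desc \<phi> k m v + desc \<phi> k m w"
    "k + m \<le> p ==> v \<in> S ==> desc \<phi> k m (sc c v) = sc c (desc \<phi> k m v)"
  by (induction m arbitrary: k) (auto simp: phi_add phi_scale desc_in)

lemma coset_span_le: "coset_span U \<subseteq> S"
  unfolding coset_span_def by (rule span_minimal[OF _ S]) (use U(1) in \<open>auto intro!: desc_in\<close>)

lemma desc_span: "k \<le> p ==> u \<in> span U ==> desc \<phi> k (p - k) u \<in> coset_span U"
proof -
  assume k: "k \<le> p" and "u \<in> span U"
  from this(2) have "u \<in> S \<and> desc \<phi> k (p - k) u \<in> coset_span U"
  proof (rule span_inductS)
    show "0 \<in> S \<and> desc \<phi> k (p - k) 0 \<in> coset_span U"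
      using desc_lin(2)[of k "p - k" 0 0] k by (simp add: coset_span_def span_zero)
  next
    fix a assume a: "a \<in> U"
    thus "a \<in> S \<and> desc \<phi> k (p - k) a \<in> coset_span U"
      unfolding coset_span_def using k U(1) by (auto intro!: span_base)
  qed (use k in \<open>auto simp: desc_lin coset_span_def span_add span_scale S_add subspace_scale[OF S]\<close>)
  thus ?thesis by blast
qed

text \<open>
  A crossing changes the position \<open>k\<close> of the last strand by one, or meets an equal crossing and gives
  zero, or passes through the coset representative and acts on \<open>U\<close>.
\<close>

lemma coset_span_phi:
  assumes t: "t < p" and v: "v \<in> coset_span U" shows "\<phi> t v \<in> coset_span U"
proof -
  have gen: "\<phi> t (desc \<phi> k (p - k) u) \<in> coset_span U" if k: "k \<le> p" and u: "u \<in> U" for k u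
  proof -
    have uS: "u \<in> S" using U(1) u by auto
    consider "Suc t < k" | "k = Suc t" | "k = t" | "k < t" by linarith
    thus ?thesis
    proof cases
      case 1 thus ?thesis using desc_far[of t k "p - k" u] k uS U(3)[of t u] u by (auto intro!: desc_span)
    next
      case 2
      hence "\<phi> t (desc \<phi> k (p - k) u) = desc \<phi> t (p - t) u" using t by (simp add: Suc_diff_Suc flip: desc.simps(2))
      thus ?thesis using t u by (auto intro!: desc_span span_base)
    next
      case 3
      hence "desc \<phi> k (p - k) u = \<phi> t (desc \<phi> (Suc t) (p - Suc t) u)"
        using t by (simp add: Suc_diff_Suc flip: desc.simps(2))
      hence "\<phi> t (desc \<phi> k (p - k) u) = 0" using phi_sq t desc_in uS by simp
      thus ?thesis by (simp add: coset_span_def span_zero)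
    next
      case 4 thus ?thesis using desc_shift[of k t "p - k" u] k uS t U(3)[of "t - 1" u] u by (auto intro!: desc_span)
    qed
  qed
  have "v \<in> span {desc \<phi> k (p - k) u | k u. k \<le> p \<and> u \<in> U}" using v by (simp add: coset_span_def)
  hence "v \<in> S \<and> \<phi> t v \<in> coset_span U"
  proof (rule span_inductS)
    fix a assume "a \<in> {desc \<phi> k (p - k) u | k u. k \<le> p \<and> u \<in> U}"
    thus "a \<in> S \<and> \<phi> t a \<in> coset_span U" using gen U(1) by (auto intro!: desc_in)
  qed (use t in \<open>auto simp: phi_0 phi_add phi_scale coset_span_def span_zero span_add span_scale S_add subspace_scale[OF S]\<close>)
  thus ?thesis by blast
qed

text \<open>
  A dot passes through the coset representative one crossing at a time; each correction term is a
  shorter representative.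
\<close>

lemma coset_span_x:
  assumes t: "t \<le> p" and v: "v \<in> coset_span U" shows "x t v \<in> coset_span U"
proof -
  have gen: "x t (desc \<phi> k m u) \<in> coset_span U \<and> desc \<phi> k m u \<in> coset_span U"
    if "k + m = p" and u: "u \<in> U" and "t \<le> p" for k m u t
    using that(1,3)
  proof (induction m arbitrary: k t)
    case 0
    thus ?case using desc_span[of p u] desc_span[of p "x t u"] U(2)[of t u] u by (auto intro: span_base)
  next
    case (Suc m)
    let ?w = "desc \<phi> (Suc k) m u"
    have kp: "k < p" "Suc k + m = p" using Suc by auto
    have uS: "u \<in> S" using U(1) u by auto
    have w: "?w \<in> coset_span U" "?w \<in> S" using Suc.IH[OF kp(2) Suc.prems(2)] coset_span_le by auto
    have xw: "x l ?w \<in> coset_span U" if "l \<le> p" for l using Suc.IH[OF kp(2) that] by blast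
    have pw: "\<phi> k ?w \<in> coset_span U" using coset_span_phi[OF kp(1) w(1)] .
    let ?t = "transpose k (Suc k) t"
    have tt: "?t \<le> p" "transpose k (Suc k) ?t = t" using Suc.prems kp by (auto simp: transpose_def)
    have "x t (\<phi> k ?w) = \<phi> k (x ?t ?w) - (if ?t = k then ?w else if ?t = Suc k then - ?w else 0)"
      using phi_x[OF kp(1) tt(1) w(2)] tt(2) by simp
    also have "\<dots> \<in> coset_span U"
    proof -
      have "\<phi> k (x ?t ?w) \<in> coset_span U" using coset_span_phi[OF kp(1) xw[OF tt(1)]] .
      thus ?thesis using w(1) by (auto simp: coset_span_def intro!: span_diff span_add span_neg)
    qed
    finally show ?case using pw by simp
  qed
  have "v \<in> span {desc \<phi> k (p - k) u | k u. k \<le> p \<and> u \<in> U}" using v by (simp add: coset_span_def)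
  hence "v \<in> S \<and> x t v \<in> coset_span U"
  proof (rule span_inductS)
    fix a assume "a \<in> {desc \<phi> k (p - k) u | k u. k \<le> p \<and> u \<in> U}"
    then obtain k u where a: "a = desc \<phi> k (p - k) u" "k \<le> p" "u \<in> U" by auto
    have "u \<in> S" using U(1) a by auto
    thus "a \<in> S \<and> x t a \<in> coset_span U" unfolding a(1) using gen[of k "p - k" u t] a t desc_in[of k "p - k" u] by simp
  qed (use t in \<open>auto simp: x_add x_scale coset_span_def span_zero span_add span_scale S_add subspace_scale[OF S]\<close>)
  thus ?thesis by blast
qed

end

end

section \<open>Irreducible modules over \<open>R(ci + j)\<close> have one word\<close>

locale cij = cartan_datum C for C :: "('i, 'p::ab_group_add) cartan_data" +
  fixes i j :: 'i and c :: nat and \<nu> :: "'i multiset"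
  assumes ij: "i \<noteq> j" and ca: "int c \<le> cartan_a C i j" and nu: "\<nu> = replicate_mset c i + {#j#}"
begin

definition word :: "nat \<Rightarrow> 'i list" where
  "word p = replicate p i @ [j] @ replicate (c - p) i"

lemma size_nu [simp]: "size \<nu> = Suc c" by (simp add: nu)

lemma word_in: "p \<le> c ==> word p \<in> seqs \<nu>"
proof -
  assume p: "p \<le> c"
  have "replicate p i @ replicate (c - p) i = replicate c i" using p by (simp flip: replicate_add)
  from arg_cong[OF this, of mset] show ?thesis
    by (simp add: nu permutations_of_multiset_def word_def)
qed

lemma word_nth: "p \<le> c ==> r \<le> c ==> word p ! r = (if r = p then j else i)"
  by (auto simp: word_def nth_append nth_Cons split: nat.split)

lemma length_word: "p \<le> c ==> length (word p) = Suc c"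
  by (simp add: word_def)

lemma word_eq_iff: "p \<le> c ==> q \<le> c ==> word p = word q \<longleftrightarrow> p = q"
  using word_nth[of p p] word_nth[of q p] ij by metis

lemma seqs_nu: "seqs \<nu> = word ` {..c}"
proof
  show "word ` {..c} \<subseteq> seqs \<nu>" using word_in by auto
  show "seqs \<nu> \<subseteq> word ` {..c}"
  proof
    fix u assume "u \<in> seqs \<nu>"
    hence m: "mset u = replicate_mset c i + {#j#}" by (simp add: nu permutations_of_multiset_def)
    hence "j \<in># mset u" by simp
    hence "j \<in> set u" by simp
    then obtain as bs where u: "u = as @ j # bs" by (meson split_list)
    have ab: "mset (as @ bs) = replicate_mset c i" using m u by simp
    have "set as \<union> set bs \<subseteq> {i}" using arg_cong[OF ab, of set_mset] by (auto split: if_splits)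
    hence "as = replicate (length as) i" "bs = replicate (length bs) i"
      by (auto simp: replicate_length_same subset_iff intro: replicate_eqI)
    moreover have "length as + length bs = c" using arg_cong[OF ab, of size] by simp
    ultimately have "u = word (length as)" "length as \<le> c" unfolding word_def u by auto
    thus "u \<in> word ` {..c}" by blast
  qed
qed

lemma swap_word: "p \<le> c ==> r < c ==> swap_seq r (word p) = word (transpose r (Suc r) p)"
proof (rule nth_equalityI)
  assume p: "p \<le> c" and r: "r < c"
  have t: "transpose r (Suc r) p \<le> c" using p r by (auto simp: transpose_def)
  show "length (swap_seq r (word p)) = length (word (transpose r (Suc r) p))"
    using length_word p t by simp
  fix l assume "l < length (swap_seq r (word p))"
  hence l: "l \<le> c" using length_word p by simp
  have "swap_seq r (word p) ! l = word p ! transpose r (Suc r) l"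
    using p r l length_word[OF p] by (auto simp: swap_seq_def nth_list_update transpose_def)
  thus "swap_seq r (word p) ! l = word (transpose r (Suc r) p) ! l"
    using p r l t by (subst (asm) word_nth) (auto simp: word_nth transpose_def split: if_splits)
qed

lemma cartan_ii: "cartan_a C i i = - 2"
proof -
  have "rform C i i * cd_coroot C i (cd_root C i) = rform C i i * 2" using coroot_eq[of i "cd_root C i"] by simp
  hence "cd_coroot C i (cd_root C i) = 2" using root_pos[of i] by simp
  thus ?thesis by (simp add: cartan_a_def)
qed

lemma cartan_pos:
  assumes "0 < c"
  shows "rform C i j \<noteq> 0" "rform C j i \<noteq> 0" "0 < cartan_a C i j" "0 < cartan_a C j i"
proof -
  show a: "0 < cartan_a C i j" using ca assms by simp
  show n: "rform C i j \<noteq> 0"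
  proof
    assume "rform C i j = 0"
    hence "rform C i i * cd_coroot C i (cd_root C j) = 0" using coroot_eq[of i "cd_root C j"] by simp
    hence "cd_coroot C i (cd_root C j) = 0" using root_pos[of i] by simp
    thus False using a by (simp add: cartan_a_def)
  qed
  thus n': "rform C j i \<noteq> 0" by (metis form_sym)
  hence "rform C j i < 0" using root_nonpos[of j i] ij by simp
  hence "rform C j j * cd_coroot C j (cd_root C i) < 0" using coroot_eq[of j "cd_root C i"] by simp
  hence "cd_coroot C j (cd_root C i) < 0" using root_pos[of j] by (simp add: mult_less_0_iff)
  thus "0 < cartan_a C j i" by (simp add: cartan_a_def)
qed

end

locale cij_module = cij C i j c \<nu> + klr_module C \<nu> M
  for C :: "('i, 'p::ab_group_add) cartan_data" and i j c \<nu>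
    and M :: "(('i, 'k::field) klr_elem, 'k, 'v::ab_group_add) gmodule"
begin

abbreviation "Ew p \<equiv> E (word p)"

definition Sp :: "nat \<Rightarrow> 'v set" where "Sp p = {v \<in> S. Ew p v = v}"

lemma SpD: "v \<in> Sp p ==> v \<in> S" "v \<in> Sp p ==> Ew p v = v" by (auto simp: Sp_def)

lemma X_add: "r \<le> c ==> v \<in> Sp p ==> w \<in> Sp p ==> X r (v + w) = X r v + X r w"
  and X_scale: "r \<le> c ==> v \<in> Sp p ==> X r (gm_scale M a v) = gm_scale M a (X r v)"
  and P_add: "r < c ==> v \<in> Sp p ==> w \<in> Sp p ==> P r (v + w) = P r v + P r w"
  and P_scale: "r < c ==> v \<in> Sp p ==> P r (gm_scale M a v) = gm_scale M a (P r v)"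
  and X_X_Sp: "r \<le> c ==> t \<le> c ==> v \<in> Sp p ==> X r (X t v) = X t (X r v)"
  by (simp_all add: SpD(1) act_addr act_scale dot_in crs_in X_X)

lemma Ew_Ew: "p \<le> c ==> q \<le> c ==> v \<in> S ==> Ew p (Ew q v) = (if p = q then Ew p v else 0)"
  using E_E[OF word_in word_in] word_eq_iff by simp

lemma Ew_in: "p \<le> c ==> v \<in> S ==> Ew p v \<in> Sp p"
  by (simp add: Sp_def E_in word_in Ew_Ew)

lemma Ew_Sp: "p \<le> c ==> q \<le> c ==> v \<in> Sp q ==> Ew p v = (if p = q then v else 0)"
  using Ew_Ew[of p q v] SpD[of v q] by auto

lemma Ew_sum: "v \<in> S ==> (\<Sum>p\<le>c. Ew p v) = v"
  using E_sum[of v] unfolding seqs_nu by (subst (asm) sum.reindex) (auto simp: inj_on_def word_eq_iff)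

lemma Sp_sub: "p \<le> c ==> gm_subspace M (Sp p)"
  unfolding Sp_def
  by (rule vs.subspaceI) (auto simp: add_in scale_in act_addr act_scale idemp_in word_in)

lemma X_Sp: "p \<le> c ==> r \<le> c ==> v \<in> Sp p ==> X r v \<in> Sp p"
  using X_E[OF word_in, of p r v] by (simp add: Sp_def X_in)

lemma P_Ew: "p \<le> c ==> r < c ==> v \<in> S ==> P r (Ew p v) = Ew (transpose r (Suc r) p) (P r v)"
  using P_E[OF word_in, of p r v] by (simp add: swap_word)

lemma transpose_le: "p \<le> c ==> r < c ==> transpose r (Suc r) p \<le> c"
  by (auto simp: transpose_def)

lemma P_Sp: "p \<le> c ==> r < c ==> v \<in> Sp p ==> P r v \<in> Sp (transpose r (Suc r) p)"
  using P_Ew[of p r v] by (simp add: Sp_def P_in)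

lemma Ew_X: "p \<le> c ==> r \<le> c ==> v \<in> S ==> Ew p (X r v) = X r (Ew p v)"
  using X_E[OF word_in, of p r v] by simp

lemma Ew_P: "p \<le> c ==> r < c ==> v \<in> S ==> Ew p (P r v) = P r (Ew (transpose r (Suc r) p) v)"
  using P_Ew[of "transpose r (Suc r) p" r v] transpose_le by simp

lemma P_X_ii:
  assumes "p \<le> c" "r < c" "r \<noteq> p" "Suc r \<noteq> p" "t \<le> c" "v \<in> Sp p"
  shows "P r (X t v) = X (transpose r (Suc r) t) (P r v) + (if t = r then v else if t = Suc r then - v else 0)"
  using P_X[OF word_in[OF assms(1)], of r t v] assms SpD[of v p] by (simp add: word_nth)

lemma P_X_ij:
  assumes "p \<le> c" "r < c" "r = p \<or> Suc r = p" "t \<le> c" "v \<in> Sp p"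
  shows "P r (X t v) = X (transpose r (Suc r) t) (P r v)"
  using P_X[OF word_in[OF assms(1)], of r t v] assms ij SpD[of v p] by (auto simp: word_nth)

lemma P_sq_ii: "p \<le> c ==> r < c ==> r \<noteq> p ==> Suc r \<noteq> p ==> v \<in> Sp p ==> P r (P r v) = 0"
  using P_sq[OF word_in, of p r v] SpD[of v p] by (simp add: word_nth)

lemma X_part: "p \<le> c ==> r \<le> c ==> v \<in> Sp p ==> v \<in> gm_part M d ==>
    X r v \<in> gm_part M (d + rform C (word p ! r) (word p ! r))"
  using act_part[OF klr_homog.dot[OF word_in, of p r C], of v d] SpD[of v p]
    act_times[OF dot_in idemp_in[OF word_in], of r p v]
  by (simp add: gact_def add.commute)

lemma P_part: "p \<le> c ==> r < c ==> v \<in> Sp p ==> v \<in> gm_part M d ==>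
    P r v \<in> gm_part M (d - rform C (word p ! r) (word p ! Suc r))"
  using act_part[OF klr_homog.crs[OF word_in, of p r C], of v d] SpD[of v p]
    act_times[OF crs_in idemp_in[OF word_in], of r p v]
  by (simp add: gact_def)

lemma Ew_part: "p \<le> c ==> v \<in> gm_part M d ==> Ew p v \<in> gm_part M d"
  using act_part[OF klr_homog.idem[OF word_in, of p C], of v d] by (simp add: gact_def)

lemma hc_Ew: "p \<le> c ==> v \<in> S ==> hc M (Ew p v) d = Ew p (hc M v d)"
  by (rule hc_E[OF word_in])

lemma hc_Sp: "p \<le> c ==> v \<in> Sp p ==> hc M v d \<in> Sp p"
  using hc_Ew[of p v d] by (simp add: Sp_def hc_in)

lemma gens_cases:
  assumes "g \<in> klr_gens \<nu>"
  obtains p where "g = Idemp (word p)" "p \<le> c" | r where "g = Dot r" "r \<le> c" | r where "g = Cross r" "r < c"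
  using assms unfolding klr_gens_def seqs_nu by auto

lemma submoduleI_cij:
  assumes "gm_subspace M N" "N \<subseteq> S" "\<And>p v. p \<le> c ==> v \<in> N ==> Ew p v \<in> N"
    "\<And>r v. r \<le> c ==> v \<in> N ==> X r v \<in> N" "\<And>r v. r < c ==> v \<in> N ==> P r v \<in> N"
    "\<And>v d. v \<in> N ==> hc M v d \<in> N"
  shows "gm_submodule C \<nu> M N"
proof (rule submoduleI[OF assms(1,2) _ assms(6)])
  fix r :: "('i, 'k) klr_elem" and v assume "r \<in> carrier (klr C \<nu>)" "v \<in> N"
  thus "gm_act M r v \<in> N"
    by (rule closed_of_gens[OF assms(1,2), rotated]) (auto elim!: gens_cases simp: assms(3-5) simp flip: idemp_gen dot_gen crs_gen)
qed

text \<open>A central element is given by its action on each word.\<close>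

lemma central_zero:
  assumes irr: "gm_irreducible C \<nu> M"
    and T: "\<And>p v. p \<le> c ==> v \<in> Sp p ==> T p v \<in> Sp p"
      "\<And>p v w. p \<le> c ==> v \<in> Sp p ==> w \<in> Sp p ==> T p (v + w) = T p v + T p w"
      "\<And>p a v. p \<le> c ==> v \<in> Sp p ==> T p (gm_scale M a v) = gm_scale M a (T p v)"
      "\<And>p r v. p \<le> c ==> r \<le> c ==> v \<in> Sp p ==> T p (X r v) = X r (T p v)"
      "\<And>p r v. p \<le> c ==> r < c ==> v \<in> Sp p ==> P r (T p v) = T (transpose r (Suc r) p) (P r v)"
      "\<And>p d v. p \<le> c ==> v \<in> Sp p ==> v \<in> gm_part M d ==> T p v \<in> gm_part M (d + \<delta>)"
    and \<delta>: "\<delta> > 0" and p: "p \<le> c" and v: "v \<in> Sp p"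
  shows "T p v = 0"
proof -
  define TT where "TT v = (\<Sum>q\<le>c. T q (Ew q v))" for v
  have T0: "T q 0 = 0" if "q \<le> c" for q using T(2)[OF that, of 0 0] Sp_sub[OF that] vs.subspace_0 by fastforce
  have TE: "T q (Ew q v) \<in> Sp q" "Ew q v \<in> Sp q" if "q \<le> c" "v \<in> S" for q v using T(1) Ew_in that by auto
  have TT_Sp: "TT v = T q v" if "q \<le> c" "v \<in> Sp q" for q v
  proof -
    have "TT v = (\<Sum>r\<le>c. if r = q then T q v else 0)"
      unfolding TT_def using that by (intro sum.cong) (auto simp: Ew_Sp T0)
    thus ?thesis using that by simp
  qed
  have "TT v = 0"
  proof (rule central_positive_degree_zero[OF irr, where T = TT and \<delta> = \<delta>])
    show "TT v \<in> S" if "v \<in> S" for v unfolding TT_def using TE[OF _ that] SpD by (intro sum_in) auto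
    show "TT (v + w) = TT v + TT w" if "v \<in> S" "w \<in> S" for v w
      unfolding TT_def using that by (simp add: act_addr idemp_in word_in T(2) Ew_in flip: sum.distrib)
    show "TT (gm_scale M a v) = gm_scale M a (TT v)" if "v \<in> S" for a v
      unfolding TT_def using that by (simp add: act_scale idemp_in word_in T(3) Ew_in vs.scale_sum_right)
    show "TT v \<in> gm_part M (d + \<delta>)" if "v \<in> gm_part M d" for d v
      unfolding TT_def using that part_in by (intro vs.subspace_sum[OF part_subspace] T(6)) (auto intro: Ew_in Ew_part)
    fix g v assume g: "g \<in> klr_gens \<nu>" and v: "v \<in> S"
    show "TT (act (gen g) v) = act (gen g) (TT v)" using g
    proof (cases rule: gens_cases)
      case (1 p)
      have "act (gen g) (TT v) = (\<Sum>q\<le>c. Ew p (T q (Ew q v)))"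
        unfolding TT_def 1 idemp_gen[symmetric] using TE(1)[OF _ v] SpD 1(2) by (intro act_sumr idemp_in word_in) auto
      also have "\<dots> = (\<Sum>q\<le>c. if q = p then T p (Ew p v) else 0)"
        using TE(1)[OF _ v] 1 by (intro sum.cong) (auto simp: Ew_Sp)
      also have "\<dots> = TT (Ew p v)" using TT_Sp[OF 1(2) TE(2)[OF 1(2) v]] 1 by simp
      finally show ?thesis by (simp add: 1 flip: idemp_gen)
    next
      case (2 r)
      have "act (gen g) (TT v) = (\<Sum>q\<le>c. X r (T q (Ew q v)))"
        unfolding TT_def 2 dot_gen[symmetric] using TE(1)[OF _ v] SpD 2 by (intro act_sumr dot_in) auto
      also have "\<dots> = TT (X r v)" unfolding TT_def using TE(2)[OF _ v] 2 v by (intro sum.cong) (auto simp: T(4) Ew_X)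
      finally show ?thesis by (simp add: 2 flip: dot_gen)
    next
      case (3 r)
      let ?t = "transpose r (Suc r)"
      have "act (gen g) (TT v) = (\<Sum>q\<le>c. P r (T q (Ew q v)))"
        unfolding TT_def 3 crs_gen[symmetric] using TE(1)[OF _ v] SpD 3 by (intro act_sumr crs_in) auto
      also have "\<dots> = (\<Sum>q\<le>c. T (?t q) (Ew (?t q) (P r v)))"
        using TE(2)[OF _ v] 3 v by (intro sum.cong) (auto simp: T(5) P_Ew)
      also have "\<dots> = TT (P r v)" unfolding TT_def
      proof (rule sum.reindex_bij_betw)
        show "bij_betw ?t {..c} {..c}"
          by (rule bij_betw_byWitness[of _ ?t]) (use 3 transpose_le in auto)
      qed
      finally show ?thesis by (simp add: 3 flip: crs_gen)
    qed
  qed (use \<delta> v SpD in auto)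
  thus ?thesis using TT_Sp[OF p v] by simp
qed

lemma dot_ops_Sp: "p \<le> c ==> dot_ops (gm_scale M) (Sp p) X {..c}"
  by unfold_locales
    (auto simp: Sp_sub X_Sp X_X_Sp X_add X_scale)

definition others :: "nat \<Rightarrow> nat list" where "others p = filter (\<lambda>l. l \<noteq> p) [0..<Suc c]"

lemma others: "set (others p) = {..c} - {p}" "distinct (others p)"
  by (auto simp: others_def)

text \<open>Dots pass a crossing of different colours without correction term.\<close>

lemma P_hsym_ij:
  assumes "p \<le> c" "r < c" "r = p \<or> Suc r = p" "v \<in> Sp p"
  shows "set ls \<subseteq> {..c} ==> P r (hsym X k ls v) = hsym X k (map (transpose r (Suc r)) ls) (P r v)"
proof (induction k ls rule: hsym_induct)
  case (3 k l ls)
  interpret D: dot_ops "gm_scale M" "Sp p" X "{..c}" by (rule dot_ops_Sp[OF assms(1)])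
  have l: "l \<le> c" "set ls \<subseteq> {..c}" using 3(3) by auto
  note in1 = SpD(1)[OF D.h_in[OF l(2) assms(4), of "Suc k"]] and in2 = D.h_in[OF 3(3) assms(4), of k]
  have "P r (hsym X (Suc k) (l # ls) v) = P r (hsym X (Suc k) ls v) + P r (X l (hsym X k (l # ls) v))"
    using in1 SpD(1)[OF D.x_in[OF _ in2, of l]] l assms(2) by (simp add: act_addr crs_in)
  also have "P r (X l (hsym X k (l # ls) v)) = X (transpose r (Suc r) l) (P r (hsym X k (l # ls) v))"
    by (rule P_X_ij[OF assms(1-3) l(1) in2])
  finally show ?case using 3 l by simp
qed (use assms in \<open>auto simp: crs_in\<close>)

context
  assumes irr: "gm_irreducible C \<nu> M"
begin

text \<open>The dot on the strand of colour \<open>j\<close> is central of positive degree.\<close>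

lemma X_j_zero: "p \<le> c ==> v \<in> Sp p ==> X p v = 0"
proof (rule central_zero[OF irr, where T = X and \<delta> = "rform C j j"])
  fix p r v assume p: "p \<le> c" "r < c" "v \<in> Sp p"
  show "P r (X p v) = X (transpose r (Suc r) p) (P r v)"
    using P_X_ij[of p r p v] P_X_ii[of p r p v] p by (cases "r = p \<or> Suc r = p") auto
next
  fix p d v assume "p \<le> c" "v \<in> Sp p" "v \<in> gm_part M d"
  thus "X p v \<in> gm_part M (d + rform C j j)" using X_part[of p p v d] by (simp add: word_nth)
qed (auto simp: X_Sp X_add X_scale X_X_Sp root_pos)

text \<open>
  Symmetric polynomials in the dots on the strands of colour \<open>i\<close> are central: crossings of two such
  strands commute with them, and crossings with \<open>j\<close> permute the dots.
\<close>

lemma hsym_others_zero: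
  assumes "k > 0" "p \<le> c" "v \<in> Sp p" shows "hsym X k (others p) v = 0"
proof (rule central_zero[OF irr, where T = "\<lambda>p. hsym X k (others p)" and \<delta> = "int k * rform C i i"])
  fix p assume p: "p \<le> c"
  interpret D: dot_ops "gm_scale M" "Sp p" X "{..c}" by (rule dot_ops_Sp[OF p])
  have o: "set (others p) \<subseteq> {..c}" using others by auto
  show "hsym X k (others p) v \<in> Sp p" if "v \<in> Sp p" for v using D.h_in[OF o that] .
  show "hsym X k (others p) (v + w) = hsym X k (others p) v + hsym X k (others p) w"
    if "v \<in> Sp p" "w \<in> Sp p" for v w using D.h_add[OF o that] .
  show "hsym X k (others p) (gm_scale M a v) = gm_scale M a (hsym X k (others p) v)"
    if "v \<in> Sp p" for a v using D.h_scale[OF o that] .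
  show "hsym X k (others p) (X r v) = X r (hsym X k (others p) v)"
    if "r \<le> c" "v \<in> Sp p" for r v using D.h_x[OF o _ that(2)] that(1) by simp
  show "P r (hsym X k (others p) v) = hsym X k (others (transpose r (Suc r) p)) (P r v)"
    if r: "r < c" and v: "v \<in> Sp p" for r v
  proof (cases "r = p \<or> Suc r = p")
    case True
    let ?t = "transpose r (Suc r)"
    interpret D': dot_ops "gm_scale M" "Sp (?t p)" X "{..c}" by (rule dot_ops_Sp[OF transpose_le[OF p r]])
    have "distinct (map ?t (others p))" using others by (simp add: distinct_map)
    moreover have "set (map ?t (others p)) = set (others (?t p))"
    proof -
      have im: "?t ` {..c} = {..c}"
        using bij_betw_byWitness[of "{..c}" ?t ?t "{..c}"] transpose_le r by (auto simp: bij_betw_def)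
      have "?t ` ({..c} - {p}) = ?t ` {..c} - ?t ` {p}" by (rule image_set_diff) simp
      thus ?thesis using others im by simp
    qed
    ultimately have "mset (map ?t (others p)) = mset (others (?t p))"
      using others set_eq_iff_mset_eq_distinct by blast
    moreover have "set (map ?t (others p)) \<subseteq> {..c}" using others transpose_le r by auto
    ultimately show ?thesis using P_hsym_ij[OF p r True v o, of k] D'.h_mset P_Sp[OF p r v] by metis
  next
    case False
    hence t: "transpose r (Suc r) p = p" by (auto simp: transpose_def)
    show ?thesis unfolding t
    proof (rule D.\<phi>_h_sym[where T = "Sp p" and r = r and s = "Suc r"])
      show "P r (v + w) = P r v + P r w" if "v \<in> Sp p" "w \<in> Sp p" for v w
        using that r by (auto simp: P_add)
      show "P r v \<in> Sp p" if "v \<in> Sp p" for v using P_Sp[OF p r that] t by simp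
    qed (use p r v False others Sp_sub X_Sp in \<open>auto simp: P_X_ii\<close>)
  qed
  have deg: "set ls \<subseteq> {..c} - {p} ==> v \<in> Sp p ==> v \<in> gm_part M d ==>
    hsym X k ls v \<in> gm_part M (d + int k * rform C i i)" for d v k ls
  proof (induction k ls rule: hsym_induct)
    case (3 k l ls)
    have l: "l \<le> c" "l \<noteq> p" "set (l # ls) \<subseteq> {..c}" using 3(3) by auto
    have "X l (hsym X k (l # ls) v) \<in> gm_part M ((d + int k * rform C i i) + rform C i i)"
      using X_part[OF p l(1) D.h_in[OF l(3) 3(4)] 3(2)[OF 3(3-5)]] p l by (simp add: word_nth)
    thus ?case using 3(1)[OF _ 3(4,5)] 3(3) by (auto simp: algebra_simps intro!: part_add)
  qed auto
  show "hsym X k (others p) v \<in> gm_part M (d + int k * rform C i i)"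
    if "v \<in> Sp p" "v \<in> gm_part M d" for d v using deg[OF _ that] others by auto
qed (use assms root_pos in auto)

text \<open>
  The polynomial \<open>h\<^sub>k\<close> in all \<open>c\<close> variables vanishes for \<open>k > 0\<close>; dropping all but one of them costs \<open>c - 1\<close>
  degrees.
\<close>

lemma X_power_zero:
  assumes "p \<le> c" "v \<in> Sp p" "l \<le> c" "l \<noteq> p" "k \<ge> c" shows "(X l ^^ k) v = 0"
proof -
  interpret D: dot_ops "gm_scale M" "Sp p" X "{..c}" by (rule dot_ops_Sp[OF assms(1)])
  let ?ws = "filter (\<lambda>m. m \<noteq> l) (others p)"
  have s: "set ?ws = {..c} - {p, l}" using others by auto
  have "card (set ?ws) = c - 1" unfolding s using assms by (subst card_Diff_subset) auto
  hence len: "length ?ws = c - 1" using others by (subst (asm) distinct_card) auto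
  have m: "mset (?ws @ [l]) = mset (others p)"
    by (subst set_eq_iff_mset_eq_distinct[symmetric]) (use others s assms in auto)
  have "hsym X k [l] v = 0"
  proof (rule D.h_tail_zero[of 0 ?ws])
    fix k :: nat and v assume "0 < k" "v \<in> Sp p"
    thus "hsym X k (?ws @ [l]) v = 0"
      using D.h_mset[OF m, of v k] hsym_others_zero[of k p v] assms s by auto
  qed (use s len assms in auto)
  thus ?thesis by (simp add: D.h_single)
qed

text \<open>
  Here all but two variables are dropped, and the sum is \<open>h\<^sub>a\<^sub>-\<^sub>1\<close> in the remaining two.
\<close>

lemma X_pair_zero:
  assumes "p \<le> c" "v \<in> Sp p" "l \<le> c" "l \<noteq> p" "m \<le> c" "m \<noteq> p" "l \<noteq> m" "a \<ge> c"
  shows "(\<Sum>t<a. (X l ^^ t) ((X m ^^ (a - 1 - t)) v)) = 0"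
proof -
  interpret D: dot_ops "gm_scale M" "Sp p" X "{..c}" by (rule dot_ops_Sp[OF assms(1)])
  let ?ws = "filter (\<lambda>n. n \<noteq> l \<and> n \<noteq> m) (others p)"
  have s: "set ?ws = {..c} - {p, l, m}" using others by auto
  have "card {p, l, m} = 3" using assms by auto
  moreover have "{p, l, m} \<subseteq> {..c}" using assms by auto
  moreover from this have "card {p, l, m} \<le> card {..c}" by (intro card_mono) auto
  ultimately have c2: "c \<ge> 2" and "card (set ?ws) = c - 2" unfolding s by (auto simp: card_Diff_subset)
  hence len: "length ?ws = c - 2" using others by (subst (asm) distinct_card) auto
  have mm: "mset (?ws @ [l, m]) = mset (others p)"
    by (subst set_eq_iff_mset_eq_distinct[symmetric]) (use others s assms in auto)
  have "hsym X (a - 1) [l, m] v = 0"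
  proof (rule D.h_tail_zero[of 0 ?ws])
    fix k :: nat and v assume "0 < k" "v \<in> Sp p"
    thus "hsym X k (?ws @ [l, m]) v = 0"
      using D.h_mset[OF mm, of v k] hsym_others_zero[of k p v] assms s by auto
  qed (use s len assms c2 in auto)
  moreover have "{..a - 1} = {..<a}" using assms(8) c2 by auto
  ultimately show ?thesis using D.h_pair[of l m v "a - 1"] assms by simp
qed

text \<open>
  Both terms of the quadratic relation are zero: one is a power of the dot on \<open>j\<close>, the other a power of
  a dot on \<open>i\<close> with exponent at least \<open>c\<close>.
\<close>

lemma P_sq_ij:
  assumes "p \<le> c" "r < c" "r = p \<or> Suc r = p" "v \<in> Sp p"
  shows "P r (P r v) = 0"
proof -
  have cp: "0 < c" using assms by auto
  note pos = cartan_pos[OF cp]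
  have v: "v \<in> S" "Ew p v = v" using SpD assms(4) by auto
  have a: "nat (cartan_a C i j) \<ge> c" using ca by simp
  have j0: "(X p ^^ nat (cartan_a C j i)) v = 0"
  proof -
    have "(X p ^^ Suc m) v = 0" for m
      by (induction m) (use X_j_zero[OF assms(1,4)] assms(1) in \<open>auto simp: dot_in\<close>)
    moreover obtain m where "nat (cartan_a C j i) = Suc m" using pos(4) by (cases "nat (cartan_a C j i)") auto
    ultimately show ?thesis by simp
  qed
  have i0: "(X l ^^ nat (cartan_a C i j)) v = 0" if "l \<le> c" "l \<noteq> p" for l
    using X_power_zero[OF assms(1,4) that a] .
  show ?thesis
  proof (cases "r = p")
    case True
    thus ?thesis using P_sq[OF word_in[OF assms(1)] _ v, of r] assms ij pos j0 i0[of "Suc r"]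
      by (simp add: word_nth)
  next
    case False
    hence "Suc r = p" using assms by auto
    thus ?thesis using P_sq[OF word_in[OF assms(1)] _ v, of r] assms ij pos j0 i0[of r] False
      by (simp add: word_nth)
  qed
qed

text \<open>
  Only for the letters \<open>iji\<close> does the braid relation have a correction term, and this is the sum in
  \<open>X_pair_zero\<close> with \<open>a\<close> the Cartan integer of \<open>i\<close> and \<open>j\<close>.
\<close>

lemma P_braid_exact:
  assumes "p \<le> c" "Suc r < c" "v \<in> Sp p"
  shows "P r (P (Suc r) (P r v)) = P (Suc r) (P r (P (Suc r) v))"
proof -
  have v: "v \<in> S" "Ew p v = v" using SpD assms(3) by auto
  let ?a = "nat (cartan_a C (word p ! r) (word p ! Suc r))"
  have "P r (P (Suc r) (P r v)) - P (Suc r) (P r (P (Suc r) v)) = 0"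
  proof (cases "p = Suc r")
    case True
    have "?a \<ge> c" using ca True assms by (simp add: word_nth)
    hence s: "(\<Sum>t<?a. (X r ^^ t) ((X (Suc (Suc r)) ^^ (?a - 1 - t)) v)) = 0"
      using True assms by (intro X_pair_zero[of p]) auto
    have "Suc (Suc r) < size \<nu>" using assms by simp
    from P_braid[OF word_in[OF assms(1)] this v refl] show ?thesis unfolding s by simp
  next
    case False
    show ?thesis
    proof (cases "p = r \<or> p = Suc (Suc r)")
      case True
      thus ?thesis using P_braid[OF word_in[OF assms(1)] _ v refl, of r] assms ij by (auto simp: word_nth)
    next
      case False
      have a0: "?a = 0" using \<open>p \<noteq> Suc r\<close> False assms cartan_ii by (simp add: word_nth)
      have "Suc (Suc r) < size \<nu>" using assms by simp
      from P_braid[OF word_in[OF assms(1)] this v refl] show ?thesis unfolding a0 by simp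
    qed
  qed
  thus ?thesis by simp
qed

end
end

section \<open>The strand of colour \<open>j\<close> does not move\<close>

lemma desc_snoc: "desc \<phi> k (Suc m) u = desc \<phi> k m (\<phi> (k + m) u)"
  by (induction m arbitrary: k) auto

context cij_module
begin

definition allowed :: "nat \<Rightarrow> 'i klr_gen set" where
  "allowed p = Dot ` {..c} \<union> Cross ` {r. r < c \<and> r \<noteq> p \<and> Suc r \<noteq> p}"

definition opw :: "'i klr_gen list \<Rightarrow> 'v \<Rightarrow> 'v" where
  "opw = foldr (\<lambda>g. act (gen g))"

lemma opw_simps [simp]: "opw [] v = v" "opw (g # ws) v = act (gen g) (opw ws v)"
  by (simp_all add: opw_def)

lemma opw_snoc: "opw (ws @ [g]) v = opw ws (act (gen g) v)"
  by (simp add: opw_def)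

lemma allowed_in: "p \<le> c ==> g \<in> allowed p ==> v \<in> Sp p ==> act (gen g) v \<in> Sp p"
  using P_Sp[of p _ v] by (auto simp: allowed_def X_Sp transpose_def simp flip: dot_gen crs_gen) metis

lemma allowed_gens: "g \<in> allowed p ==> gen g \<in> klr_fcar \<nu>"
  by (auto simp: allowed_def klr_gens_def intro!: free_alg_gen)

lemma opw_in: "p \<le> c ==> set ws \<subseteq> allowed p ==> v \<in> Sp p ==> opw ws v \<in> Sp p"
  by (induction ws) (auto intro: allowed_in)

lemma opw_S: "p \<le> c ==> set ws \<subseteq> allowed p ==> v \<in> Sp p ==> opw ws v \<in> S"
  using SpD(1)[OF opw_in] .

lemma opw_add: "p \<le> c ==> set ws \<subseteq> allowed p ==> v \<in> Sp p ==> w \<in> Sp p ==> opw ws (v + w) = opw ws v + opw ws w"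
  by (induction ws) (auto simp: act_addr allowed_gens[of _ p] opw_S[of p])

lemma opw_scale: "p \<le> c ==> set ws \<subseteq> allowed p ==> v \<in> Sp p ==> opw ws (gm_scale M a v) = gm_scale M a (opw ws v)"
  by (induction ws) (auto simp: act_scale allowed_gens[of _ p] opw_S[of p])

lemma allowed_deg: "p \<le> c ==> g \<in> allowed p ==>
    \<exists>\<delta>. \<forall>d v. v \<in> Sp p \<longrightarrow> v \<in> gm_part M d \<longrightarrow> act (gen g) v \<in> gm_part M (d + \<delta>)"
proof -
  assume p: "p \<le> c" and g: "g \<in> allowed p"
  from g consider r where "g = Dot r" "r \<le> c" | r where "g = Cross r" "r < c" by (auto simp: allowed_def)
  thus ?thesis
  proof cases
    case (1 r) thus ?thesis using X_part[OF p 1(2)] by (auto simp flip: dot_gen)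
  next
    case (2 r) thus ?thesis using P_part[OF p 2(2)]
      by (intro exI[of _ "- rform C (word p ! r) (word p ! Suc r)"]) (auto simp flip: crs_gen)
  qed
qed

lemma opw_deg: "p \<le> c ==> set ws \<subseteq> allowed p ==>
    \<exists>\<delta>. \<forall>d v. v \<in> Sp p \<longrightarrow> v \<in> gm_part M d \<longrightarrow> opw ws v \<in> gm_part M (d + \<delta>)"
proof (induction ws)
  case Nil show ?case by (intro exI[of _ 0]) simp
next
  case (Cons g ws)
  then obtain \<delta> where 1: "\<And>d v. v \<in> Sp p ==> v \<in> gm_part M d ==> opw ws v \<in> gm_part M (d + \<delta>)" by auto
  obtain \<delta>' where 2: "\<And>d v. v \<in> Sp p ==> v \<in> gm_part M d ==> act (gen g) v \<in> gm_part M (d + \<delta>')"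
    using allowed_deg[of p g] Cons.prems by auto
  have "act (gen g) (opw ws v) \<in> gm_part M (d + (\<delta> + \<delta>'))" if "v \<in> Sp p" "v \<in> gm_part M d" for d v
    using 2[OF opw_in 1[OF that]] Cons.prems that by (simp add: add.assoc)
  thus ?case by (intro exI[of _ "\<delta> + \<delta>'"]) simp
qed

lemma hc_map_Sp:
  assumes p: "p \<le> c" and T: "\<And>v. v \<in> Sp p ==> T v \<in> S" "\<And>v w. v \<in> Sp p ==> w \<in> Sp p ==> T (v + w) = T v + T w"
    and deg: "\<And>d v. v \<in> Sp p ==> v \<in> gm_part M d ==> T v \<in> gm_part M (d + \<delta>)" and v: "v \<in> Sp p"
  shows "hc M (T v) (d + \<delta>) = T (hc M v d)"
proof -
  have "hc M ((\<lambda>v. T (Ew p v)) v) (d + \<delta>) = (\<lambda>v. T (Ew p v)) (hc M v d)"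
  proof (rule hc_map)
    fix e v assume "v \<in> gm_part M e"
    thus "T (Ew p v) \<in> gm_part M (e + \<delta>)" using deg[OF Ew_in[OF p part_in] Ew_part[OF p]] by blast
  qed (use p v SpD in \<open>auto simp: act_addr idemp_in word_in T(2) Ew_in\<close>)
  thus ?thesis using SpD(2)[OF v] SpD(2)[OF hc_Sp[OF p v]] by simp
qed

text \<open>
  The strand of colour \<open>j\<close> crosses to the left by \<open>\<tau>\<close>. Vectors that stay in the kernel of \<open>\<tau>\<close>
  under the nilHecke action form a submodule: after a crossing to the right, the coset
  representatives of \<open>nil_hecke.coset_span\<close> reduce \<open>\<tau>\<close> to \<open>\<psi>\<^sub>r\<psi>\<^sub>r\<^sub>-\<^sub>1\<psi>\<^sub>r = \<psi>\<^sub>r\<^sub>-\<^sub>1\<psi>\<^sub>r\<psi>\<^sub>r\<^sub>-\<^sub>1\<close>, whose rightmost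
  factor is the earlier \<open>\<tau>\<close>.
\<close>

definition tau :: "nat \<Rightarrow> 'v \<Rightarrow> 'v" where "tau p v = (if p = 0 then 0 else P (p - 1) v)"

definition Kp :: "nat \<Rightarrow> 'v set" where
  "Kp p = {v \<in> Sp p. \<forall>ws. set ws \<subseteq> allowed p \<longrightarrow> tau p (opw ws v) = 0}"

lemma KpD: "v \<in> Kp p ==> v \<in> Sp p" "v \<in> Kp p ==> set ws \<subseteq> allowed p ==> tau p (opw ws v) = 0"
  by (auto simp: Kp_def)

lemma tau_0: "p \<le> c ==> tau p 0 = 0"
  by (auto simp: tau_def crs_in)

lemma tau_add: "p \<le> c ==> v \<in> Sp p ==> w \<in> Sp p ==> tau p (v + w) = tau p v + tau p w"
  by (auto simp: tau_def P_add)

lemma tau_scale: "p \<le> c ==> v \<in> Sp p ==> tau p (gm_scale M a v) = gm_scale M a (tau p v)"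
  by (auto simp: tau_def P_scale)

lemma tau_in: "p \<le> c ==> v \<in> Sp p ==> tau p v \<in> S"
  by (auto simp: tau_def SpD P_in)

lemma zero_Sp [simp]: "p \<le> c ==> 0 \<in> Sp p" using vs.subspace_0[OF Sp_sub] .

lemma opw_0: "p \<le> c ==> set ws \<subseteq> allowed p ==> opw ws 0 = 0"
  using opw_scale[of p ws 0 0] by simp

lemma Kp_sub: "p \<le> c ==> gm_subspace M (Kp p)"
  unfolding Kp_def
  by (rule vs.subspaceI)
    (auto simp: opw_0 tau_0 opw_add opw_scale tau_add tau_scale opw_in vs.subspace_add[OF Sp_sub] vs.subspace_scale[OF Sp_sub])

lemma Kp_allowed: "p \<le> c ==> v \<in> Kp p ==> g \<in> allowed p ==> act (gen g) v \<in> Kp p"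
  unfolding Kp_def by (auto simp: allowed_in simp flip: opw_snoc)

lemma tau_part: "p \<le> c ==> \<exists>\<delta>. \<forall>d v. v \<in> Sp p \<longrightarrow> v \<in> gm_part M d \<longrightarrow> tau p v \<in> gm_part M (d + \<delta>)"
  using P_part[of p "p - 1"]
  by (intro exI[of _ "- rform C (word p ! (p - 1)) (word p ! Suc (p - 1))"]) (auto simp: tau_def)

lemma Kp_hc: "p \<le> c ==> v \<in> Kp p ==> hc M v d \<in> Kp p"
proof -
  assume p: "p \<le> c" and v: "v \<in> Kp p"
  note v' = KpD(1)[OF v]
  have "tau p (opw ws (hc M v d)) = 0" if ws: "set ws \<subseteq> allowed p" for ws
  proof -
    obtain \<delta> where 1: "\<And>d v. v \<in> Sp p ==> v \<in> gm_part M d ==> opw ws v \<in> gm_part M (d + \<delta>)"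
      using opw_deg[OF p ws] by auto
    obtain \<delta>' where 2: "\<And>d v. v \<in> Sp p ==> v \<in> gm_part M d ==> tau p v \<in> gm_part M (d + \<delta>')"
      using tau_part[OF p] by auto
    have "hc M (tau p (opw ws v)) (d + (\<delta> + \<delta>')) = tau p (opw ws (hc M v d))"
    proof (rule hc_map_Sp[OF p, where T = "\<lambda>v. tau p (opw ws v)"])
      fix d v assume "v \<in> Sp p" "v \<in> gm_part M d"
      thus "tau p (opw ws v) \<in> gm_part M (d + (\<delta> + \<delta>'))"
        using 2[OF opw_in[OF p ws] 1] by (simp add: add.assoc)
    qed (use v' p ws in \<open>auto simp: opw_in opw_add tau_in tau_add\<close>)
    thus ?thesis using KpD(2)[OF v ws] by simp
  qed
  thus ?thesis using hc_Sp[OF p v'] by (simp add: Kp_def)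
qed

context
  assumes irr: "gm_irreducible C \<nu> M"
begin

text \<open>
  The space \<open>V\<close> of the proof is spanned by the images of \<open>P r ` Kp r\<close> under the coset representatives. It
  is stable under the dots and crossings that keep the word, and \<open>P r\<close> vanishes on it.
\<close>

lemma sigma_Kp:
  assumes r: "r < c" and w: "w \<in> Kp r"
  shows "P r w \<in> Kp (Suc r)"
proof -
  let ?q = "Suc r"
  have rc: "r \<le> c" and qc: "?q \<le> c" using r by auto
  interpret D: dot_ops "gm_scale M" "Sp ?q" X "{..c}" by (rule dot_ops_Sp[OF qc])
  have PSp: "P t v \<in> Sp ?q" if "t < c" "t \<noteq> r" "t \<noteq> ?q" "v \<in> Sp ?q" for t v
    using P_Sp[OF qc that(1,4)] that by (simp add: transpose_def)
  have far: "P t (P u v) = P u (P t v)" if "t < r" "u < r" "Suc t < u" "v \<in> Sp ?q" for t u v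
    using that r SpD(1)[OF that(4)] by (intro P_P) auto
  interpret N: nil_hecke "gm_scale M" "Sp ?q" X r P
  proof (unfold_locales, goal_cases)
    case (9 t v) thus ?case using r by (intro P_sq_ii[OF qc]) auto
  next
    case 10 thus ?case by (rule far)
  next
    case (11 t v) thus ?case using r by (intro P_braid_exact[OF irr qc]) auto
  next
    case (12 t u v) thus ?case using r P_X_ii[OF qc, of t u v] by auto
  qed (use r in \<open>auto simp: D.x_in D.x_add D.x_scale D.x_x D.S PSp P_add P_scale\<close>)
  define U where "U = P r ` Kp r"
  have U_Sp: "u \<in> Sp ?q" if "u \<in> U" for u
    using that P_Sp[OF rc r KpD(1)] by (auto simp: U_def)
  have X_U: "X t u \<in> U" if "t \<le> c" "u \<in> U" for t u
  proof -
    obtain v where v: "v \<in> Kp r" "u = P r v" using \<open>u \<in> U\<close> by (auto simp: U_def)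
    let ?t = "transpose r (Suc r) t"
    have t: "?t \<le> c" using transpose_le that r by simp
    have "P r (X ?t v) = X t u" using P_X_ij[OF rc r _ t KpD(1)[OF v(1)]] v(2) by simp
    moreover have "X ?t v \<in> Kp r" using Kp_allowed[OF rc v(1), of "Dot ?t"] t by (simp add: allowed_def flip: dot_gen)
    ultimately show ?thesis unfolding U_def by (metis imageI)
  qed
  have P_U: "P t u \<in> U" if t: "t < c" "Suc t < r \<or> Suc r < t" and u: "u \<in> U" for t u
  proof -
    obtain v where v: "v \<in> Kp r" "u = P r v" using u by (auto simp: U_def)
    have "P r (P t v) = P t u" unfolding v(2) using t r SpD(1)[OF KpD(1)[OF v(1)]] by (intro P_P) auto
    moreover have "P t v \<in> Kp r" using Kp_allowed[OF rc v(1), of "Cross t"] t by (auto simp add: allowed_def simp flip: crs_gen)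
    ultimately show ?thesis unfolding U_def by (metis imageI)
  qed
  have U: "U \<subseteq> Sp ?q" "\<And>t u. t \<le> r ==> u \<in> U ==> X t u \<in> vs.span U"
      "\<And>t u. Suc t < r ==> u \<in> U ==> P t u \<in> vs.span U"
    using U_Sp X_U P_U r by (auto intro!: vs.span_base)
  let ?V = "N.coset_span U"
  have V_Sp: "v \<in> Sp ?q" if "v \<in> ?V" for v using N.coset_span_le[OF U] that by auto
  have V_ind: "Q v" if v: "v \<in> ?V" and "\<And>k m u. k + m = r ==> u \<in> U ==> Q (desc P k m u)"
      "Q 0" "\<And>v w. v \<in> Sp ?q ==> w \<in> Sp ?q ==> Q v ==> Q w ==> Q (v + w)" "\<And>a v. v \<in> Sp ?q ==> Q v ==> Q (gm_scale M a v)" for Q v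
  proof -
    have "v \<in> vs.span {desc P k (r - k) u |k u. k \<le> r \<and> u \<in> U}" using v by (simp add: N.coset_span_def)
    hence "v \<in> Sp ?q \<and> Q v"
    proof (rule vs.span_inductS)
      fix x assume "x \<in> {desc P k (r - k) u |k u. k \<le> r \<and> u \<in> U}"
      thus "x \<in> Sp ?q \<and> Q x" using U_Sp that(2) by (auto intro!: N.desc_in)
    qed (use that qc vs.subspace_add[OF Sp_sub[OF qc]] vs.subspace_scale[OF Sp_sub[OF qc]] in auto)
    thus ?thesis by blast
  qed
  have V_desc: "desc P k m u \<in> ?V" if "k + m = r" "u \<in> U" for k m u
    using N.desc_span[OF U, of k u] vs.span_base[OF that(2)] that(1) by auto
  have V_sub: "gm_subspace M ?V" by (simp add: N.coset_span_def)
  have desc_X: "X t (desc P k m u) = desc P k m (X t u)" if "k + m \<le> r" "r < t" "t \<le> c" "u \<in> Sp ?q" for t k m u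
    using that
  proof (induction m arbitrary: k)
    case (Suc m)
    have d: "desc P (Suc k) m u \<in> Sp ?q" using Suc.prems by (intro N.desc_in) auto
    have "X t (P k (desc P (Suc k) m u)) = P k (X t (desc P (Suc k) m u))"
      using P_X_ii[OF qc _ _ _ _ d, of k t] Suc.prems r by (simp add: transpose_def)
    thus ?case using Suc by simp
  qed simp
  have desc_P: "P t (desc P k m u) = desc P k m (P t u)" if "k + m \<le> s" "s < t" "s \<le> r" "t < c" "u \<in> S" for t k m u s
    using that
  proof (induction m arbitrary: k)
    case (Suc m)
    have dS: "desc P k m u \<in> S" if "k + m \<le> r" for k using that r \<open>u \<in> S\<close>
      by (induction m arbitrary: k) (auto intro!: P_in)
    have "P t (P k (desc P (Suc k) m u)) = P k (P t (desc P (Suc k) m u))"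
      using Suc.prems r by (intro P_P dS) auto
    thus ?case using Suc by simp
  qed simp
  have V_allowed: "act (gen g) v \<in> ?V" if g: "g \<in> allowed ?q" and v: "v \<in> ?V" for g v
  proof -
    from g consider t where "g = Dot t" "t \<le> c" | t where "g = Cross t" "t < r" | t where "g = Cross t" "?q < t" "t < c"
      by (auto simp: allowed_def) linarith
    thus ?thesis
    proof cases
      case (1 t)
      show ?thesis
      proof (cases "t \<le> r")
        case True thus ?thesis using N.coset_span_x[OF U True v] by (simp add: 1 flip: dot_gen)
      next
        case False
        have "X t v \<in> ?V" using v
        proof (rule V_ind)
          fix k m u assume "k + m = r" "u \<in> U"
          thus "X t (desc P k m u) \<in> ?V" using desc_X[of k m t u] False 1 U_Sp X_U V_desc by auto
        next
          show "X t 0 \<in> ?V" using 1 vs.subspace_0[OF V_sub] by (simp add: dot_in)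
        qed (use 1 V_sub in \<open>auto simp: X_add X_scale vs.subspace_add vs.subspace_scale\<close>)
        thus ?thesis by (simp add: 1 flip: dot_gen)
      qed
    next
      case (2 t) thus ?thesis using N.coset_span_phi[OF U 2(2) v] by (simp flip: crs_gen)
    next
      case (3 t)
      have "P t v \<in> ?V" using v
      proof (rule V_ind)
        fix k m u assume a: "k + m = r" "u \<in> U"
        thus "P t (desc P k m u) \<in> ?V" using desc_P[of k m r t u] SpD(1)[OF U_Sp[OF a(2)]] 3 P_U[of t u] V_desc by auto
      next
        show "P t 0 \<in> ?V" using 3 vs.subspace_0[OF V_sub] by (simp add: crs_in)
      qed (use 3 V_sub in \<open>auto simp: P_add P_scale vs.subspace_add vs.subspace_scale\<close>)
      thus ?thesis by (simp add: 3 flip: crs_gen)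
    qed
  qed
  have V_opw: "opw ws (P r w) \<in> ?V" if "set ws \<subseteq> allowed ?q" for ws
    using that
  proof (induction ws)
    case Nil
    have "desc P r 0 (P r w) \<in> ?V" using w by (intro V_desc) (auto simp: U_def)
    thus ?case by simp
  qed (auto intro: V_allowed)
  have V_tau: "P r v = 0" if "v \<in> ?V" for v
    using that
  proof (rule V_ind)
    fix k m u assume km: "k + m = r" and u: "u \<in> U"
    then obtain v where v: "v \<in> Kp r" "u = P r v" by (auto simp: U_def)
    note v' = KpD(1)[OF v(1)]
    show "P r (desc P k m u) = 0"
    proof (cases m)
      case 0 thus ?thesis using P_sq_ij[OF irr rc r _ v'] v(2) by simp
    next
      case (Suc m')
      have r': "k + m' = r - 1" "Suc (r - 1) = r" using km Suc by auto
      have uS: "u \<in> S" using U_Sp[OF u] SpD by auto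
      have "P r (desc P k m u) = P r (desc P k m' (P (r - 1) u))" using Suc r'(1) by (simp add: desc_snoc del: desc.simps(2))
      also have "\<dots> = desc P k m' (P r (P (r - 1) u))"
        using r' r uS by (intro desc_P[of k m' "r - 1"]) (auto intro!: P_in)
      also have "P r (P (r - 1) u) = P (r - 1) (P r (P (r - 1) v))"
        using P_braid_exact[OF irr rc, of "r - 1" v] v' r' r v(2) by simp
      also have "P (r - 1) v = 0" using KpD(2)[OF v(1), of "[]"] r' by (simp add: tau_def split: if_splits)
      also have "desc P k m' (P (r - 1) (P r 0)) = 0"
      proof -
        have "P (r - 1) (P r 0) = 0" using r by (simp add: crs_in)
        moreover have "desc P k m' 0 = 0" using N.desc_lin(2)[OF U, of k m' 0 0] km Suc qc by simp
        ultimately show ?thesis by simp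
      qed
      finally show ?thesis .
    qed
  qed (use r in \<open>auto simp: crs_in P_add P_scale\<close>)
  have "P r w \<in> Sp ?q" using P_Sp[OF rc r KpD(1)[OF w]] by simp
  thus ?thesis using V_opw V_tau by (simp add: Kp_def tau_def)
qed

lemma nonzero_word: "\<exists>q. q \<le> c \<and> Sp q \<noteq> {0}"
proof (rule ccontr)
  assume "\<not> ?thesis"
  hence "Ew q v = 0" if "q \<le> c" "v \<in> S" for q v using Ew_in[OF that] that by blast
  hence "v = 0" if "v \<in> S" for v using Ew_sum[OF that] that by simp
  thus False using irr by (auto simp: gm_irreducible_def)
qed

text \<open>
  The vectors with all components in the \<open>Kp q\<close> form a submodule. It contains the component of the
  leftmost word that occurs, since nothing lies to the left of it, and so it is the whole module.
\<close>

lemma tau_zero: "p < c ==> v \<in> Sp (Suc p) ==> P p v = 0"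
proof -
  assume p: "p < c" and v: "v \<in> Sp (Suc p)"
  let ?N = "{v \<in> S. \<forall>q\<le>c. Ew q v \<in> Kp q}"
  have K0: "0 \<in> Kp q" if "q \<le> c" for q using vs.subspace_0[OF Kp_sub[OF that]] .
  have N: "gm_submodule C \<nu> M ?N"
  proof (rule submoduleI_cij)
    show "gm_subspace M ?N"
      by (rule vs.subspaceI)
        (auto simp: add_in scale_in act_addr act_scale idemp_in word_in K0 vs.subspace_add[OF Kp_sub] vs.subspace_scale[OF Kp_sub])
    fix v assume v: "v \<in> ?N"
    show "Ew q v \<in> ?N" if "q \<le> c" for q using v that K0 by (auto simp: E_in word_in Ew_Ew)
    show "X r v \<in> ?N" if "r \<le> c" for r
      using v that Kp_allowed[of _ _ "Dot r"] by (auto simp: X_in Ew_X allowed_def simp flip: dot_gen)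
    show "hc M v d \<in> ?N" for d
      using v Kp_hc by (auto simp: hc_in simp flip: hc_Ew)
    fix r assume r: "r < c"
    have "Ew q (P r v) \<in> Kp q" if q: "q \<le> c" for q
    proof -
      let ?q = "transpose r (Suc r) q"
      have e: "Ew q (P r v) = P r (Ew ?q v)" using v q r Ew_P by simp
      have k: "Ew ?q v \<in> Kp ?q" "?q \<le> c" using v transpose_le[OF q r] by auto
      consider "q = r" | "q = Suc r" | "q \<noteq> r" "q \<noteq> Suc r" by blast
      thus ?thesis
      proof cases
        case 1
        hence "?q = Suc r" by simp
        hence "P r (Ew ?q v) = 0" using KpD(2)[OF k(1), of "[]"] by (simp add: tau_def)
        thus ?thesis using e K0[OF q] by simp
      next
        case 2
        hence "?q = r" by simp
        thus ?thesis using e sigma_Kp[OF r] k 2 by simp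
      next
        case 3
        hence "?q = q" by simp
        thus ?thesis using e k Kp_allowed[of q _ "Cross r"] r 3 by (auto simp: allowed_def simp flip: crs_gen)
      qed
    qed
    thus "P r v \<in> ?N" using v r by (simp add: P_in)
  qed auto
  define q0 where "q0 = (LEAST q. q \<le> c \<and> Sp q \<noteq> {0})"
  have q0: "q0 \<le> c" "Sp q0 \<noteq> {0}" using LeastI_ex[OF nonzero_word] by (auto simp: q0_def)
  have min: "Sp q = {0}" if "q < q0" for q
    using not_less_Least[of q "\<lambda>q. q \<le> c \<and> Sp q \<noteq> {0}"] that q0(1) by (simp add: q0_def)
  have "Sp q0 \<subseteq> Kp q0"
  proof
    fix v assume v: "v \<in> Sp q0"
    have "tau q0 (opw ws v) = 0" if ws: "set ws \<subseteq> allowed q0" for ws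
    proof (cases q0)
      case (Suc q)
      have "P q (opw ws v) \<in> Sp q" using P_Sp[OF q0(1) _ opw_in[OF q0(1) ws v], of q] Suc q0 by simp
      thus ?thesis using min[of q] Suc by (simp add: tau_def)
    qed (simp add: tau_def)
    thus "v \<in> Kp q0" using v by (simp add: Kp_def)
  qed
  moreover obtain v0 where v0: "v0 \<in> Sp q0" "v0 \<noteq> 0" using q0 zero_Sp[OF q0(1)] by blast
  ultimately have "v0 \<in> ?N" using K0 q0(1) by (auto simp: Ew_Sp SpD)
  hence "?N = S" using N irr v0(2) by (auto simp: gm_irreducible_def)
  hence "v \<in> ?N" using SpD(1)[OF v] by simp
  hence "Ew (Suc p) v \<in> Kp (Suc p)" using p by auto
  hence "v \<in> Kp (Suc p)" using SpD(2)[OF v] by simp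
  from KpD(2)[OF this, of "[]"] show "P p v = 0" by (simp add: tau_def)
qed

text \<open>
  No crossing moves \<open>j\<close> to the left, so the component of the rightmost word is a submodule.
\<close>

lemma irreducible_concentrated: "\<exists>p\<le>c. concentrated C \<nu> M (word p)"
proof -
  define q where "q = Max {q. q \<le> c \<and> Sp q \<noteq> {0}}"
  have fin: "finite {q. q \<le> c \<and> Sp q \<noteq> {0}}" by simp
  have q: "q \<le> c" "Sp q \<noteq> {0}" using Max_in[OF fin] nonzero_word by (auto simp: q_def)
  have max: "Sp q' = {0}" if "q < q'" "q' \<le> c" for q'
    using Max_ge[OF fin, of q'] that by (fastforce simp: q_def)
  have "gm_submodule C \<nu> M (Sp q)"
  proof (rule submoduleI_cij[OF Sp_sub[OF q(1)]])
    fix r v assume r: "r < c" and v: "v \<in> Sp q"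
    consider "r = q" | "Suc r = q" | "r \<noteq> q" "Suc r \<noteq> q" by blast
    thus "P r v \<in> Sp q"
    proof cases
      case 1
      hence "P r v \<in> Sp (Suc q)" using P_Sp[OF q(1) r v] by simp
      thus ?thesis using max[of "Suc q"] 1 r q(1) by auto
    next
      case 2 thus ?thesis using tau_zero[OF r] v q(1) by simp
    next
      case 3 thus ?thesis using P_Sp[OF q(1) r v] by (simp add: transpose_def)
    qed
  qed (use q in \<open>auto simp: Ew_Sp X_Sp hc_Sp SpD\<close>)
  hence "Sp q = S" using irr q(2) by (auto simp: gm_irreducible_def)
  hence "concentrated C \<nu> M (word q)" using SpD(2) word_in[OF q(1)] by (auto simp: concentrated_def)
  thus ?thesis using q(1) by blast
qed

end
end

section \<open>Structure of an irreducible module with word \<open>i\<^sup>pji\<^sup>c\<^sup>-\<^sup>p\<close>\<close>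

locale cij_irr = cij_module C i j c \<nu> M
  for C :: "('i, 'p::ab_group_add) cartan_data" and i j c \<nu>
    and M :: "(('i, 'k::field) klr_elem, 'k, 'v::ab_group_add) gmodule" +
  fixes p :: nat
  assumes irr: "gm_irreducible C \<nu> M" and pc: "p \<le> c" and conc: "concentrated C \<nu> M (word p)"
begin

abbreviation "\<Delta> \<equiv> rform C i i"

lemma S_Sp: "v \<in> S ==> v \<in> Sp p"
  using conc by (simp add: concentrated_def Sp_def)

lemma Sp_other: "q \<le> c ==> q \<noteq> p ==> v \<in> Sp q ==> v = 0"
  using Ew_Sp[of p q v] S_Sp[OF SpD(1)] SpD(2) pc by metis

lemma X_S: "r \<le> c ==> v \<in> S ==> X r v \<in> S" by (simp add: X_in)
lemma P_S: "r < c ==> v \<in> S ==> P r v \<in> S" by (simp add: P_in)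

lemma P_ij_zero: "r < c ==> r = p \<or> Suc r = p ==> v \<in> S ==> P r v = 0"
  using P_Sp[OF pc, of r v] S_Sp[of v] transpose_le[OF pc, of r] Sp_other[of "transpose r (Suc r) p" "P r v"]
  by (auto simp: transpose_def)

lemma X_p_zero: "v \<in> S ==> X p v = 0"
  using X_j_zero[OF irr pc S_Sp] .

sublocale D: dot_ops "gm_scale M" S X "{..c}"
  by unfold_locales (auto simp: subspace X_in act_addr act_scale dot_in X_X)

lemma X_deg: "r \<le> c ==> r \<noteq> p ==> v \<in> gm_part M d ==> X r v \<in> gm_part M (d + \<Delta>)"
  using X_part[OF pc _ S_Sp[OF part_in], of r v d] by (simp add: word_nth pc)

lemma P_deg: "r < c ==> v \<in> gm_part M d ==> P r v \<in> gm_part M (d - \<Delta>)"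
  using P_part[OF pc _ S_Sp[OF part_in], of r v d] P_ij_zero[of r v] part_in[of v d]
  by (cases "r = p \<or> Suc r = p") (auto simp: word_nth pc)

lemma \<Delta>_pos: "\<Delta> > 0" using root_pos .

lemma P_X': "r < c ==> t \<le> c ==> r \<noteq> p ==> Suc r \<noteq> p ==> v \<in> S ==>
    P r (X t v) = X (transpose r (Suc r) t) (P r v) + (if t = r then v else if t = Suc r then - v else 0)"
  using P_X_ii[OF pc _ _ _ _ S_Sp] .

text \<open>The strands of colour \<open>i\<close> on each side of \<open>j\<close> form a block; \<open>j\<close> is a block by itself.\<close>

definition block_end :: "nat \<Rightarrow> nat" where
  "block_end r = (if r < p then p else if r = p then Suc p else Suc c)"
definition block_start :: "nat \<Rightarrow> nat" where
  "block_start r = (if r < p then 0 else if r = p then p else Suc p)"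

lemma block_bounds: "r \<le> c ==> block_start r \<le> r \<and> r < block_end r \<and> block_end r \<le> Suc c"
  using pc by (auto simp: block_end_def block_start_def)

text \<open>
  Symmetric polynomials in the dots of one block are central: crossings with \<open>j\<close>, which would mix the
  blocks, act by zero.
\<close>

lemma hsym_block:
  assumes k: "k > 0" and r: "r \<le> c" and v: "v \<in> S"
  shows "hsym X k [block_start r..<block_end r] v = 0"
proof (cases "r = p")
  case True
  obtain k' where "k = Suc k'" using k by (cases k) auto
  moreover have "[block_start r..<block_end r] = [p]" using True by (simp add: block_end_def block_start_def)
  moreover have "X p ((X p ^^ k') v) = 0" by (rule X_p_zero[OF act_power_in[OF dot_in v]]) (use pc in simp)
  ultimately show ?thesis by (simp add: D.h_single)
next
  case False
  let ?ls = "[block_start r..<block_end r]"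
  have ls: "set ?ls \<subseteq> {..c} - {p}" using r False pc by (auto simp: block_end_def block_start_def)
  hence lsc: "set ?ls \<subseteq> {..c}" by blast
  define T where "T q v = (if q = p then hsym X k ?ls v else 0)" for q v
  have "T p v = 0"
  proof (rule central_zero[OF irr, where T = T and \<delta> = "int k * \<Delta>"])
    fix q v assume q: "q \<le> c" and "v \<in> Sp q"
    hence v: "v \<in> S" "v \<in> Sp q" using SpD by auto
    show "T q v \<in> Sp q" using D.h_in[OF lsc v(1)] S_Sp q by (auto simp: T_def)
    show "T q (v + w) = T q v + T q w" if "w \<in> Sp q" for w
      using D.h_add[OF lsc v(1) SpD(1)[OF that]] by (simp add: T_def)
    show "T q (gm_scale M a v) = gm_scale M a (T q v)" for a
      using D.h_scale[OF lsc v(1)] by (simp add: T_def)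
    show "T q (X s v) = X s (T q v)" if "s \<le> c" for s
      using D.h_x[OF lsc _ v(1), of s k] that by (simp add: T_def)
    show "P s (T q v) = T (transpose s (Suc s) q) (P s v)" if s: "s < c" for s
    proof (cases "q = p")
      case qp: True
      show ?thesis
      proof (cases "s = p \<or> Suc s = p")
        case True
        have "P s (hsym X k ?ls v) = 0" by (rule P_ij_zero[OF s True D.h_in[OF lsc v(1)]])
        moreover have "P s v = 0" by (rule P_ij_zero[OF s True v(1)])
        ultimately show ?thesis using qp D.h_0[OF lsc, of k] by (simp add: T_def)
      next
        case F: False
        have t: "transpose s (Suc s) p = p" using F by (auto simp: transpose_def)
        have "P s (hsym X k ?ls v) = hsym X k ?ls (P s v)"
        proof (cases "s \<in> set ?ls")
          case True
          hence "Suc s \<in> set ?ls" using F s r by (auto simp: block_end_def block_start_def split: if_splits)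
          thus ?thesis using True
            by (intro D.\<phi>_h_sym[where T = S and r = s and s = "Suc s"])
              (use s F v lsc subspace P_S P_X' X_S in \<open>auto simp: act_addr crs_in\<close>)
        next
          case False
          hence "Suc s \<notin> set ?ls" using F s r by (auto simp: block_end_def block_start_def split: if_splits)
          hence ss: "set ?ls \<subseteq> {..c} - {s, Suc s}" using False lsc by auto
          show ?thesis
            by (rule D.\<phi>_h[where T = S and r = s and s = "Suc s", OF _ _ _ _ _ _ _ _ _ _ _ ss v(1)])
              (use s F v lsc subspace P_S P_X' X_S in \<open>auto simp: act_addr crs_in\<close>)
        qed
        thus ?thesis using qp t by (simp add: T_def)
      qed
    next
      case False
      hence v0: "v = 0" using Sp_other[OF q _ v(2)] by blast
      thus ?thesis using s D.h_0[OF lsc, of k] by (auto simp: T_def crs_in)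
    qed
    have deg: "set ls \<subseteq> {..c} - {p} ==> v \<in> gm_part M d ==> hsym X k ls v \<in> gm_part M (d + int k * \<Delta>)" for d k ls
    proof (induction k ls rule: hsym_induct)
      case (3 k l ls)
      have l: "l \<le> c" "l \<noteq> p" using 3(3) by auto
      have "X l (hsym X k (l # ls) v) \<in> gm_part M ((d + int k * \<Delta>) + \<Delta>)"
        by (rule X_deg[OF l 3(2)[OF 3(3,4)]])
      thus ?case using 3(1)[OF _ 3(4)] 3(3) by (auto simp: algebra_simps intro!: part_add)
    qed auto
    show "T q v \<in> gm_part M (d + int k * \<Delta>)" if "v \<in> gm_part M d" for d
      using deg[OF ls that] by (simp add: T_def)
  qed (use k \<Delta>_pos pc S_Sp[OF v] in auto)
  thus ?thesis by (simp add: T_def)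
qed

text \<open>
  This solves \<open>h\<^sub>n(x\<^sub>r, Y) = 0\<close> for the highest power of \<open>x\<^sub>r\<close>, where \<open>Y\<close> consists of the earlier dots of the
  block. The equation follows from \<open>hsym_block\<close> by dropping the later dots.
\<close>

lemma X_reduce:
  assumes r: "r \<le> c" and v: "v \<in> S" and n: "n = block_end r - r"
  shows "(X r ^^ n) v = - (\<Sum>t<n. (X r ^^ t) (hsym X (n - t) (rev [block_start r..<r]) v))"
proof -
  note b = block_bounds[OF r]
  let ?R = "rev [block_start r..<r]" and ?ws = "[Suc r..<block_end r]"
  have R: "set ?R \<subseteq> {..c}" using r by auto
  have n0: "n > 0" using b n by simp
  have ws: "set ?ws \<subseteq> {..c}" using b by auto
  have split: "[block_start r..<block_end r] = [block_start r..<r] @ r # ?ws"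
    using b upt_add_eq_append[of "block_start r" r "block_end r - r"] by (simp add: upt_conv_Cons)
  have "hsym X n (r # ?R) v = 0"
  proof (rule D.h_tail_zero[of 0 ?ws])
    fix k :: nat and v assume "0 < k" "v \<in> S"
    thus "hsym X k (?ws @ r # ?R) v = 0"
      using D.h_mset[of "?ws @ r # ?R" "[block_start r..<block_end r]" v k] hsym_block[of k r v] R r ws
      by (simp add: split)
  qed (use b n v in auto)
  hence "(\<Sum>t\<le>n. (X r ^^ t) (hsym X (n - t) ?R v)) = 0"
    using D.h_expand[of r ?R v n] r R v by simp
  moreover have "{..n} = insert n {..<n}" by auto
  ultimately show ?thesis by (simp add: eq_neg_iff_add_eq_0)
qed

text \<open>Monomials in the dots, and the staircase of exponents that index a basis.\<close>

fun mon :: "nat \<Rightarrow> nat list \<Rightarrow> 'v \<Rightarrow> 'v" where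
  "mon r [] v = v"
| "mon r (k # ks) v = (X r ^^ k) (mon (Suc r) ks v)"

fun stairs :: "nat \<Rightarrow> nat \<Rightarrow> nat list set" where
  "stairs r 0 = {[]}"
| "stairs r (Suc n) = (\<lambda>(k, ks). k # ks) ` ({..<block_end r - r} \<times> stairs (Suc r) n)"

lemma finite_stairs [simp]: "finite (stairs r n)"
  by (induction n arbitrary: r) auto

lemma X_pow_in: "r \<le> c ==> v \<in> S ==> (X r ^^ k) v \<in> S"
  by (induction k) (auto intro: X_S)

lemma mon_in: "a \<in> stairs r n ==> r + n = Suc c ==> v \<in> S ==> mon r a v \<in> S"
  by (induction n arbitrary: r a) (auto intro!: X_pow_in)

lemma X_pow_deg: "r \<le> c ==> r \<noteq> p ==> v \<in> gm_part M d ==> (X r ^^ k) v \<in> gm_part M (d + int k * \<Delta>)"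
proof (induction k)
  case (Suc k)
  have "X r ((X r ^^ k) v) \<in> gm_part M (d + int k * \<Delta> + \<Delta>)" by (rule X_deg) (use Suc in auto)
  thus ?case by (simp add: algebra_simps)
qed simp

lemma mon_deg: "a \<in> stairs r n ==> r + n = Suc c ==> v \<in> gm_part M d ==>
    mon r a v \<in> gm_part M (d + int (sum_list a) * \<Delta>)"
proof (induction n arbitrary: r a)
  case (Suc n)
  then obtain k ks where a: "a = k # ks" "k < block_end r - r" "ks \<in> stairs (Suc r) n" by auto
  have m: "mon (Suc r) ks v \<in> gm_part M (d + int (sum_list ks) * \<Delta>)" using Suc a by simp
  show ?case
  proof (cases "r = p")
    case True thus ?thesis using a m by (simp add: block_end_def)
  next
    case False
    thus ?thesis using X_pow_deg[OF _ False m, of k] Suc.prems a by (simp add: algebra_simps)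
  qed
qed simp

context
  fixes v0 :: 'v and d0 :: int
  assumes v0: "v0 \<in> gm_part M d0" "v0 \<noteq> 0" and low: "\<And>d. d < d0 ==> gm_part M d = {0}"
begin

lemma v0_S: "v0 \<in> S" using part_in[OF v0(1)] .

lemma P_v0: "r < c ==> P r v0 = 0"
  using P_deg[of r v0 d0] v0(1) low[of "d0 - \<Delta>"] \<Delta>_pos by auto

subsection \<open>The staircase monomials span\<close>

lemma X_orbit_whole:
  "S = vs.span {foldr X ts v0 | ts. set ts \<subseteq> {..c}}" (is "_ = vs.span ?G")
proof -
  let ?N = "vs.span ?G"
  have fS: "foldr X ts v0 \<in> S" if "set ts \<subseteq> {..c}" for ts
    using that by (induction ts) (auto simp: v0_S intro!: X_S)
  have fX: "foldr X ts v0 \<in> ?N" if "set ts \<subseteq> {..c}" for ts using that by (intro vs.span_base) auto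
  have NS: "?N \<subseteq> S" by (rule vs.span_minimal[OF _ subspace]) (use fS in auto)
  have ind: "Q v" if v: "v \<in> ?N" and "\<And>ts. set ts \<subseteq> {..c} ==> Q (foldr X ts v0)" "Q 0"
    "\<And>v w. v \<in> S ==> w \<in> S ==> Q v ==> Q w ==> Q (v + w)" "\<And>a v. v \<in> S ==> Q v ==> Q (gm_scale M a v)" for Q v
  proof -
    from v have "v \<in> S \<and> Q v"
      by (rule vs.span_inductS) (use that fS in \<open>auto simp: add_in scale_in\<close>)
    thus ?thesis by blast
  qed
  have NX: "X r v \<in> ?N" if "r \<le> c" "v \<in> ?N" for r v
    using that(2)
  proof (rule ind)
    fix ts assume "set ts \<subseteq> {..c}" thus "X r (foldr X ts v0) \<in> ?N" using fX[of "r # ts"] that(1) by simp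
  qed (use that(1) in \<open>auto simp: dot_in act_addr act_scale vs.span_zero vs.span_add vs.span_scale\<close>)
  have "gm_submodule C \<nu> M ?N"
  proof (rule submoduleI_cij[OF vs.subspace_span NS])
    show "Ew q v \<in> ?N" if "q \<le> c" "v \<in> ?N" for q v
      using Ew_Sp[OF that(1) pc S_Sp, of v] that NS by (auto simp: vs.span_zero)
    show "X r v \<in> ?N" if "r \<le> c" "v \<in> ?N" for r v using NX that .
  next
    fix r v assume r: "r < c" and v: "v \<in> ?N"
    show "P r v \<in> ?N"
    proof (cases "r = p \<or> Suc r = p")
      case True thus ?thesis using P_ij_zero[OF r True] v NS by (auto simp: vs.span_zero)
    next
      case False
      have g: "P r (foldr X ts v0) \<in> ?N" if "set ts \<subseteq> {..c}" for ts
        using that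
      proof (induction ts)
        case Nil thus ?case by (simp add: P_v0[OF r] vs.span_zero)
      next
        case (Cons t ts)
        let ?w = "foldr X ts v0"
        have w: "?w \<in> S" "?w \<in> ?N" using Cons.prems fS fX by auto
        have "X (transpose r (Suc r) t) (P r ?w) \<in> ?N"
          using Cons r transpose_le[of t r] by (intro NX) auto
        thus ?case using P_X'[OF r _ _ _ w(1), of t] Cons.prems False w(2)
          by (auto intro!: vs.span_add vs.span_neg vs.span_diff)
      qed
      show ?thesis using v
        by (rule ind) (use r g in \<open>auto simp: crs_in act_addr act_scale vs.span_zero vs.span_add vs.span_scale\<close>)
    qed
  next
    fix v d assume v: "v \<in> ?N"
    have fd: "\<exists>e. foldr X ts v0 \<in> gm_part M e" if "set ts \<subseteq> {..c}" for ts
      using that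
    proof (induction ts)
      case (Cons t ts)
      then obtain e where e: "foldr X ts v0 \<in> gm_part M e" by auto
      show ?case
      proof (cases "t = p")
        case True
        hence "foldr X (t # ts) v0 = 0" using X_p_zero fS[of ts] Cons.prems by simp
        thus ?thesis by auto
      next
        case False thus ?thesis using X_deg[OF _ False e] Cons.prems by auto
      qed
    qed (use v0 in auto)
    show "hc M v d \<in> ?N" using v
    proof (rule ind)
      fix ts assume ts: "set ts \<subseteq> {..c}"
      thus "hc M (foldr X ts v0) d \<in> ?N" using fd[OF ts] fX[OF ts] by (auto simp: hc_of_part vs.span_zero)
    qed (auto simp: hc_add hc_scale vs.span_zero vs.span_add vs.span_scale)
  qed
  moreover have "v0 \<in> ?N" using fX[of "[]"] by simp
  ultimately show ?thesis using irr v0(2) by (auto simp: gm_irreducible_def)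
qed

text \<open>
  An interpolation between all monomials, for \<open>r = c + 1\<close>, and the staircase monomials, for \<open>r = 0\<close>.
\<close>

definition Wspan :: "nat \<Rightarrow> 'v set" where
  "Wspan r = vs.span {foldr X ts (mon r a v0) | ts a. set ts \<subseteq> {..<r} \<and> a \<in> stairs r (Suc c - r)}"

lemma Wspan_base: "set ts \<subseteq> {..<r} ==> a \<in> stairs r (Suc c - r) ==> foldr X ts (mon r a v0) \<in> Wspan r"
  unfolding Wspan_def by (rule vs.span_base) blast

lemma Wspan_induct:
  assumes r: "r \<le> Suc c" and v: "v \<in> Wspan r"
    and g: "\<And>ts a. set ts \<subseteq> {..<r} ==> a \<in> stairs r (Suc c - r) ==> foldr X ts (mon r a v0) \<in> S ==> Q (foldr X ts (mon r a v0))"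
    and "Q 0" "\<And>v w. v \<in> S ==> w \<in> S ==> Q v ==> Q w ==> Q (v + w)" "\<And>a v. v \<in> S ==> Q v ==> Q (gm_scale M a v)"
  shows "v \<in> S \<and> Q v"
proof -
  have fS: "foldr X ts (mon r a v0) \<in> S" if "set ts \<subseteq> {..<r}" "a \<in> stairs r (Suc c - r)" for ts a
    using that(1)
  proof (induction ts)
    case Nil show ?case using mon_in[OF that(2) _ v0_S] r by simp
  qed (use r in \<open>auto intro!: X_S\<close>)
  show ?thesis using v unfolding Wspan_def
    by (rule vs.span_inductS) (use assms fS in \<open>auto simp: add_in scale_in\<close>)
qed

lemma Wspan_X_low:
  assumes r: "r \<le> Suc c" and t: "t < r" and v: "v \<in> Wspan r" shows "X t v \<in> Wspan r"
proof -
  have "v \<in> S \<and> X t v \<in> Wspan r" using r v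
  proof (rule Wspan_induct)
    fix ts a assume "set ts \<subseteq> {..<r}" "a \<in> stairs r (Suc c - r)"
    hence "foldr X (t # ts) (mon r a v0) \<in> Wspan r" using t by (intro Wspan_base) auto
    thus "X t (foldr X ts (mon r a v0)) \<in> Wspan r" by simp
  qed (use r t in \<open>auto simp: dot_in act_addr act_scale Wspan_def vs.span_zero vs.span_add vs.span_scale\<close>)
  thus ?thesis by blast
qed

lemma Wspan_hsym:
  assumes r: "r \<le> Suc c" shows "set ls \<subseteq> {..<r} ==> v \<in> Wspan r ==> hsym X k ls v \<in> Wspan r"
proof (induction k ls rule: hsym_induct)
  case (2 k) thus ?case by (simp add: Wspan_def vs.span_zero)
next
  case (3 k l ls)
  thus ?case using Wspan_X_low[OF r, of l] by (auto simp: Wspan_def intro!: vs.span_add)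
qed simp

lemma Wspan_Suc:
  assumes r: "r \<le> c" shows "Wspan (Suc r) \<subseteq> Wspan r"
proof -
  have n: "Suc c - r = Suc (c - r)" "Suc c - Suc r = c - r" "r \<le> Suc c" using r by auto
  note b = block_bounds[OF r]
  have sub: "vs.subspace (Wspan r)" by (simp add: Wspan_def)
  have base: "(X r ^^ k) (mon (Suc r) a v0) \<in> Wspan r" if "k < block_end r - r" "a \<in> stairs (Suc r) (c - r)" for k a
  proof -
    have "k # a \<in> stairs r (Suc c - r)" using that by (auto simp: n(1))
    hence "foldr X [] (mon r (k # a) v0) \<in> Wspan r" by (intro Wspan_base) auto
    thus ?thesis by simp
  qed
  have Xr: "X r v \<in> Wspan r" if v: "v \<in> Wspan r" for v
  proof -
    have "v \<in> S \<and> X r v \<in> Wspan r" using n(3) v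
    proof (rule Wspan_induct)
      fix ts a assume ts: "set ts \<subseteq> {..<r}" and a: "a \<in> stairs r (Suc c - r)"
      then obtain k ks where k: "a = k # ks" "k < block_end r - r" "ks \<in> stairs (Suc r) (c - r)" by (auto simp: n(1))
      let ?w = "mon (Suc r) ks v0"
      have w: "?w \<in> S" using mon_in[OF k(3) _ v0_S] r by simp
      have "(X r ^^ Suc k) ?w \<in> Wspan r"
      proof (cases "Suc k < block_end r - r")
        case True thus ?thesis using base[OF True k(3)] by simp
      next
        case False
        hence e: "Suc k = block_end r - r" using k(2) by simp
        have "(X r ^^ t) (hsym X (Suc k - t) (rev [block_start r..<r]) ?w) \<in> Wspan r" if t: "t < Suc k" for t
        proof -
          have comm: "(X r ^^ t) (hsym X l (rev [block_start r..<r]) ?w) = hsym X l (rev [block_start r..<r]) ((X r ^^ t) ?w)" for l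
          proof (induction t)
            case (Suc t)
            have "set (rev [block_start r..<r]) \<subseteq> {..c}" using r by auto
            thus ?case using Suc D.h_x[of _ r "(X r ^^ t) ?w" l] r X_pow_in[OF r w] by simp
          qed simp
          have "hsym X (Suc k - t) (rev [block_start r..<r]) ((X r ^^ t) ?w) \<in> Wspan r"
            by (rule Wspan_hsym[OF n(3) _ base[OF _ k(3)]]) (use t e in auto)
          thus ?thesis by (simp only: comm)
        qed
        thus ?thesis unfolding X_reduce[OF r w e] by (intro vs.subspace_neg[OF sub] vs.subspace_sum[OF sub]) simp
      qed
      moreover have "X r (foldr X ts (mon r a v0)) = foldr X ts ((X r ^^ Suc k) ?w)"
        using ts
      proof (induction ts)
        case Nil show ?case by (simp add: k(1))
      next
        case (Cons t ts)
        have "foldr X ts (mon r a v0) \<in> S"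
          using Cons.prems mon_in[OF a _ v0_S] r by (induction ts) (auto intro!: X_S)
        thus ?case using Cons r X_X[of r t "foldr X ts (mon r a v0)"] by simp
      qed
      moreover have "foldr X ts u \<in> Wspan r" if "u \<in> Wspan r" for u
        using ts that Wspan_X_low[OF n(3)] by (induction ts) auto
      ultimately show "X r (foldr X ts (mon r a v0)) \<in> Wspan r" by simp
    qed (use r in \<open>auto simp: dot_in act_addr act_scale Wspan_def vs.span_zero vs.span_add vs.span_scale\<close>)
    thus ?thesis by blast
  qed
  show ?thesis unfolding Wspan_def[of "Suc r"]
  proof (rule vs.span_minimal[OF _ sub], safe)
    fix ts a assume ts: "set ts \<subseteq> {..<Suc r}" and a: "a \<in> stairs (Suc r) (Suc c - Suc r)"
    show "foldr X ts (mon (Suc r) a v0) \<in> Wspan r" using ts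
    proof (induction ts)
      case Nil thus ?case using base[of 0 a] a b by simp
    next
      case (Cons t ts)
      thus ?case using Xr Wspan_X_low[OF n(3), of t] by (cases "t = r") auto
    qed
  qed
qed

lemma mon_span: "S = vs.span ((\<lambda>a. mon 0 a v0) ` stairs 0 (Suc c))"
proof -
  have "Wspan (Suc c) \<subseteq> Wspan 0"
  proof -
    have "Wspan (Suc c) \<subseteq> Wspan r" if "r \<le> Suc c" for r
      using that
    proof (induction r rule: inc_induct)
      case (step n) thus ?case using Wspan_Suc[of n] by simp
    qed simp
    thus ?thesis by simp
  qed
  moreover have "Wspan (Suc c) = S"
    unfolding Wspan_def by (subst X_orbit_whole) (auto intro!: arg_cong[of _ _ vs.span] simp: lessThan_Suc_atMost)
  moreover have "Wspan 0 = vs.span ((\<lambda>a. mon 0 a v0) ` stairs 0 (Suc c))"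
    unfolding Wspan_def by (intro arg_cong[of _ _ vs.span]) auto
  moreover have "vs.span ((\<lambda>a. mon 0 a v0) ` stairs 0 (Suc c)) \<subseteq> S"
    by (rule vs.span_minimal[OF _ subspace]) (auto intro!: mon_in simp: v0_S simp del: stairs.simps)
  ultimately show ?thesis by blast
qed

subsection \<open>The staircase monomials are independent\<close>

lemma P_mult_X:
  assumes r: "r < c" "r \<noteq> p" "Suc r \<noteq> p" and ls: "set R \<subseteq> {..c} - {r, Suc r}"
  shows "P r (hsym X (Suc k) (r # R) v0) = hsym X k (Suc r # r # R) v0"
proof -
  have R: "set R \<subseteq> {..c}" "set (Suc r # R) \<subseteq> {..c}" using ls r by auto
  have "P r (hsym X (Suc k) (r # R) v0) = hsym X (Suc k) (Suc r # R) (P r v0) + hsym X k (r # Suc r # R) v0"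
    by (rule D.\<phi>_h_r[where T = S and \<phi> = "P r", OF _ _ _ _ _ _ _ _ _ _ _ ls v0_S])
      (use r subspace P_S P_X' X_S in \<open>auto simp: act_addr crs_in\<close>)
  also have "hsym X (Suc k) (Suc r # R) (P r v0) = 0" using D.h_0[OF R(2), of "Suc k"] P_v0[OF r(1)] by simp
  finally show ?thesis using D.h_swap[of r "Suc r" R v0 k] r R v0_S by simp
qed

text \<open>
  The crossings act as divided differences, each of which lowers the degree of a complete symmetric
  polynomial by one and adds a variable. After \<open>k\<close> of them, \<open>h\<^sub>0 = 1\<close> is left.
\<close>

lemma crossings_lower_power:
  assumes "r \<le> c" "k < block_end r - r" "m \<le> k"
  shows "foldr P (rev [r..<r + m]) ((X r ^^ k) v0) = hsym X (k - m) (rev [r..<Suc (r + m)]) v0"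
  using assms(3)
proof (induction m)
  case 0 show ?case by (simp add: D.h_single)
next
  case (Suc m)
  have ne: "r + m \<noteq> p" "Suc (r + m) \<noteq> p" "r + m < c"
    using assms Suc.prems pc by (auto simp: block_end_def split: if_splits)
  have "foldr P (rev [r..<r + Suc m]) ((X r ^^ k) v0) = P (r + m) (hsym X (Suc (k - Suc m)) ((r + m) # rev [r..<r + m]) v0)"
    using Suc by (simp add: Suc_diff_Suc)
  also have "\<dots> = hsym X (k - Suc m) (Suc (r + m) # (r + m) # rev [r..<r + m]) v0"
    by (rule P_mult_X[OF ne(3,1,2)]) (use ne(3) in auto)
  finally show ?case by simp
qed

lemma crossings_recover: "r \<le> c ==> k < block_end r - r ==> foldr P (rev [r..<r + k]) ((X r ^^ k) v0) = v0"
  using crossings_lower_power[of r k k] by simp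

lemma foldr_P_in: "set ds \<subseteq> {..<c} ==> v \<in> S ==> foldr P ds v \<in> S"
  by (induction ds) (auto intro: P_S)

lemma foldr_P_add: "set ds \<subseteq> {..<c} ==> v \<in> S ==> w \<in> S ==> foldr P ds (v + w) = foldr P ds v + foldr P ds w"
  by (induction ds) (auto simp: act_addr crs_in foldr_P_in)

lemma foldr_P_scale: "set ds \<subseteq> {..<c} ==> v \<in> S ==> foldr P ds (gm_scale M a v) = gm_scale M a (foldr P ds v)"
  by (induction ds) (auto simp: act_scale crs_in foldr_P_in)

lemma foldr_P_0: "set ds \<subseteq> {..<c} ==> foldr P ds 0 = 0"
  using foldr_P_scale[of ds 0 0] by simp

lemma foldr_P_sum: "set ds \<subseteq> {..<c} ==> (\<And>x. x \<in> B ==> f x \<in> S) ==>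
    foldr P ds (\<Sum>x\<in>B. f x) = (\<Sum>x\<in>B. foldr P ds (f x))"
  by (induction B rule: infinite_finite_induct) (auto simp: foldr_P_0 foldr_P_add sum_in)

lemma foldr_P_deg: "set ds \<subseteq> {..<c} ==> v \<in> gm_part M d ==> foldr P ds v \<in> gm_part M (d - int (length ds) * \<Delta>)"
proof (induction ds)
  case (Cons s ds)
  have "P s (foldr P ds v) \<in> gm_part M (d - int (length ds) * \<Delta> - \<Delta>)" using Cons by (intro P_deg) auto
  thus ?case by (simp add: algebra_simps)
qed simp

lemma foldr_P_X: "set ds \<subseteq> {Suc r..<c} ==> v \<in> S ==> foldr P ds ((X r ^^ k) v) = (X r ^^ k) (foldr P ds v)"
proof -
  have one: "foldr P ds (X r v) = X r (foldr P ds v)" if "set ds \<subseteq> {Suc r..<c}" "v \<in> S" for v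
    using that
  proof (induction ds)
    case (Cons s ds)
    let ?w = "foldr P ds v"
    have w: "?w \<in> S" using Cons.prems by (intro foldr_P_in) auto
    have s: "s < c" "Suc r \<le> s" using Cons.prems by auto
    have "P s (X r ?w) = X r (P s ?w)"
    proof (cases "s = p \<or> Suc s = p")
      case True
      thus ?thesis using P_ij_zero[OF s(1) True] w s X_S[of r ?w] by (simp add: dot_in)
    next
      case False thus ?thesis using P_X'[OF s(1), of r ?w] w s by (simp add: transpose_def)
    qed
    thus ?case using Cons by simp
  qed simp
  assume ds: "set ds \<subseteq> {Suc r..<c}" and v: "v \<in> S"
  show ?thesis
  proof (cases ds)
    case (Cons s ds')
    hence r: "r \<le> c" using ds by auto
    show ?thesis
    proof (induction k)
      case (Suc k) thus ?case using one[OF ds X_pow_in[OF r v]] by simp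
    qed simp
  qed simp
qed

lemma X_pow_lin: "r \<le> c ==> v \<in> S ==> w \<in> S ==> (X r ^^ k) (v + w) = (X r ^^ k) v + (X r ^^ k) w"
   "r \<le> c ==> v \<in> S ==> (X r ^^ k) (gm_scale M a v) = gm_scale M a ((X r ^^ k) v)"
  by (induction k) (auto simp: act_addr act_scale dot_in X_pow_in)

lemma X_pow_sum: "r \<le> c ==> (\<And>x. x \<in> B ==> f x \<in> S) ==> (X r ^^ k) (\<Sum>x\<in>B. f x) = (\<Sum>x\<in>B. (X r ^^ k) (f x))"
  using X_pow_lin(2)[of r 0 k 0]
  by (induction B rule: infinite_finite_induct) (auto simp: X_pow_lin(1) sum_in)

text \<open>
  A nonzero homogeneous combination of staircase monomials is mapped by some product of
  crossings to a nonzero multiple of \<open>v0\<close>: among the exponents of the first dot, the smallest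
  one leaves a combination of the highest degree in the other dots, and a product of crossings
  that recovers \<open>v0\<close> from it kills the others for degree reasons.
\<close>

lemma stairs_recover:
  assumes "r + n = Suc c" "b \<in> stairs r n" "sum_list b = N" "f b \<noteq> 0"
  shows "\<exists>ds \<kappa>. set ds \<subseteq> {r..<c} \<and> length ds = N \<and> \<kappa> \<noteq> 0 \<and>
    foldr P ds (\<Sum>a\<in>{a \<in> stairs r n. sum_list a = N}. gm_scale M (f a) (mon r a v0)) = gm_scale M \<kappa> v0"
  using assms
proof (induction n arbitrary: r N f b)
  case 0
  hence "{a \<in> stairs r 0. sum_list a = N} = {[]}" "N = 0" "b = []" by auto
  thus ?case using 0(4) by (intro exI[of _ "[]"] exI[of _ "f []"]) simp
next
  case (Suc n)
  have r: "r \<le> c" "Suc r + n = Suc c" using Suc.prems by auto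
  let ?K = "block_end r - r"
  let ?A = "\<lambda>k. {ks \<in> stairs (Suc r) n. sum_list ks = N - k}"
  let ?Q = "\<lambda>k. k < ?K \<and> k \<le> N \<and> (\<exists>ks\<in>?A k. f (k # ks) \<noteq> 0)"
  let ?s = "\<lambda>k. \<Sum>ks\<in>?A k. gm_scale M (f (k # ks)) (mon (Suc r) ks v0)"
  obtain kb ksb where b: "b = kb # ksb" "kb < ?K" "ksb \<in> stairs (Suc r) n" using Suc.prems(2) by auto
  have "?Q kb" using b Suc.prems(3,4) by auto
  define k0 where "k0 = (LEAST k. ?Q k)"
  have k0: "?Q k0" unfolding k0_def by (rule LeastI[of ?Q kb]) fact
  have min: "\<not> ?Q k" if "k < k0" for k using not_less_Least[of k ?Q] that unfolding k0_def by blast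
  obtain ks0 where ks0: "ks0 \<in> stairs (Suc r) n" "sum_list ks0 = N - k0" "f (k0 # ks0) \<noteq> 0" using k0 by auto
  obtain ds \<kappa> where ds: "set ds \<subseteq> {Suc r..<c}" "length ds = N - k0" "\<kappa> \<noteq> 0"
    and dsk: "foldr P ds (?s k0) = gm_scale M \<kappa> v0"
    using Suc.IH[OF r(2) ks0(1,2), of "\<lambda>ks. f (k0 # ks)"] ks0(3) by blast
  have ds': "set ds \<subseteq> {..<c}" using ds by auto
  have m: "mon (Suc r) ks v0 \<in> S" "mon (Suc r) ks v0 \<in> gm_part M (d0 + int (sum_list ks) * \<Delta>)" if "ks \<in> stairs (Suc r) n" for ks
    using mon_in[OF that r(2) v0_S] mon_deg[OF that r(2) v0(1)] by auto
  have sS: "?s k \<in> S" for k using m by (auto intro!: sum_in scale_in)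
  have sd: "?s k \<in> gm_part M (d0 + int (N - k) * \<Delta>)" for k
    using m(2) by (intro vs.subspace_sum[OF part_subspace] part_scale) fastforce
  have zero: "foldr P ds (?s k) = 0" if k: "k < ?K" "k \<le> N" "k \<noteq> k0" for k
  proof (cases "k < k0")
    case True
    hence "f (k # ks) = 0" if "ks \<in> ?A k" for ks using min[OF True] that k by blast
    hence "?s k = 0" by (intro sum.neutral) auto
    thus ?thesis using foldr_P_0[OF ds'] by simp
  next
    case False
    have "foldr P ds (?s k) \<in> gm_part M (d0 + int (N - k) * \<Delta> - int (N - k0) * \<Delta>)"
      using foldr_P_deg[OF ds' sd[of k]] ds(2) by simp
    moreover have "(int (N - k) - int (N - k0)) * \<Delta> < 0"
      using False k k0 \<Delta>_pos by (intro mult_neg_pos) auto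
    hence "d0 + int (N - k) * \<Delta> - int (N - k0) * \<Delta> < d0" by (simp add: algebra_simps)
    ultimately show ?thesis using low by blast
  qed
  let ?Ks = "{k. k < ?K \<and> k \<le> N}"
  have "(\<Sum>a\<in>{a \<in> stairs r (Suc n). sum_list a = N}. gm_scale M (f a) (mon r a v0)) =
     (\<Sum>(k, ks)\<in>Sigma ?Ks ?A. gm_scale M (f (k # ks)) (mon r (k # ks) v0))"
  proof (rule sum.reindex_bij_witness[of _ "\<lambda>(k, ks). k # ks" "\<lambda>a. (hd a, tl a)"])
    fix b assume "b \<in> Sigma ?Ks ?A"
    then obtain k ks where "b = (k, ks)" "k < ?K" "k \<le> N" "ks \<in> stairs (Suc r) n" "sum_list ks = N - k" by auto
    thus "(case b of (k, ks) \<Rightarrow> k # ks) \<in> {a \<in> stairs r (Suc n). sum_list a = N}" by auto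
  qed auto
  also have "\<dots> = (\<Sum>k\<in>?Ks. \<Sum>ks\<in>?A k. (X r ^^ k) (gm_scale M (f (k # ks)) (mon (Suc r) ks v0)))"
    by (subst sum.Sigma[symmetric]) (auto simp: X_pow_lin(2)[OF r(1) m(1)] intro!: sum.cong)
  also have "\<dots> = (\<Sum>k\<in>?Ks. (X r ^^ k) (?s k))"
    by (intro sum.cong refl X_pow_sum[OF r(1), symmetric]) (auto intro!: scale_in m(1))
  finally have e: "foldr P ds (\<Sum>a\<in>{a \<in> stairs r (Suc n). sum_list a = N}. gm_scale M (f a) (mon r a v0)) =
    (\<Sum>k\<in>?Ks. (X r ^^ k) (foldr P ds (?s k)))"
    using sS by (simp add: foldr_P_sum[OF ds'] X_pow_in r(1) foldr_P_X[OF ds(1)])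
  also have "\<dots> = (\<Sum>k\<in>?Ks. if k = k0 then (X r ^^ k0) (gm_scale M \<kappa> v0) else 0)"
    using zero dsk X_pow_lin(2)[OF r(1) zero_in, of _ 0] by (intro sum.cong) auto
  also have "\<dots> = gm_scale M \<kappa> ((X r ^^ k0) v0)" using k0 X_pow_lin(2)[OF r(1) v0_S] by simp
  finally have f1: "foldr P ds (\<Sum>a\<in>{a \<in> stairs r (Suc n). sum_list a = N}. gm_scale M (f a) (mon r a v0)) =
    gm_scale M \<kappa> ((X r ^^ k0) v0)" .
  let ?es = "rev [r..<r + k0]"
  have es: "set ?es \<subseteq> {r..<c}" using k0 r pc by (auto simp: block_end_def split: if_splits)
  have es': "set ?es \<subseteq> {..<c}" using es by auto
  have "foldr P (?es @ ds) (\<Sum>a\<in>{a \<in> stairs r (Suc n). sum_list a = N}. gm_scale M (f a) (mon r a v0)) =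
     gm_scale M \<kappa> v0"
    using f1 foldr_P_scale[OF es' X_pow_in[OF r(1) v0_S], of \<kappa> k0] crossings_recover[OF r(1), of k0] k0
    by (simp del: stairs.simps)
  moreover have "set (?es @ ds) \<subseteq> {r..<c}" using es ds by auto
  moreover have "length (?es @ ds) = N" using ds(2) k0 by simp
  ultimately show ?case using ds(3) by blast
qed

definition stairs_deg :: "int \<Rightarrow> nat list set" where
  "stairs_deg d = {a \<in> stairs 0 (Suc c). d0 + int (sum_list a) * \<Delta> = d}"

lemma finite_stairs_deg [simp]: "finite (stairs_deg d)"
  by (simp add: stairs_deg_def del: stairs.simps)

lemma stairs_indep:
  assumes "(\<Sum>a\<in>stairs_deg d. gm_scale M (f a) (mon 0 a v0)) = 0" "b \<in> stairs_deg d"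
  shows "f b = 0"
proof (rule ccontr)
  assume fb: "f b \<noteq> 0"
  have b: "b \<in> stairs 0 (Suc c)" "d = d0 + int (sum_list b) * \<Delta>" using assms(2) by (auto simp: stairs_deg_def)
  have e: "stairs_deg d = {a \<in> stairs 0 (Suc c). sum_list a = sum_list b}"
    using \<Delta>_pos b(2) by (auto simp: stairs_deg_def)
  obtain ds \<kappa> where ds: "set ds \<subseteq> {0..<c}" "\<kappa> \<noteq> 0"
    "foldr P ds (\<Sum>a\<in>stairs_deg d. gm_scale M (f a) (mon 0 a v0)) = gm_scale M \<kappa> v0"
    using stairs_recover[OF _ b(1) refl, of f] fb unfolding e by auto
  have "set ds \<subseteq> {..<c}" using ds(1) by auto
  hence "gm_scale M \<kappa> v0 = 0" using assms(1) foldr_P_0[of ds] ds(3) by simp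
  thus False using ds(2) v0(2) by simp
qed

lemma mon_part: "a \<in> stairs_deg d ==> mon 0 a v0 \<in> gm_part M d"
  using mon_deg[of a 0 "Suc c" v0 d0] v0(1) by (auto simp: stairs_deg_def simp del: stairs.simps)

lemma dim_part: "vs.dim (gm_part M d) = card (stairs_deg d)"
proof -
  let ?m = "\<lambda>a. mon 0 a v0"
  have inj: "inj_on ?m (stairs_deg d)"
  proof (rule inj_onI, rule ccontr)
    fix a b assume ab: "a \<in> stairs_deg d" "b \<in> stairs_deg d" "?m a = ?m b" "a \<noteq> b"
    let ?f = "\<lambda>x. if x = a then 1 else if x = b then - 1 else (0 :: 'k)"
    have "(\<Sum>x\<in>stairs_deg d. gm_scale M (?f x) (?m x)) = (\<Sum>x\<in>{a, b}. gm_scale M (?f x) (?m x))"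
      using ab by (intro sum.mono_neutral_right) auto
    also have "\<dots> = 0" using ab by simp
    finally have "?f a = 0" using stairs_indep[of ?f d a] ab by blast
    thus False by simp
  qed
  have "vs.dim (gm_part M d) = card (?m ` stairs_deg d)"
  proof (rule vs.dim_unique[OF _ _ _ refl])
    show "?m ` stairs_deg d \<subseteq> gm_part M d" using mon_part by auto
    show "vs.independent (?m ` stairs_deg d)"
    proof (rule vs.independent_if_scalars_zero)
      fix f x assume f: "(\<Sum>x\<in>?m ` stairs_deg d. gm_scale M (f x) x) = 0" and x: "x \<in> ?m ` stairs_deg d"
      have "(\<Sum>a\<in>stairs_deg d. gm_scale M (f (?m a)) (?m a)) = 0"
        using f sum.reindex[OF inj, of "\<lambda>x. gm_scale M (f x) x"] by (simp only: o_def)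
      thus "f x = 0" using stairs_indep[of "\<lambda>a. f (?m a)"] x by auto
    qed simp
    show "gm_part M d \<subseteq> vs.span (?m ` stairs_deg d)"
    proof
      fix v assume v: "v \<in> gm_part M d"
      hence "v \<in> vs.span (?m ` stairs 0 (Suc c))" using part_in mon_span by blast
      hence "v \<in> S \<and> hc M v d \<in> vs.span (?m ` stairs_deg d)"
      proof (rule vs.span_inductS)
        fix x assume "x \<in> ?m ` stairs 0 (Suc c)"
        then obtain a where a: "a \<in> stairs 0 (Suc c)" "x = ?m a" by blast
        let ?d = "d0 + int (sum_list a) * \<Delta>"
        have "a \<in> stairs_deg ?d" using a by (simp add: stairs_deg_def)
        hence "x \<in> gm_part M ?d" using mon_part a by simp
        thus "x \<in> S \<and> hc M x d \<in> vs.span (?m ` stairs_deg d)"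
          using \<open>a \<in> stairs_deg ?d\<close> a(2) by (auto simp: hc_of_part part_in vs.span_zero intro!: vs.span_base)
      qed (auto simp: hc_add hc_scale vs.span_zero vs.span_add vs.span_scale add_in scale_in)
      thus "v \<in> vs.span (?m ` stairs_deg d)" using hc_of_part[OF v] by simp
    qed
  qed
  thus ?thesis using card_image[OF inj] by simp
qed

lemma gdim_stairs: "gm_gdim M S = (\<Sum>a\<in>stairs 0 (Suc c). single (d0 + int (sum_list a) * \<Delta>) 1)"
proof (rule poly_mapping_eqI)
  fix d
  have ps: "gm_part M d \<inter> S = gm_part M d" using part_subset by blast
  have "lookup (gm_gdim M S) d = int (vs.dim (gm_part M d))"
    using lookup_gdim[OF zero_in, of d] ps by simp
  also have "\<dots> = (\<Sum>a\<in>stairs 0 (Suc c). if d0 + int (sum_list a) * \<Delta> = d then 1 else 0)"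
    unfolding dim_part stairs_deg_def by (simp add: sum.If_cases Int_def del: stairs.simps)
  also have "\<dots> = lookup (\<Sum>a\<in>stairs 0 (Suc c). single (d0 + int (sum_list a) * \<Delta>) 1) d"
    by (auto simp: lookup_sum lookup_single when_def intro!: sum.cong simp del: stairs.simps)
  finally show "lookup (gm_gdim M S) d = \<dots>" .
qed

end
end

context cij_irr
begin

lemma lowest_vector:
  obtains v0 d0 where "v0 \<in> gm_part M d0" "v0 \<noteq> 0" "\<And>d. d < d0 ==> gm_part M d = {0}"
proof -
  let ?D = "{d. gm_part M d \<noteq> {0}}"
  obtain w where w: "w \<in> S" "w \<noteq> 0" using irr by (auto simp: gm_irreducible_def)
  obtain d where "hc M w d \<noteq> 0" "hc M w d \<in> gm_part M d" using homogE[OF w] .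
  hence ne: "?D \<noteq> {}" by blast
  have "Min ?D \<in> ?D" using Min_in[OF finite_parts ne] .
  then obtain v0 where v0: "v0 \<in> gm_part M (Min ?D)" "v0 \<noteq> 0" using part_zero by blast
  have "gm_part M d = {0}" if "d < Min ?D" for d
    using Min_le[OF finite_parts, of d] that by force
  thus thesis using that v0 by blast
qed

end

section \<open>Characters\<close>

text \<open>The quantum integer normalised to have lowest term 1.\<close>

definition qnat :: "int \<Rightarrow> nat \<Rightarrow> laurent" where
  "qnat e m = (\<Sum>k<m. single (int k * e) 1)"

lemma laurent_shift_sum: "(\<Sum>x\<in>A. single (e + f x) 1) = single e 1 * (\<Sum>x\<in>A. single (f x) (1::int))"
  by (simp add: sum_distrib_left mult_single)

lemma (in cartan_datum) qnat_qint: "qnat (rform C i i) m = single (rform C i i div 2 * (int m - 1)) 1 * qint C i m"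
proof -
  let ?\<delta> = "rform C i i div 2"
  have d: "rform C i i = 2 * ?\<delta>" using root_even[of i] by simp
  have "qnat (rform C i i) m = (\<Sum>k<m. single (int (m - Suc k) * rform C i i) 1)"
    unfolding qnat_def by (rule sum.nat_diff_reindex[symmetric])
  also have "\<dots> = (\<Sum>k<m. single (?\<delta> * (int m - 1) + ?\<delta> * (int m - 1 - 2 * int k)) 1)"
    by (intro sum.cong refl arg_cong2[of _ _ _ _ single]) (subst d, simp add: algebra_simps of_nat_diff)
  also have "\<dots> = single (?\<delta> * (int m - 1)) 1 * qint C i m"
    unfolding qint_def by (rule laurent_shift_sum)
  finally show ?thesis .
qed

lemma (in cartan_datum) prod_qnat: "\<exists>e. (\<Prod>t=1..m. qnat (rform C i i) t) = single e 1 * qfact C i m"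
proof (induction m)
  case 0 show ?case by (intro exI[of _ 0]) (simp add: qfact_def)
next
  case (Suc m)
  then obtain e where e: "(\<Prod>t=1..m. qnat (rform C i i) t) = single e 1 * qfact C i m" by blast
  let ?e = "rform C i i div 2 * (int (Suc m) - 1)"
  have "(\<Prod>t=1..Suc m. qnat (rform C i i) t) =
     (single e 1 * qfact C i m) * (single ?e 1 * qint C i (Suc m))"
    unfolding e[symmetric] qnat_qint[symmetric] by (simp del: of_nat_Suc)
  also have "\<dots> = (single e 1 * single ?e 1) * (qfact C i m * qint C i (Suc m))"
    by (simp only: ac_simps)
  also have "\<dots> = single (e + ?e) 1 * qfact C i (Suc m)"
    unfolding mult_single qfact_def by simp
  finally have "(\<Prod>t=1..Suc m. qnat (rform C i i) t) = single (e + ?e) 1 * qfact C i (Suc m)" .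
  thus ?case by blast
qed

context cij_irr
begin

lemma sum_stairs: "(\<Sum>a\<in>stairs r n. single (int (sum_list a) * \<Delta>) (1::int)) = (\<Prod>s=r..<r + n. qnat \<Delta> (block_end s - s))"
proof (induction n arbitrary: r)
  case (Suc n)
  have "(\<Sum>a\<in>stairs r (Suc n). single (int (sum_list a) * \<Delta>) (1::int)) =
    (\<Sum>(k, ks)\<in>{..<block_end r - r} \<times> stairs (Suc r) n. single (int k * \<Delta>) 1 * single (int (sum_list ks) * \<Delta>) 1)"
    by (simp, subst sum.reindex) (auto simp: inj_on_def mult_single algebra_simps intro!: sum.cong)
  also have "\<dots> = qnat \<Delta> (block_end r - r) * (\<Sum>ks\<in>stairs (Suc r) n. single (int (sum_list ks) * \<Delta>) 1)"
    unfolding qnat_def sum_product sum.cartesian_product by simp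
  also have "\<dots> = (\<Prod>s=r..<r + Suc n. qnat \<Delta> (block_end s - s))"
    unfolding Suc by (subst prod.atLeast_Suc_lessThan[of r]) auto
  finally show ?case .
qed simp

lemma prod_blocks: "(\<Prod>s=0..<Suc c. qnat \<Delta> (block_end s - s)) = (\<Prod>t=1..p. qnat \<Delta> t) * (\<Prod>t=1..c - p. qnat \<Delta> t)"
proof -
  let ?g = "\<lambda>s. qnat \<Delta> (block_end s - s)"
  have "(\<Prod>s=0..<Suc c. ?g s) = (\<Prod>s=0..<p. ?g s) * (\<Prod>s=p..<Suc c. ?g s)"
    by (rule prod.atLeastLessThan_concat[symmetric]) (use pc in auto)
  also have "(\<Prod>s=p..<Suc c. ?g s) = ?g p * (\<Prod>s=Suc p..<Suc c. ?g s)"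
    by (rule prod.atLeast_Suc_lessThan) (use pc in auto)
  also have "?g p = 1" by (simp add: block_end_def qnat_def)
  also have "(\<Prod>s=0..<p. ?g s) = (\<Prod>t=1..p. qnat \<Delta> t)"
    by (rule prod.reindex_bij_witness[of _ "\<lambda>t. p - t" "\<lambda>s. p - s"]) (auto simp: block_end_def)
  also have "(\<Prod>s=Suc p..<Suc c. ?g s) = (\<Prod>t=1..c - p. qnat \<Delta> t)"
    by (rule prod.reindex_bij_witness[of _ "\<lambda>t. Suc c - t" "\<lambda>s. Suc c - s"]) (auto simp: block_end_def)
  finally show ?thesis by simp
qed

text \<open>
  The exponents of a staircase monomial vary independently, so its generating function is a product
  of quantum integers, two quantum factorials up to a shift.
\<close>

lemma gdim_irr: "\<exists>e. gm_gdim M S = single e 1 * (qfact C i p * qfact C i (c - p))"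
proof -
  obtain v0 d0 where v0: "v0 \<in> gm_part M d0" "v0 \<noteq> 0" "\<And>d. d < d0 ==> gm_part M d = {0}"
    using lowest_vector by blast
  obtain e1 where e1: "(\<Prod>t=1..p. qnat \<Delta> t) = single e1 1 * qfact C i p" using prod_qnat by blast
  obtain e2 where e2: "(\<Prod>t=1..c - p. qnat \<Delta> t) = single e2 1 * qfact C i (c - p)" using prod_qnat by blast
  have "gm_gdim M S = (\<Sum>a\<in>stairs 0 (Suc c). single (d0 + int (sum_list a) * \<Delta>) 1)"
    by (rule gdim_stairs[OF v0])
  also have "\<dots> = single d0 1 * (\<Sum>a\<in>stairs 0 (Suc c). single (int (sum_list a) * \<Delta>) 1)"
    by (rule laurent_shift_sum)
  also have "\<dots> = single d0 1 * (\<Prod>s=0..<0 + Suc c. qnat \<Delta> (block_end s - s))"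
    by (simp only: sum_stairs)
  also have "\<dots> = single d0 1 * ((single e1 1 * qfact C i p) * (single e2 1 * qfact C i (c - p)))"
    using prod_blocks e1 e2 by simp
  also have "\<dots> = (single d0 1 * single e1 1 * single e2 1) * (qfact C i p * qfact C i (c - p))"
    by (simp only: ac_simps)
  also have "\<dots> = single (d0 + e1 + e2) 1 * (qfact C i p * qfact C i (c - p))"
    by (simp add: mult_single)
  finally show ?thesis by blast
qed

end

lemma gdim_shift: "gm_gdim (gm_shift k M) U = single k 1 * gm_gdim M U"
proof -
  have "(\<Sum>d | gm_part M (d - k) \<inter> U \<noteq> {0}. single d (int (vector_space.dim (gm_scale M) (gm_part M (d - k) \<inter> U)))) =
    (\<Sum>d | gm_part M d \<inter> U \<noteq> {0}. single (k + d) (int (vector_space.dim (gm_scale M) (gm_part M d \<inter> U))))"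
    by (rule sum.reindex_bij_witness[of _ "\<lambda>d. k + d" "\<lambda>d. d - k"]) auto
  thus ?thesis by (simp add: gm_gdim_def sum_distrib_left mult_single)
qed

lemma (in klr_module) gdim_zero: "gm_gdim M {0} = 0"
proof -
  have "{d. gm_part M d \<inter> {0} \<noteq> {0}} = {}" by auto
  thus ?thesis unfolding gm_gdim_def by simp
qed

lemma (in klr_module) idem_space_concentrated:
  assumes "concentrated C \<nu> M w" "u \<in> seqs \<nu>"
  shows "idem_space C \<nu> M u = (if u = w then S else {0})"
proof (cases "u = w")
  case True thus ?thesis unfolding idem_space_eq using concentrated_E[OF assms] by simp
next
  case False
  hence "E u ` S = (\<lambda>_. 0) ` S" using concentrated_E[OF assms] by (intro image_cong) auto
  thus ?thesis unfolding idem_space_eq using False image_constant[OF zero_in] by simp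
qed

lemma ch_concentrated:
  assumes M: "klr_module C \<nu> M" and c: "concentrated C \<nu> M w"
  shows "gm_ch C \<nu> M = single w (gm_gdim M (gm_space M))"
proof -
  interpret klr_module C \<nu> M by fact
  have w: "w \<in> seqs \<nu>" using c by (simp add: concentrated_def)
  have "gm_ch C \<nu> M = (\<Sum>u\<in>seqs \<nu>. if u = w then single w (gm_gdim M S) else 0)"
    unfolding gm_ch_def by (rule sum.cong) (simp_all add: idem_space_concentrated[OF c] gdim_zero)
  thus ?thesis using w by simp
qed

lemma concentrated_shift [simp]: "concentrated C \<nu> (gm_shift k M) w \<longleftrightarrow> concentrated C \<nu> M w"
  by (simp add: concentrated_def)

lemma (in cij_irr) ch_irr: "\<exists>k. gm_ch C \<nu> (gm_shift k M) = single (word p) (qfact C i p * qfact C i (c - p))"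
proof -
  obtain e where e: "gm_gdim M S = single e 1 * (qfact C i p * qfact C i (c - p))" using gdim_irr by blast
  have "gm_gdim (gm_shift (- e) M) S = (single (- e) 1 * single e 1) * (qfact C i p * qfact C i (c - p))"
    unfolding gdim_shift e by (simp only: mult.assoc)
  hence "gm_gdim (gm_shift (- e) M) S = qfact C i p * qfact C i (c - p)" by (simp add: mult_single)
  thus ?thesis using ch_concentrated[OF shift_module, of "- e" "word p"] conc by auto
qed

section \<open>Uniqueness\<close>

text \<open>The submodule of \<open>M \<oplus> L\<close> generated by a pair of lowest vectors, degree by degree.\<close>

inductive dot_pairs ::
    "('i, 'p) cartan_data \<Rightarrow> 'i multiset \<Rightarrow> nat \<Rightarrow> nat \<Rightarrow> int
     \<Rightarrow> (('i, 'k::field) klr_elem, 'k, 'v::ab_group_add) gmodule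
     \<Rightarrow> (('i, 'k) klr_elem, 'k, 'w::ab_group_add) gmodule \<Rightarrow> 'v \<Rightarrow> 'w \<Rightarrow> int \<Rightarrow> int \<Rightarrow> 'v \<Rightarrow> 'w \<Rightarrow> bool"
  for C \<nu> c p e M L v w d0 where
  base: "dot_pairs C \<nu> c p e M L v w d0 d0 v w"
| zero: "dot_pairs C \<nu> c p e M L v w d0 d 0 0"
| add: "dot_pairs C \<nu> c p e M L v w d0 d a b ==> dot_pairs C \<nu> c p e M L v w d0 d a' b' ==>
    dot_pairs C \<nu> c p e M L v w d0 d (a + a') (b + b')"
| scale: "dot_pairs C \<nu> c p e M L v w d0 d a b ==>
    dot_pairs C \<nu> c p e M L v w d0 d (gm_scale M x a) (gm_scale L x b)"
| dot: "dot_pairs C \<nu> c p e M L v w d0 d a b ==> r \<le> c ==> r \<noteq> p ==>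
    dot_pairs C \<nu> c p e M L v w d0 (d + e) (gact C \<nu> M (dot r) a) (gact C \<nu> L (dot r) b)"

text \<open>
  In the lowest degree \<open>d0\<close> the pairs in \<open>dot_pairs\<close> are multiples of \<open>(v, w)\<close>, since dots raise the degree.
  They are closed under crossings by the relation between dots and crossings.
\<close>

lemma cij_irr_unique:
  fixes M :: "(('i, 'k::field) klr_elem, 'k, 'v::ab_group_add) gmodule"
    and L :: "(('i, 'k) klr_elem, 'k, 'w::ab_group_add) gmodule"
  assumes "cij_irr C i j c \<nu> M p" "cij_irr C i j c \<nu> L p"
  shows "\<exists>k. gm_iso C \<nu> M (gm_shift k L)"
proof -
  interpret M: cij_irr C i j c \<nu> M p by fact
  interpret L: cij_irr C i j c \<nu> L p by fact
  obtain v d0 where v: "v \<in> gm_part M d0" "v \<noteq> 0" "\<And>d. d < d0 ==> gm_part M d = {0}"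
    using M.lowest_vector by blast
  obtain w e0 where w: "w \<in> gm_part L e0" "w \<noteq> 0" "\<And>d. d < e0 ==> gm_part L d = {0}"
    using L.lowest_vector by blast
  let ?k = "d0 - e0"
  let ?D = "rform C i i"
  let ?G = "dot_pairs C \<nu> c p ?D M L v w d0"
  have Gin: "a \<in> gm_part M d \<and> b \<in> gm_part L (d - ?k)" if "?G d a b" for d a b
    using that
  proof (induction rule: dot_pairs.induct)
    case (dot d a b r)
    have "M.X r a \<in> gm_part M (d + ?D)" using dot by (intro M.X_deg) auto
    moreover have "L.X r b \<in> gm_part L (d - ?k + ?D)" using dot by (intro L.X_deg) auto
    ultimately show ?case by (simp add: algebra_simps)
  qed (use v w in \<open>auto intro: M.part_add L.part_add M.part_scale L.part_scale\<close>)
  have GS: "a \<in> M.S" "b \<in> L.S" if "?G d a b" for d a b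
    using Gin[OF that] M.part_in L.part_in by auto
  have Gline: "(d < d0 \<longrightarrow> a = 0 \<and> b = 0) \<and> (d = d0 \<longrightarrow> (\<exists>x. a = gm_scale M x v \<and> b = gm_scale L x w))" if "?G d a b" for d a b
    using that
  proof (induction rule: dot_pairs.induct)
    case base show ?case by (auto intro!: exI[of _ 1])
  next
    case zero show ?case by (auto intro!: exI[of _ 0])
  next
    case (add d a b a' b')
    show ?case using add.IH by (auto simp flip: M.vs.scale_left_distrib L.vs.scale_left_distrib)
  next
    case (scale d a b x)
    show ?case using scale.IH by auto
  next
    case (dot d a b r)
    thus ?case using M.\<Delta>_pos by (auto simp: dot_in intro!: exI[of _ 0])
  qed
  have GP: "?G (d - ?D) (M.P r a) (L.P r b)" if "?G d a b" "r < c" for d a b r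
    using that
  proof (induction rule: dot_pairs.induct)
    case base
    thus ?case using M.P_v0[OF v] L.P_v0[OF w] by (simp add: dot_pairs.zero)
  next
    case zero thus ?case by (simp add: crs_in dot_pairs.zero)
  next
    case (add d a b a' b')
    thus ?case using GS[OF add(1)] GS[OF add(2)] by (simp add: M.act_addr L.act_addr crs_in dot_pairs.add)
  next
    case (scale d a b x)
    thus ?case using GS[OF scale(1)] by (simp add: M.act_scale L.act_scale crs_in dot_pairs.scale)
  next
    case (dot d a b t)
    note S = GS[OF dot(1)]
    show ?case
    proof (cases "r = p \<or> Suc r = p")
      case True
      thus ?thesis using M.P_ij_zero[OF dot(5) True M.X_S[OF dot(2) S(1)]] L.P_ij_zero[OF dot(5) True L.X_S[OF dot(2) S(2)]]
        by (simp add: dot_pairs.zero)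
    next
      case False
      let ?t = "transpose r (Suc r) t"
      have t: "?t \<le> c" "?t \<noteq> p" using dot False by (auto simp: transpose_def)
      have "?G (d - ?D + ?D) (M.X ?t (M.P r a)) (L.X ?t (L.P r b))"
        by (rule dot_pairs.dot[OF dot(4)[OF dot(5)] t])
      hence 1: "?G d (M.X ?t (M.P r a)) (L.X ?t (L.P r b))" by simp
      have neg: "?G d (- a) (- b)" using dot_pairs.scale[OF dot(1), of "- 1"] by simp
      consider (l) "t = r" | (r) "t = Suc r" | (o) "t \<noteq> r" "t \<noteq> Suc r" by blast
      thus ?thesis
      proof cases
        case l thus ?thesis using dot_pairs.add[OF 1 dot(1)] M.P_X'[OF dot(5) dot(2) _ _ S(1)] L.P_X'[OF dot(5) dot(2) _ _ S(2)] False by simp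
      next
        case r thus ?thesis using dot_pairs.add[OF 1 neg] M.P_X'[OF dot(5) dot(2) _ _ S(1)] L.P_X'[OF dot(5) dot(2) _ _ S(2)] False by simp
      next
        case o thus ?thesis using 1 M.P_X'[OF dot(5) dot(2) _ _ S(1)] L.P_X'[OF dot(5) dot(2) _ _ S(2)] False by simp
      qed
    qed
  qed
  define H where "H a b \<longleftrightarrow> a \<in> M.S \<and> b \<in> L.S \<and> (\<forall>d. ?G d (hc M a d) (hc L b (d - ?k)))" for a b
  have "gm_iso C \<nu> M (gm_shift ?k L)"
  proof (rule iso_from_graph[OF M.irr L.irr, where G = H and v = v and w = w and ?d0.0 = d0])
    show "H 0 0" by (simp add: H_def dot_pairs.zero)
    show "H (a + a') (b + b')" if "H a b" "H a' b'" for a b a' b'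
      using that by (simp add: H_def M.add_in L.add_in M.hc_add L.hc_add dot_pairs.add)
    show "H (gm_scale M x a) (gm_scale L x b)" if "H a b" for x a b
      using that by (simp add: H_def M.scale_in L.scale_in M.hc_scale L.hc_scale dot_pairs.scale)
    show "H (hc M a d) (hc L b (d - ?k))" if "H a b" for a b d
    proof -
      have ab: "a \<in> M.S" "b \<in> L.S" "?G d (hc M a d) (hc L b (d - ?k))" using that by (auto simp: H_def)
      show ?thesis unfolding H_def
        using ab M.hc_of_part[OF M.hc_part[OF ab(1)], of d] L.hc_of_part[OF L.hc_part[OF ab(2)], of "d - ?k"]
        by (auto simp: M.hc_in L.hc_in dot_pairs.zero)
    qed
    show "H v w" unfolding H_def using M.hc_of_part[OF v(1)] L.hc_of_part[OF w(1)] M.part_in[OF v(1)] L.part_in[OF w(1)]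
      by (auto simp: dot_pairs.zero dot_pairs.base)
    show "w \<in> gm_part L (d0 - ?k)" using w(1) by simp
    show "\<exists>x. a = gm_scale M x v \<and> b = gm_scale L x w" if "H a b" "a \<in> gm_part M d0" "b \<in> gm_part L (d0 - ?k)" for a b
    proof -
      have "\<forall>d. ?G d (hc M a d) (hc L b (d - ?k))" using that(1) unfolding H_def by (elim conjE)
      hence "?G d0 (hc M a d0) (hc L b (d0 - ?k))" by (rule spec)
      hence "?G d0 a b" using M.hc_of_part[OF that(2)] L.hc_of_part[OF that(3)] by simp
      thus ?thesis using Gline by blast
    qed
    fix g a b assume g: "g \<in> klr_gens \<nu>" and H: "H a b"
    hence ab: "a \<in> M.S" "b \<in> L.S" and G: "\<And>d. ?G d (hc M a d) (hc L b (d - ?k))" by (auto simp: H_def)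
    show "H (M.act (gen g) a) (L.act (gen g) b)" using g
    proof (cases rule: M.gens_cases)
      case (1 q)
      show ?thesis
        using M.Ew_Sp[OF 1(2) M.pc M.S_Sp[OF ab(1)]] L.Ew_Sp[OF 1(2) L.pc L.S_Sp[OF ab(2)]] H \<open>H 0 0\<close> 1(1)
        by (simp flip: idemp_gen split: if_splits)
    next
      case (2 r)
      show ?thesis
      proof (cases "r = p")
        case True thus ?thesis using M.X_p_zero[OF ab(1)] L.X_p_zero[OF ab(2)] \<open>H 0 0\<close> 2 by (simp flip: dot_gen)
      next
        case False
        have "?G (d + ?D) (hc M (M.X r a) (d + ?D)) (hc L (L.X r b) (d - ?k + ?D))" for d
        proof -
          have "hc M (M.X r a) (d + ?D) = M.X r (hc M a d)"
            by (rule M.hc_map) (use 2 False ab M.X_deg in \<open>auto simp: M.act_addr dot_in\<close>)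
          moreover have "hc L (L.X r b) (d - ?k + ?D) = L.X r (hc L b (d - ?k))"
            by (rule L.hc_map) (use 2 False ab L.X_deg in \<open>auto simp: L.act_addr dot_in\<close>)
          ultimately show ?thesis using dot_pairs.dot[OF G[of d] 2(2) False] by simp
        qed
        from this[of "d - ?D" for d] have "?G d (hc M (M.X r a) d) (hc L (L.X r b) (d - ?k))" for d
          by (simp add: algebra_simps)
        thus ?thesis using ab 2 by (simp add: H_def M.X_S L.X_S flip: dot_gen)
      qed
    next
      case (3 r)
      have "?G (d - ?D) (hc M (M.P r a) (d + - ?D)) (hc L (L.P r b) (d - ?k + - ?D))" for d
      proof -
        have "hc M (M.P r a) (d + - ?D) = M.P r (hc M a d)"
          by (rule M.hc_map) (use 3 ab M.P_deg in \<open>auto simp: M.act_addr crs_in\<close>)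
        moreover have "hc L (L.P r b) (d - ?k + - ?D) = L.P r (hc L b (d - ?k))"
          by (rule L.hc_map) (use 3 ab L.P_deg in \<open>auto simp: L.act_addr crs_in\<close>)
        ultimately show ?thesis using GP[OF G[of d] 3(2)] by simp
      qed
      from this[of "d + ?D" for d] have "?G d (hc M (M.P r a) d) (hc L (L.P r b) (d - ?k))" for d
        by (simp add: algebra_simps)
      thus ?thesis using ab 3 by (simp add: H_def M.P_S L.P_S flip: crs_gen)
    qed
  qed (use v w in \<open>auto simp: H_def\<close>)
  thus ?thesis by blast
qed

section \<open>Functionals on polynomial functions\<close>

text \<open>
  Polynomial functions by degree, restricted to points with distinct coordinates so that divided
  differences are honest quotients.
\<close>

inductive polyfun :: "nat \<Rightarrow> ((nat \<Rightarrow> 'k::field) \<Rightarrow> 'k) \<Rightarrow> bool" where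
  one: "polyfun 0 (\<lambda>z. if inj z then 1 else 0)"
| zero: "polyfun d (\<lambda>z. 0)"
| add: "polyfun d f ==> polyfun d g ==> polyfun d (\<lambda>z. f z + g z)"
| scale: "polyfun d f ==> polyfun d (\<lambda>z. c * f z)"
| var: "polyfun d f ==> polyfun (Suc d) (\<lambda>z. z t * f z)"

definition swap_pt :: "nat \<Rightarrow> (nat \<Rightarrow> 'k) \<Rightarrow> nat \<Rightarrow> 'k" where
  "swap_pt r z = z \<circ> transpose r (Suc r)"

definition ddiff :: "nat \<Rightarrow> ((nat \<Rightarrow> 'k::field) \<Rightarrow> 'k) \<Rightarrow> (nat \<Rightarrow> 'k) \<Rightarrow> 'k" where
  "ddiff r f z = (f z - f (swap_pt r z)) / (z r - z (Suc r))"

lemma swap_pt_apply: "swap_pt r z l = z (transpose r (Suc r) l)"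
  by (simp add: swap_pt_def)

lemma swap_pt_swap_pt [simp]: "swap_pt r (swap_pt r z) = z"
  by (auto simp: swap_pt_def fun_eq_iff)

lemma inj_swap_pt [simp]: "inj (swap_pt r z) \<longleftrightarrow> inj z"
proof -
  have 1: "inj (swap_pt r z)" if "inj z" for z :: "nat \<Rightarrow> 'b"
    unfolding swap_pt_def using that by (intro inj_compose) auto
  from 1[of z] 1[of "swap_pt r z"] show ?thesis by auto
qed

lemma swap_pt_braid: "swap_pt r (swap_pt (Suc r) (swap_pt r z)) = swap_pt (Suc r) (swap_pt r (swap_pt (Suc r) z))"
  by (auto simp: swap_pt_def fun_eq_iff transpose_def)

lemma swap_pt_far: "Suc r < t ==> swap_pt r (swap_pt t z) = swap_pt t (swap_pt r z)"
  by (auto simp: swap_pt_def fun_eq_iff transpose_def)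

lemma polyfun_supp: "polyfun d f ==> \<not> inj z ==> f z = 0"
  by (induction rule: polyfun.induct) auto

lemma inj_neq: "inj z ==> l \<noteq> m ==> z l \<noteq> z m"
  by (auto dest: injD)

lemma ddiff_var:
  assumes "\<And>z. \<not> inj z ==> f z = 0"
  shows "ddiff r (\<lambda>z. z t * f z) = (\<lambda>z. z (transpose r (Suc r) t) * ddiff r f z + (if t = r then f z else if t = Suc r then - f z else 0))"
proof
  fix z :: "nat \<Rightarrow> 'a"
  show "ddiff r (\<lambda>z. z t * f z) z = z (transpose r (Suc r) t) * ddiff r f z + (if t = r then f z else if t = Suc r then - f z else 0)"
  proof (cases "inj z")
    case True
    hence "z r - z (Suc r) \<noteq> 0" using inj_neq[OF True, of r "Suc r"] by simp
    thus ?thesis by (auto simp: ddiff_def swap_pt_apply field_simps)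
  next
    case False thus ?thesis using assms[of z] assms[of "swap_pt r z"] by (simp add: ddiff_def)
  qed
qed

lemma ddiff_add: "ddiff r (\<lambda>z. f z + g z) = (\<lambda>z. ddiff r f z + ddiff r g z)"
  by (auto simp: ddiff_def fun_eq_iff diff_divide_distrib add_divide_distrib)

lemma ddiff_scale: "ddiff r (\<lambda>z. c * f z) = (\<lambda>z. c * ddiff r f z)"
  by (auto simp: ddiff_def fun_eq_iff right_diff_distrib[symmetric])

lemma ddiff_zero [simp]: "ddiff r (\<lambda>z. 0) = (\<lambda>z. 0)"
  by (simp add: ddiff_def fun_eq_iff)

lemma ddiff_sq: "ddiff r (ddiff r f) = (\<lambda>z. 0)"
proof
  fix z
  have "ddiff r f (swap_pt r z) = ddiff r f z"
    by (simp add: ddiff_def swap_pt_apply) (metis minus_diff_eq minus_divide_divide)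
  thus "ddiff r (ddiff r f) z = 0" unfolding ddiff_def[of r "ddiff r f"] by simp
qed

lemma ddiff_far:
  assumes "Suc r < t" shows "ddiff r (ddiff t f) = ddiff t (ddiff r f)"
  by (rule ext) (use assms in \<open>simp add: ddiff_def swap_pt_apply swap_pt_far[OF assms] transpose_def
    diff_divide_distrib mult.commute\<close>)

text \<open>
  Both sides are the alternating sum over the six permutations of three coordinates, divided by the
  same product of differences.
\<close>

lemma ddiff_braid:
  assumes "\<And>z. \<not> inj z ==> f z = 0"
  shows "ddiff r (ddiff (Suc r) (ddiff r f)) = ddiff (Suc r) (ddiff r (ddiff (Suc r) f))"
proof
  fix z :: "nat \<Rightarrow> 'a"
  show "ddiff r (ddiff (Suc r) (ddiff r f)) z = ddiff (Suc r) (ddiff r (ddiff (Suc r) f)) z"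
  proof (cases "inj z")
    case False thus ?thesis using assms by (simp add: ddiff_def)
  next
    case True
    let ?a = "z r" and ?b = "z (Suc r)" and ?c = "z (Suc (Suc r))"
    have n: "?a - ?b \<noteq> 0" "?b - ?c \<noteq> 0" "?a - ?c \<noteq> 0"
      using inj_neq[OF True] by auto
    have alg: "((f1 - f2) / (a - b) - (f3 - f4) / (a - c)) / (b - c) - ((f2 - f1) / (b - a) - (f5 - f6) / (b - c)) / (a - c)
        = (a - b) * ((((f1 - f3) / (b - c) - (f2 - f5) / (a - c)) / (a - b) - ((f3 - f1) / (c - b) - (f4 - f6) / (a - b)) / (a - c)) / (b - c))"
      if "a - b \<noteq> 0" "b - c \<noteq> 0" "a - c \<noteq> 0" for a b c f1 f2 f3 f4 f5 f6 :: 'a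
    proof -
      have s: "b - a = - (a - b)" "c - b = - (b - c)" by auto
      define x y where "x = a - b" and "y = b - c"
      have xy: "a - c = x + y" by (simp add: x_def y_def)
      show ?thesis using that unfolding s xy x_def[symmetric] y_def[symmetric]
        by (simp add: divide_simps) (simp add: algebra_simps)
    qed
    have swaps: "swap_pt r (swap_pt (Suc r) (swap_pt r z)) = swap_pt (Suc r) (swap_pt r (swap_pt (Suc r) z))"
      by (rule swap_pt_braid)
    show ?thesis
      using n alg[OF n, of "f z" "f (swap_pt r z)" "f (swap_pt (Suc r) z)" "f (swap_pt r (swap_pt (Suc r) z))"
          "f (swap_pt (Suc r) (swap_pt r z))" "f (swap_pt r (swap_pt (Suc r) (swap_pt r z)))"]
      by (simp add: ddiff_def[of _ "ddiff _ _"] ddiff_def[of _ f] swap_pt_apply transpose_def swaps)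
  qed
qed

lemma polyfun_ddiff: "polyfun d f ==> (d = 0 \<longrightarrow> ddiff r f = (\<lambda>z. 0)) \<and> (\<forall>d'. d = Suc d' \<longrightarrow> polyfun d' (ddiff r f))"
proof (induction rule: polyfun.induct)
  case one
  show ?case by (auto simp: ddiff_def fun_eq_iff)
next
  case (add d f g) thus ?case by (auto simp: ddiff_add intro: polyfun.add)
next
  case (scale d f c) thus ?case by (auto simp: ddiff_scale intro: polyfun.scale)
next
  case (var d f t)
  have "polyfun d (\<lambda>z. z (transpose r (Suc r) t) * ddiff r f z)"
  proof (cases d)
    case 0 thus ?thesis using var.IH by (simp add: polyfun.zero)
  next
    case (Suc d') thus ?thesis using var.IH by (auto intro: polyfun.var)
  qed
  moreover have "polyfun d (\<lambda>z. if t = r then f z else if t = Suc r then - f z else 0)"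
    using polyfun.scale[OF var.hyps, of "- 1"] var.hyps polyfun.zero[of d]
    by (cases "t = r"; cases "t = Suc r") simp_all
  ultimately show ?case
    by (subst ddiff_var[OF polyfun_supp[OF var.hyps]]) (auto intro: polyfun.add)
qed (auto intro: polyfun.zero)

text \<open>
  Functionals on polynomial functions, by degree. Multiplication and divided differences act
  by precomposition; evaluation of constants generates a finite-dimensional module.
\<close>

type_synonym 'k functional = "nat \<Rightarrow> ((nat \<Rightarrow> 'k) \<Rightarrow> 'k) \<Rightarrow> 'k"

definition fn_scale :: "'k::field \<Rightarrow> 'k functional \<Rightarrow> 'k functional" where
  "fn_scale c \<phi> = (\<lambda>e f. c * \<phi> e f)"

definition fn_dot :: "nat \<Rightarrow> 'k::field functional \<Rightarrow> 'k functional" where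
  "fn_dot t \<phi> = (\<lambda>e f. if polyfun e f then \<phi> (Suc e) (\<lambda>z. z t * f z) else 0)"

definition fn_crs :: "nat \<Rightarrow> 'k::field functional \<Rightarrow> 'k functional" where
  "fn_crs r \<phi> = (\<lambda>e f. if polyfun e f then (case e of 0 \<Rightarrow> 0 | Suc e' \<Rightarrow> \<phi> e' (ddiff r f)) else 0)"

definition functionals :: "'k::field functional set" where
  "functionals = {\<phi>. (\<forall>e f. \<not> polyfun e f \<longrightarrow> \<phi> e f = 0) \<and>
     (\<forall>e f g. polyfun e f \<longrightarrow> polyfun e g \<longrightarrow> \<phi> e (\<lambda>z. f z + g z) = \<phi> e f + \<phi> e g) \<and>
     (\<forall>e f c. polyfun e f \<longrightarrow> \<phi> e (\<lambda>z. c * f z) = c * \<phi> e f)}"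

definition fn_eval :: "(nat \<Rightarrow> 'k) \<Rightarrow> 'k::field functional" where
  "fn_eval z0 = (\<lambda>e f. if e = 0 \<and> polyfun 0 f then f z0 else 0)"

definition fn_comp :: "nat \<Rightarrow> 'k::field functional \<Rightarrow> 'k functional" where
  "fn_comp e \<phi> = (\<lambda>e' f. if e' = e then \<phi> e f else 0)"

lemma fn_vector_space: "vector_space (fn_scale :: 'k::field \<Rightarrow> _)"
  by unfold_locales (auto simp: fn_scale_def fun_eq_iff algebra_simps)

interpretation fn: vector_space "fn_scale :: 'k::field \<Rightarrow> 'k functional \<Rightarrow> 'k functional"
  by (rule fn_vector_space)

lemma functionals_sub: "fn.subspace functionals"
  by (rule fn.subspaceI) (auto simp: functionals_def fn_scale_def algebra_simps)

lemma fn_dot_in: "\<phi> \<in> functionals ==> fn_dot t \<phi> \<in> functionals"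
proof -
  assume "\<phi> \<in> functionals"
  hence a: "\<And>e f g. polyfun e f ==> polyfun e g ==> \<phi> e (\<lambda>z. f z + g z) = \<phi> e f + \<phi> e g"
    and s: "\<And>e f c. polyfun e f ==> \<phi> e (\<lambda>z. c * f z) = c * \<phi> e f" by (auto simp: functionals_def)
  have "\<phi> (Suc e) (\<lambda>z. z t * (f z + g z)) = \<phi> (Suc e) (\<lambda>z. z t * f z) + \<phi> (Suc e) (\<lambda>z. z t * g z)"
    if "polyfun e f" "polyfun e g" for e f g
    using a[OF polyfun.var[OF that(1), of t] polyfun.var[OF that(2), of t]] by (simp add: distrib_left)
  moreover have "\<phi> (Suc e) (\<lambda>z. z t * (c * f z)) = c * \<phi> (Suc e) (\<lambda>z. z t * f z)" if "polyfun e f" for e f c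
    using s[OF polyfun.var[OF that, of t], of c] by (simp add: mult.left_commute)
  ultimately show ?thesis by (auto simp: functionals_def fn_dot_def polyfun.add polyfun.scale)
qed

lemma fn_crs_in: "\<phi> \<in> functionals ==> fn_crs r \<phi> \<in> functionals"
proof -
  assume "\<phi> \<in> functionals"
  hence a: "\<And>e f g. polyfun e f ==> polyfun e g ==> \<phi> e (\<lambda>z. f z + g z) = \<phi> e f + \<phi> e g"
    and s: "\<And>e f c. polyfun e f ==> \<phi> e (\<lambda>z. c * f z) = c * \<phi> e f" by (auto simp: functionals_def)
  have dp: "polyfun e (ddiff r f)" if "polyfun (Suc e) f" for e f using polyfun_ddiff[OF that] by simp
  have a': "\<phi> e (\<lambda>z. ddiff r f z + ddiff r g z) = \<phi> e (ddiff r f) + \<phi> e (ddiff r g)"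
    if "polyfun (Suc e) f" "polyfun (Suc e) g" for e f g using a[OF dp dp] that by blast
  have s': "\<phi> e (\<lambda>z. c * ddiff r f z) = c * \<phi> e (ddiff r f)" if "polyfun (Suc e) f" for e f c
    using s[OF dp] that by blast
  show ?thesis
    by (auto simp: functionals_def fn_crs_def polyfun.add polyfun.scale ddiff_add ddiff_scale a' s' split: nat.splits)
qed

lemma fn_lin: "fn_dot t (\<phi> + \<psi>) = fn_dot t \<phi> + fn_dot t \<psi>" "fn_dot t (fn_scale c \<phi>) = fn_scale c (fn_dot t \<phi>)"
    "fn_crs t (\<phi> + \<psi>) = fn_crs t \<phi> + fn_crs t \<psi>" "fn_crs t (fn_scale c \<phi>) = fn_scale c (fn_crs t \<phi>)"
  by (auto simp: fn_dot_def fn_crs_def fn_scale_def fun_eq_iff split: nat.splits)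

lemma fn_dot_dot: "fn_dot t (fn_dot u \<phi>) = fn_dot u (fn_dot t \<phi>)"
  by (auto simp: fn_dot_def fun_eq_iff polyfun.var mult.left_commute)

lemma polyfun_ddiff_Suc: "polyfun (Suc e) f ==> polyfun e (ddiff r f)"
  using polyfun_ddiff by blast

lemma functional_zero: "\<phi> \<in> functionals ==> \<phi> e (\<lambda>z. 0) = 0"
proof -
  assume "\<phi> \<in> functionals"
  hence "\<phi> e (\<lambda>z. 0 * 0) = 0 * \<phi> e (\<lambda>z. 0)" using polyfun.zero[of e] unfolding functionals_def by blast
  thus ?thesis by simp
qed

lemma fn_crs_sq: "\<phi> \<in> functionals ==> fn_crs r (fn_crs r \<phi>) = 0"
  by (auto simp: fn_crs_def fun_eq_iff polyfun_ddiff_Suc ddiff_sq functional_zero split: nat.splits)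

lemma fn_crs_far:
  assumes "Suc r < t" shows "fn_crs r (fn_crs t \<phi>) = fn_crs t (fn_crs r \<phi>)"
  by (auto simp: fn_crs_def fun_eq_iff polyfun_ddiff_Suc ddiff_far[OF assms] split: nat.splits)

lemma fn_crs_braid: "fn_crs r (fn_crs (Suc r) (fn_crs r \<phi>)) = fn_crs (Suc r) (fn_crs r (fn_crs (Suc r) \<phi>))"
proof -
  have br: "ddiff r (ddiff (Suc r) (ddiff r f)) = ddiff (Suc r) (ddiff r (ddiff (Suc r) f))"
    if "polyfun e f" for e f by (rule ddiff_braid) (rule polyfun_supp[OF that])
  show ?thesis
  proof (rule ext, rule ext)
    fix e f
    show "fn_crs r (fn_crs (Suc r) (fn_crs r \<phi>)) e f = fn_crs (Suc r) (fn_crs r (fn_crs (Suc r) \<phi>)) e f"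
    proof (cases "polyfun e f")
      case True
      show ?thesis using True br[OF True]
        by (auto simp: fn_crs_def polyfun_ddiff_Suc split: nat.splits)
    qed (simp add: fn_crs_def)
  qed
qed

text \<open>
  Precomposition reverses the order of operators, so the Leibniz rule \<open>ddiff_var\<close> appears with the
  roles of \<open>u\<close> and its image under the transposition exchanged.
\<close>

lemma fn_crs_dot:
  assumes \<phi>: "\<phi> \<in> functionals"
  shows "fn_crs r (fn_dot u \<phi>) = fn_dot (transpose r (Suc r) u) (fn_crs r \<phi>) + (if u = r then \<phi> else if u = Suc r then - \<phi> else 0)"
proof (rule ext, rule ext)
  fix e f
  have a: "\<And>e f g. polyfun e f ==> polyfun e g ==> \<phi> e (\<lambda>z. f z + g z) = \<phi> e f + \<phi> e g"
    and s: "\<And>e f c. polyfun e f ==> \<phi> e (\<lambda>z. c * f z) = c * \<phi> e f"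
    and n: "\<And>e f. \<not> polyfun e f ==> \<phi> e f = 0" using \<phi> by (auto simp: functionals_def)
  let ?t = "transpose r (Suc r) u"
  let ?\<sigma> = "if u = r then 1 else if u = Suc r then - 1 else 0 :: 'a"
  have corr: "(if u = r then \<phi> else if u = Suc r then - \<phi> else 0) e f = ?\<sigma> * \<phi> e f" by simp
  show "fn_crs r (fn_dot u \<phi>) e f = (fn_dot ?t (fn_crs r \<phi>) + (if u = r then \<phi> else if u = Suc r then - \<phi> else 0)) e f"
  proof (cases "polyfun e f")
    case False thus ?thesis by (simp add: fn_crs_def fn_dot_def corr n)
  next
    case True
    have t: "transpose r (Suc r) ?t = u" by simp
    have tr: "(if ?t = r then f z else if ?t = Suc r then - f z else 0) = - ?\<sigma> * f z" for z
      by (auto simp: transpose_def)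
    have dv: "ddiff r (\<lambda>z. z ?t * f z) = (\<lambda>z. z u * ddiff r f z + - ?\<sigma> * f z)"
    proof
      fix z
      have "ddiff r (\<lambda>z. z ?t * f z) z = z (transpose r (Suc r) ?t) * ddiff r f z + (if ?t = r then f z else if ?t = Suc r then - f z else 0)"
        by (rule fun_cong[OF ddiff_var]) (rule polyfun_supp[OF True])
      thus "ddiff r (\<lambda>z. z ?t * f z) z = z u * ddiff r f z + - ?\<sigma> * f z" unfolding t tr .
    qed
    have "fn_dot ?t (fn_crs r \<phi>) e f = \<phi> e (ddiff r (\<lambda>z. z ?t * f z))"
      using True polyfun.var[OF True, of ?t] by (simp add: fn_dot_def fn_crs_def)
    also have "\<dots> = \<phi> e (\<lambda>z. z u * ddiff r f z) + - ?\<sigma> * \<phi> e f"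
    proof -
      have "polyfun e (\<lambda>z. z u * ddiff r f z)"
        using polyfun_ddiff[OF True, of r] by (cases e) (auto simp: polyfun.zero intro: polyfun.var)
      thus ?thesis unfolding dv using a[OF _ polyfun.scale[OF True, of "- ?\<sigma>"]] s[OF True, of "- ?\<sigma>"] by simp
    qed
    also have "\<phi> e (\<lambda>z. z u * ddiff r f z) = fn_crs r (fn_dot u \<phi>) e f"
      using polyfun_ddiff[OF True, of r] True functional_zero[OF \<phi>]
      by (cases e) (auto simp: fn_crs_def fn_dot_def)
    finally show ?thesis using corr by simp
  qed
qed

lemma functionals_nil_hecke: "nil_hecke fn_scale functionals fn_dot p fn_crs"
  by unfold_locales
    (auto simp: functionals_sub fn_dot_in fn_crs_in fn_lin fn_crs_sq fn_crs_dot intro: fn_dot_dot fn_crs_far fn_crs_braid)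

lemma fn_eval_in: "fn_eval z0 \<in> functionals"
  by (auto simp: fn_eval_def functionals_def polyfun.add polyfun.scale)

lemma fn_dot_eval: "fn_dot t (fn_eval z0) = 0"
  by (auto simp: fn_eval_def fn_dot_def fun_eq_iff)

lemma fn_eval_nonzero: "inj z0 ==> fn_eval z0 \<noteq> 0"
proof
  assume z0: "inj z0" and "fn_eval z0 = 0"
  hence "fn_eval z0 0 (\<lambda>z. if inj z then 1 else 0) = 0" by simp
  thus False by (simp add: fn_eval_def z0 polyfun.one)
qed

definition homog_fn :: "'k::field functional \<Rightarrow> bool" where
  "homog_fn \<phi> \<longleftrightarrow> (\<exists>e. \<phi> = fn_comp e \<phi>)"

lemma homog_fn_iff: "homog_fn \<phi> \<longleftrightarrow> (\<exists>e. \<forall>e'. e' \<noteq> e \<longrightarrow> \<phi> e' = (\<lambda>f. 0))"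
  by (auto simp: homog_fn_def fn_comp_def fun_eq_iff)

lemma homog_crs: "homog_fn \<phi> ==> homog_fn (fn_crs r \<phi>)"
proof -
  assume "homog_fn \<phi>"
  then obtain e where "\<And>e'. e' \<noteq> e ==> \<phi> e' = (\<lambda>f. 0)" by (auto simp: homog_fn_iff)
  hence "fn_crs r \<phi> e' = (\<lambda>f. 0)" if "e' \<noteq> Suc e" for e' using that by (auto simp: fn_crs_def fun_eq_iff split: nat.splits)
  thus ?thesis by (auto simp: homog_fn_iff)
qed

lemma homog_desc: "homog_fn \<phi> ==> homog_fn (desc fn_crs k m \<phi>)"
  by (induction m arbitrary: k) (auto intro: homog_crs)

lemma desc_dot_far: "k + m < t ==> u \<in> functionals ==> fn_dot t (desc fn_crs k m u) = desc fn_crs k m (fn_dot t u)"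
proof (induction m arbitrary: k)
  case (Suc m)
  have "desc fn_crs (Suc k) m u \<in> functionals" using Suc.prems(2) by (induction m arbitrary: k) (auto intro: fn_crs_in)
  from fn_crs_dot[OF this, of k t] show ?case using Suc by (simp add: transpose_def)
qed simp

lemma desc_fn_0: "desc fn_crs k m 0 = 0"
proof (induction m arbitrary: k)
  case (Suc m)
  have "fn_crs k 0 = (0 :: 'a functional)" by (auto simp: fn_crs_def fun_eq_iff split: nat.splits)
  thus ?case by (simp only: desc.simps Suc.IH)
qed (simp only: desc.simps)

text \<open>
  Induction on the number of strands: the coset representatives applied to a spanning set for \<open>l\<close> span a
  space stable under one more crossing. Every dot kills the evaluation, which settles \<open>l = 0\<close>.
\<close>

lemma finite_nil_hecke_span:
  "\<exists>B. finite B \<and> B \<subseteq> functionals \<and> (\<forall>b\<in>B. homog_fn b) \<and> fn_eval z0 \<in> fn.span B \<and>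
    (\<forall>t. \<forall>b\<in>B. fn_dot t b \<in> fn.span B) \<and> (\<forall>t>l. \<forall>b\<in>B. fn_dot t b = 0) \<and> (\<forall>t<l. \<forall>b\<in>B. fn_crs t b \<in> fn.span B)"
proof (induction l)
  case 0
  have "homog_fn (fn_eval z0)" by (auto simp: homog_fn_iff fn_eval_def intro!: exI[of _ 0])
  thus ?case
    by (intro exI[of _ "{fn_eval z0}"])
      (simp only: fn_eval_in fn_dot_eval fn.span_zero ball_simps empty_subsetI insert_subset finite.intros
        fn.span_base insertI1 simp_thms not_less0 HOL.refl)
next
  case (Suc l)
  from Suc.IH obtain B where B0: "finite B" "B \<subseteq> functionals" "\<forall>b\<in>B. homog_fn b" "fn_eval z0 \<in> fn.span B"
    "\<forall>t. \<forall>b\<in>B. fn_dot t b \<in> fn.span B" "\<forall>t>l. \<forall>b\<in>B. fn_dot t b = 0" "\<forall>t<l. \<forall>b\<in>B. fn_crs t b \<in> fn.span B"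
    by (elim exE conjE)
  have B: "finite B" "B \<subseteq> functionals" "\<And>b. b \<in> B ==> homog_fn b" "fn_eval z0 \<in> fn.span B"
    "\<And>t b. b \<in> B ==> fn_dot t b \<in> fn.span B" "\<And>t b. t > l ==> b \<in> B ==> fn_dot t b = 0"
    "\<And>t b. t < l ==> b \<in> B ==> fn_crs t b \<in> fn.span B" using B0 by simp_all
  interpret N: nil_hecke fn_scale functionals fn_dot "Suc l" fn_crs by (rule functionals_nil_hecke)
  let ?B = "{desc fn_crs k (Suc l - k) u | k u. k \<le> Suc l \<and> u \<in> B}"
  have U: "B \<subseteq> functionals" "\<And>t u. t \<le> Suc l ==> u \<in> B ==> fn_dot t u \<in> fn.span B"
    "\<And>t u. Suc t < Suc l ==> u \<in> B ==> fn_crs t u \<in> fn.span B" using B by auto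
  have cs: "N.coset_span B = fn.span ?B" by (simp add: N.coset_span_def)
  have "?B = (\<lambda>(k, u). desc fn_crs k (Suc l - k) u) ` ({..Suc l} \<times> B)" by auto
  hence fin: "finite ?B" using B(1) by simp
  have sub: "?B \<subseteq> functionals" using B(2) by (auto intro!: N.desc_in)
  have base: "b \<in> ?B ==> b \<in> N.coset_span B" for b unfolding cs by (rule fn.span_base)
  have hi: "fn_dot t b = 0" if t: "t > Suc l" and b: "b \<in> ?B" for t b
  proof -
    obtain k u where ku: "b = desc fn_crs k (Suc l - k) u" "k \<le> Suc l" "u \<in> B" using b by blast
    have "fn_dot t b = desc fn_crs k (Suc l - k) (fn_dot t u)"
      unfolding ku(1) using ku t B(2) by (intro desc_dot_far) auto
    also have "fn_dot t u = 0" using B(6)[of t u] t ku(3) by simp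
    finally show ?thesis by (simp only: desc_fn_0)
  qed
  have X: "fn_dot t b \<in> fn.span ?B" if "b \<in> ?B" for t b
  proof (cases "t \<le> Suc l")
    case True thus ?thesis using N.coset_span_x[OF U True base[OF that]] cs by simp
  next
    case False thus ?thesis using hi[OF _ that, of t] by (simp add: fn.span_zero)
  qed
  have P: "fn_crs t b \<in> fn.span ?B" if "t < Suc l" "b \<in> ?B" for t b
    using N.coset_span_phi[OF U that(1) base[OF that(2)]] cs by simp
  have "desc fn_crs (Suc l) (Suc l - Suc l) (fn_eval z0) \<in> N.coset_span B"
    by (rule N.desc_span[OF U order_refl B(4)])
  hence ev: "fn_eval z0 \<in> fn.span ?B" unfolding cs by simp
  show ?case
  proof (intro exI[of _ ?B] conjI ballI allI impI)
    show "homog_fn b" if "b \<in> ?B" for b using that B(3) homog_desc by auto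
  qed (fact fin sub ev X P hi)+
qed

lemma fn_comp_lin: "fn_comp e (\<phi> + \<psi>) = fn_comp e \<phi> + fn_comp e \<psi>" "fn_comp e (fn_scale c \<phi>) = fn_scale c (fn_comp e \<phi>)"
  by (auto simp: fn_comp_def fn_scale_def fun_eq_iff)

lemma fn_dot_comp: "fn_dot t (fn_comp e \<phi>) = (if e = 0 then 0 else fn_comp (e - 1) (fn_dot t \<phi>))"
  by (auto simp: fn_comp_def fn_dot_def fun_eq_iff)

lemma fn_comp_comp: "fn_comp e (fn_comp e' \<phi>) = (if e = e' then fn_comp e \<phi> else 0)"
  by (auto simp: fn_comp_def fun_eq_iff)

lemma fn_crs_comp: "fn_crs t (fn_comp e \<phi>) = fn_comp (Suc e) (fn_crs t \<phi>)"
  by (auto simp: fn_comp_def fn_crs_def fun_eq_iff split: nat.splits)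

lemma fn_comp_span:
  assumes B: "\<And>b. b \<in> B ==> homog_fn b" and v: "v \<in> fn.span B"
  shows "fn_comp e v \<in> fn.span B"
proof -
  have "fn_comp e b \<in> fn.span B" if b: "b \<in> B" for b
  proof -
    obtain e' where "b = fn_comp e' b" using B[OF b] by (auto simp: homog_fn_def)
    hence "fn_comp e b = (if e = e' then b else 0)" using fn_comp_comp[of e e' b] by metis
    thus ?thesis using b by (auto simp: fn.span_base fn.span_zero)
  qed
  note base = this
  have z: "fn_comp e 0 = (0 :: 'a functional)" by (auto simp: fn_comp_def fun_eq_iff)
  show ?thesis
  proof (rule fn.span_inductS[OF v])
    show "fn_comp e 0 \<in> fn.span B" unfolding z by (rule fn.span_zero)
  next
    fix b assume "b \<in> B" thus "fn_comp e b \<in> fn.span B" by (rule base)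
  next
    fix x y assume "fn_comp e x \<in> fn.span B" "fn_comp e y \<in> fn.span B"
    thus "fn_comp e (x + y) \<in> fn.span B" unfolding fn_comp_lin by (rule fn.span_add)
  next
    fix c x assume "fn_comp e x \<in> fn.span B"
    thus "fn_comp e (fn_scale c x) \<in> fn.span B" unfolding fn_comp_lin by (rule fn.span_scale)
  qed
qed

lemma fn_comp_finite:
  assumes B: "finite B" "\<And>b. b \<in> B ==> homog_fn b" and v: "v \<in> fn.span B"
  shows "finite {e. fn_comp e v \<noteq> 0}" "v = (\<Sum>e | fn_comp e v \<noteq> 0. fn_comp e v)"
proof -
  have z: "fn_comp e 0 = (0 :: 'a functional)" for e by (auto simp: fn_comp_def fun_eq_iff)
  show f: "finite {e. fn_comp e v \<noteq> 0}"
  proof (rule fn.span_inductS[OF v])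
    fix b assume "b \<in> B"
    then obtain e' where "b = fn_comp e' b" using B by (auto simp: homog_fn_def)
    hence "fn_comp e b = 0" if "e \<noteq> e'" for e using fn_comp_comp[of e e' b] that by metis
    hence "{e. fn_comp e b \<noteq> 0} \<subseteq> {e'}" by auto
    thus "finite {e. fn_comp e b \<noteq> 0}" by (rule finite_subset) simp
  next
    fix x y :: "'a functional" assume "finite {e. fn_comp e x \<noteq> 0}" "finite {e. fn_comp e y \<noteq> 0}"
    thus "finite {e. fn_comp e (x + y) \<noteq> 0}"
      by (rule_tac finite_subset[of _ "{e. fn_comp e x \<noteq> 0} \<union> {e. fn_comp e y \<noteq> 0}"]) (auto simp: fn_comp_lin)
  next
    fix c and x :: "'a functional" assume "finite {e. fn_comp e x \<noteq> 0}"
    thus "finite {e. fn_comp e (fn_scale c x) \<noteq> 0}"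
      by (rule_tac finite_subset[of _ "{e. fn_comp e x \<noteq> 0}"]) (auto simp: fn_comp_lin)
  qed (unfold z, simp)
  have sum_app: "(\<Sum>e\<in>A. h e) e' f = (\<Sum>e\<in>A. h e e' f)" for h :: "nat \<Rightarrow> 'a functional" and A e' f
    by (induction A rule: infinite_finite_induct) auto
  show "v = (\<Sum>e | fn_comp e v \<noteq> 0. fn_comp e v)"
  proof (rule ext, rule ext)
    fix e f
    have "(\<Sum>e | fn_comp e v \<noteq> 0. fn_comp e v) e f = (\<Sum>e' | fn_comp e' v \<noteq> 0. if e' = e then v e f else 0)"
      unfolding sum_app by (intro sum.cong) (auto simp: fn_comp_def)
    also have "\<dots> = v e f" using f by (auto simp: fn_comp_def fun_eq_iff)
    finally show "v e f = (\<Sum>e | fn_comp e v \<noteq> 0. fn_comp e v) e f" by simp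
  qed
qed

text \<open>Otherwise \<open>\<Prod>\<^sub>a (X - a) + 1\<close> has no root.\<close>

lemma infinite_alg_closed: "infinite (UNIV :: 'k::alg_closed_field set)"
proof
  assume fin: "finite (UNIV :: 'k set)"
  let ?p = "(\<Prod>a\<in>UNIV. [:- a, 1:]) + 1 :: 'k poly"
  have "degree (\<Prod>a\<in>UNIV. [:- a, 1:] :: 'k poly) = card (UNIV :: 'k set)"
    by (subst degree_prod_eq_sum_degree) auto
  moreover have "card (UNIV :: 'k set) > 0" using fin by (simp add: card_gt_0_iff)
  ultimately have "degree ?p > 0" by (simp add: degree_add_eq_left)
  then obtain x where "poly ?p x = 0" using alg_closed_imp_poly_has_root by blast
  moreover have "poly (\<Prod>a\<in>UNIV. [:- a, 1:]) x = 0" using fin by (auto simp: poly_prod prod_zero_iff)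
  ultimately show False by simp
qed

section \<open>A module on a prescribed word\<close>

text \<open>
  A finite-dimensional nilHecke module \<open>T\<close> on \<open>c + 1\<close> strands, from which a module on the word with \<open>j\<close> at
  position \<open>p\<close> is cut out. It is graded in degrees \<open>\<le> 0\<close>: the projection \<open>gr e\<close> is the one to degree
  \<open>- e (\<alpha>\<^sub>i, \<alpha>\<^sub>i)\<close>, since dots lower the degree of the functions on which functionals are evaluated.
\<close>

locale cij_model = cij C i j c \<nu> + nil_hecke sc T x c \<phi>
  for C :: "('i, 'p::ab_group_add) cartan_data" and i j :: 'i and c :: nat and \<nu> :: "'i multiset"
    and sc :: "'k::field \<Rightarrow> 'v::ab_group_add \<Rightarrow> 'v" and T x \<phi> +
  fixes p :: nat and gr :: "nat \<Rightarrow> 'v \<Rightarrow> 'v"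
  assumes pc: "p \<le> c"
    and T_fd: "\<exists>B. finite B \<and> T = span B"
    and gr_in: "v \<in> T ==> gr e v \<in> T"
    and gr_add: "gr e (v + w) = gr e v + gr e w"
    and gr_scale: "gr e (sc a v) = sc a (gr e v)"
    and gr_gr: "gr e (gr e' v) = (if e = e' then gr e v else 0)"
    and gr_x: "x t (gr e v) = (if e = 0 then 0 else gr (e - 1) (x t v))"
    and gr_phi: "\<phi> t (gr e v) = gr (Suc e) (\<phi> t v)"
    and gr_phi_0: "gr 0 (\<phi> t v) = 0"
    and gr_fin: "v \<in> T ==> finite {e. gr e v \<noteq> 0}"
    and gr_sum: "v \<in> T ==> v = (\<Sum>e | gr e v \<noteq> 0. gr e v)"
begin

text \<open>
  The symmetric polynomials of each block have to vanish, as they do on irreducible modules.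
\<close>

definition N :: "'v set" where
  "N = {v \<in> T. \<forall>k. hsym x (Suc k) [0..<p] v = 0 \<and> hsym x (Suc k) [Suc p..<Suc c] v = 0}"

lemma blocks: "set [0..<p] \<subseteq> {..c}" "set [Suc p..<Suc c] \<subseteq> {..c}" using pc by auto

lemma N_T: "v \<in> N ==> v \<in> T" by (simp add: N_def)

lemma N_sub: "subspace N"
  by (rule subspaceI) (auto simp: N_def h_add h_scale blocks[unfolded set_upt] S_add subspace_scale[OF S] simp del: upt_Suc)

lemma N_x: "t \<le> c ==> v \<in> N ==> x t v \<in> N"
  using blocks by (auto simp: N_def h_x x_in simp del: upt_Suc)

lemma gr_0 [simp]: "gr e 0 = 0" using gr_add[of e 0 0] by simp

lemma gr_sums: "gr e (\<Sum>a\<in>A. h a) = (\<Sum>a\<in>A. gr e (h a))"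
  by (induction A rule: infinite_finite_induct) (auto simp: gr_add)

lemma gr_h: "set ls \<subseteq> {..c} ==> hsym x k ls (gr e v) = (if k \<le> e then gr (e - k) (hsym x k ls v) else 0)"
proof (induction k ls rule: hsym_induct)
  case (3 k l ls)
  have l: "l \<le> c" "set ls \<subseteq> {..c}" using 3(3) by auto
  show ?case
  proof (cases "Suc k \<le> e")
    case True
    hence "x l (hsym x k (l # ls) (gr e v)) = gr (e - Suc k) (x l (hsym x k (l # ls) v))"
      using 3(2)[OF 3(3)] by (simp add: gr_x)
    thus ?thesis using True 3(1)[OF l(2)] by (simp add: gr_add)
  next
    case False
    have "x l (hsym x k (l # ls) (gr e v)) = 0"
      using False 3(2)[OF 3(3)] l(1) by (auto simp: gr_x x_0)
    thus ?thesis using False 3(1)[OF l(2)] by simp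
  qed
qed auto

lemma N_gr: "v \<in> N ==> gr e v \<in> N"
  using blocks by (auto simp: N_def gr_h gr_in simp del: upt_Suc)

lemma N_phi:
  assumes r: "r < c" "r \<noteq> p" "Suc r \<noteq> p" and v: "v \<in> N"
  shows "\<phi> r v \<in> N"
proof -
  have T1: "subspace T" "T \<subseteq> T" "\<And>l v. l \<in> {..c} ==> v \<in> T ==> x l v \<in> T" using S x_in by auto
  have T2: "\<And>v. v \<in> T ==> \<phi> r v \<in> T" "\<And>v w. v \<in> T ==> w \<in> T ==> \<phi> r (v + w) = \<phi> r v + \<phi> r w"
    using r phi_in phi_add by auto
  have T3: "r \<in> {..c}" "Suc r \<in> {..c}" "r \<noteq> Suc r" using r by auto
  have T4: "\<And>v. v \<in> T ==> \<phi> r (x r v) = x (Suc r) (\<phi> r v) + v"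
     "\<And>v. v \<in> T ==> \<phi> r (x (Suc r) v) = x r (\<phi> r v) - v"
     "\<And>l v. l \<in> {..c} ==> l \<noteq> r ==> l \<noteq> Suc r ==> v \<in> T ==> \<phi> r (x l v) = x l (\<phi> r v)"
    using r by (auto simp: phi_x transpose_def)
  have "\<phi> r (hsym x k ls w) = hsym x k ls (\<phi> r w)"
    if "set ls \<subseteq> {..c}" "distinct ls" "r \<in> set ls \<longleftrightarrow> Suc r \<in> set ls" "w \<in> T" for k ls w
  proof (cases "r \<in> set ls")
    case True
    thus ?thesis using that by (intro \<phi>_h_sym[OF T1 T2 T3 T4]) auto
  next
    case False
    thus ?thesis using that by (intro \<phi>_h[OF T1 T2 T3 T4]) auto
  qed
  note comm = this[OF blocks(1)] this[OF blocks(2)]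
  have "\<phi> r (hsym x k [0..<p] v) = hsym x k [0..<p] (\<phi> r v)" for k
    by (rule comm(1)) (use r N_T[OF v] in auto)
  moreover have "\<phi> r (hsym x k [Suc p..<Suc c] v) = hsym x k [Suc p..<Suc c] (\<phi> r v)" for k
    by (rule comm(2)) (use r N_T[OF v] in auto)
  moreover have "hsym x (Suc k) [0..<p] v = 0" "hsym x (Suc k) [Suc p..<Suc c] v = 0" for k
    using v by (simp_all add: N_def del: upt_Suc)
  ultimately have "hsym x (Suc k) [0..<p] (\<phi> r v) = 0" "hsym x (Suc k) [Suc p..<Suc c] (\<phi> r v) = 0" for k
    using phi_0[OF r(1)] by metis+
  thus ?thesis using phi_in[OF r(1) N_T[OF v]] by (simp add: N_def del: upt_Suc)
qed

lemma N_ops: "dot_ops sc N x {..c}"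
  by unfold_locales (auto simp: N_sub N_x N_T x_add x_scale intro: x_x N_T)

lemma x_pow_left: "Suc r = p ==> v \<in> N ==> p \<le> k ==> (x r ^^ k) v = 0"
proof -
  assume r: "Suc r = p" and v: "v \<in> N" and k: "p \<le> (k :: nat)"
  interpret D: dot_ops sc N x "{..c}" by (rule N_ops)
  have e: "[0..<p] = [0..<r] @ [r]" using r by auto
  have "hsym x k [r] v = 0"
  proof (rule D.h_tail_zero[of 0 "[0..<r]"])
    fix k :: nat and w assume "0 < k" "w \<in> N"
    thus "hsym x k ([0..<r] @ [r]) w = 0" unfolding e[symmetric] N_def by (cases k) auto
  qed (use r v k pc in auto)
  thus ?thesis by (simp add: h_single)
qed

lemma x_pow_right: "p < c ==> v \<in> N ==> c - p \<le> k ==> (x (Suc p) ^^ k) v = 0"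
proof -
  assume r: "p < c" and v: "v \<in> N" and k: "c - p \<le> k"
  interpret D: dot_ops sc N x "{..c}" by (rule N_ops)
  let ?ws = "[Suc (Suc p)..<Suc c]"
  have m: "mset (?ws @ [Suc p]) = mset [Suc p..<Suc c]" using r by (simp add: upt_conv_Cons del: upt_Suc)
  have "hsym x k [Suc p] v = 0"
  proof (rule D.h_tail_zero[of 0 "?ws"])
    fix k :: nat and w assume k: "0 < k" and w: "w \<in> N"
    have "hsym x k (?ws @ [Suc p]) w = hsym x k [Suc p..<Suc c] w"
      by (rule h_mset[OF m]) (use r w N_T in auto)
    also have "\<dots> = 0" using k w unfolding N_def by (cases k) (auto simp del: upt_Suc)
    finally show "hsym x k (?ws @ [Suc p]) w = 0" .
  qed (use r v k pc in auto)
  thus ?thesis by (simp add: h_single)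
qed

text \<open>The strand of colour \<open>j\<close> is inert.\<close>

fun op :: "'i klr_gen \<Rightarrow> 'v \<Rightarrow> 'v" where
  "op (Idemp u) v = (if u = word p then v else 0)"
| "op (Dot r) v = (if r = p then 0 else x r v)"
| "op (Cross r) v = (if r = p \<or> Suc r = p then 0 else \<phi> r v)"

lemma op_words: "word_ops sc (klr_gens \<nu>) N op"
proof (unfold_locales, goal_cases)
  case 1 show ?case by (rule N_sub)
next
  case (2 g v) thus ?case by (cases g) (auto simp: klr_gens_def N_x N_phi subspace_0[OF N_sub])
next
  case (3 g v w) thus ?case by (cases g) (auto simp: klr_gens_def x_add phi_add N_T)
next
  case (4 g v a) thus ?case by (cases g) (auto simp: klr_gens_def x_scale phi_scale N_T)
qed

sublocale W: word_ops sc "klr_gens \<nu>" N op by (rule op_words)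

lemma op_in [intro]: "g \<in> klr_gens \<nu> ==> v \<in> N ==> op g v \<in> N" by (rule W.f_in)

lemma gens: "u \<in> seqs \<nu> ==> Idemp u \<in> klr_gens \<nu>" "r \<le> c ==> Dot r \<in> klr_gens \<nu>" "r < c ==> Cross r \<in> klr_gens \<nu>"
  by (auto simp: klr_gens_def)

lemma gen_eqs: "idemp u = gen (Idemp u)" "dot r = gen (Dot r)" "crs r = gen (Cross r)"
  by (simp_all add: idemp_def dot_def crs_def gen_def)

lemma ext_gens:
  fixes v :: 'v assumes "v \<in> N"
  shows "u \<in> seqs \<nu> ==> W.ext (idemp u :: ('i, 'k) klr_free) v = op (Idemp u) v"
    "r \<le> c ==> W.ext (dot r :: ('i, 'k) klr_free) v = op (Dot r) v"
    "r < c ==> W.ext (crs r :: ('i, 'k) klr_free) v = op (Cross r) v"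
  using assms gens by (simp_all only: gen_eqs W.ext_gen)

lemma fcar: "u \<in> seqs \<nu> ==> (idemp u :: ('i, 'k) klr_free) \<in> klr_fcar \<nu>" "r \<le> c ==> (dot r :: ('i, 'k) klr_free) \<in> klr_fcar \<nu>"
    "r < c ==> (crs r :: ('i, 'k) klr_free) \<in> klr_fcar \<nu>"
  by (simp_all add: idemp_in dot_in crs_in)

lemma x_pow_in: "r \<le> c ==> v \<in> N ==> (x r ^^ k) v \<in> N"
  by (induction k) (auto intro: N_x)

lemma ext_dot_pow: "r \<le> c ==> v \<in> N ==> W.ext ((dot r :: ('i, 'k) klr_free) ^ k) v = (op (Dot r) ^^ k) v"
proof -
  assume r: "r \<le> c" and v: "v \<in> N"
  have "(op (Dot r) ^^ k) v \<in> N \<and> (W.ext (dot r :: ('i, 'k) klr_free) ^^ k) v = (op (Dot r) ^^ k) v"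
    by (induction k) (use r v gens(2)[OF r] in \<open>auto simp: ext_gens simp del: op.simps\<close>)
  thus ?thesis using W.ext_power[OF fcar(2)[OF r] v] by simp
qed

lemma dot_pow:
  assumes r: "r \<le> c" and v: "v \<in> N"
  shows "(op (Dot r) ^^ k) v = (if r = p then if k = 0 then v else 0 else (x r ^^ k) v)"
  by (induction k) auto

lemma a_ij: "c \<le> nat (cartan_a C i j)" using ca by simp

definition adj :: "nat \<Rightarrow> bool" where "adj r \<longleftrightarrow> r = p \<or> Suc r = p"

lemma op_adj: "op (Cross r) v = (if adj r then 0 else \<phi> r v)" by (simp add: adj_def)

lemma word_adj: "r < c ==> word p ! r = word p ! Suc r \<longleftrightarrow> \<not> adj r"
  using word_nth[OF pc, of r] word_nth[OF pc, of "Suc r"] ij by (auto simp: adj_def)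

lemma op_crs_in: "r < c ==> v \<in> N ==> op (Cross r) v \<in> N"
  and op_dot_in: "r \<le> c ==> v \<in> N ==> op (Dot r) v \<in> N"
  and op_idemp_in: "u \<in> seqs \<nu> ==> v \<in> N ==> op (Idemp u) v \<in> N"
  using gens by (auto intro!: op_in simp del: op.simps)

lemma N0 [simp]: "0 \<in> N" by (rule subspace_0[OF N_sub])

text \<open>Products of generators act letter by letter.\<close>

lemma ext_prod:
  fixes v :: 'v and q :: "('i, 'k) klr_free"
  assumes "v \<in> N" "q \<in> klr_fcar \<nu>"
  shows "u \<in> seqs \<nu> ==> W.ext (q * idemp u) v = W.ext q (op (Idemp u) v)"
    "r \<le> c ==> W.ext (q * dot r) v = W.ext q (op (Dot r) v)"
    "r < c ==> W.ext (q * crs r) v = W.ext q (op (Cross r) v)"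
  using assms fcar by (simp_all only: W.ext_mult ext_gens)

lemmas exts = ext_prod ext_gens fcar op_crs_in op_dot_in op_idemp_in free_alg_mult free_alg_diff
  W.ext_diff W.ext_add W.ext_0

lemma rel_idem_idem:
  "u \<in> seqs \<nu> ==> w \<in> seqs \<nu> ==> v \<in> N ==>
    W.ext (idemp u * idemp w - (if u = w then idemp u else 0) :: ('i, 'k) klr_free) v = 0"
  by (cases "u = w") (auto simp: exts simp del: op.simps, auto)

lemma rel_crs_idem:
  assumes u: "u \<in> seqs \<nu>" and r: "r < c" and v: "v \<in> N"
  shows "W.ext (crs r * idemp u - idemp (swap_seq r u) * crs r :: ('i, 'k) klr_free) v = 0"
proof -
  obtain q where q: "u = word q" "q \<le> c" using u unfolding seqs_nu by auto
  have tq: "transpose r (Suc r) q \<le> c" using q(2) r by (auto simp: transpose_def)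
  have sw: "swap_seq r u = word (transpose r (Suc r) q)" using swap_word[OF q(2) r] q(1) by simp
  have iff: "\<not> adj r ==> transpose r (Suc r) q = p \<longleftrightarrow> q = p"
    by (auto simp: adj_def transpose_def)
  have "op (Cross r) (op (Idemp u) v) = op (Idemp (swap_seq r u)) (op (Cross r) v)"
  proof -
    have e: "op (Idemp u) w = (if q = p then w else 0)" "op (Idemp (swap_seq r u)) w = (if transpose r (Suc r) q = p then w else 0)" for w
      using word_eq_iff[OF q(2) pc] word_eq_iff[OF tq pc] unfolding q(1) sw[unfolded q(1)] by simp_all
    show ?thesis unfolding e op_adj using iff by (simp add: phi_0 r)
  qed
  thus ?thesis using assms by (simp add: exts sw word_in[OF tq] del: op.simps)
qed

lemma rel_dot_dot:
  "r \<le> c ==> t \<le> c ==> v \<in> N ==> W.ext (dot r * dot t - dot t * dot r :: ('i, 'k) klr_free) v = 0"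
  by (simp add: exts del: op.simps) (auto simp: x_0 x_x N_T)

lemma rel_crs_crs:
  assumes "r < c" "t < c" "\<bar>int r - int t\<bar> > 1" "v \<in> N"
  shows "W.ext (crs r * crs t - crs t * crs r :: ('i, 'k) klr_free) v = 0"
proof -
  have "Suc r < t \<or> Suc t < r" using assms(3) by linarith
  hence "\<phi> r (\<phi> t v) = \<phi> t (\<phi> r v)" using phi_far assms(1,2) N_T[OF assms(4)] by metis
  hence "op (Cross r) (op (Cross t) v) = op (Cross t) (op (Cross r) v)"
    using assms(1,2) by (auto simp: phi_0)
  thus ?thesis using assms by (simp add: exts del: op.simps)
qed

lemma rel_crs_dot:
  assumes r: "r < c" and t: "t \<le> c" and u: "u \<in> seqs \<nu>" and v: "v \<in> N"
  shows "W.ext ((crs r * dot t - dot (transpose r (Suc r) t) * crs r) * idemp u -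
       (if t = r \<and> u ! r = u ! Suc r then idemp u
        else if t = Suc r \<and> u ! r = u ! Suc r then - idemp u else 0) :: ('i, 'k) klr_free) v = 0"
proof (cases "u = word p")
  case False
  have tr: "transpose r (Suc r) t \<le> c" using r t by (auto simp: transpose_def)
  have z: "op (Idemp u) v = 0" "op (Cross r) 0 = 0" "\<And>t. t \<le> c ==> op (Dot t) 0 = 0"
    using False r by (auto simp: phi_0 x_0)
  show ?thesis using assms tr by (simp add: exts z W.ext_uminus free_alg_uminus del: op.simps)
next
  case True
  have tr: "transpose r (Suc r) t \<le> c" using r t by (auto simp: transpose_def)
  have z: "op (Idemp (word p)) v = v" "\<And>t. t \<le> c ==> op (Dot t) 0 = 0" by (auto simp: x_0)
  have "op (Cross r) (op (Dot t) v) - op (Dot (transpose r (Suc r) t)) (op (Cross r) v)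
      = (if adj r then 0 else if t = r then v else if t = Suc r then - v else 0)"
  proof (cases "adj r")
    case True thus ?thesis using tr by (simp only: op_adj if_True z diff_self)
  next
    case False
    hence rp: "r \<noteq> p" "Suc r \<noteq> p" by (auto simp: adj_def)
    show ?thesis
    proof (cases "t = p")
      case True
      hence "transpose r (Suc r) t = p" using rp by (simp add: transpose_def)
      thus ?thesis using True rp False r by (auto simp: phi_0)
    next
      case tp: False
      hence "transpose r (Suc r) t \<noteq> p" using rp by (auto simp: transpose_def)
      thus ?thesis using tp False r t v rp by (simp add: phi_x N_T)
    qed
  qed
  thus ?thesis using assms tr word_adj[OF r] True
    by (auto simp: exts z W.ext_uminus free_alg_uminus simp del: op.simps)
qed

text \<open>
  Next to \<open>j\<close> the right hand side of the quadratic relation is a power of the dot on \<open>j\<close> plus a power of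
  a dot whose exponent is at least \<open>c\<close>, hence zero on \<open>N\<close>.
\<close>

lemma rel_crs_sq:
  assumes r: "r < c" and u: "u \<in> seqs \<nu>" and v: "v \<in> N" and kl: "k = u ! r" "l = u ! Suc r"
  shows "W.ext (crs r * crs r * idemp u -
       (if k = l then 0 else if rform C k l = 0 then idemp u
        else (dot r ^ nat (cartan_a C k l) + dot (Suc r) ^ nat (cartan_a C l k)) * idemp u) :: ('i, 'k) klr_free) v = 0"
proof -
  have cr: "op (Cross r) 0 = 0" using r by (auto simp: phi_0)
  have pw: "W.ext ((dot r ^ a + dot (Suc r) ^ b) * idemp u :: ('i, 'k) klr_free) v
      = (op (Dot r) ^^ a) (op (Idemp u) v) + (op (Dot (Suc r)) ^^ b) (op (Idemp u) v)" for a b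
  proof -
    have "(dot r ^ a + dot (Suc r) ^ b :: ('i, 'k) klr_free) \<in> klr_fcar \<nu>"
      using r by (intro free_alg_add free_alg_power fcar) auto
    thus ?thesis using r v u op_idemp_in[OF u v]
      by (simp add: ext_prod W.ext_add ext_dot_pow del: op.simps)
  qed
  have sq: "W.ext (crs r * crs r * idemp u :: ('i, 'k) klr_free) v = op (Cross r) (op (Cross r) (op (Idemp u) v))"
    using assms by (simp add: exts del: op.simps)
  show ?thesis
  proof (cases "u = word p")
    case False
    hence z: "op (Idemp u) v = 0" by simp
    have z2: "(op (Dot t) ^^ a) 0 = 0" if "t \<le> c" for t a
      using that by (induction a) (auto simp: x_0)
    show ?thesis using r by (simp add: W.ext_diff sq z cr pw z2 ext_gens(1)[OF v u] del: op.simps)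
  next
    case True
    hence z: "op (Idemp u) v = v" by simp
    show ?thesis
    proof (cases "adj r")
      case False
      hence "k = l" using word_adj[OF r] True kl by simp
      moreover have "op (Cross r) (op (Cross r) v) = 0"
        unfolding op_adj using False r v by (simp add: phi_sq N_T)
      ultimately show ?thesis by (simp add: W.ext_diff sq z del: op.simps)
    next
      case True
      have c0: "0 < c" using r by simp
      have rf: "k \<noteq> l" "rform C k l \<noteq> 0"
        "(op (Dot r) ^^ nat (cartan_a C k l)) v + (op (Dot (Suc r)) ^^ nat (cartan_a C l k)) v = 0"
      proof -
        have n: "u ! r = (if r = p then j else i)" "u ! Suc r = (if Suc r = p then j else i)"
          using word_nth[OF pc, of r] word_nth[OF pc, of "Suc r"] \<open>u = word p\<close> r by simp_all
        show "k \<noteq> l" using True n ij kl unfolding adj_def by auto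
        show "rform C k l \<noteq> 0" using True n cartan_pos[OF c0] kl unfolding adj_def by auto
        show "(op (Dot r) ^^ nat (cartan_a C k l)) v + (op (Dot (Suc r)) ^^ nat (cartan_a C l k)) v = 0"
        proof (cases "r = p")
          case True
          hence "k = j" "l = i" using n kl by auto
          thus ?thesis using True r v cartan_pos[OF c0] x_pow_right[OF _ v, of "nat (cartan_a C i j)"] a_ij
            by (simp add: dot_pow)
        next
          case False
          hence sp: "Suc r = p" using True by (simp add: adj_def)
          hence "k = i" "l = j" using n kl False by auto
          thus ?thesis using sp r v cartan_pos[OF c0] x_pow_left[OF sp v, of "nat (cartan_a C i j)"] a_ij pc
            by (simp add: dot_pow)
        qed
      qed
      have "op (Cross r) (op (Cross r) v) = 0" using True r unfolding op_adj by simp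
      thus ?thesis using rf by (simp add: W.ext_diff sq z pw del: op.simps)
    qed
  qed
qed

text \<open>
  Around \<open>j\<close> the crossings act by zero, and in every summand of the correction term one of the two
  exponents is at least the length of the block of its dot.
\<close>

lemma rel_braid:
  assumes r: "Suc r < c" and u: "u \<in> seqs \<nu>" and v: "v \<in> N"
    and kl: "k = u ! r" "l = u ! Suc r" "m = u ! Suc (Suc r)" "a = nat (cartan_a C k l)"
  shows "W.ext ((crs r * crs (Suc r) * crs r - crs (Suc r) * crs r * crs (Suc r)) * idemp u -
       (if k = m \<and> rform C k l \<noteq> 0
        then (\<Sum>t<a. dot r ^ t * dot (Suc (Suc r)) ^ (a - 1 - t)) * idemp u
        else 0) :: ('i, 'k) klr_free) v = 0"
proof -
  have r': "r < c" "Suc r < c" "r \<le> c" "Suc (Suc r) \<le> c" using r by auto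
  have br: "W.ext ((crs r * crs (Suc r) * crs r - crs (Suc r) * crs r * crs (Suc r)) * idemp u :: ('i, 'k) klr_free) v
     = op (Cross r) (op (Cross (Suc r)) (op (Cross r) (op (Idemp u) v)))
       - op (Cross (Suc r)) (op (Cross r) (op (Cross (Suc r)) (op (Idemp u) v)))"
    using r' u v by (simp add: exts del: op.simps)
  have cr: "op (Cross t) 0 = 0" if "t < c" for t using that by (auto simp: phi_0)
  have sm: "W.ext ((\<Sum>t<a. dot r ^ t * dot (Suc (Suc r)) ^ (a - 1 - t)) * idemp u :: ('i, 'k) klr_free) v
     = (\<Sum>t<a. (op (Dot r) ^^ t) ((op (Dot (Suc (Suc r))) ^^ (a - 1 - t)) (op (Idemp u) v)))"
  proof -
    have d: "(dot r ^ t * dot (Suc (Suc r)) ^ s :: ('i, 'k) klr_free) \<in> klr_fcar \<nu>" for t s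
      using r' by (intro free_alg_mult free_alg_power fcar) auto
    have "W.ext (dot r ^ t * dot (Suc (Suc r)) ^ s :: ('i, 'k) klr_free) w
        = (op (Dot r) ^^ t) ((op (Dot (Suc (Suc r))) ^^ s) w)" if w: "w \<in> N" for t s w
    proof -
      have "W.ext (dot (Suc (Suc r)) ^ s :: ('i, 'k) klr_free) w \<in> N"
        by (rule W.ext_in[OF _ w]) (intro free_alg_power fcar r')
      thus ?thesis using r' w by (simp add: W.ext_mult free_alg_power fcar ext_dot_pow del: op.simps)
    qed
    thus ?thesis using d u v op_idemp_in[OF u v]
      by (subst ext_prod) (simp_all add: free_alg_sum W.ext_sum del: op.simps)
  qed
  show ?thesis
  proof (cases "u = word p")
    case False
    hence z: "op (Idemp u) v = 0" by simp
    have z2: "(op (Dot t) ^^ b) 0 = 0" if "t \<le> c" for t b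
      using that by (induction b) (auto simp: x_0)
    have s0: "W.ext ((\<Sum>t<a. dot r ^ t * dot (Suc (Suc r)) ^ (a - 1 - t)) * idemp u :: ('i, 'k) klr_free) v = 0"
      unfolding sm z using r' by (simp add: z2 del: op.simps)
    show ?thesis using r' s0 by (simp add: W.ext_diff br z cr del: op.simps)
  next
    case True
    hence z: "op (Idemp u) v = v" by simp
    have n: "k = (if r = p then j else i)" "l = (if Suc r = p then j else i)" "m = (if Suc (Suc r) = p then j else i)"
      using word_nth[OF pc, of r] word_nth[OF pc, of "Suc r"] word_nth[OF pc, of "Suc (Suc r)"] True r kl by simp_all
    consider "adj r" "Suc r \<noteq> p" | "Suc r = p" | "adj (Suc r)" "\<not> adj r" | "\<not> adj r" "\<not> adj (Suc r)" by (auto simp: adj_def)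
    thus ?thesis
    proof cases
      case 1
      hence "k \<noteq> m" using n ij by (auto simp: adj_def)
      thus ?thesis using 1 r' by (simp add: W.ext_diff br z op_adj cr[unfolded op_adj] phi_0 del: op.simps)
    next
      case 3
      hence "k \<noteq> m" using n ij by (auto simp: adj_def)
      thus ?thesis using 3 r' by (simp add: W.ext_diff br z op_adj cr[unfolded op_adj] phi_0 del: op.simps)
    next
      case 4
      hence "k = i" "l = i" "m = i" using n by (auto simp: adj_def)
      hence "a = 0" using kl(4) cartan_ii by simp
      moreover have "op (Cross r) (op (Cross (Suc r)) (op (Cross r) v)) = op (Cross (Suc r)) (op (Cross r) (op (Cross (Suc r)) v))"
        unfolding op_adj using 4 phi_braid[OF r N_T[OF v]] by simp
      ultimately show ?thesis by (simp add: W.ext_diff br sm z del: op.simps)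
    next
      case 2
      hence ad: "adj r" "adj (Suc r)" by (auto simp: adj_def)
      have a: "a = nat (cartan_a C i j)" using kl(4) n 2 by simp
      have "(op (Dot r) ^^ t) ((op (Dot (Suc (Suc r))) ^^ (a - 1 - t)) v) = 0" if "t < a" for t
      proof (cases "p \<le> t")
        case True
        have "(x (Suc p) ^^ (a - 1 - t)) v \<in> N" using r' 2 by (intro x_pow_in v) auto
        from x_pow_left[OF 2 this True] show ?thesis using 2 r' v by (simp add: dot_pow x_pow_in)
      next
        case False
        hence "c - p \<le> a - 1 - t" using a a_ij that by simp
        moreover have "(x r ^^ t) 0 = 0" using r'(3) by (induction t) (auto simp: x_0)
        ultimately show ?thesis using 2 r' v x_pow_right[OF _ v, of "a - 1 - t"] by (simp add: dot_pow)
      qed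
      hence "W.ext ((\<Sum>t<a. dot r ^ t * dot (Suc (Suc r)) ^ (a - 1 - t)) * idemp u :: ('i, 'k) klr_free) v = 0"
        unfolding sm z by (intro sum.neutral) auto
      thus ?thesis using ad r' by (simp add: W.ext_diff br z op_adj del: op.simps)
    qed
  qed
qed

lemma ext_relators:
  assumes "q \<in> klr_relators C \<nu>" and v: "v \<in> N"
  shows "W.ext (q :: ('i, 'k) klr_free) v = 0"
  using assms(1)
proof cases
  case unit
  have "(\<Sum>u\<in>seqs \<nu>. W.ext (idemp u :: ('i, 'k) klr_free) v) = (\<Sum>u\<in>seqs \<nu>. if u = word p then v else 0)"
    by (rule sum.cong) (simp_all add: ext_gens v)
  also have "\<dots> = v" using word_in[OF pc] by simp
  finally show ?thesis unfolding unit by (simp add: W.ext_diff W.ext_sum)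
next
  case (idem_idem u w) thus ?thesis using rel_idem_idem v by simp
next
  case (dot_idem u r)
  hence "W.ext (dot r * idemp u - idemp u * dot r :: ('i, 'k) klr_free) v = 0"
    using v by (simp add: exts del: op.simps) (auto simp: x_0)
  thus ?thesis using dot_idem by simp
next
  case (crs_idem u r) thus ?thesis using rel_crs_idem[OF _ _ v, of u r] by simp
next
  case (dot_dot r t) thus ?thesis using rel_dot_dot[OF _ _ v, of r t] by simp
next
  case (crs_crs r t) thus ?thesis using rel_crs_crs[OF _ _ _ v, of r t] by simp
next
  case (crs_sq u r k l) thus ?thesis using rel_crs_sq[OF _ _ v, of r u k l] by simp
next
  case (braid u r k l m a) thus ?thesis using rel_braid[OF _ _ v, of r u k l m a] by simp
next
  case (crs_dot u r t) thus ?thesis using rel_crs_dot[OF _ _ _ v, of r t u] by simp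
qed

abbreviation "\<Delta> \<equiv> rform C i i"

definition part :: "int \<Rightarrow> 'v set" where
  "part d = {v \<in> N. \<forall>e. gr e v \<noteq> 0 \<longrightarrow> d = - \<Delta> * int e}"

lemma part_gr:
  assumes v: "v \<in> part d"
  shows "d = - \<Delta> * int e ==> gr e v = v" "d \<noteq> - \<Delta> * int e ==> gr e v = 0"
    "(\<And>e. d \<noteq> - \<Delta> * int e) ==> v = 0"
proof -
  have vT: "v \<in> T" using v N_T by (simp add: part_def)
  show "d \<noteq> - \<Delta> * int e ==> gr e v = 0" for e using v by (auto simp: part_def)
  show "v = 0" if "\<And>e. d \<noteq> - \<Delta> * int e"
  proof -
    have "{e. gr e v \<noteq> 0} = {}" using v that by (auto simp: part_def)
    thus ?thesis using gr_sum[OF vT] by simp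
  qed
  show "gr e v = v" if d: "d = - \<Delta> * int e" for e
  proof -
    have "{e'. gr e' v \<noteq> 0} \<subseteq> {e}" using v d root_pos[of i] by (auto simp: part_def)
    hence "{e'. gr e' v \<noteq> 0} = (if gr e v = 0 then {} else {e})" by auto
    thus ?thesis using gr_sum[OF vT] by (auto split: if_splits)
  qed
qed

lemma gr_part: "v \<in> N ==> gr e v \<in> part (- \<Delta> * int e)"
  by (auto simp: part_def N_gr gr_gr)

lemma part_sub: "subspace (part d)"
  by (rule subspaceI) (auto simp: part_def subspace_add[OF N_sub] subspace_scale[OF N_sub] gr_add gr_scale, force+)

lemma part_x: "t \<le> c ==> v \<in> part d ==> x t v \<in> part (\<Delta> + d)"
proof -
  assume t: "t \<le> c" and v: "v \<in> part d"
  have "\<Delta> + d = - \<Delta> * int e" if "gr e (x t v) \<noteq> 0" for e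
  proof -
    have "gr e (x t v) = x t (gr (Suc e) v)" by (simp add: gr_x)
    hence "gr (Suc e) v \<noteq> 0" using that t by (auto simp: x_0)
    hence "d = - \<Delta> * int (Suc e)" using v by (auto simp: part_def)
    thus ?thesis by (simp add: algebra_simps)
  qed
  thus ?thesis using v N_x[OF t] by (simp add: part_def)
qed

lemma part_phi: "r < c ==> r \<noteq> p ==> Suc r \<noteq> p ==> v \<in> part d ==> \<phi> r v \<in> part (- \<Delta> + d)"
proof -
  assume r: "r < c" "r \<noteq> p" "Suc r \<noteq> p" and v: "v \<in> part d"
  have "- \<Delta> + d = - \<Delta> * int e" if ne: "gr e (\<phi> r v) \<noteq> 0" for e
  proof (cases e)
    case 0 thus ?thesis using ne gr_phi_0 by simp
  next
    case (Suc e')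
    have "gr e (\<phi> r v) = \<phi> r (gr e' v)" by (simp add: gr_phi Suc)
    hence "gr e' v \<noteq> 0" using ne r by (auto simp: phi_0)
    hence "d = - \<Delta> * int e'" using v by (auto simp: part_def)
    thus ?thesis using Suc by (simp add: algebra_simps)
  qed
  thus ?thesis using v N_phi[OF r] by (simp add: part_def)
qed

text \<open>
  The component in degree \<open>- \<Delta> * int e\<close> is \<open>gr e v\<close>, and there are no others.
\<close>

lemma part_decomp:
  assumes v: "v \<in> N"
  shows "\<exists>!f. (\<forall>d. f d \<in> part d) \<and> finite {d. f d \<noteq> 0} \<and> v = (\<Sum>d | f d \<noteq> 0. f d)"
proof (rule ex_ex1I)
  have vT: "v \<in> T" using v N_T by simp
  let ?D = "\<lambda>e. - \<Delta> * int e"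
  have inj: "inj ?D" using root_pos[of i] by (auto simp: inj_def)
  let ?f = "\<lambda>d. if d \<in> range ?D then gr (inv_into UNIV ?D d) v else 0"
  have fD: "?f (?D e) = gr e v" for e
  proof -
    have "?D e \<in> range ?D" by (rule rangeI)
    thus ?thesis using inv_f_f[OF inj, of e] by (simp only: if_True)
  qed
  have supp: "{d. ?f d \<noteq> 0} = ?D ` {e. gr e v \<noteq> 0}"
  proof
    show "{d. ?f d \<noteq> 0} \<subseteq> ?D ` {e. gr e v \<noteq> 0}"
    proof
      fix d assume d: "d \<in> {d. ?f d \<noteq> 0}"
      then obtain e where e: "d = ?D e" by (auto split: if_splits)
      have "?f d \<noteq> 0" using d by (rule CollectD)
      hence "gr e v \<noteq> 0" unfolding e fD .
      thus "d \<in> ?D ` {e. gr e v \<noteq> 0}" unfolding e by (intro imageI CollectI)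
    qed
    show "?D ` {e. gr e v \<noteq> 0} \<subseteq> {d. ?f d \<noteq> 0}"
    proof (intro image_subsetI CollectI)
      fix e assume "e \<in> {e. gr e v \<noteq> 0}"
      hence "gr e v \<noteq> 0" by (rule CollectD)
      thus "?f (?D e) \<noteq> 0" unfolding fD .
    qed
  qed
  have "(\<Sum>d | ?f d \<noteq> 0. ?f d) = (\<Sum>e | gr e v \<noteq> 0. ?f (?D e))"
    unfolding supp by (subst sum.reindex) (use inj in \<open>auto simp: inj_on_def inj_def\<close>)
  also have "\<dots> = (\<Sum>e | gr e v \<noteq> 0. gr e v)" by (simp only: fD)
  also have "\<dots> = v" using gr_sum[OF vT] by simp
  finally have s: "v = (\<Sum>d | ?f d \<noteq> 0. ?f d)" by (rule sym)
  have "finite {d. ?f d \<noteq> 0}" unfolding supp by (rule finite_imageI[OF gr_fin[OF vT]])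
  moreover have "?f d \<in> part d" for d
  proof (cases "d \<in> range ?D")
    case True
    then obtain e where "d = ?D e" by auto
    thus ?thesis using gr_part[OF v, of e] fD[of e] by (simp only:)
  next
    case False thus ?thesis using subspace_0[OF part_sub] by simp
  qed
  ultimately show "\<exists>f. (\<forall>d. f d \<in> part d) \<and> finite {d. f d \<noteq> 0} \<and> v = (\<Sum>d | f d \<noteq> 0. f d)"
    using s by (intro exI[of _ ?f] conjI allI)
next
  fix f g assume f: "(\<forall>d. f d \<in> part d) \<and> finite {d. f d \<noteq> 0} \<and> v = (\<Sum>d | f d \<noteq> 0. f d)"
    and g: "(\<forall>d. g d \<in> part d) \<and> finite {d. g d \<noteq> 0} \<and> v = (\<Sum>d | g d \<noteq> 0. g d)"
  have val: "gr e v = h (- \<Delta> * int e)"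
    if "(\<forall>d. h d \<in> part d) \<and> finite {d. h d \<noteq> 0} \<and> v = (\<Sum>d | h d \<noteq> 0. h d)" for h e
  proof -
    have h: "\<And>d. h d \<in> part d" "finite {d. h d \<noteq> 0}" "v = (\<Sum>d | h d \<noteq> 0. h d)" using that by auto
    have "gr e v = (\<Sum>d | h d \<noteq> 0. gr e (h d))" by (subst h(3), rule gr_sums)
    also have "\<dots> = (\<Sum>d | h d \<noteq> 0. if d = - \<Delta> * int e then h (- \<Delta> * int e) else 0)"
      using part_gr[OF h(1)] by (intro sum.cong) auto
    also have "\<dots> = h (- \<Delta> * int e)" using h(2) by auto
    finally show ?thesis .
  qed
  show "f = g"
  proof
    fix d
    show "f d = g d"
    proof (cases "\<exists>e. d = - \<Delta> * int e")
      case True thus ?thesis using val[OF f] val[OF g] by metis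
    next
      case False
      have "f d \<in> part d" "g d \<in> part d" using f g by auto
      thus ?thesis using part_gr(3)[of "f d" d] part_gr(3)[of "g d" d] False by auto
    qed
  qed
qed

lemma klr_ops: "klr_ops C \<nu> sc N op part"
proof (intro klr_ops.intro klr_ops_axioms.intro W.word_ops_axioms, goal_cases)
  case 1
  obtain B where B: "finite B" "T = span B" using T_fd by auto
  obtain B' where "finite B'" "N = span B'"
    by (rule finite_basis_of_subspace[OF N_sub, of B]) (use B N_T in auto)
  thus ?case by blast
next
  case (2 q v) thus ?case by (rule ext_relators)
next
  case (3 d) show ?case by (rule part_sub)
next
  case (4 d) show ?case by (auto simp: part_def)
next
  case (5 v) thus ?case by (rule part_decomp)
next
  case (6 u v e) thus ?case using subspace_0[OF part_sub] by simp
next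
  case (7 u r v e)
  have z: "0 \<in> part d" for d by (rule subspace_0[OF part_sub])
  have r: "r \<le> c" using 7(2) by simp
  show ?case
  proof (cases "u = word p \<and> r \<noteq> p")
    case True
    thus ?thesis using part_x[OF r 7(3)] word_nth[OF pc r] by simp
  next
    case False
    hence "op (Dot r) (op (Idemp u) v) = 0" using x_0[of r] r by auto
    thus ?thesis using z by (simp only:)
  qed
next
  case (8 u r v e)
  have z: "0 \<in> part d" for d by (rule subspace_0[OF part_sub])
  have r: "r < c" using 8(2) by simp
  show ?case
  proof (cases "u = word p \<and> \<not> adj r")
    case True
    hence "u ! r = i" "u ! Suc r = i" using word_nth[OF pc, of r] word_nth[OF pc, of "Suc r"] r by (auto simp: adj_def)
    thus ?thesis using True part_phi[OF r _ _ 8(3)] by (simp add: adj_def)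
  next
    case False
    hence "op (Cross r) (op (Idemp u) v) = 0" using phi_0[OF r] by (auto simp: adj_def)
    thus ?thesis using z by (simp only:)
  qed
qed

sublocale K: klr_ops C \<nu> sc N op part by (rule klr_ops)

lemma op_module_concentrated: "concentrated C \<nu> K.op_module (word p)"
  unfolding concentrated_def using word_in[OF pc] by (simp add: K.gact_op_module idemp_in ext_gens)

end

section \<open>Existence\<close>

definition pm_scale :: "'k::field \<Rightarrow> (nat \<Rightarrow>\<^sub>0 'k) \<Rightarrow> nat \<Rightarrow>\<^sub>0 'k" where
  "pm_scale a q = Poly_Mapping.map ((*) a) q"

lemma lookup_pm_scale: "lookup (pm_scale a q) n = a * lookup q n"
  by (simp add: pm_scale_def Poly_Mapping.map.rep_eq when_def)

lemma pm_vector_space: "vector_space (pm_scale :: 'k::field \<Rightarrow> _)"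
  by unfold_locales (auto intro!: poly_mapping_eqI simp: lookup_pm_scale lookup_add algebra_simps)

text \<open>
  Coordinates with respect to a basis that extends one of \<open>T\<close>, with those of \<open>T\<close> left out. They embed a
  module into the standard space if \<open>T = {0}\<close>, and realise the quotient by \<open>T\<close> in general.
\<close>

lemma (in klr_module) linear_coords:
  fixes T :: "'v set"
  assumes T: "gm_subspace M T" "T \<subseteq> S"
  obtains \<pi> :: "'v \<Rightarrow> nat \<Rightarrow>\<^sub>0 'k" where "\<And>v w. v \<in> S ==> w \<in> S ==> \<pi> (v + w) = \<pi> v + \<pi> w"
    "\<And>a v. v \<in> S ==> \<pi> (gm_scale M a v) = pm_scale a (\<pi> v)" "{v \<in> S. \<pi> v = 0} = T"
proof -
  obtain F where F: "finite F" "S = vs.span F" using finite_dim by auto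
  obtain A where A: "A \<subseteq> T" "vs.independent A" "finite A" "vs.span A = T"
    by (rule vs.finite_basis_of_subspace[OF T(1), of F]) (use T F in auto)
  obtain B where B: "A \<subseteq> B" "B \<subseteq> S" "vs.independent B" "finite B" "vs.span B = S"
    using vs.finite_basis_extending[OF subspace, of F A] A T F by auto
  obtain h :: "'v \<Rightarrow> nat" where h: "inj_on h B" using B(4) by (meson finite_imp_inj_to_nat_seg)
  define \<pi> :: "'v \<Rightarrow> nat \<Rightarrow>\<^sub>0 'k" where
    "\<pi> v = (\<Sum>b\<in>B - A. single (h b) (vs.representation B v b))" for v
  have ps: "pm_scale a (\<Sum>x\<in>Y. f x) = (\<Sum>x\<in>Y. pm_scale a (f x))" for a and f :: "'v \<Rightarrow> nat \<Rightarrow>\<^sub>0 'k" and Y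
    by (rule poly_mapping_eqI) (simp add: lookup_pm_scale lookup_sum sum_distrib_left)
  have pg: "pm_scale a (single n b) = single n (a * b)" for a b :: 'k and n
    by (rule poly_mapping_eqI) (simp add: lookup_pm_scale lookup_single when_def)
  show ?thesis
  proof (rule that[of \<pi>])
    show "\<pi> (v + w) = \<pi> v + \<pi> w" if "v \<in> S" "w \<in> S" for v w
      using that B(5) by (simp add: \<pi>_def vs.representation_add[OF B(3)] single_add sum.distrib)
    show "\<pi> (gm_scale M a v) = pm_scale a (\<pi> v)" if "v \<in> S" for a v
      using that B(5) by (simp add: \<pi>_def vs.representation_scale[OF B(3)] ps pg)
    have lk: "lookup (\<pi> v) (h b) = vs.representation B v b" if "b \<in> B - A" for v b
    proof -
      have "lookup (\<pi> v) (h b) = (\<Sum>b'\<in>B - A. if b' = b then vs.representation B v b' else 0)"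
        unfolding \<pi>_def lookup_sum lookup_single
        by (intro sum.cong) (use that h in \<open>auto simp: when_def dest: inj_onD\<close>)
      thus ?thesis using that B(4) by simp
    qed
    show "{v \<in> S. \<pi> v = 0} = T"
    proof (intro equalityI subsetI)
      fix v assume "v \<in> {v \<in> S. \<pi> v = 0}"
      hence v: "v \<in> S" and "\<pi> v = 0" by auto
      hence z: "vs.representation B v b = 0" if "b \<in> B - A" for b using lk[OF that, of v] by simp
      have "v = (\<Sum>b | vs.representation B v b \<noteq> 0. gm_scale M (vs.representation B v b) b)"
        using vs.sum_nonzero_representation_eq[OF B(3), of v] v B(5) by simp
      moreover have "\<dots> \<in> T"
      proof (intro vs.subspace_sum[OF T(1)] vs.subspace_scale[OF T(1)])
        fix b assume b: "b \<in> {b. vs.representation B v b \<noteq> 0}"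
        hence "b \<in> B" using vs.representation_ne_zero by auto
        thus "b \<in> T" using b z A(1) by auto
      qed
      ultimately show "v \<in> T" by simp
    next
      fix v assume v: "v \<in> T"
      have "vs.representation B v = vs.representation A v"
        by (rule vs.representation_extend[OF B(3) _ B(1)]) (use v A in simp)
      hence "vs.representation B v b = 0" if "b \<in> B - A" for b
        using that vs.representation_ne_zero[of A v b] by auto
      thus "v \<in> {v \<in> S. \<pi> v = 0}" using v T(2) by (auto simp: \<pi>_def)
    qed
  qed
qed

lemma (in klr_module) irreducible_of_concentrated:
  assumes ne: "S \<noteq> {0}" and u: "concentrated C \<nu> M u"
  shows "\<exists>L :: ('i, 'k) klr_mod. gm_irreducible C \<nu> L \<and> concentrated C \<nu> L u"
proof -
  obtain \<pi> :: "'v \<Rightarrow> nat \<Rightarrow>\<^sub>0 'k" where \<pi>: "\<And>v w. v \<in> S ==> w \<in> S ==> \<pi> (v + w) = \<pi> v + \<pi> w"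
    "\<And>a v. v \<in> S ==> \<pi> (gm_scale M a v) = pm_scale a (\<pi> v)" "{v \<in> S. \<pi> v = 0} = {0}"
    by (rule linear_coords[of "{0}"]) (use zero_in in auto)
  let ?Q = "gm_push pm_scale \<pi> M"
  have "gm_submodule C \<nu> M {v \<in> S. \<pi> v = 0}" unfolding \<pi>(3) by (rule zero_submodule)
  note Q = push_module[OF pm_vector_space \<pi>(1,2) this]
  interpret Q: klr_module C \<nu> ?Q by (rule Q(1))
  have sp: "gm_space ?Q = \<pi> ` S" by (simp add: gm_push_def)
  obtain v where "v \<in> S" "v \<noteq> 0" using ne zero_in by auto
  hence "\<pi> v \<noteq> 0" using \<pi>(3) by auto
  hence "gm_space ?Q \<noteq> {0}" using \<open>v \<in> S\<close> sp by auto
  then obtain N where N: "gm_submodule C \<nu> ?Q N" "gm_irreducible C \<nu> (gm_restrict ?Q N)" by (rule Q.irreducible_submodule)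
  have uin: "u \<in> seqs \<nu>" using u by (simp add: concentrated_def)
  have "gact C \<nu> ?Q (idemp u) w = w" if w: "w \<in> gm_space ?Q" for w
  proof -
    obtain v where v: "v \<in> S" "w = \<pi> v" using w unfolding sp by (rule imageE) auto
    have "gact C \<nu> ?Q (idemp u) w = \<pi> (gact C \<nu> M (idemp u) v)"
      using Q(2) v klr_cls_in[OF idemp_in[OF uin]] unfolding gm_hom_def gact_def by metis
    thus ?thesis using u v by (simp add: concentrated_def)
  qed
  hence "concentrated C \<nu> (gm_restrict ?Q N) u"
    using Q.sub_le[OF N(1)] uin by (auto simp: concentrated_def gact_restrict)
  thus ?thesis using N(2) by blast
qed

lemma (in cij) exists_irreducible:
  assumes pc: "p \<le> c"
  shows "\<exists>L :: ('i, 'k::alg_closed_field) klr_mod. gm_irreducible C \<nu> L \<and> concentrated C \<nu> L (word p)"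
proof -
  \<comment> \<open>evaluation of the constant function 1 is nonzero at points with distinct coordinates only\<close>
  obtain z0 :: "nat \<Rightarrow> 'k" where z0: "inj z0" using infinite_countable_subset[OF infinite_alg_closed] by blast
  from finite_nil_hecke_span[of z0 c] obtain B where B: "finite B" "B \<subseteq> functionals" "\<forall>b\<in>B. homog_fn b" "fn_eval z0 \<in> fn.span B"
    "\<forall>t. \<forall>b\<in>B. fn_dot t b \<in> fn.span B" "\<forall>t>c. \<forall>b\<in>B. fn_dot t b = 0" "\<forall>t<c. \<forall>b\<in>B. fn_crs t b \<in> fn.span B"
    by (elim exE conjE)
  let ?T = "fn.span B"
  interpret F: nil_hecke fn_scale functionals fn_dot c fn_crs by (rule functionals_nil_hecke)
  have TF: "v \<in> functionals" if "v \<in> ?T" for v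
    using fn.span_minimal[OF B(2) functionals_sub] that by blast
  have xT: "fn_dot t v \<in> ?T" if v: "v \<in> ?T" for t v
  proof (rule fn.span_inductS[OF v])
    have "fn_dot t 0 = (0 :: 'k functional)" using fn_lin(2)[of t 0 0] by (simp only: fn.scale_zero_left)
    thus "fn_dot t 0 \<in> ?T" by (simp only: fn.span_zero)
  qed (simp_all only: fn_lin fn.span_add fn.span_scale B(5)[rule_format])
  have pT: "fn_crs t v \<in> ?T" if v: "v \<in> ?T" and t: "t < c" for t v
  proof (rule fn.span_inductS[OF v])
    have "fn_crs t 0 = (0 :: 'k functional)" using fn_lin(4)[of t 0 0] by (simp only: fn.scale_zero_left)
    thus "fn_crs t 0 \<in> ?T" by (simp only: fn.span_zero)
  qed (simp_all only: fn_lin fn.span_add fn.span_scale B(7)[rule_format] t)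
  have NH: "nil_hecke fn_scale ?T fn_dot c fn_crs"
  proof (unfold_locales, goal_cases)
    case 1 show ?case by (rule fn.subspace_span)
  next
    case (2 l v) show ?case by (rule xT) fact
  next
    case (6 t v) show ?case by (rule pT) fact+
  next
    case (9 t v) show ?case by (rule F.phi_sq) (use 9 TF in auto)
  next
    case (10 t u v) show ?case by (rule F.phi_far) (use 10 TF in auto)
  next
    case (11 t v) show ?case by (rule F.phi_braid) (use 11 TF in auto)
  next
    case (12 t u v) show ?case by (rule F.phi_x) (use 12 TF in auto)
  qed (rule fn_lin fn_dot_dot)+
  have "cij_model C i j c \<nu> fn_scale ?T fn_dot fn_crs p fn_comp"
  proof (intro cij_model.intro cij_axioms NH cij_model_axioms.intro, goal_cases)
    case 1 show ?case by fact
  next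
    case 2 show ?case using B(1) by blast
  next
    case (3 v e) show ?case by (rule fn_comp_span) (use B(3) 3 in auto)
  next
    case (9 t v) show ?case by (auto simp: fn_comp_def fn_crs_def fun_eq_iff)
  next
    case (10 v) show ?case by (rule fn_comp_finite(1)[OF B(1) _ 10]) (use B(3) in blast)
  next
    case (11 v) show ?case by (rule fn_comp_finite(2)[OF B(1) _ 11]) (use B(3) in blast)
  qed (rule fn_comp_lin fn_comp_comp fn_dot_comp fn_crs_comp)+
  then interpret m: cij_model C i j c \<nu> fn_scale ?T fn_dot fn_crs p fn_comp .
  interpret K: klr_module C \<nu> m.K.op_module by (rule m.K.klr_module_op_module)
  \<comment> \<open>dots kill the evaluation, so it lies in the subspace cut out by the symmetric polynomials\<close>
  have "hsym fn_dot (Suc k) ls (fn_eval z0) = 0" if "set ls \<subseteq> {..c}" for k ls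
  proof -
    have "hsym fn_dot (Suc k) ls (fn_eval z0) = 0 \<and> True" for k
      using that
    proof (induction ls arbitrary: k)
      case (Cons l ls)
      have IH: "hsym fn_dot (Suc k) ls (fn_eval z0) = 0" for k by (rule conjunct1[OF Cons.IH]) (use Cons.prems in auto)
      have l: "l \<in> {..c}" "set (l # ls) \<subseteq> {..c}" using Cons.prems by auto
      have "fn_dot l (hsym fn_dot k (l # ls) (fn_eval z0)) = hsym fn_dot k (l # ls) (fn_dot l (fn_eval z0))"
        by (rule F.h_x[symmetric]) (use l fn_eval_in in auto)
      also have "\<dots> = 0" unfolding fn_dot_eval using F.h_0[OF l(2), of k] by (simp only: if_cancel)
      finally show ?case using IH[of k] by (simp only: hsym.simps add_0_left simp_thms)
    qed (simp only: hsym.simps simp_thms)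
    thus ?thesis by blast
  qed
  note hz = this
  have "fn_eval z0 \<in> m.N" unfolding m.N_def
    by (intro CollectI conjI B(4) allI hz m.blocks)
  hence "gm_space m.K.op_module \<noteq> {0}" using fn_eval_nonzero[OF z0] by (simp only: m.K.op_module_sel) blast
  from K.irreducible_of_concentrated[OF this m.op_module_concentrated] show ?thesis .
qed

section \<open>Graded dimension is additive\<close>

locale klr_hom = L: klr_module C \<nu> L + M: klr_module C \<nu> M
  for C :: "('i, 'p) cartan_data" and \<nu>
    and L :: "(('i, 'k::field) klr_elem, 'k, 'v::ab_group_add) gmodule"
    and M :: "(('i, 'k) klr_elem, 'k, 'w::ab_group_add) gmodule" +
  fixes f :: "'v \<Rightarrow> 'w"
  assumes hom: "gm_hom C \<nu> L M f"
begin

lemma f_in: "v \<in> L.S ==> f v \<in> M.S"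
  and f_add: "v \<in> L.S ==> w \<in> L.S ==> f (v + w) = f v + f w"
  and f_part: "v \<in> gm_part L d ==> f v \<in> gm_part M d"
  using hom by (auto simp: gm_hom_def)

lemma f_act: "p \<in> klr_fcar \<nu> ==> v \<in> L.S ==> f (L.act p v) = M.act p (f v)"
  using hom by (simp add: gm_hom_def gact_def)

lemma f_scale: "v \<in> L.S ==> f (gm_scale L a v) = gm_scale M a (f v)"
  using f_act[OF free_alg_const, of v a] by (simp add: L.act_const' M.act_const' f_in)

lemma f_0 [simp]: "f 0 = 0" using f_add[of 0 0] by simp

lemma f_sum: "(\<And>x. x \<in> A ==> h x \<in> L.S) ==> f (\<Sum>x\<in>A. h x) = (\<Sum>x\<in>A. f (h x))"
  by (induction A rule: infinite_finite_induct) (auto simp: f_add L.sum_in)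

lemma f_hc: assumes v: "v \<in> L.S" shows "hc M (f v) = (\<lambda>d. f (hc L v d))"
proof (rule M.hc_unique)
  show "f v = (\<Sum>d | hc L v d \<noteq> 0. f (hc L v d))"
    by (subst (1) L.hc_sum[OF v]) (rule f_sum, rule L.hc_in[OF v])
qed (use v in \<open>auto simp: f_part L.hc_part L.hc_finite\<close>)

end

abbreviation gd :: "('i, 'p) cartan_data \<Rightarrow> 'i multiset \<Rightarrow> 'i list
    \<Rightarrow> (('i, 'k::field) klr_elem, 'k, 'v::ab_group_add) gmodule \<Rightarrow> laurent" where
  "gd C \<nu> u M \<equiv> gm_gdim M (idem_space C \<nu> M u)"

context klr_module begin

lemma idem_space_fix: "u \<in> seqs \<nu> ==> idem_space C \<nu> M u = {v \<in> S. E u v = v}"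
  unfolding idem_space_eq using E_E[of u u] by (auto simp: E_in image_iff) metis

lemma idem_part_sub: "u \<in> seqs \<nu> ==> gm_subspace M (gm_part M d \<inter> idem_space C \<nu> M u)"
  unfolding idem_space_fix
  by (rule vs.subspaceI) (auto simp: part_add part_scale add_in scale_in act_addr act_scale idemp_in)

lemma finite_span_part: "\<exists>F. finite F \<and> gm_part M d \<inter> U \<subseteq> gm_span M F"
  using finite_dim part_subset by blast

end

text \<open>
  Rank and nullity of \<open>g\<close> on the vectors of degree \<open>d\<close> and word \<open>u\<close>. Preimages can be chosen there, since
  homomorphisms commute with idempotents and with homogeneous components.
\<close>

lemma gdim_exact:
  fixes L :: "(('i, 'k::field) klr_elem, 'k, 'v::ab_group_add) gmodule"
    and M :: "(('i, 'k) klr_elem, 'k, 'v) gmodule" and N :: "(('i, 'k) klr_elem, 'k, 'v) gmodule"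
  assumes L: "klr_module C \<nu> L" and M: "klr_module C \<nu> M" and N: "klr_module C \<nu> N"
    and ex: "gm_exact C \<nu> L M N" and u: "u \<in> seqs \<nu>"
  shows "gd C \<nu> u M = gd C \<nu> u L + gd C \<nu> u N"
proof -
  obtain f g where fg: "gm_hom C \<nu> L M f" "gm_hom C \<nu> M N g" "inj_on f (gm_space L)"
    "g ` gm_space M = gm_space N" "f ` gm_space L = {v \<in> gm_space M. g v = 0}" using ex by (auto simp: gm_exact_def)
  interpret f: klr_hom C \<nu> L M f by (intro klr_hom.intro klr_hom_axioms.intro L M fg)
  interpret g: klr_hom C \<nu> M N g by (intro klr_hom.intro klr_hom_axioms.intro M N fg)
  have z: "0 \<in> idem_space C \<nu> L u" "0 \<in> idem_space C \<nu> M u" "0 \<in> idem_space C \<nu> N u"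
    using u by (simp_all add: f.L.idem_space_fix f.M.idem_space_fix g.M.idem_space_fix idemp_in)
  have dims: "f.M.vs.dim (gm_part M d \<inter> idem_space C \<nu> M u)
      = f.L.vs.dim (gm_part L d \<inter> idem_space C \<nu> L u) + g.M.vs.dim (gm_part N d \<inter> idem_space C \<nu> N u)" for d
  proof -
    let ?L = "gm_part L d \<inter> idem_space C \<nu> L u" and ?M = "gm_part M d \<inter> idem_space C \<nu> M u"
      and ?N = "gm_part N d \<inter> idem_space C \<nu> N u"
    obtain F where F: "finite F" "?M \<subseteq> gm_span M F" using f.M.finite_span_part by blast
    obtain F' where F': "finite F'" "?L \<subseteq> gm_span L F'" using f.L.finite_span_part by blast
    have MS: "?M \<subseteq> f.M.S" "?L \<subseteq> f.L.S" using f.M.part_subset f.L.part_subset by auto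
    have gM: "g ` ?M = ?N"
    proof (intro equalityI subsetI)
      fix w assume "w \<in> g ` ?M"
      then obtain v where v: "v \<in> gm_part M d" "f.M.E u v = v" "w = g v" using u by (auto simp: f.M.idem_space_fix)
      have "g.M.E u w = w" using g.f_act[OF idemp_in[OF u] f.M.part_in[OF v(1)]] v by simp
      thus "w \<in> ?N" using v u g.f_part[OF v(1)] by (simp add: g.M.idem_space_fix g.M.part_in)
    next
      fix w assume "w \<in> ?N"
      hence w: "w \<in> gm_part N d" "g.M.E u w = w" "w \<in> g.M.S" using u by (auto simp: g.M.idem_space_fix g.M.part_in)
      then obtain v where v: "v \<in> f.M.S" "w = g v" using fg(4) by blast
      let ?v = "hc M (f.M.E u v) d"
      have Ev: "f.M.E u v \<in> f.M.S" using u v by (intro f.M.E_in)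
      have "g ?v = hc N (g (f.M.E u v)) d" using g.f_hc[OF Ev] by simp
      also have "g (f.M.E u v) = w" using g.f_act[OF idemp_in[OF u] v(1)] v w by simp
      also have "hc N w d = w" using g.M.hc_of_part[OF w(1)] by simp
      finally have "g ?v = w" .
      moreover have "?v \<in> ?M" using u Ev f.M.hc_part[OF Ev, of d] f.M.E_E[OF u u v(1)]
        by (simp add: f.M.idem_space_fix f.M.hc_E[OF u Ev, symmetric] f.M.hc_in)
      ultimately show "w \<in> g ` ?M" by blast
    qed
    have fL: "{v \<in> ?M. g v = 0} = f ` ?L"
    proof (intro equalityI subsetI)
      fix w assume "w \<in> f ` ?L"
      then obtain v where v: "v \<in> gm_part L d" "f.L.E u v = v" "w = f v" using u by (auto simp: f.L.idem_space_fix)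
      have "f.M.E u w = w" using f.f_act[OF idemp_in[OF u] f.L.part_in[OF v(1)]] v by simp
      moreover have "g w = 0" using fg(5) v f.L.part_in by blast
      ultimately show "w \<in> {v \<in> ?M. g v = 0}" using v u f.f_part[OF v(1)] by (simp add: f.M.idem_space_fix f.M.part_in)
    next
      fix w assume w': "w \<in> {v \<in> ?M. g v = 0}"
      hence w: "w \<in> gm_part M d" "f.M.E u w = w" "w \<in> f.M.S" using u by (auto simp: f.M.idem_space_fix f.M.part_in)
      then obtain v where v: "v \<in> f.L.S" "w = f v" using fg(5) w' by blast
      let ?v = "hc L (f.L.E u v) d"
      have Ev: "f.L.E u v \<in> f.L.S" using u v by (intro f.L.E_in)
      have "f ?v = hc M (f (f.L.E u v)) d" using f.f_hc[OF Ev] by simp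
      also have "f (f.L.E u v) = w" using f.f_act[OF idemp_in[OF u] v(1)] v w by simp
      also have "hc M w d = w" using f.M.hc_of_part[OF w(1)] by simp
      finally have "f ?v = w" .
      moreover have "?v \<in> ?L" using u Ev f.L.hc_part[OF Ev, of d] f.L.E_E[OF u u v(1)]
        by (simp add: f.L.idem_space_fix f.L.hc_E[OF u Ev, symmetric] f.L.hc_in)
      ultimately show "w \<in> f ` ?L" by blast
    qed
    have "f.M.vs.dim ?M = f.M.vs.dim {v \<in> ?M. g v = 0} + g.M.vs.dim (g ` ?M)"
      by (rule rank_nullity[OF f.M.vector_space g.M.vector_space f.M.idem_part_sub[OF u] F(2,1)])
        (auto simp: f.M.part_in g.f_add g.f_scale)
    moreover have "f.L.vs.dim ?L = f.L.vs.dim {v \<in> ?L. f v = 0} + f.M.vs.dim (f ` ?L)"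
      by (rule rank_nullity[OF f.L.vector_space f.M.vector_space f.L.idem_part_sub[OF u] F'(2,1)])
        (auto simp: f.L.part_in f.f_add f.f_scale)
    moreover have "{v \<in> ?L. f v = 0} = {0}"
    proof -
      have "v = 0" if "v \<in> ?L" "f v = 0" for v
        using inj_onD[OF fg(3), of v 0] that MS(2) by auto
      thus ?thesis using z(1) by auto
    qed
    moreover have "f.L.vs.dim {0} = 0" using f.L.vs.dim_unique[of "{}" "{0}" 0, OF _ _ f.L.vs.independent_empty] by simp
    ultimately show ?thesis unfolding fL gM by simp
  qed
  show ?thesis
    by (rule poly_mapping_eqI) (simp add: lookup_add f.L.lookup_gdim f.M.lookup_gdim g.M.lookup_gdim z dims)
qed

section \<open>The Grothendieck group\<close>

abbreviation "K0_car C \<nu> \<equiv> {x. keys x \<subseteq> {M. klr_module C \<nu> M}}"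

lemma K0_free_ops [simp]: "x \<in> carrier (K0_free C \<nu>) \<longleftrightarrow> keys x \<subseteq> {M. klr_module C \<nu> M}"
    "x \<otimes>\<^bsub>K0_free C \<nu>\<^esub> y = x + y" "\<one>\<^bsub>K0_free C \<nu>\<^esub> = 0"
  by (simp_all add: K0_free_def)

lemma K0_free_group: "group (K0_free C \<nu>)" by (simp add: K0_free_def)

lemma K0_free_inv: "keys x \<subseteq> {M. klr_module C \<nu> M} ==> inv\<^bsub>K0_free C \<nu>\<^esub> x = - x"
  by (simp add: K0_free_def)

lemma keys_frag_diff: "keys x \<subseteq> A ==> keys y \<subseteq> A ==> keys (x - y :: 'a \<Rightarrow>\<^sub>0 int) \<subseteq> A"
  using keys_diff[of x y] by auto

lemma K0_exact_keys: "klr_module C \<nu> L ==> klr_module C \<nu> M ==> klr_module C \<nu> N ==>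
    keys (frag_of M - frag_of L - frag_of N) \<subseteq> {M. klr_module C \<nu> M}"
  by (intro keys_frag_diff) auto

lemma K0_rel_induct [consumes 1, case_names exact zero uminus add]:
  assumes "x \<in> K0_rel C \<nu>"
    and exact: "\<And>L M N. klr_module C \<nu> L ==> klr_module C \<nu> M ==> klr_module C \<nu> N ==> gm_exact C \<nu> L M N
      ==> P (frag_of M - frag_of L - frag_of N)"
    and z: "P 0" and u: "\<And>x. P x ==> P (- x)" and a: "\<And>x y. P x ==> P y ==> P (x + y)"
  shows "P x"
  using assms(1) unfolding K0_rel_def
proof (induction rule: generate.induct)
  case one thus ?case using z by simp
next
  case (incl h) thus ?case using exact by auto
next
  case (inv h)
  then obtain L M N where h: "h = frag_of M - frag_of L - frag_of N" "klr_module C \<nu> L" "klr_module C \<nu> M"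
    "klr_module C \<nu> N" "gm_exact C \<nu> L M N" by blast
  show ?case unfolding h(1) K0_free_inv[OF K0_exact_keys[OF h(2-4)]] by (rule u[OF exact[OF h(2-5)]])
next
  case (eng x y) thus ?case using a by simp
qed

lemma K0_rel_sub: "subgroup (K0_rel C \<nu>) (K0_free C \<nu>)"
  unfolding K0_rel_def by (rule group.generate_is_subgroup[OF K0_free_group]) (use K0_exact_keys in fastforce)

lemma K0_rel_keys: "x \<in> K0_rel C \<nu> ==> keys x \<subseteq> {M. klr_module C \<nu> M}"
  using subsetD[OF subgroup.subset[OF K0_rel_sub], of x C \<nu>] by simp

lemma K0_rel_0 [simp]: "0 \<in> K0_rel C \<nu>"
  using subgroup.one_closed[OF K0_rel_sub] by simp

lemma K0_rel_add: "x \<in> K0_rel C \<nu> ==> y \<in> K0_rel C \<nu> ==> x + y \<in> K0_rel C \<nu>"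
  using subgroup.m_closed[OF K0_rel_sub, of x C \<nu> y] by simp

lemma K0_rel_neg: "x \<in> K0_rel C \<nu> ==> - x \<in> K0_rel C \<nu>"
  using subgroup.m_inv_closed[OF K0_rel_sub, of x C \<nu>] K0_free_inv[OF K0_rel_keys, of x C \<nu>] by simp

lemma K0_rel_diff: "x \<in> K0_rel C \<nu> ==> y \<in> K0_rel C \<nu> ==> x - y \<in> K0_rel C \<nu>"
  using K0_rel_add[of x C \<nu> "- y"] K0_rel_neg[of y C \<nu>] by simp

lemma K0_rel_sum: "(\<And>a. a \<in> A ==> h a \<in> K0_rel C \<nu>) ==> (\<Sum>a\<in>A. h a) \<in> K0_rel C \<nu>"
  by (induction A rule: infinite_finite_induct) (auto intro: K0_rel_add)

lemma K0_rel_cmul: "x \<in> K0_rel C \<nu> ==> frag_cmul n x \<in> K0_rel C \<nu>"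
proof (induction n rule: int_induct[where k = 0])
  case base show ?case by simp
next
  case (step1 n) thus ?case by (simp add: frag_cmul_distrib K0_rel_add)
next
  case (step2 n) thus ?case by (simp add: frag_cmul_diff_distrib K0_rel_diff)
qed

lemma K0_rel_extend: "(\<And>M. M \<in> keys x ==> F M \<in> K0_rel C \<nu>) ==> frag_extend F x \<in> K0_rel C \<nu>"
  unfolding frag_extend_def by (intro K0_rel_sum K0_rel_cmul)

lemma K0_rel_exact:
  "klr_module C \<nu> L ==> klr_module C \<nu> M ==> klr_module C \<nu> N ==> gm_exact C \<nu> L M N
    ==> frag_of M - frag_of L - frag_of N \<in> K0_rel C \<nu>"
  unfolding K0_rel_def by (rule generate.incl) blast

lemma K0_cls_eq: "K0_cls C \<nu> x = (\<lambda>r. r + x) ` K0_rel C \<nu>"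
  by (auto simp: K0_cls_def r_coset_def)

lemma K0_cls_self: "x \<in> K0_cls C \<nu> x"
  unfolding K0_cls_eq by (rule image_eqI[of _ _ 0]) auto

lemma K0_cls_iff: "K0_cls C \<nu> x = K0_cls C \<nu> y \<longleftrightarrow> x - y \<in> K0_rel C \<nu>"
proof
  assume "K0_cls C \<nu> x = K0_cls C \<nu> y"
  hence "x \<in> K0_cls C \<nu> y" using K0_cls_self by blast
  then obtain r where "r \<in> K0_rel C \<nu>" "x = r + y" unfolding K0_cls_eq by blast
  thus "x - y \<in> K0_rel C \<nu>" by simp
next
  assume d: "x - y \<in> K0_rel C \<nu>"
  have le: "K0_cls C \<nu> x \<subseteq> K0_cls C \<nu> y" if "x - y \<in> K0_rel C \<nu>" for x y
  proof
    fix z assume "z \<in> K0_cls C \<nu> x"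
    then obtain r where r: "r \<in> K0_rel C \<nu>" "z = r + x" unfolding K0_cls_eq by blast
    have "z = (r + (x - y)) + y" using r by simp
    thus "z \<in> K0_cls C \<nu> y" unfolding K0_cls_eq using K0_rel_add[OF r(1) that] by (rule image_eqI)
  qed
  have "y - x \<in> K0_rel C \<nu>" using K0_rel_neg[OF d] by simp
  thus "K0_cls C \<nu> x = K0_cls C \<nu> y" using le[OF d] le by blast
qed

lemma K0_carrier: "carrier (K0 C \<nu>) = K0_cls C \<nu> ` K0_car C \<nu>"
  by (auto simp: K0_def FactGroup_def RCOSETS_def K0_cls_def)

lemma K0_one: "\<one>\<^bsub>K0 C \<nu>\<^esub> = K0_cls C \<nu> 0"
  by (simp add: K0_def FactGroup_def K0_cls_eq)

lemma K0_map_cls: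
  fixes x :: "('i, 'k::field) klr_frag" and C :: "('i, 'p) cartan_data" and F :: "('i, 'k) klr_mod \<Rightarrow> ('i, 'k) klr_frag"
  assumes ex: "\<And>L M N. klr_module C \<nu> L ==> klr_module C \<nu> M ==> klr_module C \<nu> N ==> gm_exact C \<nu> L M N
      ==> F M - F L - F N \<in> K0_rel C \<mu>"
  shows "K0_map C \<mu> F (K0_cls C \<nu> x) = K0_cls C \<mu> (frag_extend F x)"
proof -
  have rel: "frag_extend F r \<in> K0_rel C \<mu>" if "r \<in> K0_rel C \<nu>" for r
    using that
  proof (induction r rule: K0_rel_induct)
    case (exact L M N) thus ?case using ex by (simp add: frag_extend_diff)
  qed (simp_all add: frag_extend_minus frag_extend_add K0_rel_neg K0_rel_add)
  have "K0_cls C \<mu> (frag_extend F (r + x)) = K0_cls C \<mu> (frag_extend F x)" if "r \<in> K0_rel C \<nu>" for r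
    unfolding K0_cls_iff using rel[OF that] by (simp add: frag_extend_add)
  note c = this
  have "(\<lambda>x. K0_cls C \<mu> (frag_extend F x)) ` K0_cls C \<nu> x
      = (\<lambda>r. K0_cls C \<mu> (frag_extend F (r + x))) ` K0_rel C \<nu>"
    unfolding K0_cls_eq[of C \<nu>] image_image ..
  also have "\<dots> = (\<lambda>r. K0_cls C \<mu> (frag_extend F x)) ` (K0_rel C \<nu> :: ('i, 'k) klr_frag set)"
    by (intro image_cong HOL.refl c)
  also have "\<dots> = {K0_cls C \<mu> (frag_extend F x)}" by (rule image_constant[OF K0_rel_0])
  finally have "(\<lambda>x. K0_cls C \<mu> (frag_extend F x)) ` K0_cls C \<nu> x = {K0_cls C \<mu> (frag_extend F x)}" .
  thus ?thesis by (simp add: K0_map_def)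
qed

section \<open>Restriction and grading shift in the Grothendieck group\<close>

lemma shift_hom: "gm_hom C \<nu> L M f ==> gm_hom C \<nu> (gm_shift k L) (gm_shift k M) f"
  by (simp add: gm_hom_def)

lemma shift_exact: "gm_exact C \<nu> L M N ==> gm_exact C \<nu> (gm_shift k L) (gm_shift k M) (gm_shift k N)"
proof -
  assume "gm_exact C \<nu> L M N"
  then obtain f g where "gm_hom C \<nu> L M f" "gm_hom C \<nu> M N g" "inj_on f (gm_space L)"
    "g ` gm_space M = gm_space N" "f ` gm_space L = {v \<in> gm_space M. g v = 0}"
    unfolding gm_exact_def by (elim exE conjE)
  thus ?thesis unfolding gm_exact_def gm_shift_sel by (intro exI conjI shift_hom)
qed

lemma frag_cmul_diff_distrib2: "frag_cmul n (a - b) = frag_cmul n a - frag_cmul n b"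
  by (rule poly_mapping_eqI) (simp add: lookup_minus right_diff_distrib)

lemma frag_extend_diff_fun: "frag_extend (\<lambda>a. f a - g a) x = frag_extend f x - frag_extend g x"
  by (simp add: frag_extend_def sum_subtractf frag_cmul_diff_distrib2)

lemma K0_scale_cls:
  fixes x :: "('i, 'k::field) klr_frag"
  shows "K0_scale C \<nu> p (K0_cls C \<nu> x)
    = K0_cls C \<nu> (frag_extend (\<lambda>M. frag_extend (\<lambda>d. frag_of (gm_shift d M)) p) x)"
proof -
  have "K0_map C \<nu> (\<lambda>M. frag_extend (\<lambda>d. frag_of (gm_shift d M)) p) (K0_cls C \<nu> x)
    = K0_cls C \<nu> (frag_extend (\<lambda>M. frag_extend (\<lambda>d. frag_of (gm_shift d M)) p) x)"
  proof (rule K0_map_cls)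
    fix L M N :: "('i, 'k) klr_mod"
    assume m: "klr_module C \<nu> L" "klr_module C \<nu> M" "klr_module C \<nu> N" and ex: "gm_exact C \<nu> L M N"
    have "frag_extend (\<lambda>d. frag_of (gm_shift d M)) p - frag_extend (\<lambda>d. frag_of (gm_shift d L)) p
        - frag_extend (\<lambda>d. frag_of (gm_shift d N)) p
      = frag_extend (\<lambda>d. frag_of (gm_shift d M) - frag_of (gm_shift d L) - frag_of (gm_shift d N)) p"
      by (simp only: frag_extend_diff_fun)
    moreover have "\<dots> \<in> K0_rel C \<nu>"
      using m ex by (intro K0_rel_extend K0_rel_exact klr_module.shift_module shift_exact)
    ultimately show "frag_extend (\<lambda>d. frag_of (gm_shift d M)) p - frag_extend (\<lambda>d. frag_of (gm_shift d L)) p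
        - frag_extend (\<lambda>d. frag_of (gm_shift d N)) p \<in> K0_rel C \<nu>" by (simp only:)
  qed
  thus ?thesis unfolding K0_scale_def frag_extend_def[of _ p] .
qed

context
  fixes C :: "('i, 'p) cartan_data" and \<nu> :: "'i multiset" and i :: 'i
  assumes i: "i \<in># \<nu>"
begin

interpretation e: strand C \<nu> i "[]" "[i]"
  by unfold_locales (use i in auto)

lemma e_fun_Res: "e_fun C \<nu> i M = e.Res M"
  by (simp add: e_fun_def gen_first_between)

lemma e_fun_module: "klr_module C \<nu> M ==> klr_module C (\<nu> - {#i#}) (e_fun C \<nu> i M)"
  unfolding e_fun_Res by (rule e.Res_module)

lemma K0_e_cls:
  fixes x :: "('i, 'k::field) klr_frag"
  shows "K0_e C \<nu> i (K0_cls C \<nu> x) = K0_cls C (\<nu> - {#i#}) (frag_extend (\<lambda>M. frag_of (e_fun C \<nu> i M)) x)"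
  unfolding K0_e_def
proof (rule K0_map_cls)
  fix L M N :: "('i, 'k) klr_mod"
  assume m: "klr_module C \<nu> L" "klr_module C \<nu> M" "klr_module C \<nu> N" and ex: "gm_exact C \<nu> L M N"
  have "gm_exact C (\<nu> - {#i#}) (e_fun C \<nu> i L) (e_fun C \<nu> i M) (e_fun C \<nu> i N)"
    unfolding e_fun_Res by (rule e.Res_exact[OF m ex])
  thus "frag_of (e_fun C \<nu> i M) - frag_of (e_fun C \<nu> i L) - frag_of (e_fun C \<nu> i N) \<in> K0_rel C (\<nu> - {#i#})"
    by (intro K0_rel_exact e_fun_module m)
qed

lemma gd_e_fun: "klr_module C \<nu> M ==> u \<in> seqs (\<nu> - {#i#}) ==> gd C (\<nu> - {#i#}) u (e_fun C \<nu> i M) = gd C \<nu> (u @ [i]) M"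
  unfolding e_fun_Res using e.gdim_Res[of M u] by simp

lemma e_fun_zero: "klr_module C \<nu> M ==> concentrated C \<nu> M w ==> last w \<noteq> i ==> gm_space (e_fun C \<nu> i M) = {0}"
  unfolding e_fun_Res by (rule e.Res_concentrated_zero) auto

end

text \<open>
  The coefficient of the character at the word \<open>u\<close>. Laurent polynomials are formal sums of exponents, so
  \<open>frag_extend\<close> extends graded dimensions additively to formal sums of modules.
\<close>

abbreviation chW :: "('i, 'p) cartan_data \<Rightarrow> 'i multiset \<Rightarrow> 'i list \<Rightarrow> ('i, 'k::field) klr_frag \<Rightarrow> laurent" where
  "chW C \<nu> u \<equiv> frag_extend (gd C \<nu> u)"

lemma chW_rel: "x \<in> K0_rel C \<nu> ==> u \<in> seqs \<nu> ==> chW C \<nu> u x = 0"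
  by (induction x rule: K0_rel_induct) (simp_all add: frag_extend_diff frag_extend_minus frag_extend_add gdim_exact)

lemma gd_shift: "gd C \<nu> u (gm_shift k M) = single k 1 * gd C \<nu> u M"
  by (simp add: gdim_shift idem_space_def)

lemma frag_extend_extend: "frag_extend f (frag_extend g x) = frag_extend (\<lambda>a. frag_extend f (g a)) x"
  unfolding frag_extend_def[of g] frag_extend_def[of "\<lambda>a. frag_extend f (g a)"]
  by (subst frag_extend_sum) (simp_all add: frag_extend_cmul o_def)

lemma frag_cmul_times: "frag_cmul n (p :: laurent) = of_int n * p"
proof (induction n rule: int_induct[where k = 0])
  case base show ?case by simp
next
  case (step1 n) thus ?case by (simp add: frag_cmul_distrib distrib_right)
next
  case (step2 n) thus ?case by (simp add: frag_cmul_diff_distrib left_diff_distrib)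
qed

lemma of_int_single: "of_int n * single d 1 = (single d n :: laurent)"
proof -
  have "single 0 (of_int n :: int) = (of_int n :: laurent)" by (rule single_of_int)
  hence "of_int n = (single 0 n :: laurent)" by (simp only: of_int_eq_id id_apply)
  thus ?thesis by (simp add: mult_single)
qed

lemma laurent_extend: "frag_extend (\<lambda>d. single d 1 * f) p = (p :: laurent) * f"
proof -
  have "frag_extend (\<lambda>d. single d 1 * f) p = (\<Sum>d\<in>keys p. single d (lookup p d)) * f"
    unfolding frag_extend_def frag_cmul_times by (simp add: sum_distrib_right of_int_single flip: mult.assoc)
  thus ?thesis by (simp flip: poly_mapping_sum_singles)
qed

lemma chW_scale:
  fixes x :: "('i, 'k::field) klr_frag"
  shows "chW C \<nu> u (frag_extend (\<lambda>M. frag_extend (\<lambda>d. frag_of (gm_shift d M)) p) x) = p * chW C \<nu> u x"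
proof -
  have "frag_extend (gd C \<nu> u) (frag_extend (\<lambda>d. frag_of (gm_shift d M)) p) = p * gd C \<nu> u M" for M :: "('i, 'k) klr_mod"
    by (simp add: frag_extend_extend gd_shift laurent_extend)
  hence "chW C \<nu> u (frag_extend (\<lambda>M. frag_extend (\<lambda>d. frag_of (gm_shift d M)) p) x) = frag_extend (\<lambda>M. p * gd C \<nu> u M) x"
    by (subst frag_extend_extend) (simp only:)
  also have "\<dots> = p * chW C \<nu> u x"
    by (simp add: frag_extend_def frag_cmul_times sum_distrib_left mult.left_commute)
  finally show ?thesis .
qed

lemma chW_e:
  fixes x :: "('i, 'k::field) klr_frag"
  assumes "i \<in># \<nu>" "x \<in> K0_car C \<nu>" "u \<in> seqs (\<nu> - {#i#})"
  shows "chW C (\<nu> - {#i#}) u (frag_extend (\<lambda>M. frag_of (e_fun C \<nu> i M)) x) = chW C \<nu> (u @ [i]) x"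
  unfolding frag_extend_extend frag_extend_of
proof (rule frag_extend_eq)
  fix M assume "M \<in> keys x"
  hence "klr_module C \<nu> M" using assms(2) by auto
  thus "gd C (\<nu> - {#i#}) u (e_fun C \<nu> i M) = gd C \<nu> (u @ [i]) M" by (rule gd_e_fun[OF assms(1) _ assms(3)])
qed

lemma keys_frag_extend_le: "(\<And>a. a \<in> keys x ==> keys (F a) \<subseteq> A) ==> keys (frag_extend F x) \<subseteq> A"
  using keys_frag_extend[of F x] by blast

lemma frag_extend_e_car:
  assumes "i \<in># \<nu>" "x \<in> K0_car C \<nu>"
  shows "frag_extend (\<lambda>M. frag_of (e_fun C \<nu> i M)) x \<in> K0_car C (\<nu> - {#i#})"
  unfolding mem_Collect_eq
proof (rule keys_frag_extend_le)
  fix M assume "M \<in> keys x"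
  hence "klr_module C \<nu> M" using assms(2) by auto
  thus "keys (frag_of (e_fun C \<nu> i M)) \<subseteq> {M. klr_module C (\<nu> - {#i#}) M}"
    by (simp add: e_fun_module[OF assms(1)])
qed

lemma frag_extend_scale_car:
  assumes "x \<in> K0_car C \<nu>"
  shows "frag_extend (\<lambda>M. frag_extend (\<lambda>d. frag_of (gm_shift d M)) p) x \<in> K0_car C \<nu>"
  unfolding mem_Collect_eq
proof (intro keys_frag_extend_le)
  fix M d assume "M \<in> keys x"
  hence "klr_module C \<nu> M" using assms by auto
  thus "keys (frag_of (gm_shift d M)) \<subseteq> {M. klr_module C \<nu> M}"
    by (simp add: klr_module.shift_module)
qed

section \<open>Composition factors\<close>

lemma gm_zero_hom: "klr_module C \<nu> M ==> klr_module C \<nu> Z ==> gm_space Z = {0} ==> gm_hom C \<nu> M Z (\<lambda>v. 0)"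
proof -
  assume M: "klr_module C \<nu> M" and Z: "klr_module C \<nu> Z" and z: "gm_space Z = {0}"
  interpret Z: klr_module C \<nu> Z by fact
  have "gm_act Z r 0 = 0" if "r \<in> carrier (klr C \<nu>)" for r using Z.act_closed[OF that, of 0] z by simp
  thus ?thesis using z by (simp add: gm_hom_def)
qed

lemma id_hom: "gm_hom C \<nu> M M (\<lambda>v. v)" by (simp add: gm_hom_def)

lemma K0_zero_space:
  assumes Z: "klr_module C \<nu> Z" and z: "gm_space Z = {0}"
  shows "frag_of Z \<in> K0_rel C \<nu>"
proof -
  have "gm_exact C \<nu> Z Z Z" unfolding gm_exact_def
    by (intro exI[of _ "\<lambda>v. v"] exI[of _ "\<lambda>v. 0"]) (use gm_zero_hom[OF Z Z z] id_hom z in auto)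
  from K0_rel_neg[OF K0_rel_exact[OF Z Z Z this]] show ?thesis by simp
qed

lemma K0_iso:
  assumes M: "klr_module C \<nu> M" and N: "klr_module C \<nu> N" and iso: "gm_iso C \<nu> M N"
  shows "frag_of M - frag_of N \<in> K0_rel C \<nu>"
proof -
  obtain f where f: "gm_hom C \<nu> M N f" "bij_betw f (gm_space M) (gm_space N)" using iso by (auto simp: gm_iso_def)
  have Z: "klr_module C \<nu> (gm_zero N)" by (rule zero_space_module[OF klr_module.vector_space[OF N]])
  have z: "gm_space (gm_zero N) = {0}" by (simp add: gm_zero_def)
  have n0: "0 \<in> gm_space N" using klr_module.zero_in[OF N] .
  have "gm_exact C \<nu> M N (gm_zero N)" unfolding gm_exact_def
    by (intro exI[of _ f] exI[of _ "\<lambda>v. 0"]) (use gm_zero_hom[OF N Z z] f z n0 in \<open>auto simp: bij_betw_def\<close>)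
  from K0_rel_add[OF K0_rel_exact[OF M N Z this] K0_zero_space[OF Z z]]
  have "frag_of N - frag_of M \<in> K0_rel C \<nu>" by simp
  from K0_rel_neg[OF this] show ?thesis by simp
qed

text \<open>
  The quotient \<open>M / N\<close> is realised by coordinates that vanish exactly on \<open>N\<close>.
\<close>

lemma quotient_exact:
  fixes M :: "('i, 'k::field) klr_mod"
  assumes M: "klr_module C \<nu> M" and N: "gm_submodule C \<nu> M N" and ne: "N \<noteq> {0}"
  obtains Q :: "('i, 'k) klr_mod" where "klr_module C \<nu> Q" "gm_exact C \<nu> (gm_restrict M N) M Q"
    "vector_space.dim (gm_scale Q) (gm_space Q) < vector_space.dim (gm_scale M) (gm_space M)"
proof -
  interpret M: klr_module C \<nu> M by fact
  obtain \<pi> :: "(nat \<Rightarrow>\<^sub>0 'k) \<Rightarrow> nat \<Rightarrow>\<^sub>0 'k" where \<pi>: "\<And>v w. v \<in> M.S ==> w \<in> M.S ==> \<pi> (v + w) = \<pi> v + \<pi> w"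
    "\<And>a v. v \<in> M.S ==> \<pi> (gm_scale M a v) = pm_scale a (\<pi> v)" "{v \<in> M.S. \<pi> v = 0} = N"
    by (rule M.linear_coords[OF M.sub_subspace[OF N] M.sub_le[OF N]]) auto
  let ?Q = "gm_push pm_scale \<pi> M"
  note Q = M.push_module[OF pm_vector_space \<pi>(1,2) N[folded \<pi>(3)]]
  have sp: "gm_space ?Q = \<pi> ` M.S" "gm_scale ?Q = pm_scale" by (simp_all add: gm_push_def)
  have NS: "N \<subseteq> M.S" by (rule M.sub_le[OF N])
  have "gm_hom C \<nu> (gm_restrict M N) M (\<lambda>v. v)" using NS by (auto simp: gm_hom_def)
  hence ex: "gm_exact C \<nu> (gm_restrict M N) M ?Q" unfolding gm_exact_def
    by (intro exI[of _ "\<lambda>v. v"] exI[of _ \<pi>]) (use Q(2) sp \<pi>(3) in auto)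
  obtain F where F: "finite F" "M.S = gm_span M F" using M.finite_dim by auto
  have "M.vs.dim M.S = M.vs.dim {v \<in> M.S. \<pi> v = 0} + vector_space.dim pm_scale (\<pi> ` M.S)"
    by (rule rank_nullity[OF M.vector_space pm_vector_space M.subspace _ F(1)]) (use F(2) \<pi> in auto)
  moreover have "M.vs.dim {0} < M.vs.dim N"
    by (rule M.dim_sub) (use M.zero_submodule M.sub_subspace N NS ne M.vs.subspace_0[OF M.sub_subspace[OF N]] in auto)
  ultimately have "vector_space.dim (gm_scale ?Q) (gm_space ?Q) < M.vs.dim M.S" unfolding sp \<pi>(3) by simp
  from that[OF Q(1) ex this] show ?thesis .
qed

text \<open>
  Every class is a combination of irreducible ones. If irreducible modules are separated, up to
  shift, by a word on which they are concentrated, characters therefore separate classes.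
\<close>

locale word_reps =
  fixes C :: "('i, 'p) cartan_data" and \<mu> :: "'i multiset" and W :: "'i list set" and R :: "'i list \<Rightarrow> ('i, 'k::field) klr_mod"
  assumes W: "W \<subseteq> seqs \<mu>"
    and R: "u \<in> W ==> klr_module C \<mu> (R u)" "u \<in> W ==> concentrated C \<mu> (R u) u"
    and R_gd: "u \<in> W ==> gd C \<mu> u (R u) \<noteq> 0"
    and reps: "gm_irreducible C \<mu> (M :: ('i, 'k) klr_mod) ==> \<exists>u\<in>W. \<exists>k. gm_iso C \<mu> M (gm_shift k (R u))"
begin

abbreviation comb :: "('i list \<Rightarrow> laurent) \<Rightarrow> ('i, 'k) klr_frag" where
  "comb p \<equiv> \<Sum>u\<in>W. frag_extend (\<lambda>d. frag_of (gm_shift d (R u))) (p u)"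

lemma fin: "finite W" by (rule finite_subset[OF W]) simp

lemma comb_add: "comb (\<lambda>u. p u + q u) = comb p + comb q"
  by (simp add: frag_extend_add sum.distrib)

lemma comb_single: "w \<in> W ==> comb (\<lambda>u. if u = w then p else 0) = frag_extend (\<lambda>d. frag_of (gm_shift d (R w))) p"
proof -
  assume w: "w \<in> W"
  have "comb (\<lambda>u. if u = w then p else 0) = (\<Sum>u\<in>W. if u = w then frag_extend (\<lambda>d. frag_of (gm_shift d (R w))) p else 0)"
    by (intro sum.cong) auto
  thus ?thesis using w fin by simp
qed

text \<open>An irreducible submodule is split off and the quotient has smaller dimension.\<close>

lemma module_comb:
  assumes "klr_module C \<mu> (M :: ('i, 'k) klr_mod)"
  shows "\<exists>p. frag_of M - comb p \<in> K0_rel C \<mu>"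
  using assms
proof (induction "vector_space.dim (gm_scale M) (gm_space M)" arbitrary: M rule: less_induct)
  case less
  interpret M: klr_module C \<mu> M by (rule less.prems)
  show ?case
  proof (cases "M.S = {0}")
    case True
    thus ?thesis using K0_zero_space[OF less.prems] by (intro exI[of _ "\<lambda>_. 0"]) simp
  next
    case False
    obtain N where N: "gm_submodule C \<mu> M N" "gm_irreducible C \<mu> (gm_restrict M N)" "N \<noteq> {0}"
      by (rule M.irreducible_submodule[OF False])
    obtain Q :: "('i, 'k) klr_mod" where Q: "klr_module C \<mu> Q" "gm_exact C \<mu> (gm_restrict M N) M Q"
      "vector_space.dim (gm_scale Q) (gm_space Q) < M.vs.dim M.S" by (rule quotient_exact[OF less.prems N(1,3)])
    obtain p where p: "frag_of Q - comb p \<in> K0_rel C \<mu>" using less.hyps[OF Q(3,1)] by blast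
    obtain w k where w: "w \<in> W" "gm_iso C \<mu> (gm_restrict M N) (gm_shift k (R w))" using reps[OF N(2)] by blast
    have Nm: "klr_module C \<mu> (gm_restrict M N)" by (rule irreducible_module[OF N(2)])
    have "frag_of (gm_restrict M N) - frag_of (gm_shift k (R w)) \<in> K0_rel C \<mu>"
      by (rule K0_iso[OF Nm klr_module.shift_module[OF R(1)[OF w(1)]] w(2)])
    hence r: "frag_of (gm_restrict M N) - comb (\<lambda>u. if u = w then frag_of k else 0) \<in> K0_rel C \<mu>"
      unfolding comb_single[OF w(1)] by simp
    have "frag_of M - comb (\<lambda>u. p u + (if u = w then frag_of k else 0))
      = (frag_of M - frag_of (gm_restrict M N) - frag_of Q) + (frag_of Q - comb p)
        + (frag_of (gm_restrict M N) - comb (\<lambda>u. if u = w then frag_of k else 0))"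
      unfolding comb_add by simp
    moreover have "\<dots> \<in> K0_rel C \<mu>"
      by (intro K0_rel_add K0_rel_exact p r Nm less.prems Q(1,2))
    ultimately show ?thesis
      by (intro exI[of _ "\<lambda>u. p u + (if u = w then frag_of k else 0)"]) (simp only:)
  qed
qed

lemma frag_comb:
  fixes x :: "('i, 'k) klr_frag"
  assumes "x \<in> K0_car C \<mu>" shows "\<exists>p. x - comb p \<in> K0_rel C \<mu>"
proof -
  have "keys x \<subseteq> {M. klr_module C \<mu> M}" using assms by simp
  thus ?thesis
  proof (induction x rule: frag_induction)
    case zero show ?case by (intro exI[of _ "\<lambda>_. 0"]) simp
  next
    case (one M) thus ?case using module_comb by simp
  next
    case (diff x y)
    then obtain p q where pq: "x - comb p \<in> K0_rel C \<mu>" "y - comb q \<in> K0_rel C \<mu>" by blast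
    have "comb (\<lambda>u. p u - q u) = comb p - comb q" by (simp add: frag_extend_diff sum_subtractf)
    hence "(x - y) - comb (\<lambda>u. p u - q u) = (x - comb p) - (y - comb q)" by simp
    thus ?case using K0_rel_diff[OF pq] by (intro exI[of _ "\<lambda>u. p u - q u"]) (simp only:)
  qed
qed

text \<open>
  The coefficient at \<open>w\<close> of the character of a combination of representatives involves \<open>R w\<close> only.
\<close>

lemma K0_rel_iff_ch:
  fixes x :: "('i, 'k) klr_frag"
  assumes x: "x \<in> K0_car C \<mu>" and ch: "\<And>u. u \<in> seqs \<mu> ==> chW C \<mu> u x = 0"
  shows "x \<in> K0_rel C \<mu>"
proof -
  obtain p where p: "x - comb p \<in> K0_rel C \<mu>" using frag_comb[OF x] by blast
  have "p w = 0" if w: "w \<in> W" for w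
  proof -
    have ws: "w \<in> seqs \<mu>" using W w by auto
    have "chW C \<mu> w (comb p) = (\<Sum>u\<in>W. p u * gd C \<mu> w (R u))"
      by (simp add: frag_extend_sum[OF fin] frag_extend_extend gd_shift laurent_extend)
    also have "\<dots> = (\<Sum>u\<in>W. if u = w then p w * gd C \<mu> w (R w) else 0)"
    proof (rule sum.cong[OF HOL.refl])
      fix u assume u: "u \<in> W"
      interpret u: klr_module C \<mu> "R u" by (rule R(1)[OF u])
      show "p u * gd C \<mu> w (R u) = (if u = w then p w * gd C \<mu> w (R w) else 0)"
        using u.idem_space_concentrated[OF R(2)[OF u] ws] u.gdim_zero by auto
    qed
    also have "\<dots> = p w * gd C \<mu> w (R w)" using fin w by simp
    finally have "chW C \<mu> w (comb p) = p w * gd C \<mu> w (R w)" .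
    moreover have "chW C \<mu> w (x - comb p) = 0" by (rule chW_rel[OF p ws])
    ultimately have "p w * gd C \<mu> w (R w) = 0" using ch[OF ws] by (simp add: frag_extend_diff)
    thus ?thesis using R_gd[OF w] by simp
  qed
  hence "comb p = 0" by (intro sum.neutral) simp
  thus ?thesis using p by simp
qed

lemma K0_cls_eqI:
  fixes x :: "('i, 'k) klr_frag"
  assumes "x \<in> K0_car C \<mu>" "y \<in> K0_car C \<mu>" and "\<And>u. u \<in> seqs \<mu> ==> chW C \<mu> u x = chW C \<mu> u y"
  shows "K0_cls C \<mu> x = K0_cls C \<mu> y"
  unfolding K0_cls_iff
proof (rule K0_rel_iff_ch)
  show "x - y \<in> K0_car C \<mu>" unfolding mem_Collect_eq by (rule keys_frag_diff) (use assms in simp_all)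
  show "chW C \<mu> u (x - y) = 0" if "u \<in> seqs \<mu>" for u using assms(3)[OF that] by (simp add: frag_extend_diff)
qed

end

section \<open>Divided powers of restriction\<close>

text \<open>
  Restriction \<open>r\<close> times reads off the character at the words that end in \<open>i\<^sup>r\<close>.
\<close>

lemma weight_pow_K0_e:
  fixes x :: "('i, 'k::field) klr_frag"
  assumes "r \<le> count \<nu> i" "x \<in> K0_car C \<nu>"
  shows "\<exists>x'\<in>K0_car C (\<nu> - replicate_mset r i).
    weight_pow i (\<lambda>\<mu>. K0_e C \<mu> i) r \<nu> (K0_cls C \<nu> x) = K0_cls C (\<nu> - replicate_mset r i) x' \<and>
    (\<forall>u\<in>seqs (\<nu> - replicate_mset r i). chW C (\<nu> - replicate_mset r i) u x' = chW C \<nu> (u @ replicate r i) x)"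
  using assms
proof (induction r arbitrary: \<nu> x)
  case 0
  thus ?case by (intro bexI[of _ x]) auto
next
  case (Suc r)
  have i: "i \<in># \<nu>" using Suc.prems(1) by (metis Suc_le_D count_greater_zero_iff zero_less_Suc)
  let ?x = "frag_extend (\<lambda>M. frag_of (e_fun C \<nu> i M)) x"
  have w: "\<nu> - {#i#} - replicate_mset r i = \<nu> - replicate_mset (Suc r) i" by simp
  have "r \<le> count (\<nu> - {#i#}) i" using Suc.prems(1) by simp
  from Suc.IH[OF this frag_extend_e_car[OF i Suc.prems(2)]]
  obtain x' where x': "x' \<in> K0_car C (\<nu> - replicate_mset (Suc r) i)"
    "weight_pow i (\<lambda>\<mu>. K0_e C \<mu> i) r (\<nu> - {#i#}) (K0_cls C (\<nu> - {#i#}) ?x) = K0_cls C (\<nu> - replicate_mset (Suc r) i) x'"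
    "\<forall>u\<in>seqs (\<nu> - replicate_mset (Suc r) i). chW C (\<nu> - replicate_mset (Suc r) i) u x' = chW C (\<nu> - {#i#}) (u @ replicate r i) ?x"
    unfolding w by (elim bexE conjE)
  have "chW C (\<nu> - replicate_mset (Suc r) i) u x' = chW C \<nu> (u @ replicate (Suc r) i) x"
    if u: "u \<in> seqs (\<nu> - replicate_mset (Suc r) i)" for u
  proof -
    have "mset u = \<nu> - replicate_mset (Suc r) i" using u by (simp only: permutations_of_multiset_def mem_Collect_eq)
    moreover have "replicate_mset (Suc r) i \<subseteq># \<nu>" using Suc.prems(1) by (simp only: count_le_replicate_mset_subset_eq)
    ultimately have "mset u + replicate_mset (Suc r) i = \<nu>" by (simp only: subset_mset.diff_add)
    hence "mset (u @ replicate r i) = \<nu> - {#i#}" by auto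
    hence "u @ replicate r i \<in> seqs (\<nu> - {#i#})" by (simp only: permutations_of_multiset_def mem_Collect_eq)
    from chW_e[OF i Suc.prems(2) this] x'(3) u show ?thesis by (simp add: replicate_append_same)
  qed
  moreover have "weight_pow i (\<lambda>\<mu>. K0_e C \<mu> i) (Suc r) \<nu> (K0_cls C \<nu> x) = K0_cls C (\<nu> - replicate_mset (Suc r) i) x'"
    unfolding weight_pow.simps K0_e_cls[OF i] by (rule x'(2))
  ultimately show ?case by (intro bexI[OF _ x'(1)] conjI ballI)
qed

lemma (in cartan_datum) qint_nonzero: "0 < a ==> qint C i a \<noteq> 0"
proof
  let ?\<delta> = "rform C i i div 2" let ?f = "\<lambda>t. ?\<delta> * (int a - 1 - 2 * int t)"
  assume a: "0 < a" and "qint C i a = 0"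
  hence "0 = lookup (qint C i a) (?f 0)" by simp
  also have "\<dots> = (\<Sum>t<a. if ?f t = ?f 0 then 1 else 0)"
    unfolding qint_def lookup_sum by (intro sum.cong) (auto simp: lookup_single when_def)
  also have "\<dots> \<ge> (\<Sum>t\<in>{0}. if ?f t = ?f 0 then 1 else 0 :: int)"
    by (rule sum_mono2) (use a in auto)
  finally show False by simp
qed

lemma (in cartan_datum) qfact_nonzero: "qfact C i a \<noteq> 0"
  by (auto simp: qfact_def qint_nonzero)

lemma qfact_Suc: "qfact C i (Suc a) = qfact C i a * qint C i (Suc a)"
  by (simp add: qfact_def)

lemma qint_add: "qint C i (a + b) = single (rform C i i div 2 * int b) 1 * qint C i a
    + single (- (rform C i i div 2) * int a) 1 * qint C i b"
proof -
  have split: "(\<Sum>k<a + b. f k) = (\<Sum>k<a. f k) + (\<Sum>k<b. f (a + k))" for f :: "nat \<Rightarrow> laurent"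
    by (induction b) (simp_all add: add.assoc)
  show ?thesis unfolding qint_def split sum_distrib_left mult_single
    by (intro arg_cong2[of _ _ _ _ "(+)"] sum.cong) (simp_all add: algebra_simps)
qed

text \<open>Gaussian binomial coefficients are Laurent polynomials, by the quantum Pascal rule.\<close>

lemma qbinomial: "\<exists>B. qfact C i (s + t) = qfact C i s * qfact C i t * B"
proof (induction "s + t" arbitrary: s t)
  case 0 thus ?case by (intro exI[of _ 1]) (simp add: qfact_def)
next
  case (Suc m)
  show ?case
  proof (cases "s = 0 \<or> t = 0")
    case True thus ?thesis by (intro exI[of _ 1]) (auto simp: qfact_def)
  next
    case False
    then obtain s' t' where st: "s = Suc s'" "t = Suc t'" by (metis not0_implies_Suc)
    have m: "m = s' + t" "m = s + t'" using Suc.hyps(2) st by auto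
    obtain B1 where B1: "qfact C i (s' + t) = qfact C i s' * qfact C i t * B1" using Suc.hyps(1)[OF m(1)] by blast
    obtain B2 where B2: "qfact C i (s + t') = qfact C i s * qfact C i t' * B2" using Suc.hyps(1)[OF m(2)] by blast
    let ?a = "single (rform C i i div 2 * int t) 1 :: laurent"
    let ?b = "single (- (rform C i i div 2) * int s) 1 :: laurent"
    have "qfact C i (s + t) = qfact C i m * qint C i (s + t)" using qfact_Suc[of C i m] Suc.hyps(2) by simp
    also have "\<dots> = ?a * (qfact C i m * qint C i s) + ?b * (qfact C i m * qint C i t)"
      unfolding qint_add by (simp only: algebra_simps)
    also have "qfact C i m * qint C i s = qfact C i s * qfact C i t * B1"
      unfolding m(1) B1 using qfact_Suc[of C i s'] st by (simp add: mult_ac)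
    also have "qfact C i m * qint C i t = qfact C i s * qfact C i t * B2"
      unfolding m(2) B2 using qfact_Suc[of C i t'] st by (simp add: mult_ac)
    finally show ?thesis by (intro exI[of _ "?a * B1 + ?b * B2"]) (simp only: algebra_simps)
  qed
qed

text \<open>
  The equation that defines the quotient and the uniqueness of its solution can both be checked on
  characters, because \<open>[r]!\<close> is not a zero divisor.
\<close>

lemma K0_e_div_cls:
  fixes x y :: "('i, 'k::field) klr_frag"
  assumes C: "cartan_datum C" and reps: "word_reps C \<mu> W (R :: 'i list \<Rightarrow> ('i, 'k) klr_mod)"
    and \<mu>: "\<mu> = \<nu> - replicate_mset r i" and r: "r \<le> count \<nu> i"
    and x: "x \<in> K0_car C \<nu>" and y: "y \<in> K0_car C \<mu>"
    and ch: "\<And>u. u \<in> seqs \<mu> ==> qfact C i r * chW C \<mu> u y = chW C \<nu> (u @ replicate r i) x"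
  shows "K0_e_div C \<nu> i r (K0_cls C \<nu> x) = K0_cls C \<mu> y"
proof -
  interpret word_reps C \<mu> W R by (rule reps)
  let ?sc = "\<lambda>y. frag_extend (\<lambda>M. frag_extend (\<lambda>d. frag_of (gm_shift d M)) (qfact C i r)) y :: ('i, 'k) klr_frag"
  obtain x' where x': "x' \<in> K0_car C \<mu>"
    "weight_pow i (\<lambda>\<mu>. K0_e C \<mu> i) r \<nu> (K0_cls C \<nu> x) = K0_cls C \<mu> x'"
    "\<forall>u\<in>seqs \<mu>. chW C \<mu> u x' = chW C \<nu> (u @ replicate r i) x"
    using weight_pow_K0_e[OF r x] unfolding \<mu>[symmetric] by (elim bexE conjE)
  have sol: "K0_scale C \<mu> (qfact C i r) (K0_cls C \<mu> y) = K0_cls C \<mu> x'"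
    unfolding K0_scale_cls
    by (rule K0_cls_eqI[OF frag_extend_scale_car[OF y] x'(1)]) (simp only: chW_scale ch x'(3)[rule_format])
  have uniq: "Y = K0_cls C \<mu> y" if Y: "Y \<in> carrier (K0 C \<mu>)" "K0_scale C \<mu> (qfact C i r) Y = K0_cls C \<mu> x'" for Y
  proof -
    obtain y' where y': "y' \<in> K0_car C \<mu>" "Y = K0_cls C \<mu> y'" using Y(1) unfolding K0_carrier by (rule imageE)
    have "K0_cls C \<mu> (?sc y') = K0_cls C \<mu> x'" using Y(2) unfolding y'(2) K0_scale_cls .
    hence d: "?sc y' - x' \<in> K0_rel C \<mu>" unfolding K0_cls_iff .
    show ?thesis unfolding y'(2)
    proof (rule K0_cls_eqI[OF y'(1) y])
      fix u assume u: "u \<in> seqs \<mu>"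
      have "chW C \<mu> u (?sc y') - chW C \<mu> u x' = 0" using chW_rel[OF d u] unfolding frag_extend_diff .
      hence "qfact C i r * chW C \<mu> u y' = qfact C i r * chW C \<mu> u y"
        using ch[OF u] x'(3) u by (simp only: chW_scale eq_iff_diff_eq_0[symmetric])
      thus "chW C \<mu> u y' = chW C \<mu> u y" using cartan_datum.qfact_nonzero[OF C, of i r] by simp
    qed
  qed
  show ?thesis unfolding K0_e_div_def \<mu>[symmetric] x'(2)
  proof (rule the_equality)
    show "K0_cls C \<mu> y \<in> carrier (K0 C \<mu>) \<and> K0_scale C \<mu> (qfact C i r) (K0_cls C \<mu> y) = K0_cls C \<mu> x'"
      by (rule conjI[OF _ sol]) (unfold K0_carrier, rule imageI[OF y])
    show "Y = K0_cls C \<mu> y" if "Y \<in> carrier (K0 C \<mu>) \<and> K0_scale C \<mu> (qfact C i r) Y = K0_cls C \<mu> x'" for Y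
      using that by (intro uniq) (rule conjunct1, assumption, rule conjunct2, assumption)
  qed
qed

lemma gd_concentrated_nonzero:
  assumes M: "gm_irreducible C \<nu> M" and c: "concentrated C \<nu> M u" shows "gd C \<nu> u M \<noteq> 0"
proof -
  interpret klr_module C \<nu> M using M by (rule irreducible_module)
  have u: "u \<in> seqs \<nu>" using c by (simp add: concentrated_def)
  have i: "idem_space C \<nu> M u = S" using idem_space_concentrated[OF c u] by simp
  obtain v where v: "v \<in> S" "v \<noteq> 0" using M zero_in unfolding gm_irreducible_def by auto
  obtain d where d: "hc M v d \<noteq> 0" "hc M v d \<in> gm_part M d" by (rule homogE[OF v])
  have "vs.dim {0} < vs.dim (gm_part M d)"
    by (rule dim_sub) (use d part_subset part_subspace in \<open>auto intro: vs.subspace_single_0\<close>)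
  moreover have "gm_part M d \<inter> S = gm_part M d" using part_subset by auto
  ultimately have "lookup (gm_gdim M S) d \<noteq> 0" using lookup_gdim[of S d] zero_in by simp
  thus ?thesis unfolding i by auto
qed

lemma word_repsI:
  fixes C :: "('i, 'p) cartan_data"
  assumes W: "W \<subseteq> seqs \<mu>"
    and ex: "\<And>u. u \<in> W ==> \<exists>L :: ('i, 'k::field) klr_mod. gm_irreducible C \<mu> L \<and> concentrated C \<mu> L u"
    and conc: "\<And>M :: ('i, 'k) klr_mod. gm_irreducible C \<mu> M ==> \<exists>u\<in>W. concentrated C \<mu> M u"
    and uniq: "\<And>(M :: ('i, 'k) klr_mod) L u. gm_irreducible C \<mu> M ==> concentrated C \<mu> M u ==>
      gm_irreducible C \<mu> L ==> concentrated C \<mu> (L :: ('i, 'k) klr_mod) u ==> u \<in> W ==> \<exists>k. gm_iso C \<mu> M (gm_shift k L)"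
  shows "\<exists>R :: 'i list \<Rightarrow> ('i, 'k) klr_mod. word_reps C \<mu> W R"
proof -
  define R :: "'i list \<Rightarrow> ('i, 'k) klr_mod" where "R u = (SOME L. gm_irreducible C \<mu> L \<and> concentrated C \<mu> L u)" for u
  have R: "gm_irreducible C \<mu> (R u) \<and> concentrated C \<mu> (R u) u" if "u \<in> W" for u
    unfolding R_def by (rule someI_ex[OF ex[OF that]])
  have "word_reps C \<mu> W R"
  proof (rule word_reps.intro)
    show "W \<subseteq> seqs \<mu>" by (rule W)
    fix u assume u: "u \<in> W"
    show "klr_module C \<mu> (R u)" by (rule irreducible_module[OF conjunct1[OF R[OF u]]])
    show "concentrated C \<mu> (R u) u" by (rule conjunct2[OF R[OF u]])
    show "gd C \<mu> u (R u) \<noteq> 0" by (rule gd_concentrated_nonzero[OF conjunct1[OF R[OF u]] conjunct2[OF R[OF u]]])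
  next
    fix M :: "('i, 'k) klr_mod" assume M: "gm_irreducible C \<mu> M"
    from conc[OF M] obtain u where u: "u \<in> W" "concentrated C \<mu> M u" by (rule bexE)
    have "\<exists>k. gm_iso C \<mu> M (gm_shift k (R u))"
      by (rule uniq[OF M u(2) conjunct1[OF R[OF u(1)]] conjunct2[OF R[OF u(1)]] u(1)])
    thus "\<exists>u\<in>W. \<exists>k. gm_iso C \<mu> M (gm_shift k (R u))" by (rule bexI[OF _ u(1)])
  qed
  thus ?thesis by (intro exI[of _ R])
qed

text \<open>
  The only generator of \<open>R(0)\<close> acts as the identity, so the multiples of a pair of homogeneous vectors
  form a submodule of \<open>M \<oplus> L\<close>.
\<close>

lemma irreducible_weight_0_unique:
  fixes M :: "(('i, 'k::field) klr_elem, 'k, 'v::ab_group_add) gmodule"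
    and L :: "(('i, 'k) klr_elem, 'k, 'w::ab_group_add) gmodule"
  assumes M: "gm_irreducible C {#} M" and L: "gm_irreducible C {#} L"
  shows "\<exists>k. gm_iso C {#} M (gm_shift k L)"
proof -
  interpret M: klr_module C "{#}" M using M by (rule irreducible_module)
  interpret L: klr_module C "{#}" L using L by (rule irreducible_module)
  obtain v' where v': "v' \<in> M.S" "v' \<noteq> 0" using M M.zero_in unfolding gm_irreducible_def by auto
  obtain w' where w': "w' \<in> L.S" "w' \<noteq> 0" using L L.zero_in unfolding gm_irreducible_def by auto
  obtain d0 where d0: "hc M v' d0 \<noteq> 0" "hc M v' d0 \<in> gm_part M d0" by (rule M.homogE[OF v'])
  obtain d1 where d1: "hc L w' d1 \<noteq> 0" "hc L w' d1 \<in> gm_part L d1" by (rule L.homogE[OF w'])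
  define v w where "v = hc M v' d0" and "w = hc L w' d1"
  have vw: "v \<noteq> 0" "w \<noteq> 0" "v \<in> gm_part M d0" "w \<in> gm_part L d1" "v \<in> M.S" "w \<in> L.S"
    using d0 d1 M.part_in L.part_in by (auto simp: v_def w_def)
  let ?k = "d0 - d1"
  let ?G = "\<lambda>a b. \<exists>c. a = gm_scale M c v \<and> b = gm_scale L c w"
  have "gm_iso C {#} M (gm_shift ?k L)"
  proof (rule iso_from_graph[OF M L, where G = ?G and v = v and w = w and ?d0.0 = d0])
    show "a \<in> M.S \<and> b \<in> L.S" if "?G a b" for a b using that vw M.scale_in L.scale_in by auto
    show "?G 0 0" by (rule exI[of _ 0]) simp
    show "?G (a + a') (b + b')" if "?G a b" "?G a' b'" for a b a' b'
      using that M.vs.scale_left_distrib L.vs.scale_left_distrib by metis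
    show "?G (gm_scale M c a) (gm_scale L c b)" if "?G a b" for c a b
      using that M.vs.scale_scale L.vs.scale_scale by metis
    show "?G v w" by (rule exI[of _ 1]) simp
    show "?G (gact C {#} M (gen g) a) (gact C {#} L (gen g) b)" if g: "g \<in> klr_gens {#}" and G: "?G a b" for g a b
    proof -
      have g: "(gen g :: ('i, 'k) klr_free) = idemp []" using g by (auto simp: klr_gens_def gen_def idemp_def)
      obtain c where c: "a = gm_scale M c v" "b = gm_scale L c w" using G by blast
      have "a \<in> M.S" "b \<in> L.S" using c vw M.scale_in L.scale_in by auto
      hence "gact C {#} M (gen g) a = a" "gact C {#} L (gen g) b = b"
        using M.E_sum[of a] L.E_sum[of b] by (simp_all add: g)
      thus ?thesis using G by simp
    qed
    show "?G (hc M a d) (hc L b (d - ?k))" if G: "?G a b" for a b d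
    proof -
      obtain c where c: "a = gm_scale M c v" "b = gm_scale L c w" using G by blast
      have "hc M a d = (if d = d0 then a else 0)" unfolding c(1)
        using M.hc_of_part[OF M.part_scale[OF vw(3)]] by simp
      moreover have "hc L b (d - ?k) = (if d = d0 then b else 0)" unfolding c(2)
        using L.hc_of_part[OF L.part_scale[OF vw(4)]] by simp
      ultimately show ?thesis using G by (cases "d = d0") (auto intro: exI[of _ 0])
    qed
  qed (use vw in auto)
  thus ?thesis by blast
qed

lemma word_reps_weight_0: "\<exists>W. \<exists>R :: 'i list \<Rightarrow> ('i, 'k::field) klr_mod. word_reps C {#} W R"
proof -
  have conc: "concentrated C {#} M []" if "gm_irreducible C {#} M" for M :: "('i, 'k) klr_mod"
  proof -
    interpret klr_module C "{#}" M using that by (rule irreducible_module)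
    have "E [] v = v" if "v \<in> S" for v using E_sum[OF that] by simp
    thus ?thesis by (simp add: concentrated_def)
  qed
  let ?W = "if \<exists>L :: ('i, 'k) klr_mod. gm_irreducible C {#} L then {[]} else {} :: 'i list set"
  have "\<exists>R :: 'i list \<Rightarrow> ('i, 'k) klr_mod. word_reps C {#} ?W R"
  proof (rule word_repsI)
    show "\<exists>L :: ('i, 'k) klr_mod. gm_irreducible C {#} L \<and> concentrated C {#} L u" if "u \<in> ?W" for u
    proof -
      have "(\<exists>L :: ('i, 'k) klr_mod. gm_irreducible C {#} L) \<and> u = []" using that by (auto split: if_splits)
      thus ?thesis using conc by blast
    qed
    show "\<exists>u\<in>?W. concentrated C {#} M u" if "gm_irreducible C {#} M" for M :: "('i, 'k) klr_mod"
    proof -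
      have "[] \<in> ?W" using that by auto
      thus ?thesis using conc[OF that] by (rule bexI[rotated])
    qed
  qed (simp, rule irreducible_weight_0_unique)
  thus ?thesis by (rule exI)
qed

lemma (in cij) irr_at:
  fixes M :: "(('i, 'k::field) klr_elem, 'k, 'v::ab_group_add) gmodule"
  assumes M: "gm_irreducible C \<nu> M"
  obtains p where "p \<le> c" "concentrated C \<nu> M (word p)"
proof -
  interpret cij_module C i j c \<nu> M by (intro cij_module.intro cij_axioms irreducible_module[OF M])
  show ?thesis using irreducible_concentrated[OF M] that by blast
qed

lemma (in cij) cij_irrI:
  fixes M :: "(('i, 'k::field) klr_elem, 'k, 'v::ab_group_add) gmodule"
  assumes "gm_irreducible C \<nu> M" "p \<le> c" "concentrated C \<nu> M (word p)"
  shows "cij_irr C i j c \<nu> M p"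
  by (intro cij_irr.intro cij_module.intro cij_axioms irreducible_module[OF assms(1)] cij_irr_axioms.intro assms)

lemma (in cij) word_reps_seqs: "\<exists>R :: 'i list \<Rightarrow> ('i, 'k::alg_closed_field) klr_mod. word_reps C \<nu> (seqs \<nu>) R"
proof (rule word_repsI[OF order_refl])
  fix u assume "u \<in> seqs \<nu>"
  then obtain p where p: "u = word p" "p \<le> c" unfolding seqs_nu by auto
  show "\<exists>L :: ('i, 'k) klr_mod. gm_irreducible C \<nu> L \<and> concentrated C \<nu> L u"
    unfolding p(1) by (rule exists_irreducible[OF p(2)])
next
  fix M :: "('i, 'k) klr_mod" assume "gm_irreducible C \<nu> M"
  then obtain p where "p \<le> c" "concentrated C \<nu> M (word p)" by (rule irr_at)
  thus "\<exists>u\<in>seqs \<nu>. concentrated C \<nu> M u" using word_in by blast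
next
  fix M L :: "('i, 'k) klr_mod" and u
  assume M: "gm_irreducible C \<nu> M" "concentrated C \<nu> M u" and L: "gm_irreducible C \<nu> L" "concentrated C \<nu> L u"
    and "u \<in> seqs \<nu>"
  then obtain p where p: "u = word p" "p \<le> c" unfolding seqs_nu by auto
  show "\<exists>k. gm_iso C \<nu> M (gm_shift k L)"
    by (rule cij_irr_unique[OF cij_irrI[OF M(1) p(2) M(2)[unfolded p(1)]] cij_irrI[OF L(1) p(2) L(2)[unfolded p(1)]]])
qed

section \<open>Classification of the irreducible modules of weight \<open>ci + j\<close>\<close>

lemma append_replicate_neq:
  assumes "length u \<le> p" "i \<noteq> j" "p < length u + s"
  shows "u @ replicate s i \<noteq> replicate p i @ [j] @ w"
proof
  assume e: "u @ replicate s i = replicate p i @ [j] @ w"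
  have "(u @ replicate s i) ! p = i" using assms by (simp add: nth_append)
  moreover have "(replicate p i @ [j] @ w) ! p = j" by (simp add: nth_append)
  ultimately show False using assms(2) e by simp
qed

context cij begin

lemma gd_irr:
  fixes L :: "(('i, 'k::field) klr_elem, 'k, 'v::ab_group_add) gmodule"
  assumes L: "gm_irreducible C \<nu> L" "p \<le> c" "concentrated C \<nu> L (word p)"
  shows "\<exists>e. \<forall>u\<in>seqs \<nu>. gd C \<nu> u L = (if u = word p then single e 1 * (qfact C i p * qfact C i (c - p)) else 0)"
proof -
  interpret cij_irr C i j c \<nu> L p by (rule cij_irrI[OF L])
  obtain e where "gm_gdim L S = single e 1 * (qfact C i p * qfact C i (c - p))" using gdim_irr by blast
  hence "\<forall>u\<in>seqs \<nu>. gd C \<nu> u L = (if u = word p then single e 1 * (qfact C i p * qfact C i (c - p)) else 0)"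
    using idem_space_concentrated[OF conc] gdim_zero by simp
  thus ?thesis by (rule exI[of _ e])
qed

text \<open>
  For \<open>s > c - p\<close> no word in the character ends in \<open>i\<^sup>s\<close>, and the solution is 0. For \<open>s < c - p\<close> it is a multiple
  of the irreducible module on the word shortened by \<open>s\<close> letters; the factor is a Gaussian binomial
  coefficient, shifted to match the grading.
\<close>

lemma divided_power_solution:
  fixes L :: "('i, 'k::alg_closed_field) klr_mod"
  assumes L: "gm_irreducible C \<nu> L" "p \<le> c" "concentrated C \<nu> L (word p)"
    and s: "s \<le> c" "s \<noteq> c - p" and \<mu>: "\<mu> = \<nu> - replicate_mset s i"
  shows "\<exists>y :: ('i, 'k) klr_frag. y \<in> K0_car C \<mu> \<and>
     (\<forall>u\<in>seqs \<mu>. qfact C i s * chW C \<mu> u y = chW C \<nu> (u @ replicate s i) (frag_of L)) \<and>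
     (\<forall>M\<in>keys y. \<exists>w. concentrated C \<mu> M w \<and> last w \<noteq> j)"
proof -
  have m: "\<mu> = replicate_mset (c - s) i + {#j#}" using s(1) ij
    by (intro multiset_eqI) (auto simp: \<mu> nu)
  obtain e where e: "\<And>u. u \<in> seqs \<nu> ==> gd C \<nu> u L = (if u = word p then single e 1 * (qfact C i p * qfact C i (c - p)) else 0)"
    using gd_irr[OF L] by blast
  have us: "u @ replicate s i \<in> seqs \<nu>" "length u = Suc (c - s)" if "u \<in> seqs \<mu>" for u
  proof -
    have mu: "mset u = replicate_mset (c - s) i + {#j#}" using that m by (simp add: permutations_of_multiset_def)
    have "replicate_mset (c - s) i + replicate_mset s i = replicate_mset c i" using s(1)
      by (intro multiset_eqI) auto
    thus "u @ replicate s i \<in> seqs \<nu>" using mu by (simp add: permutations_of_multiset_def nu)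
    show "length u = Suc (c - s)" using arg_cong[OF mu, of size] by simp
  qed
  show ?thesis
  proof (cases "c - p < s")
    case True
    have "chW C \<nu> (u @ replicate s i) (frag_of L) = 0" if u: "u \<in> seqs \<mu>" for u
    proof -
      have "length u \<le> p" "p < length u + s" using us(2)[OF u] True s(1) L(2) by auto
      from append_replicate_neq[OF this(1) ij this(2), of "replicate (c - p) i"] have "u @ replicate s i \<noteq> word p" unfolding word_def .
      thus ?thesis using e[OF us(1)[OF u]] by simp
    qed
    thus ?thesis by (intro exI[of _ 0]) simp
  next
    case False
    hence sn: "s < c - p" using s(2) by simp
    interpret m: cij C i j "c - s" \<mu> by unfold_locales (use ij ca m in auto)
    have ps: "p \<le> c - s" using sn by simp
    obtain L' :: "('i, 'k) klr_mod" where L': "gm_irreducible C \<mu> L'" "concentrated C \<mu> L' (m.word p)"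
      using m.exists_irreducible[OF ps] by blast
    obtain e' where e': "\<And>u. u \<in> seqs \<mu> ==> gd C \<mu> u L' = (if u = m.word p then single e' 1 * (qfact C i p * qfact C i (c - s - p)) else 0)"
      using m.gd_irr[OF L'(1) ps L'(2)] by blast
    obtain B where B: "qfact C i (s + (c - s - p)) = qfact C i s * qfact C i (c - s - p) * B" using qbinomial[of C i s "c - s - p"] by (rule exE)
    have B: "qfact C i (c - p) = qfact C i s * qfact C i (c - s - p) * B" using B sn by simp
    let ?B = "single (e - e') 1 * B"
    define y where "y = frag_extend (\<lambda>M. frag_extend (\<lambda>d. frag_of (gm_shift d M)) ?B) (frag_of L')"
    have y: "y \<in> K0_car C \<mu>" unfolding y_def
      by (rule frag_extend_scale_car) (simp add: irreducible_module[OF L'(1)])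
    have wp: "m.word p @ replicate s i = word p"
      using sn unfolding word_def m.word_def by (simp flip: replicate_add)
    have "qfact C i s * chW C \<mu> u y = chW C \<nu> (u @ replicate s i) (frag_of L)" if u: "u \<in> seqs \<mu>" for u
    proof -
      have iff: "u @ replicate s i = word p \<longleftrightarrow> u = m.word p" unfolding wp[symmetric] by simp
      have ch: "chW C \<mu> u y = ?B * gd C \<mu> u L'" unfolding y_def chW_scale by simp
      show ?thesis
      proof (cases "u = m.word p")
        case True
        have "qfact C i s * chW C \<mu> u y
            = (single (e - e') 1 * single e' 1) * (qfact C i p * (qfact C i s * qfact C i (c - s - p) * B))"
          unfolding ch e'[OF u] using True by (simp add: mult_ac)
        also have "\<dots> = single e 1 * (qfact C i p * qfact C i (c - p))"
          unfolding B by (simp add: mult_single)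
        also have "\<dots> = chW C \<nu> (u @ replicate s i) (frag_of L)" using e[OF us(1)[OF u]] iff True by simp
        finally show ?thesis .
      next
        case False
        thus ?thesis unfolding ch e'[OF u] using e[OF us(1)[OF u]] iff by simp
      qed
    qed
    moreover have "\<exists>w. concentrated C \<mu> M w \<and> last w \<noteq> j" if M: "M \<in> keys y" for M
    proof -
      have "keys y \<subseteq> range (\<lambda>d. gm_shift d L')" unfolding y_def frag_extend_of
        by (rule keys_frag_extend_le) simp
      then obtain d where "M = gm_shift d L'" using M by blast
      hence "concentrated C \<mu> M (m.word p)" using L'(2) by simp
      moreover have "last (m.word p) \<noteq> j" using sn ij unfolding m.word_def by (simp add: last_replicate)
      ultimately show ?thesis by blast
    qed
    ultimately show ?thesis using y by (intro exI[of _ y] conjI ballI)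
  qed
qed

text \<open>
  The modules that make up the divided power have words that do not end in \<open>j\<close>.
\<close>

lemma restriction_vanishes:
  fixes L :: "('i, 'k::alg_closed_field) klr_mod"
  assumes L: "gm_irreducible C \<nu> L" "p \<le> c" "concentrated C \<nu> L (word p)"
    and s: "s \<le> c" "s \<noteq> c - p"
  shows "K0_e_div C (\<nu> - replicate_mset s i - {#j#}) i (c - s)
      (K0_e C (\<nu> - replicate_mset s i) j (K0_e_div C \<nu> i s (K0_of C \<nu> L))) = \<one>\<^bsub>K0 C {#}\<^esub>"
proof -
  define \<mu> where "\<mu> = \<nu> - replicate_mset s i"
  have m: "\<mu> = replicate_mset (c - s) i + {#j#}" using s(1) ij
    by (intro multiset_eqI) (auto simp: \<mu>_def nu)
  interpret m: cij C i j "c - s" \<mu> by unfold_locales (use ij ca m in auto)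
  obtain R :: "'i list \<Rightarrow> ('i, 'k) klr_mod" where R: "word_reps C \<mu> (seqs \<mu>) R" using m.word_reps_seqs by (rule exE)
  obtain y :: "('i, 'k) klr_frag" where y: "y \<in> K0_car C \<mu>"
    "\<forall>u\<in>seqs \<mu>. qfact C i s * chW C \<mu> u y = chW C \<nu> (u @ replicate s i) (frag_of L)"
    "\<forall>M\<in>keys y. \<exists>w. concentrated C \<mu> M w \<and> last w \<noteq> j"
    using divided_power_solution[OF L s \<mu>_def] by (elim exE conjE)
  have sc: "s \<le> count \<nu> i" using s(1) by (simp add: nu)
  have 1: "K0_e_div C \<nu> i s (K0_of C \<nu> L) = K0_cls C \<mu> y"
    unfolding K0_of_def
    by (rule K0_e_div_cls[OF cartan_datum_axioms R \<mu>_def sc _ y(1)]) (use irreducible_module[OF L(1)] y(2) in auto)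
  let ?z = "frag_extend (\<lambda>M. frag_of (e_fun C \<mu> j M)) y"
  have jm: "j \<in># \<mu>" by (simp add: m)
  have "?z \<in> K0_rel C (\<mu> - {#j#})"
  proof (rule K0_rel_extend)
    fix M assume M: "M \<in> keys y"
    have Mm: "klr_module C \<mu> M" using y(1) M by auto
    obtain w where w: "concentrated C \<mu> M w" "last w \<noteq> j" using y(3) M by blast
    show "frag_of (e_fun C \<mu> j M) \<in> K0_rel C (\<mu> - {#j#})"
      by (rule K0_zero_space[OF e_fun_module[OF jm Mm] e_fun_zero[OF jm Mm w]])
  qed
  hence 2: "K0_e C \<mu> j (K0_cls C \<mu> y) = K0_cls C (\<mu> - {#j#}) 0"
    unfolding K0_e_cls[OF jm] K0_cls_iff by simp
  have m0: "{#} = \<mu> - {#j#} - replicate_mset (c - s) i" and cs: "c - s \<le> count (\<mu> - {#j#}) i"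
    using ij by (simp_all add: m)
  obtain W and R0 :: "'i list \<Rightarrow> ('i, 'k) klr_mod" where R0: "word_reps C {#} W R0"
    using word_reps_weight_0[of C] by (elim exE)
  have 3: "K0_e_div C (\<mu> - {#j#}) i (c - s) (K0_cls C (\<mu> - {#j#}) (0 :: ('i, 'k) klr_frag)) = K0_cls C {#} 0"
    by (rule K0_e_div_cls[OF cartan_datum_axioms R0 m0 cs]) simp_all
  show ?thesis unfolding \<mu>_def[symmetric] 1 2 3 K0_one ..
qed

end

theorem theorem6p10:
  fixes C :: "('i, 'p::ab_group_add) cartan_data"
    and i j :: 'i and c n :: nat and \<nu> :: "'i multiset"
  assumes "cartan_datum C"
    and "i \<noteq> j"
    and "int c \<le> cartan_a C i j"
    and "\<nu> = replicate_mset c i + {#j#}"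
    and "n \<le> c"
  shows "\<exists>L :: ('i, 'k::alg_closed_field) klr_mod.
     gm_irreducible C \<nu> L \<and> eps C \<nu> i L = n \<and>
     (\<forall>M :: (('i, 'k) klr_elem, 'k, 'v::ab_group_add) gmodule.
        gm_irreducible C \<nu> M \<and> eps C \<nu> i M = n \<longrightarrow> (\<exists>k. gm_iso C \<nu> M (gm_shift k L))) \<and>
     eps_check C \<nu> i L = c - n \<and>
     (\<exists>k. gm_ch C \<nu> (gm_shift k L) =
        Poly_Mapping.single (replicate (c - n) i @ [j] @ replicate n i)
          (qfact C i (c - n) * qfact C i n)) \<and>
     (\<forall>s\<le>c. s \<noteq> n \<longrightarrow>
        K0_e_div C (\<nu> - replicate_mset s i - {#j#}) i (c - s)
          (K0_e C (\<nu> - replicate_mset s i) j (K0_e_div C \<nu> i s (K0_of C \<nu> L)))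
        = \<one>\<^bsub>K0 C {#}\<^esub>)"
proof -
  interpret cartan_datum C by fact
  interpret cij C i j c \<nu> by unfold_locales (use assms in auto)
  let ?p = "c - n"
  have p: "?p \<le> c" "c - ?p = n" using assms(5) by auto
  obtain L :: "('i, 'k) klr_mod" where L: "gm_irreducible C \<nu> L" "concentrated C \<nu> L (word ?p)"
    using exists_irreducible[OF p(1)] by (elim exE conjE)
  interpret L: cij_irr C i j c \<nu> L ?p by (rule cij_irrI[OF L(1) p(1) L(2)])
  have Lne: "gm_space L \<noteq> {0}" using L(1) unfolding gm_irreducible_def by (elim conjE)
  have Lw: "concentrated C \<nu> L (replicate (c - n) i @ [j] @ replicate n i)"
    using L(2) unfolding word_def p(2) .
  show ?thesis
  proof (intro exI[of _ L] conjI allI impI)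
    show "gm_irreducible C \<nu> L" by (rule L(1))
    show "eps C \<nu> i L = n" by (rule eps_concentrated[OF L.klr_module_axioms Lne ij Lw])
    show "eps_check C \<nu> i L = c - n" by (rule eps_check_concentrated[OF L.klr_module_axioms Lne ij Lw])
    show "\<exists>k. gm_ch C \<nu> (gm_shift k L) =
        Poly_Mapping.single (replicate (c - n) i @ [j] @ replicate n i) (qfact C i (c - n) * qfact C i n)"
      using L.ch_irr unfolding word_def p(2) .
  next
    fix M :: "(('i, 'k) klr_elem, 'k, 'v) gmodule"
    assume "gm_irreducible C \<nu> M \<and> eps C \<nu> i M = n"
    hence M: "gm_irreducible C \<nu> M" and e: "eps C \<nu> i M = n" by (rule conjunct1, rule conjunct2)
    obtain q where q: "q \<le> c" "concentrated C \<nu> M (word q)" by (rule irr_at[OF M])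
    have "gm_space M \<noteq> {0}" using M unfolding gm_irreducible_def by (elim conjE)
    from eps_concentrated[OF irreducible_module[OF M] this ij q(2)[unfolded word_def]]
    have "q = ?p" using e q(1) by simp
    with q(2) have "concentrated C \<nu> M (word ?p)" by simp
    from cij_irr_unique[OF cij_irrI[OF M p(1) this] L.cij_irr_axioms]
    show "\<exists>k. gm_iso C \<nu> M (gm_shift k L)" .
  next
    fix s assume "s \<le> c" "s \<noteq> n"
    thus "K0_e_div C (\<nu> - replicate_mset s i - {#j#}) i (c - s)
          (K0_e C (\<nu> - replicate_mset s i) j (K0_e_div C \<nu> i s (K0_of C \<nu> L))) = \<one>\<^bsub>K0 C {#}\<^esub>"
      by (intro restriction_vanishes[OF L(1) p(1) L(2)]) (simp_all only: p(2) not_False_eq_True)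
  qed
qed

end
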